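(* Let $k\ge1$ and let $f:(S^d)^k\to\mathbb R$ be bounded measurable. Let $F(x)=\sum_{i=1}^k f_i(x)$ and assume $F$ is not almost everywhere constant on $S^d$. Then \[ \lim_{n\to\infty}\frac{\mathrm{Var}(L_nf)}{k_n^{2k-1}}=\frac{2^{d-2}}{s_d^{2k}\Gamma(d)\pi}\Gamma\Big(\frac d2\Big)^2\int_{S^d}\int_{S^d}\frac{(F(x)-F(y))^2}{\sin^{d-1}(\arccos(x\cdot y))}\,dx\,dy>0, \] and \[ \frac{L_nf-\mathbb E(L_nf)}{\mathrm{Var}(L_nf)^{1/2}}\xrightarrow{d}N(0,1). \]
   Context: Let $d\ge2$ and let $S^d\subset\mathbb R^{d+1}$ be the unit sphere with the standard round metric; $dx$ denotes its volume measure and $s_d=2\pi^{(d+1)/2}/\Gamma(\frac{d+1}2)$ its total area. For $n\ge0$ let $\mathcal H_n(S^d)$ be the space of spherical harmonics of degree $n$, of dimension $k_n=\frac{2n+d-1}{n+d-1}\binom{n+d-1}{d-1}$. Let $K_n(x,y)$ be the integral kernel of the orthogonal projection $L^2(S^d)\to\mathcal H_n(S^d)$ (equivalently $K_n(x,y)=\frac{k_n}{s_d}P_n(x\cdot y)$ with $P_n$ the Legendre polynomial of degree $n$ in dimension $d+1$, $P_n(1)=1$). Let $\Phi_n$ be the determinantal point process on $S^d$ with kernel $K_n$ w.r.t. $dx$ (correlation functions $\det(K_n(x_a,x_b))_{a,b}$). For $f:(S^d)^k\to\mathbb R$, $L_nf=\sum f(x_1,\dots,x_k)$ over all ordered $k$-tuples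 of pairwise distinct points of $\Phi_n$. For $1\le i\le k$, the $i$-margin $f_i(x)$ is the integral of $f(x_1,\dots,x_{i-1},x,x_{i+1},\dots,x_k)$ over all variables other than the $i$-th (w.r.t. $dx$); if $k=1$, $f_1=f$. *)

theory Defs
  imports "HOL-Probability.Probability"
begin

text \<open>Round surface measure on the unit sphere S^d of real^'n (d+1 = CARD('n)),
  realised as (d+1) times the cone measure: sigma(A) = (d+1) * vol({t x : x in A, 0 < t <= 1}).\<close>
definition sphere_measure :: "(real^'n) measure" where
  "sphere_measure =
     scale_measure (of_nat CARD('n))
       (distr (restrict_space lborel (cball 0 1 - {0})) (restrict_space borel (sphere 0 1))
              (\<lambda>x. x /\<^sub>R norm x))"

definition sphere_area :: "nat \<Rightarrow> real" where
  "sphere_area d = 2 * pi powr ((real d + 1) / 2) / Gamma ((real d + 1) / 2)"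

text \<open>Dimension k_n of the space of spherical harmonics of degree n on S^d.\<close>
definition harm_dim :: "nat \<Rightarrow> nat \<Rightarrow> real" where
  "harm_dim d n = (2 * real n + real d - 1) / (real n + real d - 1) * real ((n + d - 1) choose (d - 1))"

text \<open>Legendre polynomial of degree n in dimension d+1, normalised by P_n(1) = 1:
  (n+d-1) P_{n+1}(t) = (2n+d-1) t P_n(t) - n P_{n-1}(t).\<close>
fun legendre :: "nat \<Rightarrow> nat \<Rightarrow> real \<Rightarrow> real" where
  "legendre d 0 t = 1"
| "legendre d (Suc 0) t = t"
| "legendre d (Suc (Suc n)) t =
     ((2 * real (Suc n) + real d - 1) * t * legendre d (Suc n) t - real (Suc n) * legendre d n t)
     / (real (Suc n) + real d - 1)"

text \<open>Projection kernel onto H_n(S^d).\<close>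
definition harm_kernel :: "nat \<Rightarrow> nat \<Rightarrow> real^'n \<Rightarrow> real^'n \<Rightarrow> real" where
  "harm_kernel d n x y = harm_dim d n / sphere_area d * legendre d n (x \<bullet> y)"

definition ldet :: "nat \<Rightarrow> (nat \<Rightarrow> nat \<Rightarrow> real) \<Rightarrow> real" where
  "ldet k A = (\<Sum>p\<in>{p. p permutes {..<k}}. of_int (sign p) * (\<Prod>i<k. A i (p i)))"

definition distinct_tuples :: "nat \<Rightarrow> 'b set \<Rightarrow> (nat \<Rightarrow> 'b) set" where
  "distinct_tuples k P = {x \<in> {..<k} \<rightarrow>\<^sub>E P. inj_on x {..<k}}"

text \<open>Phi (a random finite point configuration on the probability space M) is a determinantal
  point process w.r.t. base measure mu with kernel K: its k-th correlation functions are
  det (K(x_a,x_b))_{a,b}, i.e. the factorial moment identity holds for all nonnegative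
  measurable test functions.\<close>
definition is_dpp :: "'a measure \<Rightarrow> 'b measure \<Rightarrow> ('b \<Rightarrow> 'b \<Rightarrow> real) \<Rightarrow> ('a \<Rightarrow> 'b set) \<Rightarrow> bool" where
  "is_dpp M \<mu> K \<Phi> \<longleftrightarrow>
     (\<forall>\<omega>\<in>space M. finite (\<Phi> \<omega>) \<and> \<Phi> \<omega> \<subseteq> space \<mu>) \<and>
     (\<forall>k\<ge>1. \<forall>g \<in> borel_measurable (PiM {..<k} (\<lambda>_. \<mu>)).
        (\<lambda>\<omega>. \<Sum>x\<in>distinct_tuples k (\<Phi> \<omega>). g x) \<in> borel_measurable M \<and>
        (\<integral>\<^sup>+\<omega>. (\<Sum>x\<in>distinct_tuples k (\<Phi> \<omega>). g x) \<partial>M) =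
        (\<integral>\<^sup>+x. g x * ennreal (ldet k (\<lambda>a b. K (x a) (x b))) \<partial>PiM {..<k} (\<lambda>_. \<mu>)))"

definition lin_stat :: "nat \<Rightarrow> ((nat \<Rightarrow> 'b) \<Rightarrow> real) \<Rightarrow> 'b set \<Rightarrow> real" where
  "lin_stat k f P = (\<Sum>x\<in>distinct_tuples k P. f x)"

definition margin :: "'b measure \<Rightarrow> nat \<Rightarrow> ((nat \<Rightarrow> 'b) \<Rightarrow> real) \<Rightarrow> nat \<Rightarrow> 'b \<Rightarrow> real" where
  "margin \<mu> k f i x = (\<integral>y. f (y(i := x)) \<partial>PiM ({..<k} - {i}) (\<lambda>_. \<mu>))"

end

theory Submission
  imports Defs "Jordan_Normal_Form.Schur_Decomposition" "HOL-Real_Asymp.Real_Asymp"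
    "HOL-Analysis.Generalised_Binomial_Theorem"
begin

text \<open>Subtracting the one-variable projections \<open>f\<^sub>i\<close> splits \<open>L\<^sub>n f\<close> into a multiple of the linear statistic
  \<open>Y\<^sub>n\<close> of \<open>F\<close>, a constant (the number of points is almost surely \<open>k\<^sub>n\<close>) and the statistic of a function
  with vanishing \<open>1\<close>-margins. In the second moment of the latter, the integral belonging to a permutation vanishes
  unless the permutation moves enough points, and then it is small because the \<open>L\<^sup>1\<close> norm of \<open>K\<^sub>n(x, y)\<close> in \<open>y\<close>
  is at most \<open>sqrt k\<^sub>n\<close>; so this statistic is of lower order.

  The variance of \<open>Y\<^sub>n\<close> is a quadratic form in \<open>F\<close> with kernel \<open>P\<^sub>n\<^sup>2\<close>. With respect to the zonal density, the
  measures \<open>k\<^sub>n P\<^sub>n\<^sup>2\<close> converge weakly to a multiple of the arcsine law, which gives the limit. Finally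
  \<open>E (exp (i t Y\<^sub>n))\<close> is the determinant of a compression of the multiplication by \<open>exp (i t F)\<close> to the
  \<open>k\<^sub>n\<close>-dimensional range of \<open>K\<^sub>n\<close>. Its eigenvalues are close to \<open>1\<close> for small \<open>t\<close>, so its logarithm is the
  quadratic term up to \<open>O(k\<^sub>n |t|\<^sup>3)\<close>, and the continuity theorem for characteristic functions applies.\<close>

no_notation Matrix.scalar_prod (infix "\<bullet>" 70)
hide_const (open) Determinants.det

section \<open>The round measure\<close>

text \<open>No coordinates are introduced on the sphere, which is known only through the cones over
  its subsets. Reflections force all integrals of zonal functions: invariance fixes the moments of
  \<open>x \<bullet> y\<close>, hence a linear functional \<open>J\<close> on polynomials, and
  orthogonality, norms and the reproducing property of \<open>P n\<close> become algebra with
  \<open>J\<close>. The arcsine law appears because the recurrence coefficients of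
  \<open>P n\<close> tend to 1/2: multiplication by the Chebyshev polynomial of degree m becomes
  half the sum of the shifts by m and -m, which has a diagonal entry only for m = 0. Up to a
  constant, the density of this law with respect to the zonal one is
  \<open>1 / sin (arccos t) ^ (d - 1)\<close>, which is unbounded. It is therefore approximated from
  below by polynomials, and the limits along these and along
  \<open>k\<^sub>n P\<^sub>n\<^sup>2\<close> are identified through their Legendre coefficients.
  Powers of \<open>k\<^sub>n\<close> decide the rest: the second moment of the degenerate part has
  exponent at most 2k - 3/2, against 2k - 1 for the variance of the main part.\<close>

lemma normalize_measurable:
  "(\<lambda>x. x /\<^sub>R norm x) \<in> restrict_space lborel (cball 0 1 - {0}) \<rightarrow>\<^sub>M restrict_space borel (sphere (0::real^'n) 1)"
  by (rule measurable_restrict_space3) (auto intro!: measurableI)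

lemma space_sphere_measure [simp]: "space (sphere_measure :: (real^'n) measure) = sphere 0 1"
  by (simp add: sphere_measure_def space_scale_measure space_restrict_space)

lemma sets_sphere_measure [simp, measurable_cong]:
  "sets (sphere_measure :: (real^'n) measure) = sets (restrict_space borel (sphere 0 1))"
  by (simp add: sphere_measure_def)

lemma emeasure_sphere_measure:
  fixes A :: "(real^'n) set"
  assumes A: "A \<in> sets sphere_measure"
  shows "emeasure sphere_measure A = of_nat CARD('n) * emeasure lborel {x \<in> cball 0 1 - {0}. x /\<^sub>R norm x \<in> A}"
    "{x \<in> cball 0 1 - {0}. x /\<^sub>R norm x \<in> A} \<in> sets borel"
proof -
  let ?T = "\<lambda>x::real^'n. x /\<^sub>R norm x"
  let ?D = "cball (0::real^'n) 1 - {0}"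
  have A': "A \<in> sets (restrict_space borel (sphere 0 1))" using A by simp
  have eq: "?T -` A \<inter> space (restrict_space lborel ?D) = {x \<in> ?D. ?T x \<in> A}"
    by (auto simp: space_restrict_space)
  have "?T -` A \<inter> space (restrict_space lborel ?D) \<in> sets (restrict_space lborel ?D)"
    using measurable_sets[OF normalize_measurable A'] .
  then have m: "{x \<in> ?D. ?T x \<in> A} \<in> sets (restrict_space lborel ?D)" unfolding eq .
  then show "{x \<in> ?D. ?T x \<in> A} \<in> sets borel"
    by (subst (asm) sets_restrict_space_iff) auto
  have "emeasure sphere_measure A = of_nat CARD('n) * emeasure (restrict_space lborel ?D) {x \<in> ?D. ?T x \<in> A}"
    unfolding sphere_measure_def emeasure_scale_measure emeasure_distr[OF normalize_measurable A'] eq ..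
  also have "emeasure (restrict_space lborel ?D) {x \<in> ?D. ?T x \<in> A} = emeasure lborel {x \<in> ?D. ?T x \<in> A}"
    by (rule emeasure_restrict_space) auto
  finally show "emeasure sphere_measure A = of_nat CARD('n) * emeasure lborel {x \<in> ?D. ?T x \<in> A}" .
qed

text \<open>The cone over the whole sphere is the punctured unit ball, and d + 1 times the volume of
  the ball becomes \<open>sphere_area d\<close> by the functional equation of
  \<open>Gamma\<close>.\<close>

lemma emeasure_sphere_measure_space:
  assumes "CARD('n) = d + 1"
  shows "emeasure (sphere_measure :: (real^'n) measure) (sphere 0 1) = ennreal (sphere_area d)"
proof -
  let ?D = "cball (0::real^'n) 1 - {0}"
  have "sphere 0 1 \<in> sets (sphere_measure :: (real^'n) measure)"
    by (simp add: sets_restrict_space_iff)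
  then have "emeasure (sphere_measure :: (real^'n) measure) (sphere 0 1)
      = of_nat CARD('n) * emeasure lborel {x \<in> ?D. x /\<^sub>R norm x \<in> sphere 0 1}"
    by (rule emeasure_sphere_measure)
  also have "{x \<in> ?D. x /\<^sub>R norm x \<in> sphere 0 1} = ?D" by auto
  also have "emeasure lborel ?D = emeasure lborel (cball (0::real^'n) 1)"
    by (subst emeasure_Diff) auto
  also have "\<dots> = ennreal (unit_ball_vol (real (d + 1)))"
    using assms by (subst emeasure_cball) auto
  also have "of_nat CARD('n) * \<dots> = ennreal (real (d + 1) * unit_ball_vol (real (d+1)))"
    using assms by (simp add: ennreal_mult' ennreal_of_nat_eq_real_of_nat)
  also have "real (d + 1) * unit_ball_vol (real (d+1)) = sphere_area d"
  proof -
    have "Gamma ((real d + 1)/2 + 1) = (real d + 1)/2 * Gamma ((real d + 1)/2)"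
      by (rule Gamma_plus1) (auto elim!: nonpos_Ints_cases)
    moreover have pos: "Gamma ((real d + 1)/2) > 0" by (rule Gamma_real_pos) simp
    ultimately have "(real d + 1) * (pi powr ((real d + 1)/2) / Gamma ((real d + 1)/2 + 1))
        = 2 * pi powr ((real d + 1)/2) / Gamma ((real d + 1)/2)"
      by (auto simp: divide_simps)
    then show ?thesis
      unfolding unit_ball_vol_def sphere_area_def by (simp add: add.commute)
  qed
  finally show ?thesis .
qed

lemma sphere_area_pos: "0 < sphere_area d"
  unfolding sphere_area_def by (auto intro!: divide_pos_pos Gamma_real_pos)

lemma finite_measure_sphere: "finite_measure (sphere_measure :: (real^'n) measure)"
proof
  have "0 < CARD('n)" by simp
  then obtain d where "CARD('n) = d + 1" by (metis Suc_eq_plus1 gr0_conv_Suc)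
  from emeasure_sphere_measure_space[OF this]
  show "emeasure (sphere_measure :: (real^'n) measure) (space sphere_measure) \<noteq> \<infinity>" by simp
qed

text \<open>Uniqueness of translation-invariant measures: integrating \<open>1\<^sub>A(x) 1\<^sub>B(x + y)\<close> in both orders,
  with \<open>A\<close> the unit ball, compares the image measure with Lebesgue measure.\<close>

lemma lborel_distr_orthogonal:
  fixes Q :: "'a::euclidean_space \<Rightarrow> 'a"
  assumes Q: "orthogonal_transformation Q"
  shows "distr lborel borel Q = lborel"
proof (rule measure_eqI)
  let ?\<nu> = "distr lborel borel Q"
  have lin: "linear Q" and norm: "\<And>x. norm (Q x) = norm x" and bij: "bij Q"
    using Q by (auto simp: orthogonal_transformation_linear orthogonal_transformation_norm orthogonal_transformation_bij)
  have Qm [measurable]: "Q \<in> borel_measurable borel"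
    by (intro borel_measurable_continuous_onI linear_continuous_on lin linear_conv_bounded_linear[THEN iffD1])
  have nui: "(\<integral>\<^sup>+y. f y \<partial>?\<nu>) = (\<integral>\<^sup>+y. f (Q y) \<partial>lborel)" if "f \<in> borel_measurable borel" for f
    using that by (subst nn_integral_distr) auto
  have tr: "(\<integral>\<^sup>+y. f (c + y) \<partial>lborel) = (\<integral>\<^sup>+y. f y \<partial>lborel)"
    if [measurable]: "f \<in> borel_measurable borel" for f and c :: 'a
    by (subst lborel_distr_plus[of c, symmetric], subst nn_integral_distr) auto
  have trn: "(\<integral>\<^sup>+y. f (c + y) \<partial>?\<nu>) = (\<integral>\<^sup>+y. f y \<partial>?\<nu>)"
    if [measurable]: "f \<in> borel_measurable borel" for f and c :: 'a
  proof -
    obtain c' where c': "c = Q c'" using bij by (metis bij_pointE)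
    have "(\<integral>\<^sup>+y. f (c + y) \<partial>?\<nu>) = (\<integral>\<^sup>+y. f (Q (c' + y)) \<partial>lborel)"
      unfolding c' by (subst nui) (auto simp: linear_add[OF lin])
    also have "\<dots> = (\<integral>\<^sup>+y. f (Q y) \<partial>lborel)" by (rule tr) simp
    also have "\<dots> = (\<integral>\<^sup>+y. f y \<partial>?\<nu>)" by (rule nui[symmetric]) simp
    finally show ?thesis .
  qed
  let ?A = "ball (0::'a) 1"
  \<comment> \<open>\<open>Q\<close> maps the ball onto itself. This equality fixes the factor that
    translation invariance alone leaves open.\<close>
  have nuA: "emeasure ?\<nu> ?A = emeasure lborel ?A"
  proof -
    have "Q -` ?A = ?A" using norm by auto
    then show ?thesis by (subst emeasure_distr) auto
  qed
  have sfn: "sigma_finite_measure ?\<nu>"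
  proof
    let ?F = "range (\<lambda>n::nat. ball (0::'a) (real n))"
    have "x \<in> \<Union>?F" for x :: 'a
      using reals_Archimedean2[of "norm x"] by auto
    then have "\<Union>?F = UNIV" by blast
    moreover have "emeasure ?\<nu> a \<noteq> \<infinity>" if "a \<in> ?F" for a
    proof -
      from that obtain n where a: "a = ball 0 (real n)" by auto
      have "Q -` a = a" unfolding a using norm by auto
      then show ?thesis unfolding a by (subst emeasure_distr) (auto simp: emeasure_ball)
    qed
    ultimately show "\<exists>A. countable A \<and> A \<subseteq> sets ?\<nu> \<and> \<Union> A = space ?\<nu> \<and> (\<forall>a\<in>A. emeasure ?\<nu> a \<noteq> \<infinity>)"
      by (intro exI[of _ ?F]) auto
  qed
  interpret N: sigma_finite_measure ?\<nu> by fact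
  interpret P: pair_sigma_finite lborel ?\<nu> by standard
  fix B assume "B \<in> sets ?\<nu>"
  then have B [measurable]: "B \<in> sets borel" by simp
  have A [measurable]: "?A \<in> sets borel" by simp
  have pm: "(\<lambda>z. fst z + snd z :: 'a) \<in> borel_measurable (borel \<Otimes>\<^sub>M borel)"
    "(\<lambda>z. fst z - snd z :: 'a) \<in> borel_measurable (borel \<Otimes>\<^sub>M borel)" by measurable
  have sets_eq: "sets (lborel \<Otimes>\<^sub>M ?\<nu>) = sets (borel \<Otimes>\<^sub>M borel)"
    by (intro sets_pair_measure_cong) auto
  let ?g = "\<lambda>x y. indicator ?A x * indicator B (x + y) :: ennreal"
  have m1 [measurable]: "(\<lambda>(x,y). ?g x y) \<in> borel_measurable (lborel \<Otimes>\<^sub>M ?\<nu>)"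
    unfolding split_beta' measurable_cong_sets[OF sets_eq refl]
    by (intro borel_measurable_times_ennreal measurable_compose[OF measurable_fst borel_measurable_indicator[OF A]]
        measurable_compose[OF pm(1) borel_measurable_indicator[OF B]])
  have m2 [measurable]: "(\<lambda>(x,y). indicator B x * indicator ?A (x - y) :: ennreal) \<in> borel_measurable (lborel \<Otimes>\<^sub>M ?\<nu>)"
    unfolding split_beta' measurable_cong_sets[OF sets_eq refl]
    by (intro borel_measurable_times_ennreal measurable_compose[OF measurable_fst borel_measurable_indicator[OF B]]
        measurable_compose[OF pm(2) borel_measurable_indicator[OF A]])
  have "(\<integral>\<^sup>+x. (\<integral>\<^sup>+y. ?g x y \<partial>?\<nu>) \<partial>lborel) = (\<integral>\<^sup>+x. indicator ?A x * emeasure ?\<nu> B \<partial>lborel)"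
  proof (rule nn_integral_cong)
    fix x :: 'a
    show "(\<integral>\<^sup>+y. ?g x y \<partial>?\<nu>) = indicator ?A x * emeasure ?\<nu> B"
      using trn[of "indicator B" x] by (subst nn_integral_cmult) auto
  qed
  also have "\<dots> = emeasure lborel ?A * emeasure ?\<nu> B"
    by (subst nn_integral_multc) auto
  finally have 1: "(\<integral>\<^sup>+x. (\<integral>\<^sup>+y. ?g x y \<partial>?\<nu>) \<partial>lborel) = emeasure lborel ?A * emeasure ?\<nu> B" .
  have "(\<integral>\<^sup>+x. (\<integral>\<^sup>+y. ?g x y \<partial>?\<nu>) \<partial>lborel) = (\<integral>\<^sup>+y. (\<integral>\<^sup>+x. ?g x y \<partial>lborel) \<partial>?\<nu>)"
    by (rule P.Fubini'[OF m1, symmetric])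
  also have "\<dots> = (\<integral>\<^sup>+y. (\<integral>\<^sup>+x. indicator B x * indicator ?A (x - y) \<partial>lborel) \<partial>?\<nu>)"
  proof (rule nn_integral_cong)
    fix y :: 'a
    show "(\<integral>\<^sup>+x. ?g x y \<partial>lborel) = (\<integral>\<^sup>+x. indicator B x * indicator ?A (x - y) \<partial>lborel)"
      using tr[of "\<lambda>x. indicator B x * indicator ?A (x - y)" y]
      by (simp add: mult.commute add.commute)
  qed
  also have "\<dots> = (\<integral>\<^sup>+x. (\<integral>\<^sup>+y. indicator B x * indicator ?A (x - y) \<partial>?\<nu>) \<partial>lborel)"
    by (rule P.Fubini'[OF m2])
  also have "\<dots> = (\<integral>\<^sup>+x. indicator B x * emeasure ?\<nu> ?A \<partial>lborel)"
  proof (rule nn_integral_cong)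
    fix x :: 'a
    have "(\<integral>\<^sup>+y. indicator ?A (x - y) \<partial>?\<nu>) = (\<integral>\<^sup>+y. indicator ?A (- x + y) \<partial>?\<nu>)"
      by (rule nn_integral_cong) (auto simp: indicator_def norm_minus_commute)
    also have "\<dots> = emeasure ?\<nu> ?A" using trn[of "indicator ?A" "-x"] by simp
    finally show "(\<integral>\<^sup>+y. indicator B x * indicator ?A (x - y) \<partial>?\<nu>) = indicator B x * emeasure ?\<nu> ?A"
      by (subst nn_integral_cmult) auto
  qed
  also have "\<dots> = emeasure lborel ?A * emeasure lborel B"
    by (subst nn_integral_multc) (auto simp: nuA mult.commute)
  finally have "emeasure lborel ?A * emeasure ?\<nu> B = emeasure lborel ?A * emeasure lborel B"
    unfolding 1 .
  moreover have "unit_ball_vol (real DIM('a)) \<noteq> 0"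
    using unit_ball_vol_pos[of "real DIM('a)"] by linarith
  then have "emeasure lborel ?A \<noteq> 0" "emeasure lborel ?A \<noteq> \<infinity>"
    using unit_ball_vol_pos[of "real DIM('a)"] by (simp_all add: emeasure_ball)
  ultimately show "emeasure ?\<nu> B = emeasure lborel B"
    by (simp add: ennreal_mult_cancel_left)
qed simp

section \<open>Invariance of the sphere measure under orthogonal maps\<close>

lemma orthogonal_measurable_sphere:
  fixes Q :: "real^'n \<Rightarrow> real^'n"
  assumes Q: "orthogonal_transformation Q"
  shows "Q \<in> sphere_measure \<rightarrow>\<^sub>M sphere_measure"
proof -
  have "Q \<in> restrict_space borel (sphere 0 1) \<rightarrow>\<^sub>M restrict_space borel (sphere 0 1)"
    using Q by (intro measurable_restrict_space3)
      (auto simp: orthogonal_transformation_norm intro!: borel_measurable_continuous_onI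
         linear_continuous_on orthogonal_transformation_linear linear_conv_bounded_linear[THEN iffD1])
  then show ?thesis by (simp cong: measurable_cong_sets)
qed

text \<open>\<open>Q\<close> is linear and preserves norms, so the cone over the preimage of
  \<open>A\<close> is the preimage of the cone over \<open>A\<close>; the invariance of Lebesgue
  measure carries over.\<close>

lemma distr_sphere_measure_orthogonal:
  fixes Q :: "real^'n \<Rightarrow> real^'n"
  assumes Q: "orthogonal_transformation Q"
  shows "distr sphere_measure sphere_measure Q = sphere_measure"
proof (rule measure_eqI)
  note meas = orthogonal_measurable_sphere[OF Q]
  fix A assume "A \<in> sets (distr sphere_measure sphere_measure Q)"
  then have A: "A \<in> sets sphere_measure" by simp
  let ?D = "cball (0::real^'n) 1 - {0}"
  let ?B = "{x \<in> ?D. x /\<^sub>R norm x \<in> A}"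
  let ?B' = "{x \<in> ?D. x /\<^sub>R norm x \<in> Q -` A \<inter> sphere 0 1}"
  have A': "Q -` A \<inter> sphere 0 1 \<in> sets sphere_measure"
    using measurable_sets[OF meas A] by simp
  have lin: "linear Q" and norm: "\<And>x. norm (Q x) = norm x" and bij: "bij Q"
    using Q by (auto simp: orthogonal_transformation_linear orthogonal_transformation_norm orthogonal_transformation_bij)
  have img: "Q ` ?B' = ?B"
  proof (intro equalityI subsetI)
    fix x assume "x \<in> Q ` ?B'" then show "x \<in> ?B"
      using norm linear_scale[OF lin] linear_0[OF lin] by (auto) (metis norm norm_eq_zero)
  next
    fix x assume x: "x \<in> ?B"
    obtain y where y: "x = Q y" using bij by (metis bij_pointE)
    have "y \<noteq> 0" using x unfolding y by (auto simp: linear_0[OF lin])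
    then have "y \<in> ?B'" using x unfolding y using norm linear_scale[OF lin] linear_0[OF lin] by auto
    then show "x \<in> Q ` ?B'" using y by auto
  qed
  have "linear Q" by fact
  then have Qm: "Q \<in> borel_measurable borel"
    by (intro borel_measurable_continuous_onI linear_continuous_on linear_conv_bounded_linear[THEN iffD1])
  have "Q -` (Q ` ?B') = ?B'" using bij by (intro inj_vimage_image_eq) (simp add: bij_def)
  then have "Q -` ?B = ?B'" unfolding img .
  then have "emeasure lborel ?B = emeasure lborel ?B'"
    using emeasure_distr[of Q lborel borel ?B] emeasure_sphere_measure(2)[OF A] Qm
    by (simp add: lborel_distr_orthogonal[OF Q])
  then show "emeasure (distr sphere_measure sphere_measure Q) A = emeasure sphere_measure A"
    using emeasure_distr[OF meas A] emeasure_sphere_measure(1)[OF A] emeasure_sphere_measure(1)[OF A']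
    by simp
qed simp

lemma integral_sphere_orthogonal:
  fixes Q :: "real^'n \<Rightarrow> real^'n" and h :: "real^'n \<Rightarrow> real"
  assumes Q: "orthogonal_transformation Q" and h: "h \<in> borel_measurable sphere_measure"
  shows "(\<integral>x. h (Q x) \<partial>sphere_measure) = (\<integral>x. h x \<partial>sphere_measure)"
  using integral_distr[OF orthogonal_measurable_sphere[OF Q] h]
  by (simp add: distr_sphere_measure_orthogonal[OF Q])

text \<open>The reflection in the hyperplane orthogonal to \<open>a - b\<close>. It fixes that
  hyperplane, which consists of the \<open>y\<close> with equal inner products with \<open>a\<close>
  and \<open>b\<close>; so one direction can be exchanged for another while a chosen axis stays in
  place.\<close>

lemma reflection_between:
  fixes a b :: "'a::euclidean_space"
  assumes "norm a = norm b"
  obtains Q where "orthogonal_transformation Q" "Q a = b" "\<And>y. y \<bullet> a = y \<bullet> b \<Longrightarrow> Q y = y"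
proof (cases "a = b")
  case True
  then show ?thesis using that[of id] by (auto simp: id_def)
next
  case False
  define h where "h = a - b"
  have h0: "h \<bullet> h \<noteq> 0" using False by (simp add: h_def)
  define Q where "Q = (\<lambda>x. x - (2 * (x \<bullet> h) / (h \<bullet> h)) *\<^sub>R h)"
  have "linear Q" unfolding Q_def
    by (rule linearI) (auto simp: algebra_simps inner_simps add_divide_distrib)
  moreover have "Q x \<bullet> Q y = x \<bullet> y" for x y
    using h0 by (simp add: Q_def inner_simps inner_commute field_simps)
  ultimately have "orthogonal_transformation Q" by (auto simp: orthogonal_transformation_def)
  moreover have ab: "a \<bullet> a = b \<bullet> b" using assms by (simp add: norm_eq)
  have "2 * (a \<bullet> h) = h \<bullet> h" using ab by (simp add: h_def inner_simps inner_commute)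
  then have "Q a = b" unfolding Q_def using h0 by (simp add: h_def)
  moreover have "Q y = y" if "y \<bullet> a = y \<bullet> b" for y
    using that by (simp add: Q_def h_def inner_simps)
  ultimately show ?thesis using that by blast
qed

section \<open>Zonal moments\<close>

locale round_sphere =
  fixes \<sigma> :: "(real^'n) measure" and d :: nat
  assumes sigma: "\<sigma> = sphere_measure" and dim: "CARD('n) = d + 1" and d2: "d \<ge> 2"
begin

abbreviation area :: real where "area \<equiv> sphere_area d"

lemma space_sigma [simp]: "space \<sigma> = sphere 0 1" by (simp add: sigma)

lemma sets_sigma [measurable_cong]: "sets \<sigma> = sets (restrict_space borel (sphere 0 1))"
  by (simp add: sigma)

sublocale finite_measure \<sigma> unfolding sigma by (rule finite_measure_sphere)

lemma measure_sigma: "measure \<sigma> (sphere 0 1) = area"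
  using emeasure_sphere_measure_space[OF dim] sphere_area_pos[of d] by (simp add: sigma measure_def)

lemma area_pos: "0 < area" by (rule sphere_area_pos)

lemma borel_measurable_sigma: "h \<in> borel_measurable borel \<Longrightarrow> h \<in> borel_measurable \<sigma>"
  by (subst measurable_cong_sets[OF sets_sigma refl]) (rule measurable_restrict_space1)

lemma continuous_measurable: "continuous_on UNIV h \<Longrightarrow> (h :: real^'n \<Rightarrow> real) \<in> borel_measurable \<sigma>"
  by (intro borel_measurable_sigma borel_measurable_continuous_onI)

lemma continuous_integrable:
  fixes h :: "real^'n \<Rightarrow> real"
  assumes h: "continuous_on UNIV h"
  shows "integrable \<sigma> h"
proof -
  have "compact (h ` sphere 0 1)"
    by (intro compact_continuous_image continuous_on_subset[OF h]) auto
  then obtain B where "\<And>x. x \<in> sphere 0 1 \<Longrightarrow> norm (h x) \<le> B"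
    using compact_imp_bounded bounded_iff by (metis imageI)
  then show ?thesis
    using continuous_measurable[OF h] by (intro integrable_const_bound[of _ B]) auto
qed

lemma integral_orthogonal:
  fixes h :: "real^'n \<Rightarrow> real"
  assumes "orthogonal_transformation Q" "continuous_on UNIV h"
  shows "(\<integral>x. h (Q x) \<partial>\<sigma>) = (\<integral>x. h x \<partial>\<sigma>)"
  using integral_sphere_orthogonal[OF assms(1), of h] continuous_measurable[OF assms(2)]
  by (simp add: sigma)

text \<open>The reflection taking \<open>v\<close> to \<open>w\<close> fixes \<open>y\<close> and
  hence preserves the zonal factor. The moment identities that follow rest on this symmetry.\<close>

lemma zonal_moment_cong:
  assumes v: "norm v = norm (w::real^'n)" and y: "y \<bullet> v = y \<bullet> w"
  shows "(\<integral>x. poly p (x \<bullet> y) * (x \<bullet> v) ^ n \<partial>\<sigma>) = (\<integral>x. poly p (x \<bullet> y) * (x \<bullet> w) ^ n \<partial>\<sigma>)"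
proof -
  obtain Q where Q: "orthogonal_transformation Q" "Q v = w" "Q y = y"
    using reflection_between[OF v] y by metis
  have "(\<integral>x. poly p (x \<bullet> y) * (x \<bullet> w) ^ n \<partial>\<sigma>) = (\<integral>x. poly p (Q x \<bullet> y) * (Q x \<bullet> w) ^ n \<partial>\<sigma>)"
    by (rule integral_orthogonal[OF Q(1), symmetric]) (intro continuous_intros)
  also have "\<dots> = (\<integral>x. poly p (x \<bullet> y) * (x \<bullet> v) ^ n \<partial>\<sigma>)"
    using Q by (metis (no_types, lifting) orthogonal_transformation_def)
  finally show ?thesis by simp
qed

text \<open>The case \<open>w = - v\<close> of the previous symmetry.\<close>

lemma zonal_moment_odd:
  assumes y: "y \<bullet> (v::real^'n) = 0" and n: "odd n"
  shows "(\<integral>x. poly p (x \<bullet> y) * (x \<bullet> v) ^ n \<partial>\<sigma>) = 0"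
  using zonal_moment_cong[of v "-v" y p n] y n by simp

lemma coeff_one_plus_square_power: "coeff ([:1, 0, 1::real:] ^ r) 0 = 1" "coeff ([:1, 0, 1::real:] ^ r) 2 = real r"
proof -
  have s: "coeff ([:1, 0, 1:] * q) 2 = coeff q 2 + coeff q 0" for q :: "real poly"
    by (simp add: numeral_2_eq_2)
  show 1: "coeff ([:1, 0, 1::real:] ^ r) 0 = 1" for r by (induction r) auto
  show "coeff ([:1, 0, 1::real:] ^ r) 2 = real r"
  proof (induction r)
    case (Suc r)
    have "coeff ([:1, 0, 1::real:] ^ Suc r) 2 = coeff ([:1, 0, 1:] * [:1, 0, 1::real:] ^ r) 2" by simp
    then show ?case unfolding s using Suc 1[of r] by simp
  qed simp
qed

text \<open>The vectors \<open>sqrt (1 + u^2) *\<^sub>R v\<close> and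
  \<open>v + u *\<^sub>R w\<close> have the same norm and are both orthogonal to \<open>y\<close>,
  so their moments of order n = b + 2 = 2r agree for every u. Both sides are polynomials in u; the
  coefficients of u^2 give (n choose 2) M 2 = r M 0, and n choose 2 is r (b + 1).\<close>

lemma zonal_moment_mixed:
  fixes v w y :: "real^'n"
  assumes u: "norm v = 1" "norm w = 1" and o: "v \<bullet> w = 0" "y \<bullet> v = 0" "y \<bullet> w = 0" and b: "even b"
  shows "(real b + 1) * (\<integral>x. poly p (x \<bullet> y) * (x \<bullet> v) ^ b * (x \<bullet> w)^2 \<partial>\<sigma>)
       = (\<integral>x. poly p (x \<bullet> y) * (x \<bullet> v) ^ (b + 2) \<partial>\<sigma>)"
proof -
  define n where "n = b + 2"
  define r where "r = n div 2"
  have n: "n = 2 * r" and r0: "r > 0" using b by (auto simp: n_def r_def)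
  define M where "M = (\<lambda>i. \<integral>x. poly p (x \<bullet> y) * (x \<bullet> w)^i * (x \<bullet> v)^(n - i) \<partial>\<sigma>)"
  define A where "A = (\<Sum>i\<le>n. monom (of_nat (n choose i) * M i) i)"
  have int [simp]: "integrable \<sigma> (\<lambda>x. poly p (x \<bullet> y) * (x \<bullet> w)^i * (x \<bullet> v)^j)" for i j
    by (intro continuous_integrable continuous_intros)
  have "poly A u = poly (Polynomial.smult (M 0) ([:1, 0, 1:] ^ r)) u" for u
  proof -
    have "norm (sqrt (1 + u^2) *\<^sub>R v) = norm (v + u *\<^sub>R w)"
      using u o by (simp add: norm_eq_sqrt_inner inner_simps inner_commute power2_eq_square)
    moreover have "y \<bullet> (sqrt (1 + u^2) *\<^sub>R v) = y \<bullet> (v + u *\<^sub>R w)"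
      using o by (simp add: inner_simps)
    ultimately have "(\<integral>x. poly p (x \<bullet> y) * (x \<bullet> (sqrt (1 + u^2) *\<^sub>R v)) ^ n \<partial>\<sigma>)
        = (\<integral>x. poly p (x \<bullet> y) * (x \<bullet> (v + u *\<^sub>R w)) ^ n \<partial>\<sigma>)"
      by (rule zonal_moment_cong)
    moreover have "(x \<bullet> (sqrt (1 + u^2) *\<^sub>R v)) ^ n = (1 + u^2)^r * (x \<bullet> v) ^ n" for x
      by (simp add: n power_mult_distrib power_mult)
    moreover have "(x \<bullet> (v + u *\<^sub>R w)) ^ n = (\<Sum>i\<le>n. of_nat (n choose i) * u^i * ((x \<bullet> w)^i * (x \<bullet> v)^(n - i)))" for x
      using binomial_ring[of "u * (x \<bullet> w)" "x \<bullet> v" n]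
      by (simp add: inner_simps power_mult_distrib algebra_simps)
    ultimately have "(\<integral>x. (1 + u^2)^r * (poly p (x \<bullet> y) * (x \<bullet> w)^0 * (x \<bullet> v) ^ n) \<partial>\<sigma>)
      = (\<integral>x. (\<Sum>i\<le>n. of_nat (n choose i) * u^i * (poly p (x \<bullet> y) * (x \<bullet> w)^i * (x \<bullet> v)^(n - i))) \<partial>\<sigma>)"
      by (simp add: sum_distrib_left mult_ac)
    then have "(1 + u^2)^r * M 0 = (\<Sum>i\<le>n. of_nat (n choose i) * u^i * M i)"
      unfolding M_def by (subst (asm) Bochner_Integration.integral_sum) auto
    then show ?thesis
      by (simp add: A_def poly_sum poly_monom poly_power power2_eq_square mult_ac)
  qed
  then have "A = Polynomial.smult (M 0) ([:1, 0, 1:] ^ r)" by (simp add: poly_eq_poly_eq_iff[symmetric] fun_eq_iff)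
  then have "coeff A 2 = M 0 * real r" using coeff_one_plus_square_power(2) by simp
  moreover have "coeff A 2 = real (n choose 2) * M 2"
    using r0 n by (simp add: A_def coeff_sum sum.delta)
  moreover have "real (n choose 2) = real r * (real b + 1)"
  proof -
    have "n choose 2 = n * (n - 1) div 2" by (rule choose_two)
    also have "n - 1 = b + 1" by (simp add: n_def)
    also have "n * (b + 1) div 2 = r * (b + 1)" unfolding n by simp
    finally have "n choose 2 = r * (b + 1)" .
    then show ?thesis by (simp add: algebra_simps)
  qed
  ultimately have "(real b + 1) * M 2 = M 0" using r0 by simp
  then show ?thesis by (simp add: M_def n_def mult_ac)
qed

lemma orthonormal_basis:
  assumes "norm (y::real^'n) = 1"
  obtains S where "finite S" "y \<in> S" "card S = d + 1" "\<And>e. e \<in> S \<Longrightarrow> norm e = 1"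
    "\<And>e e'. e \<in> S \<Longrightarrow> e' \<in> S \<Longrightarrow> e \<noteq> e' \<Longrightarrow> e \<bullet> e' = 0"
    "\<And>x. (\<Sum>e\<in>S. (x \<bullet> e)^2) = (norm x)^2"
proof -
  obtain S where S: "y \<in> S" "pairwise real_inner_class.orthogonal S" "\<And>x. x \<in> S \<Longrightarrow> norm x = 1"
      "independent S" "card S = DIM(real^'n)" "span S = (UNIV::(real^'n) set)"
    using vector_in_orthonormal_basis[OF assms] by blast
  have fin: "finite S" using S(4) independent_imp_finite by blast
  have "(\<Sum>e\<in>S. (x \<bullet> e)^2) = (norm x)^2" for x
  proof -
    have "x = (\<Sum>v\<in>S. (x \<bullet> v) *\<^sub>R v)"
      using orthonormal_basis_expand[OF S(2,3) _ fin, of x] S(6) by simp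
    then have "x \<bullet> x = x \<bullet> (\<Sum>v\<in>S. (x \<bullet> v) *\<^sub>R v)" by simp
    then show ?thesis by (simp add: inner_sum_right flip: power2_eq_square power2_norm_eq_inner)
  qed
  then show ?thesis using that[OF fin S(1)] S dim
    by (auto simp: pairwise_def real_inner_class.orthogonal_def)
qed

text \<open>On the sphere, 1 - (x . y)^2 is the sum of the squared components along the other d
  vectors of an orthonormal basis. One of them contributes the moment of order b + 2, each of the
  other d - 1 a mixed moment, which is smaller by the factor b + 1.\<close>

lemma zonal_moment_step:
  fixes y e :: "real^'n"
  assumes u: "norm y = 1" "norm e = 1" and o: "y \<bullet> e = 0" and b: "even b"
  shows "(real b + real d) * (\<integral>x. poly p (x \<bullet> y) * (x \<bullet> e) ^ (b + 2) \<partial>\<sigma>)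
       = (real b + 1) * (\<integral>x. poly (p * [:1, 0, -1:]) (x \<bullet> y) * (x \<bullet> e) ^ b \<partial>\<sigma>)"
proof -
  obtain S where S: "finite S" "y \<in> S" "card S = d + 1" "\<And>e. e \<in> S \<Longrightarrow> norm e = 1"
    "\<And>e e'. e \<in> S \<Longrightarrow> e' \<in> S \<Longrightarrow> e \<noteq> e' \<Longrightarrow> e \<bullet> e' = 0"
    "\<And>x. (\<Sum>e\<in>S. (x \<bullet> e)^2) = (norm x)^2"
    using orthonormal_basis[OF u(1)] by blast
  have "card (S - {y}) = d" using S by simp
  with d2 have "S - {y} \<noteq> {}" by (metis card.empty not_numeral_le_zero)
  then obtain e0 where e0: "e0 \<in> S" "e0 \<noteq> y" by auto
  \<comment> \<open>The given \<open>e\<close> need not belong to the basis; by symmetry it may be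
    replaced by a basis vector.\<close>
  have cong: "(\<integral>x. poly q (x \<bullet> y) * (x \<bullet> e) ^ n \<partial>\<sigma>) = (\<integral>x. poly q (x \<bullet> y) * (x \<bullet> e0) ^ n \<partial>\<sigma>)" for q n
    using e0 S u o by (intro zonal_moment_cong) auto
  define m where "m = (\<integral>x. poly p (x \<bullet> y) * (x \<bullet> e0) ^ (b + 2) \<partial>\<sigma>)"
  have int [simp]: "integrable \<sigma> (\<lambda>x. poly p (x \<bullet> y) * (x \<bullet> e0)^i * (x \<bullet> v)^j)" for i j v
    by (intro continuous_integrable continuous_intros)
  have "(\<integral>x. poly (p * [:1, 0, -1:]) (x \<bullet> y) * (x \<bullet> e0) ^ b \<partial>\<sigma>)
     = (\<integral>x. (\<Sum>v\<in>S-{y}. poly p (x \<bullet> y) * (x \<bullet> e0)^b * (x \<bullet> v)^2) \<partial>\<sigma>)"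
  proof (rule Bochner_Integration.integral_cong[OF refl])
    fix x assume "x \<in> space \<sigma>"
    then have "norm x = 1" by simp
    then have "(\<Sum>v\<in>S-{y}. (x \<bullet> v)^2) = 1 - (x \<bullet> y)^2"
      using S(6)[of x] S(1,2) by (simp add: sum_diff1)
    then have "(\<Sum>v\<in>S-{y}. poly p (x \<bullet> y) * (x \<bullet> e0)^b * (x \<bullet> v)^2) = poly p (x \<bullet> y) * (x \<bullet> e0)^b * (1 - (x \<bullet> y)^2)"
      by (simp add: sum_distrib_left[symmetric])
    then show "poly (p * [:1, 0, -1:]) (x \<bullet> y) * (x \<bullet> e0) ^ b = (\<Sum>v\<in>S-{y}. poly p (x \<bullet> y) * (x \<bullet> e0)^b * (x \<bullet> v)^2)"
      by (simp add: power2_eq_square algebra_simps)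
  qed
  also have "\<dots> = (\<Sum>v\<in>S-{y}. (\<integral>x. poly p (x \<bullet> y) * (x \<bullet> e0)^b * (x \<bullet> v)^2 \<partial>\<sigma>))"
    by (rule Bochner_Integration.integral_sum) simp
  also have "\<dots> = (\<integral>x. poly p (x \<bullet> y) * (x \<bullet> e0)^b * (x \<bullet> e0)^2 \<partial>\<sigma>)
      + (\<Sum>v\<in>S-{y}-{e0}. (\<integral>x. poly p (x \<bullet> y) * (x \<bullet> e0)^b * (x \<bullet> v)^2 \<partial>\<sigma>))"
    using S e0 by (subst sum.remove[of _ e0]) auto
  also have "(\<integral>x. poly p (x \<bullet> y) * (x \<bullet> e0)^b * (x \<bullet> e0)^2 \<partial>\<sigma>) = m"
    by (simp add: m_def power_add power2_eq_square mult_ac)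
  also have "(\<Sum>v\<in>S-{y}-{e0}. (\<integral>x. poly p (x \<bullet> y) * (x \<bullet> e0)^b * (x \<bullet> v)^2 \<partial>\<sigma>)) = (\<Sum>v\<in>S-{y}-{e0}. m / (real b + 1))"
  proof (rule sum.cong[OF refl])
    fix v assume v: "v \<in> S - {y} - {e0}"
    have "(real b + 1) * (\<integral>x. poly p (x \<bullet> y) * (x \<bullet> e0)^b * (x \<bullet> v)^2 \<partial>\<sigma>) = m"
      unfolding m_def using v S e0 b by (intro zonal_moment_mixed) (auto simp: inner_commute)
    then show "(\<integral>x. poly p (x \<bullet> y) * (x \<bullet> e0)^b * (x \<bullet> v)^2 \<partial>\<sigma>) = m / (real b + 1)"
      by (simp add: field_simps)
  qed
  also have "\<dots> = (real d - 1) * (m / (real b + 1))"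
    using S e0 d2 by (simp add: of_nat_diff)
  finally show ?thesis unfolding cong m_def[symmetric] by (simp add: field_simps)
qed

text \<open>The same summation over a basis with a single axis: one pure term and d mixed
  ones.\<close>

lemma axial_moment_step:
  fixes e :: "real^'n"
  assumes e: "norm e = 1" and b: "even b"
  shows "(real b + 1 + real d) * (\<integral>x. (x \<bullet> e) ^ (b + 2) \<partial>\<sigma>) = (real b + 1) * (\<integral>x. (x \<bullet> e) ^ b \<partial>\<sigma>)"
proof -
  obtain S where S: "finite S" "e \<in> S" "card S = d + 1" "\<And>e. e \<in> S \<Longrightarrow> norm e = 1"
    "\<And>e e'. e \<in> S \<Longrightarrow> e' \<in> S \<Longrightarrow> e \<noteq> e' \<Longrightarrow> e \<bullet> e' = 0"
    "\<And>x. (\<Sum>e\<in>S. (x \<bullet> e)^2) = (norm x)^2"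
    using orthonormal_basis[OF e(1)] by blast
  define m where "m = (\<integral>x. (x \<bullet> e) ^ (b + 2) \<partial>\<sigma>)"
  have int [simp]: "integrable \<sigma> (\<lambda>x. (x \<bullet> e)^i * (x \<bullet> v)^j)" for i j v
    by (intro continuous_integrable continuous_intros)
  have "(\<integral>x. (x \<bullet> e) ^ b \<partial>\<sigma>) = (\<integral>x. (\<Sum>v\<in>S. (x \<bullet> e)^b * (x \<bullet> v)^2) \<partial>\<sigma>)"
    by (rule Bochner_Integration.integral_cong) (auto simp: sum_distrib_left[symmetric] S(6))
  also have "\<dots> = (\<Sum>v\<in>S. (\<integral>x. (x \<bullet> e)^b * (x \<bullet> v)^2 \<partial>\<sigma>))"
    by (rule Bochner_Integration.integral_sum) simp
  also have "\<dots> = m + (\<Sum>v\<in>S-{e}. (\<integral>x. (x \<bullet> e)^b * (x \<bullet> v)^2 \<partial>\<sigma>))"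
    using S by (subst sum.remove[of _ e]) (auto simp: m_def power_add power2_eq_square mult_ac)
  also have "(\<Sum>v\<in>S-{e}. (\<integral>x. (x \<bullet> e)^b * (x \<bullet> v)^2 \<partial>\<sigma>)) = (\<Sum>v\<in>S-{e}. m / (real b + 1))"
  proof (rule sum.cong[OF refl])
    fix v assume v: "v \<in> S - {e}"
    have "(real b + 1) * (\<integral>x. (x \<bullet> e)^b * (x \<bullet> v)^2 \<partial>\<sigma>) = m"
      unfolding m_def using zonal_moment_mixed[of e v 0 b 1] v S b by auto
    then show "(\<integral>x. (x \<bullet> e)^b * (x \<bullet> v)^2 \<partial>\<sigma>) = m / (real b + 1)"
      by (simp add: field_simps)
  qed
  also have "\<dots> = real d * (m / (real b + 1))" using S by simp
  finally show ?thesis unfolding m_def[symmetric] by (simp add: field_simps)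
qed

text \<open>The choice of the axis is immaterial by \<open>J_eq\<close>. As \<open>J_trig\<close>
  shows later, this is a multiple of integration of p(t) against (1 - t^2)^((d-2)/2) over
  [-1, 1].\<close>

definition J :: "real poly \<Rightarrow> real" where
  "J p = (\<integral>x. poly p (x \<bullet> axis undefined 1) \<partial>\<sigma>)"

lemma J_eq:
  assumes "norm (y::real^'n) = 1"
  shows "(\<integral>x. poly p (x \<bullet> y) \<partial>\<sigma>) = J p"
proof -
  have "norm y = norm (axis undefined 1 :: real^'n)" using assms by (simp add: norm_axis_1)
  then obtain Q :: "real^'n \<Rightarrow> real^'n" where Q: "orthogonal_transformation Q" "Q y = axis undefined 1"
    by (rule reflection_between) blast
  have "J p = (\<integral>x. poly p (Q x \<bullet> Q y) \<partial>\<sigma>)"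
    unfolding J_def Q(2)
    by (rule integral_orthogonal[OF Q(1), symmetric]) (intro continuous_intros)
  also have "\<dots> = (\<integral>x. poly p (x \<bullet> y) \<partial>\<sigma>)"
    using Q(1) by (simp add: orthogonal_transformation_def)
  finally show ?thesis by simp
qed

lemma integrable_poly_inner [simp]: "integrable \<sigma> (\<lambda>x. poly p (x \<bullet> y))"
  by (intro continuous_integrable continuous_intros)

lemma J_add: "J (p + q) = J p + J q" and J_diff: "J (p - q) = J p - J q"
  and J_smult: "J (Polynomial.smult c p) = c * J p" and J_0: "J 0 = 0"
  by (simp_all add: J_def)

lemma J_sum: "J (\<Sum>i\<in>I. f i) = (\<Sum>i\<in>I. J (f i))"
  by (induction I rule: infinite_finite_induct) (auto simp: J_0 J_add)

lemma J_1: "J 1 = area"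
  by (simp add: J_def measure_sigma)

text \<open>The even moments, of order 2i, of one coordinate of a uniformly distributed unit vector
  in d-dimensional space.\<close>

fun mu :: "nat \<Rightarrow> real" where
  "mu 0 = 1"
| "mu (Suc i) = (2 * real i + 1) / (2 * real i + real d) * mu i"

text \<open>Given x . y = t, the component of x along \<open>e\<close> behaves like sqrt(1 - t^2)
  times a coordinate of a uniform unit vector orthogonal to \<open>y\<close>. Each use of
  \<open>zonal_moment_step\<close> trades two powers of that component for one factor 1 -
  t^2.\<close>

lemma zonal_moment_even:
  fixes y e :: "real^'n"
  assumes u: "norm y = 1" "norm e = 1" and o: "y \<bullet> e = 0"
  shows "(\<integral>x. poly p (x \<bullet> y) * (x \<bullet> e) ^ (2 * i) \<partial>\<sigma>) = mu i * J (p * [:1, 0, -1:] ^ i)"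
proof (induction i arbitrary: p)
  case (Suc i)
  have "(2 * real i + real d) * (\<integral>x. poly p (x \<bullet> y) * (x \<bullet> e) ^ (2 * Suc i) \<partial>\<sigma>)
      = (2 * real i + 1) * (mu i * J (p * [:1, 0, -1:] * [:1, 0, -1:] ^ i))"
    using zonal_moment_step[OF u o, of "2 * i" p] Suc[of "p * [:1, 0, -1:]"] by simp
  moreover have "2 * real i + real d > 0" using d2 by simp
  ultimately show ?case by (simp add: field_simps)
qed (simp add: J_eq[OF u(1)])

text \<open>In the expansion of (x . z)^j this polynomial occurs twice: in x . y under the integral,
  and in y . z as the result.\<close>

definition zbasis :: "nat \<Rightarrow> nat \<Rightarrow> real poly" where
  "zbasis j i = [:0, 1:] ^ (j - 2 * i) * [:1, 0, -1:] ^ i"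

lemma degree_zbasis: "i \<le> j div 2 \<Longrightarrow> degree (zbasis j i) \<le> j"
proof -
  assume i: "i \<le> j div 2"
  have "degree (zbasis j i) \<le> degree ([:0, 1::real:] ^ (j - 2 * i)) + degree ([:1, 0, -1::real:] ^ i)"
    unfolding zbasis_def by (rule degree_mult_le)
  also have "\<dots> \<le> (j - 2 * i) + 2 * i"
    by (intro add_mono order_trans[OF degree_power_le]) auto
  also have "\<dots> = j" using i by simp
  finally show ?thesis .
qed

lemma sum_even_reindex:
  fixes f :: "nat \<Rightarrow> real"
  assumes "\<And>k. odd k \<Longrightarrow> f k = 0"
  shows "(\<Sum>k\<le>j. f k) = (\<Sum>i\<le>j div 2. f (2 * i))"
proof -
  have "(\<Sum>k\<le>j. f k) = (\<Sum>k\<in>(*) 2 ` {..j div 2}. f k)"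
  proof (rule sum.mono_neutral_right)
    show "\<forall>i\<in>{..j} - (*) 2 ` {..j div 2}. f i = 0"
    proof
      fix i assume i: "i \<in> {..j} - (*) 2 ` {..j div 2}"
      have "odd i"
      proof
        assume "even i"
        then obtain m where "i = 2 * m" by (elim evenE)
        with i show False by auto
      qed
      then show "f i = 0" by (rule assms)
    qed
  qed auto
  then show ?thesis by (subst (asm) sum.reindex) (auto simp: inj_on_def)
qed

text \<open>Writing z = s y + r e with e orthogonal to y, the binomial formula reduces everything to
  moments in y and e. Only even powers of r survive, and r^2 = 1 - s^2, so the result is a
  polynomial in s = y . z.\<close>

lemma zonal_moment:
  fixes y z :: "real^'n"
  assumes u: "norm y = 1" "norm z = 1"
  shows "(\<integral>x. poly p (x \<bullet> y) * (x \<bullet> z) ^ j \<partial>\<sigma>)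
       = (\<Sum>i\<le>j div 2. real (j choose (2 * i)) * mu i * J (p * zbasis j i) * poly (zbasis j i) (y \<bullet> z))"
proof -
  define s where "s = y \<bullet> z"
  define r where "r = sqrt (1 - s^2)"
  have n: "norm (z - s *\<^sub>R y) ^ 2 = 1 - s^2"
    using u unfolding s_def power2_norm_eq_inner norm_eq_1
    by (simp add: inner_simps inner_commute power2_eq_square)
  then have s1: "1 - s^2 \<ge> 0" by (metis zero_le_power2)
  have r2: "r^2 = 1 - s^2" using s1 by (simp add: r_def)
  have rn: "norm (z - s *\<^sub>R y) = r" unfolding r_def n[symmetric] by simp
  \<comment> \<open>If r = 0, that is z = y or z = -y, any unit vector orthogonal to
    \<open>y\<close> serves.\<close>
  have "\<exists>e. norm e = 1 \<and> y \<bullet> e = 0 \<and> z = s *\<^sub>R y + r *\<^sub>R e"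
  proof (cases "r = 0")
    case True
    obtain S where S: "finite S" "y \<in> S" "card S = d + 1" "\<And>e. e \<in> S \<Longrightarrow> norm e = 1"
      "\<And>e e'. e \<in> S \<Longrightarrow> e' \<in> S \<Longrightarrow> e \<noteq> e' \<Longrightarrow> e \<bullet> e' = 0"
      "\<And>x. (\<Sum>e\<in>S. (x \<bullet> e)^2) = (norm x)^2"
      using orthonormal_basis[OF u(1)] by blast
    have "card (S - {y}) = d" using S by simp
    with d2 have "S - {y} \<noteq> {}" by (metis card.empty not_numeral_le_zero)
    then obtain e where "e \<in> S" "e \<noteq> y" by auto
    then have "norm e = 1" "y \<bullet> e = 0" using S(2,4,5) by metis+
    moreover have "z = s *\<^sub>R y" using rn True by simp
    ultimately show ?thesis using True by auto
  next
    case False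
    then have "r > 0" using rn norm_ge_zero[of "z - s *\<^sub>R y"] by linarith
    moreover have "y \<bullet> (z - s *\<^sub>R y) = 0"
      using u(1) unfolding norm_eq_1 by (simp add: s_def inner_diff_right)
    ultimately show ?thesis using rn
      by (intro exI[of _ "(1/r) *\<^sub>R (z - s *\<^sub>R y)"]) simp
  qed
  then obtain e where e: "norm e = 1" "y \<bullet> e = 0" "z = s *\<^sub>R y + r *\<^sub>R e" by auto
  have int [simp]: "integrable \<sigma> (\<lambda>x. poly p (x \<bullet> y) * (x \<bullet> e)^k)" for k p
    by (intro continuous_integrable continuous_intros)
  define f where "f = (\<lambda>k. real (j choose k) * r^k * s^(j-k) * (\<integral>x. poly (p * [:0,1:]^(j-k)) (x \<bullet> y) * (x \<bullet> e)^k \<partial>\<sigma>))"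
  have "(x \<bullet> z) ^ j = (\<Sum>k\<le>j. real (j choose k) * r^k * s^(j-k) * ((x \<bullet> y)^(j-k) * (x \<bullet> e)^k))" for x
    using binomial_ring[of "r * (x \<bullet> e)" "s * (x \<bullet> y)" j]
    by (simp add: e(3) inner_simps power_mult_distrib mult_ac add.commute)
  then have "(\<integral>x. poly p (x \<bullet> y) * (x \<bullet> z) ^ j \<partial>\<sigma>)
      = (\<integral>x. (\<Sum>k\<le>j. real (j choose k) * r^k * s^(j-k) * (poly (p * [:0,1:]^(j-k)) (x \<bullet> y) * (x \<bullet> e)^k)) \<partial>\<sigma>)"
    by (simp add: sum_distrib_left mult_ac poly_power)
  also have "\<dots> = (\<Sum>k\<le>j. f k)"
    unfolding f_def by (subst Bochner_Integration.integral_sum) (auto simp del: poly_mult)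
  also have "\<dots> = (\<Sum>i\<le>j div 2. f (2 * i))"
    by (rule sum_even_reindex) (simp add: f_def zonal_moment_odd[OF e(2)] del: poly_mult)
  also have "\<dots> = (\<Sum>i\<le>j div 2. real (j choose (2 * i)) * mu i * J (p * zbasis j i) * poly (zbasis j i) (y \<bullet> z))"
  proof (rule sum.cong[OF refl])
    fix i
    have "poly (zbasis j i) (y \<bullet> z) = s ^ (j - 2*i) * r ^ (2 * i)"
      unfolding zbasis_def power_mult r2 by (simp add: poly_power s_def power2_eq_square)
    then show "f (2 * i) = real (j choose (2 * i)) * mu i * J (p * zbasis j i) * poly (zbasis j i) (y \<bullet> z)"
      unfolding f_def zonal_moment_even[OF u(1) e(1,2)] by (simp add: zbasis_def mult.assoc)
  qed
  finally show ?thesis .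
qed

text \<open>The zonal convolution, as a polynomial in the inner product of the two axes. It is
  written in the \<open>zbasis\<close> polynomials so that two facts can be read off: the degree is
  at most that of \<open>q\<close>, and \<open>p\<close> enters only through \<open>J\<close>
  against polynomials of degree at most that of \<open>q\<close>.\<close>

definition conv :: "real poly \<Rightarrow> real poly \<Rightarrow> real poly" where
  "conv p q = (\<Sum>j\<le>degree q. \<Sum>i\<le>j div 2.
     Polynomial.smult (coeff q j * (real (j choose (2 * i)) * mu i * J (p * zbasis j i))) (zbasis j i))"

lemma integral_zonal_product:
  fixes y z :: "real^'n"
  assumes u: "norm y = 1" "norm z = 1"
  shows "(\<integral>x. poly p (x \<bullet> y) * poly q (x \<bullet> z) \<partial>\<sigma>) = poly (conv p q) (y \<bullet> z)"
proof -
  have int [simp]: "integrable \<sigma> (\<lambda>x. poly p (x \<bullet> y) * (x \<bullet> z)^k)" for k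
    by (intro continuous_integrable continuous_intros)
  have "(\<integral>x. poly p (x \<bullet> y) * poly q (x \<bullet> z) \<partial>\<sigma>)
     = (\<integral>x. (\<Sum>j\<le>degree q. coeff q j * (poly p (x \<bullet> y) * (x \<bullet> z)^j)) \<partial>\<sigma>)"
    by (simp add: poly_altdef[of q] sum_distrib_left mult_ac)
  also have "\<dots> = (\<Sum>j\<le>degree q. coeff q j * (\<integral>x. poly p (x \<bullet> y) * (x \<bullet> z)^j \<partial>\<sigma>))"
    by (subst Bochner_Integration.integral_sum) auto
  also have "\<dots> = poly (conv p q) (y \<bullet> z)"
    unfolding zonal_moment[OF u] conv_def by (simp add: poly_sum sum_distrib_left mult_ac)
  finally show ?thesis .
qed

lemma degree_conv: "degree (conv p q) \<le> degree q"
  unfolding conv_def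
proof (intro degree_sum_le finite_atMost)
  fix j i assume "j \<in> {..degree q}" "i \<in> {..j div 2}"
  then show "degree (Polynomial.smult (coeff q j * (real (j choose (2 * i)) * mu i * J (p * zbasis j i))) (zbasis j i)) \<le> degree q"
    using degree_zbasis[of i j] by (intro order_trans[OF degree_smult_le]) auto
qed

lemma conv_eq_0:
  assumes "\<And>r. degree r \<le> degree q \<Longrightarrow> J (p * r) = 0"
  shows "conv p q = 0"
  unfolding conv_def
proof (intro sum.neutral ballI)
  fix j i assume "j \<in> {..degree q}" "i \<in> {..j div 2}"
  then have "degree (zbasis j i) \<le> degree q" using degree_zbasis[of i j] by simp
  from assms[OF this] show "Polynomial.smult (coeff q j * (real (j choose (2 * i)) * mu i * J (p * zbasis j i))) (zbasis j i) = 0"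
    by simp
qed

lemma J_odd: "odd b \<Longrightarrow> J ([:0, 1:] ^ b) = 0"
  using zonal_moment_odd[of 0 "axis undefined 1" b 1] by (simp add: J_def poly_power)

lemma J_moment: "(real b + 1 + real d) * J ([:0, 1:] ^ (b + 2)) = (real b + 1) * J ([:0, 1:] ^ b)"
proof (cases "even b")
  case True
  then show ?thesis using axial_moment_step[of "axis undefined 1" b]
    by (simp add: J_def poly_power norm_axis_1)
next
  case False
  then show ?thesis using J_odd[of b] J_odd[of "b + 2"] by (simp del: power_Suc)
qed

end

section \<open>Legendre polynomials and the projection kernel\<close>

lemma poly_basis_expansion:
  fixes B :: "nat \<Rightarrow> real poly"
  assumes B: "\<And>j. degree (B j) = j" "\<And>j. B j \<noteq> 0" and p: "degree p \<le> n"
  shows "\<exists>a. p = (\<Sum>j\<le>n. Polynomial.smult (a j) (B j))"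
  using p
proof (induction n arbitrary: p)
  case 0
  define b where "b = coeff (B 0) 0"
  have "B 0 = [:b:]" using B(1)[of 0] unfolding b_def by (metis degree_0_id)
  moreover have "b \<noteq> 0" using B(2)[of 0] calculation by auto
  moreover have "p = [:coeff p 0:]" using 0 by (metis degree_0_id le_zero_eq)
  ultimately show ?case by (intro exI[of _ "\<lambda>_. coeff p 0 / b"]) simp
next
  case (Suc n)
  define b where "b = coeff (B (Suc n)) (Suc n)"
  have b: "b \<noteq> 0" using B[of "Suc n"] unfolding b_def by (metis leading_coeff_0_iff)
  define q where "q = p - Polynomial.smult (coeff p (Suc n) / b) (B (Suc n))"
  have "degree q \<le> n"
  proof (rule degree_le, intro allI impI)
    fix i assume "n < i"
    show "coeff q i = 0"
    proof (cases "i = Suc n")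
      case True then show ?thesis using b by (simp add: q_def b_def)
    next
      case False
      with \<open>n < i\<close> have "degree p < i" "degree (B (Suc n)) < i" using Suc.prems B(1)[of "Suc n"] by auto
      then show ?thesis by (simp add: q_def coeff_eq_0)
    qed
  qed
  then obtain a where a: "q = (\<Sum>j\<le>n. Polynomial.smult (a j) (B j))" using Suc.IH by blast
  have "p = q + Polynomial.smult (coeff p (Suc n) / b) (B (Suc n))" by (simp add: q_def)
  also have "\<dots> = (\<Sum>j\<le>Suc n. Polynomial.smult ((a(Suc n := coeff p (Suc n) / b)) j) (B j))"
    unfolding a by (auto intro!: sum.cong)
  finally show ?case by blast
qed

lemma degree_X_power: "degree ([:0, 1::real:] ^ j) = j"
  by (simp add: degree_power_eq)

text \<open>Identities between linear functionals are thus checked on powers of t; integration by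
  parts for \<open>J\<close> and its expression by the polar angle are obtained in this way.\<close>

lemma linear_functional_monomials:
  fixes G :: "real poly \<Rightarrow> real"
  assumes add: "\<And>p q. G (p + q) = G p + G q" and sm: "\<And>c p. G (Polynomial.smult c p) = c * G p"
    and X: "\<And>i. G ([:0, 1:] ^ i) = 0"
  shows "G p = 0"
proof -
  obtain a where a: "p = (\<Sum>j\<le>degree p. Polynomial.smult (a j) ([:0, 1:] ^ j))"
    using poly_basis_expansion[of "\<lambda>j. [:0, 1:] ^ j" p "degree p"] by (auto simp: degree_X_power)
  have z: "G 0 = 0" using sm[of 0 0] by simp
  have "G (\<Sum>j\<le>n. Polynomial.smult (a j) ([:0, 1:] ^ j)) = 0" for n
    by (induction n) (simp_all only: sum.atMost_Suc atMost_0 sum.insert finite.emptyI empty_iff not_False_eq_True sum.empty add z sm X mult_zero_right add_0_right)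
  with a show ?thesis by metis
qed

context round_sphere
begin

text \<open>The recursion of \<open>legendre\<close> for polynomials as algebraic objects, which
  makes degrees, leading coefficients and derivatives available.\<close>

fun P :: "nat \<Rightarrow> real poly" where
  "P 0 = 1"
| "P (Suc 0) = [:0, 1:]"
| "P (Suc (Suc n)) = Polynomial.smult (1 / (real (Suc n) + real d - 1))
     (Polynomial.smult (2 * real (Suc n) + real d - 1) ([:0, 1:] * P (Suc n)) - Polynomial.smult (real (Suc n)) (P n))"

lemma poly_P: "poly (P n) t = legendre d n t"
  by (induction n rule: P.induct) (auto simp: field_simps)

lemma P_rec: "(real n + real d) * poly (P (Suc (Suc n))) t
    = (2 * real n + real d + 1) * t * poly (P (Suc n)) t - (real n + 1) * poly (P n) t"
proof -
  have "real n + real d \<noteq> 0" using d2 by simp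
  then show ?thesis by (simp add: field_simps)
qed

text \<open>The recurrence read as multiplication by t. For j = 0 the truncated index
  \<open>j - 1\<close> does no harm, as its coefficient is 0.\<close>

lemma X_P: "(2 * real j + real d - 1) * (t * poly (P j) t)
    = (real j + real d - 1) * poly (P (Suc j)) t + real j * poly (P (j - 1)) t"
proof (cases j)
  case (Suc n)
  then show ?thesis using P_rec[of n t] by (simp add: algebra_simps)
qed simp

lemma degree_P_aux: "degree (P n) \<le> n \<and> coeff (P n) n > 0"
proof (induction n rule: P.induct)
  case (3 n)
  have d1: "degree ([:0, 1:] * P (Suc n)) \<le> Suc (Suc n)"
    using 3 by (intro order_trans[OF degree_mult_le]) auto
  have "coeff (P n) (Suc (Suc n)) = 0" using 3 by (intro coeff_eq_0) linarith
  moreover have "coeff ([:0, 1:] * P (Suc n)) (Suc (Suc n)) = coeff (P (Suc n)) (Suc n)"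
    by simp
  ultimately have "coeff (P (Suc (Suc n))) (Suc (Suc n)) =
      (2 * real (Suc n) + real d - 1) / (real (Suc n) + real d - 1) * coeff (P (Suc n)) (Suc n)"
    by (simp del: of_nat_Suc)
  also have "\<dots> > 0" using 3 d2 by (intro mult_pos_pos divide_pos_pos) auto
  finally have "coeff (P (Suc (Suc n))) (Suc (Suc n)) > 0" .
  moreover have "degree (P (Suc (Suc n))) \<le> Suc (Suc n)"
    unfolding P.simps using d1 3
    by (intro order_trans[OF degree_smult_le] degree_diff_le) auto
  ultimately show ?case by blast
qed auto

lemma degree_P: "degree (P n) = n"
  using degree_P_aux[of n] le_degree[of "P n" n] by auto

lemma P_nonzero: "P n \<noteq> 0"
  using degree_P_aux[of n] by auto

lemma P_one: "poly (P n) 1 = 1"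
proof (induction n rule: P.induct)
  case (3 n)
  have "real n + real d > 0" using d2 by simp
  moreover have "(real n + real d) * poly (P (Suc (Suc n))) 1 = (real n + real d) * 1"
    using 3 P_rec[of n 1] by (simp del: P.simps)
  ultimately show ?case by (metis mult_left_cancel less_irrefl)
qed auto

lemma P_parity: "poly (P n) (-t) = (-1)^n * poly (P n) t"
proof (induction n rule: P.induct)
  case (3 n)
  have "real n + real d > 0" using d2 by simp
  moreover have "(real n + real d) * poly (P (Suc (Suc n))) (-t)
      = (real n + real d) * ((-1) ^ Suc (Suc n) * poly (P (Suc (Suc n))) t)"
  proof -
    have "(real n + real d) * ((-1) ^ Suc (Suc n) * poly (P (Suc (Suc n))) t)
        = (-1) ^ n * ((real n + real d) * poly (P (Suc (Suc n))) t)" by simp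
    then show ?thesis using 3 unfolding P_rec by (simp add: algebra_simps del: P.simps)
  qed
  ultimately show ?case by (metis mult_left_cancel less_irrefl)
qed auto

lemma J_reflect: "J (pcompose p [:0, -1:]) = J p"
proof -
  have "J p = (\<integral>x. poly p (x \<bullet> (- axis undefined 1)) \<partial>\<sigma>)"
    by (rule J_eq[symmetric]) (simp add: norm_axis_1)
  then show ?thesis by (simp add: J_def poly_pcompose)
qed

lemma J_cong: "(\<And>t. poly p t = poly q t) \<Longrightarrow> J p = J q"
  by (simp add: J_def)

text \<open>On the monomial t^(b+1) this is the moment recurrence \<open>J_moment\<close>. In terms
  of the weight (1 - t^2)^((d-2)/2) it says that the boundary terms vanish.\<close>

lemma integration_by_parts: "J ([:1, 0, -1:] * pderiv p) = real d * J ([:0, 1:] * p)"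
proof -
  define G where "G = (\<lambda>p. J ([:1, 0, -1:] * pderiv p) - real d * J ([:0, 1:] * p))"
  have "G p = 0"
  proof (rule linear_functional_monomials)
    fix i
    show "G ([:0, 1:] ^ i) = 0"
    proof (cases i)
      case 0
      then show ?thesis using J_odd[of 1] by (simp add: G_def pderiv_1 J_0 one_pCons)
    next
      case (Suc b)
      have "J ([:1, 0, -1:] * pderiv ([:0, 1:] ^ Suc b))
        = J (Polynomial.smult (real b + 1) ([:0, 1:] ^ b) - Polynomial.smult (real b + 1) ([:0, 1:] ^ (b + 2)))"
      proof (rule J_cong)
        have "pderiv ([:0, 1::real:] ^ Suc b) = Polynomial.smult (real b + 1) ([:0, 1:] ^ b)"
          by (simp only: pderiv_power_Suc) (simp add: pderiv_pCons add.commute)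
        then show "poly ([:1, 0, -1:] * pderiv ([:0, 1:] ^ Suc b)) t
            = poly (Polynomial.smult (real b + 1) ([:0, 1:] ^ b) - Polynomial.smult (real b + 1) ([:0, 1:] ^ (b + 2))) t" for t
          by (simp add: algebra_simps)
      qed
      also have "\<dots> = real d * J ([:0, 1:] ^ (b + 2))"
        using J_moment[of b] unfolding J_diff J_smult by (simp add: algebra_simps)
      finally show ?thesis unfolding G_def Suc by simp
    qed
  next
    show "G (p + q) = G p + G q" for p q
      unfolding G_def pderiv_add distrib_left J_add by linarith
    show "G (Polynomial.smult c p) = c * G p" for c p
      unfolding G_def pderiv_smult mult_smult_right J_smult by (simp only: right_diff_distrib mult.left_commute)
  qed
  then show ?thesis by (simp add: G_def)
qed

lemma P_derivative: "(1 - t^2) * poly (pderiv (P n)) t = real n * (poly (P (n - 1)) t - t * poly (P n) t)"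
proof -
  let ?D = "\<lambda>n. poly (pderiv (P n)) t" and ?p = "\<lambda>n. poly (P n) t"
  have rec: "(real n + real d) * ?D (Suc (Suc n))
      = (2 * real n + real d + 1) * (?p (Suc n) + t * ?D (Suc n)) - (real n + 1) * ?D n" for n
  proof -
    have "real n + real d \<noteq> 0" using d2 by simp
    then show ?thesis by (simp add: pderiv_smult pderiv_diff pderiv_mult pderiv_pCons field_simps)
  qed
  \<comment> \<open>The second relation expresses the derivative through the next polynomial. It
    must be carried along because the differentiated recurrence involves two consecutive
    derivatives.\<close>
  have main: "(1 - t^2) * ?D (Suc n) = (real n + 1) * (?p n - t * ?p (Suc n))
    \<and> (1 - t^2) * ?D n = (real n + real d - 1) * (t * ?p n - ?p (Suc n))" for n
  proof (induction n)
    case 0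
    show ?case by (simp add: pderiv_pCons power2_eq_square pderiv_1)
  next
    case (Suc n)
    have nd: "real n + real d \<noteq> 0" using d2 by simp
    define a b c where "a = ?p n" and "b = ?p (Suc n)" and "c = ?p (Suc (Suc n))"
    define a' b' c' where "a' = ?D n" and "b' = ?D (Suc n)" and "c' = ?D (Suc (Suc n))"
    have 1: "(1 - t^2) * b' = (real n + 1) * (a - t * b)" and 2: "(1 - t^2) * a' = (real n + real d - 1) * (t * a - b)"
      using Suc by (simp_all add: a_def b_def a'_def b'_def)
    have 3: "(real n + real d) * c = (2 * real n + real d + 1) * t * b - (real n + 1) * a"
      using P_rec[of n t] by (simp add: a_def b_def c_def)
    have 4: "(real n + real d) * c' = (2 * real n + real d + 1) * (b + t * b') - (real n + 1) * a'"
      using rec[of n] by (simp add: b_def a'_def b'_def c'_def)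
    have "(real n + real d) * ((1 - t^2) * c') = (1 - t^2) * ((real n + real d) * c')" by simp
    also have "\<dots> = (2 * real n + real d + 1) * ((1 - t^2) * b + t * ((1 - t^2) * b')) - (real n + 1) * ((1 - t^2) * a')"
      unfolding 4 by (simp add: algebra_simps)
    also have "\<dots> = (real n + 2) * ((real n + real d) * b - t * ((2 * real n + real d + 1) * t * b - (real n + 1) * a))"
      unfolding 1 2 by (simp add: algebra_simps power2_eq_square)
    also have "\<dots> = (real n + real d) * ((real n + 2) * (b - t * c))"
      unfolding 3[symmetric] by (simp add: algebra_simps)
    finally have "(1 - t^2) * c' = (real n + 2) * (b - t * c)" using nd by simp
    moreover have "(1 - t^2) * b' = (real n + real d) * (t * b - c)"
      unfolding 1 right_diff_distrib[of "real n + real d"] 3 by (simp add: algebra_simps)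
    ultimately show ?case by (simp add: a_def b_def c_def a'_def b'_def c'_def algebra_simps)
  qed
  show ?thesis
  proof (cases n)
    case 0 then show ?thesis by (simp add: pderiv_1)
  next
    case (Suc m) then show ?thesis using main[of m] by (simp add: add.commute)
  qed
qed

lemma J_X_P: "(2 * real j + real d - 1) * J ([:0, 1:] * P j * Q)
    = (real j + real d - 1) * J (P (Suc j) * Q) + real j * J (P (j - 1) * Q)"
proof -
  have "J (Polynomial.smult (2 * real j + real d - 1) ([:0, 1:] * P j * Q))
    = J (Polynomial.smult (real j + real d - 1) (P (Suc j) * Q) + Polynomial.smult (real j) (P (j - 1) * Q))"
  proof (rule J_cong)
    fix t
    show "poly (Polynomial.smult (2 * real j + real d - 1) ([:0, 1:] * P j * Q)) t
     = poly (Polynomial.smult (real j + real d - 1) (P (Suc j) * Q) + Polynomial.smult (real j) (P (j - 1) * Q)) t"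
      using arg_cong[OF X_P[of j t], of "\<lambda>u. u * poly Q t"] by (simp add: algebra_simps del: P.simps)
  qed
  then show ?thesis unfolding J_add J_smult .
qed

lemma J_X_square: "J ([:0, 1:] * P n * P n) = 0"
proof -
  have "J ([:0, 1:] * P n * P n) = J (pcompose ([:0, 1:] * P n * P n) [:0, -1:])" by (rule J_reflect[symmetric])
  also have "\<dots> = J (Polynomial.smult (-1) ([:0, 1:] * P n * P n))"
    by (rule J_cong) (simp add: poly_pcompose P_parity)
  finally show ?thesis unfolding J_smult by simp
qed

text \<open>Integration by parts for the product of two neighbours, with the derivatives replaced by
  \<open>P_derivative\<close>. Only the orthogonality of \<open>P (Suc m)\<close> and
  \<open>P (m - 1)\<close> is assumed, since this serves inside the induction that establishes
  orthogonality; for m = 0 that term has coefficient 0.\<close>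

lemma J_X_consecutive:
  assumes "J (P (Suc m) * P (m - 1)) = 0 \<or> m = 0"
  shows "(2 * real m + real d + 1) * J ([:0, 1:] * P (Suc m) * P m) = (real m + 1) * J (P m * P m)"
proof -
  have "real d * J ([:0, 1:] * (P (Suc m) * P m)) = J ([:1, 0, -1:] * pderiv (P (Suc m) * P m))"
    by (rule integration_by_parts[symmetric])
  also have "\<dots> = J (Polynomial.smult (real m + 1) (P m * P m) - Polynomial.smult (2 * real m + 1) ([:0, 1:] * P (Suc m) * P m)
     + Polynomial.smult (real m) (P (Suc m) * P (m - 1)))"
  proof (rule J_cong)
    fix t
    have "poly ([:1, 0, -1:] * pderiv (P (Suc m) * P m)) t
      = ((1 - t^2) * poly (pderiv (P (Suc m))) t) * poly (P m) t + ((1 - t^2) * poly (pderiv (P m)) t) * poly (P (Suc m)) t"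
      by (simp add: pderiv_mult power2_eq_square algebra_simps del: P.simps)
    then show "poly ([:1, 0, -1:] * pderiv (P (Suc m) * P m)) t = poly (Polynomial.smult (real m + 1) (P m * P m) - Polynomial.smult (2 * real m + 1) ([:0, 1:] * P (Suc m) * P m)
     + Polynomial.smult (real m) (P (Suc m) * P (m - 1))) t"
      unfolding P_derivative by (simp add: algebra_simps del: P.simps)
  qed
  also have "\<dots> = (real m + 1) * J (P m * P m) - (2 * real m + 1) * J ([:0, 1:] * P (Suc m) * P m)"
    unfolding J_add J_diff J_smult using assms by auto
  finally show ?thesis by (simp add: algebra_simps mult.assoc del: P.simps mult_pCons_left)
qed

text \<open>With n = m + 2 the recurrence leaves three cases. For j = m + 1 parity annihilates the
  moment of t; for j = m the two terms cancel by \<open>J_X_consecutive\<close>; for j < m the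
  factor t is moved to \<open>P j\<close>, where it produces only degrees at most m, orthogonal to
  \<open>P (Suc m)\<close> by induction.\<close>

lemma orthogonal_P_less: "j < n \<Longrightarrow> J (P n * P j) = 0"
proof (induction n arbitrary: j rule: less_induct)
  case (less n)
  consider "n = 1" | m where "n = Suc (Suc m)" using less.prems by (cases n rule: P.cases) auto
  then show ?case
  proof cases
    case 1
    then show ?thesis using less.prems J_odd[of 1] by simp
  next
    case 2
    have nd: "real m + real d > 0" using d2 by simp
    have IH: "J (P i * P j) = 0" if "j < i" "i \<le> Suc m" for i j
      using less.IH[of i j] that 2 by simp
    have com: "J (P i * P j) = J (P j * P i)" for i j by (simp add: mult.commute)
    have rec: "(real m + real d) * J (P (Suc (Suc m)) * P j)
       = (2 * real m + real d + 1) * J ([:0, 1:] * P (Suc m) * P j) - (real m + 1) * J (P m * P j)"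
      using J_X_P[of "Suc m" "P j"] by (simp add: algebra_simps del: P.simps mult_pCons_left)
    consider "j = Suc m" | "j = m" | "j < m" using less.prems 2 by linarith
    then have "(real m + real d) * J (P (Suc (Suc m)) * P j) = 0"
    proof cases
      case 1
      then show ?thesis unfolding rec using J_X_square[of "Suc m"] IH[of m "Suc m"] com[of m "Suc m"]
        by (simp del: P.simps mult_pCons_left)
    next
      case 2
      have "J (P (Suc m) * P (m - 1)) = 0 \<or> m = 0" using IH[of "m - 1" "Suc m"] by auto
      from J_X_consecutive[OF this] show ?thesis unfolding rec unfolding 2 by (simp only: diff_self)
    next
      case 3
      have "(2 * real j + real d - 1) * J ([:0, 1:] * P j * P (Suc m)) = 0"
        unfolding J_X_P using 3 IH[of "Suc j" "Suc m"] IH[of "j - 1" "Suc m"] com[of "Suc j" "Suc m"] com[of "j - 1" "Suc m"] by auto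
      moreover have "2 * real j + real d - 1 \<noteq> 0" using d2 by simp
      moreover have "[:0, 1:] * P (Suc m) * P j = [:0, 1:] * P j * P (Suc m)" by (simp only: mult_ac)
      ultimately have "J ([:0, 1:] * P (Suc m) * P j) = 0" by (metis mult_eq_0_iff)
      then show ?thesis unfolding rec using IH[of j m] com[of m j] 3 by simp
    qed
    then show ?thesis using nd 2 by auto
  qed
qed

lemma orthogonal_P: "i \<noteq> j \<Longrightarrow> J (P i * P j) = 0"
  by (metis orthogonal_P_less linorder_neqE_nat mult.commute)

lemma harm_dim_pos: "harm_dim d n > 0"
proof -
  have "(n + d - 1) choose (d - 1) > 0" using d2 by (intro zero_less_binomial) auto
  then show ?thesis unfolding harm_dim_def using d2 by (intro mult_pos_pos divide_pos_pos) auto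
qed

text \<open>The quotient of consecutive dimensions, cross-multiplied to be matched with the quotient
  of consecutive norms in \<open>norm_P\<close>.\<close>

lemma harm_dim_Suc: "harm_dim d (Suc m) * ((2 * real m + real d - 1) * (real m + 1))
    = harm_dim d m * ((real m + real d - 1) * (2 * real m + real d + 1))"
proof -
  have "(m + d - (d - 1)) * ((m + d) choose (d - 1)) = (m + d) * ((m + d - 1) choose (d - 1))"
    by (rule binomial_absorb_comp)
  moreover have "m + d - (d - 1) = Suc m" using d2 by simp
  ultimately have "real (Suc m * ((m + d) choose (d - 1))) = real ((m + d) * ((m + d - 1) choose (d - 1)))" by metis
  then have b: "(real m + 1) * real ((m + d) choose (d - 1)) = (real m + real d) * real ((m + d - 1) choose (d - 1))"
    by (simp add: algebra_simps)
  have nz: "real m + real d \<noteq> 0" "real m + real d - 1 \<noteq> 0" using d2 by auto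
  have "harm_dim d (Suc m) * ((2 * real m + real d - 1) * (real m + 1))
    = (2 * real m + real d + 1) / (real m + real d) * (2 * real m + real d - 1) * ((real m + 1) * real ((m + d) choose (d - 1)))"
    by (simp add: harm_dim_def algebra_simps)
  also have "\<dots> = (2 * real m + real d + 1) * (2 * real m + real d - 1) * real ((m + d - 1) choose (d - 1))"
    unfolding b using nz by (simp add: field_simps)
  also have "\<dots> = harm_dim d m * ((real m + real d - 1) * (2 * real m + real d + 1))"
    using nz by (simp add: harm_dim_def)
  finally show ?thesis .
qed

text \<open>The integral of t P_m P_(m+1) is computed twice: integration by parts gives a multiple
  of the norm of \<open>P m\<close>, the recurrence a multiple of the norm of
  \<open>P (Suc m)\<close>. The resulting ratio is the inverse of that in
  \<open>harm_dim_Suc\<close>.\<close>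

lemma norm_P: "J (P n * P n) = area / harm_dim d n"
proof (induction n)
  case 0
  have "harm_dim d 0 = 1" using d2 by (simp add: harm_dim_def)
  then show ?case by (simp add: J_1)
next
  case (Suc m)
  let ?h = "harm_dim d"
  have "(2 * real m + real d + 1) * J ([:0, 1:] * P (Suc m) * P m) = (real m + 1) * J (P m * P m)"
    using orthogonal_P[of "Suc m" "m - 1"] by (intro J_X_consecutive) auto
  moreover have "[:0, 1:] * P (Suc m) * P m = [:0, 1:] * P m * P (Suc m)" by (simp only: mult_ac)
  ultimately have 1: "(2 * real m + real d + 1) * J ([:0, 1:] * P m * P (Suc m)) = (real m + 1) * (area / ?h m)"
    using Suc by metis
  have 2: "(2 * real m + real d - 1) * J ([:0, 1:] * P m * P (Suc m)) = (real m + real d - 1) * J (P (Suc m) * P (Suc m))"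
    using J_X_P[of m "P (Suc m)"] orthogonal_P[of "m - 1" "Suc m"] by auto
  define I H where "I = J ([:0, 1:] * P m * P (Suc m))" and "H = J (P (Suc m) * P (Suc m))"
  have nz: "2 * real m + real d + 1 > 0" "2 * real m + real d - 1 > 0" "real m + real d - 1 > 0" using d2 by auto
  have gen: "H * c3 * c1 * h = c2 * e * a" if "c2 * (e * (a / h) / c1) = c3 * H" "c1 > 0" "h > 0" for c1 c2 c3 e a h H :: real
    using that by (simp add: field_simps)
  have "I = (real m + 1) * (area / ?h m) / (2 * real m + real d + 1)"
    using 1[folded I_def] nz(1) by (metis nonzero_mult_div_cancel_left less_irrefl)
  then have "H * (real m + real d - 1) * (2 * real m + real d + 1) * ?h m = (2 * real m + real d - 1) * (real m + 1) * area"
    using gen[of "2 * real m + real d - 1" "real m + 1" area "?h m" "2 * real m + real d + 1" "real m + real d - 1" H]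
      2[folded I_def H_def] nz harm_dim_pos[of m] by metis
  then have "H * (?h (Suc m) * ((2 * real m + real d - 1) * (real m + 1))) = (2 * real m + real d - 1) * (real m + 1) * area"
    unfolding harm_dim_Suc by (simp add: mult_ac)
  then have "((2 * real m + real d - 1) * (real m + 1)) * (H * ?h (Suc m)) = ((2 * real m + real d - 1) * (real m + 1)) * area"
    by (simp add: mult_ac)
  moreover have "(2 * real m + real d - 1) * (real m + 1) \<noteq> 0" using nz by simp
  ultimately have "H * ?h (Suc m) = area" by (metis mult_left_cancel)
  then show ?case unfolding H_def[symmetric] using harm_dim_pos[of "Suc m"] by (simp add: field_simps)
qed

lemma orthogonal_lower_degree:
  assumes "degree r < n" shows "J (P n * r) = 0"
proof -
  obtain a where a: "r = (\<Sum>j\<le>degree r. Polynomial.smult (a j) (P j))"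
    using poly_basis_expansion[of P r "degree r"] degree_P P_nonzero by blast
  have "J (P n * (\<Sum>j\<le>degree r. Polynomial.smult (a j) (P j))) = (\<Sum>j\<le>degree r. a j * J (P n * P j))"
    by (simp add: sum_distrib_left J_sum J_smult)
  also have "\<dots> = 0" using assms by (intro sum.neutral ballI) (auto simp: orthogonal_P_less)
  finally show ?thesis using a by metis
qed

section \<open>Zonal convolution of Legendre polynomials and the projection kernel\<close>

lemma continuous_integrable_pair:
  fixes h :: "(real^'n) \<times> (real^'n) \<Rightarrow> real"
  assumes h: "continuous_on UNIV h"
  shows "integrable (\<sigma> \<Otimes>\<^sub>M \<sigma>) h"
proof -
  interpret PP: finite_measure "\<sigma> \<Otimes>\<^sub>M \<sigma>"
    by (intro finite_measure_pair_measure) unfold_locales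
  have "compact (h ` (sphere 0 1 \<times> sphere 0 1))"
    by (intro compact_continuous_image continuous_on_subset[OF h] compact_Times) auto
  then obtain B where B: "\<And>x. x \<in> sphere 0 1 \<times> sphere 0 1 \<Longrightarrow> norm (h x) \<le> B"
    using compact_imp_bounded bounded_iff by (metis imageI)
  have id: "(\<lambda>x. x) \<in> \<sigma> \<rightarrow>\<^sub>M borel" 
    by (subst measurable_cong_sets[OF sets_sigma refl]) (rule measurable_restrict_space1, simp)
  have "h \<in> borel_measurable (borel \<Otimes>\<^sub>M borel)"
    unfolding borel_prod by (rule borel_measurable_continuous_onI[OF h])
  moreover have "(\<lambda>z. (fst z, snd z)) \<in> \<sigma> \<Otimes>\<^sub>M \<sigma> \<rightarrow>\<^sub>M borel \<Otimes>\<^sub>M borel"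
    by (intro measurable_Pair measurable_compose[OF measurable_fst id] measurable_compose[OF measurable_snd id])
  ultimately have "(\<lambda>z. h (fst z, snd z)) \<in> borel_measurable (\<sigma> \<Otimes>\<^sub>M \<sigma>)"
    by (rule measurable_compose[rotated])
  then have "h \<in> borel_measurable (\<sigma> \<Otimes>\<^sub>M \<sigma>)" by simp
  then show ?thesis using B by (intro PP.integrable_const_bound[of _ B]) (auto simp: space_pair_measure)
qed

sublocale SS: pair_sigma_finite \<sigma> \<sigma> ..

lemma conv_P_less: "j < m \<Longrightarrow> conv (P m) (P j) = 0"
  by (rule conv_eq_0) (auto simp: degree_P intro: orthogonal_lower_degree)

text \<open>The degree of \<open>conv\<close> is controlled by its second argument only, so for m <
  j the two factors change places.\<close>

lemma conv_P_diff:
  fixes y z :: "real^'n"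
  assumes "m \<noteq> j" "norm y = 1" "norm z = 1"
  shows "(\<integral>x. poly (P m) (x \<bullet> y) * poly (P j) (x \<bullet> z) \<partial>\<sigma>) = 0"
proof (cases "j < m")
  case True
  then show ?thesis using integral_zonal_product[OF assms(2,3)] conv_P_less by simp
next
  case False
  then have "m < j" using assms(1) by simp
  then show ?thesis using integral_zonal_product[OF assms(3,2), of "P j" "P m"] conv_P_less
    by (simp add: mult.commute)
qed

text \<open>The convolution has degree at most m. By Fubini and \<open>conv_P_diff\<close> it is
  orthogonal to every \<open>P j\<close> with j < m, hence a multiple of \<open>P m\<close>; equal
  axes, where the convolution is the norm and \<open>P m\<close> is 1, give the factor.\<close>

lemma conv_P_self: "conv (P m) (P m) = Polynomial.smult (area / harm_dim d m) (P m)"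
proof -
  let ?R = "conv (P m) (P m)" and ?y = "axis undefined 1 :: real^'n"
  have ny: "norm ?y = 1" by (simp add: norm_axis_1)
  obtain a where a: "?R = (\<Sum>j\<le>m. Polynomial.smult (a j) (P j))"
    using poly_basis_expansion[of P ?R m] degree_P P_nonzero degree_conv[of "P m" "P m"] by auto
  have "a j = 0" if j: "j < m" for j
  proof -
    have cont: "continuous_on UNIV (\<lambda>(z,x). poly (P m) (x \<bullet> ?y) * poly (P m) (x \<bullet> z) * poly (P j) (z \<bullet> ?y))"
      unfolding split_beta by (intro continuous_intros)
    have "J (?R * P j) = (\<integral>z. poly ?R (z \<bullet> ?y) * poly (P j) (z \<bullet> ?y) \<partial>\<sigma>)"
      by (simp add: J_def)
    also have "\<dots> = (\<integral>z. (\<integral>x. poly (P m) (x \<bullet> ?y) * poly (P m) (x \<bullet> z) * poly (P j) (z \<bullet> ?y) \<partial>\<sigma>) \<partial>\<sigma>)"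
    proof (rule Bochner_Integration.integral_cong[OF refl])
      fix z :: "real^'n" assume "z \<in> space \<sigma>"
      then have "norm z = 1" by simp
      from integral_zonal_product[OF ny this, of "P m" "P m"]
      show "poly ?R (z \<bullet> ?y) * poly (P j) (z \<bullet> ?y)
        = (\<integral>x. poly (P m) (x \<bullet> ?y) * poly (P m) (x \<bullet> z) * poly (P j) (z \<bullet> ?y) \<partial>\<sigma>)"
        by (simp add: inner_commute[of z ?y])
    qed
    also have "\<dots> = (\<integral>x. (\<integral>z. poly (P m) (x \<bullet> ?y) * poly (P m) (x \<bullet> z) * poly (P j) (z \<bullet> ?y) \<partial>\<sigma>) \<partial>\<sigma>)"
      by (rule SS.Fubini_integral[symmetric]) (rule continuous_integrable_pair[OF cont])
    also have "\<dots> = (\<integral>x. poly (P m) (x \<bullet> ?y) * (\<integral>z. poly (P m) (z \<bullet> x) * poly (P j) (z \<bullet> ?y) \<partial>\<sigma>) \<partial>\<sigma>)"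
      by (simp add: mult.assoc inner_commute)
    also have "\<dots> = (\<integral>x. 0 \<partial>\<sigma>)"
      by (rule Bochner_Integration.integral_cong) (use conv_P_diff[of m j] ny j in auto)
    finally have "J (?R * P j) = 0" by simp
    moreover have "J (?R * P j) = (\<Sum>i\<le>m. a i * J (P i * P j))"
      unfolding a by (simp add: sum_distrib_right J_sum J_smult)
    moreover have "\<dots> = a j * J (P j * P j)"
      using j by (subst sum.remove[of _ j]) (auto intro!: sum.neutral simp: orthogonal_P)
    ultimately show ?thesis using area_pos harm_dim_pos[of j] by (simp add: norm_P)
  qed
  then have R: "?R = Polynomial.smult (a m) (P m)"
    unfolding a by (subst sum.remove[of _ m]) (auto intro!: sum.neutral)
  have "a m = poly ?R (?y \<bullet> ?y)" unfolding R by (simp add: P_one norm_axis_1 flip: power2_norm_eq_inner)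
  also have "\<dots> = area / harm_dim d m"
    unfolding integral_zonal_product[OF ny ny, symmetric] by (simp add: norm_P[symmetric] J_def)
  finally show ?thesis using R by simp
qed

abbreviation K :: "nat \<Rightarrow> real^'n \<Rightarrow> real^'n \<Rightarrow> real" where "K n \<equiv> harm_kernel d n"

lemma K_eq: "K n x y = harm_dim d n / area * poly (P n) (x \<bullet> y)"
  by (simp add: harm_kernel_def poly_P)

lemma K_sym: "K n x y = K n y x"
  by (simp add: K_eq inner_commute)

lemma K_diag: "norm x = 1 \<Longrightarrow> K n x x = harm_dim d n / area"
  by (simp add: K_eq P_one flip: power2_norm_eq_inner)

lemma K_reproducing:
  assumes "norm x = 1" "norm z = 1"
  shows "(\<integral>y. K m x y * K j y z \<partial>\<sigma>) = (if m = j then K m x z else 0)"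
proof -
  have "(\<integral>y. K m x y * K j y z \<partial>\<sigma>) = harm_dim d m / area * (harm_dim d j / area)
      * (\<integral>y. poly (P m) (y \<bullet> x) * poly (P j) (y \<bullet> z) \<partial>\<sigma>)"
    by (simp add: K_eq mult_ac inner_commute)
  also have "\<dots> = (if m = j then K m x z else 0)"
    using conv_P_diff[of m j x z] assms harm_dim_pos[of j] area_pos
    by (auto simp: integral_zonal_product conv_P_self K_eq)
  finally show ?thesis .
qed

end

section \<open>Quadratic forms of zonal kernels\<close>

text \<open>Apart from the singular limit kernel, the functions integrated on the base spaces are
  bounded and the measures finite. This one predicate, closed under the operations in use, then
  provides integrability and Fubini.\<close>

definition bounded_measurable :: "'a measure \<Rightarrow> ('a \<Rightarrow> 'b::{real_normed_vector, second_countable_topology}) \<Rightarrow> bool" where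
  "bounded_measurable M h \<longleftrightarrow> h \<in> borel_measurable M \<and> (\<exists>B. \<forall>x\<in>space M. norm (h x) \<le> B)"

lemma bounded_measurableI: "h \<in> borel_measurable M \<Longrightarrow> (\<And>x. x \<in> space M \<Longrightarrow> norm (h x) \<le> B) \<Longrightarrow> bounded_measurable M h"
  by (auto simp: bounded_measurable_def)

lemma bounded_measurableD: "bounded_measurable M h \<Longrightarrow> h \<in> borel_measurable M"
  by (auto simp: bounded_measurable_def)

lemma bounded_measurable_bound:
  assumes "bounded_measurable M h"
  obtains B where "B > 0" "\<And>x. x \<in> space M \<Longrightarrow> norm (h x) \<le> B"
proof -
  obtain B where B: "\<forall>x\<in>space M. norm (h x) \<le> B" using assms by (auto simp: bounded_measurable_def)
  show ?thesis by (rule that[of "max B 1"]) (use B in \<open>auto intro: max.coboundedI1\<close>)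
qed

lemma bounded_measurable_const [simp, intro]: "bounded_measurable M (\<lambda>_. c)"
  by (intro bounded_measurableI) auto

lemma bounded_measurable_add [intro]:
  assumes "bounded_measurable M f" "bounded_measurable M g"
  shows "bounded_measurable M (\<lambda>x. f x + g x)"
proof -
  obtain B where B: "B > 0" "\<And>x. x \<in> space M \<Longrightarrow> norm (f x) \<le> B"
    using bounded_measurable_bound[OF assms(1)] by blast
  obtain C where C: "C > 0" "\<And>x. x \<in> space M \<Longrightarrow> norm (g x) \<le> C"
    using bounded_measurable_bound[OF assms(2)] by blast
  show ?thesis
  proof (rule bounded_measurableI)
    show "(\<lambda>x. f x + g x) \<in> borel_measurable M" using assms[THEN bounded_measurableD] by measurable
    fix x assume x: "x \<in> space M"
    show "norm (f x + g x) \<le> B + C"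
      using B(2)[OF x] C(2)[OF x] norm_triangle_ineq[of "f x" "g x"] by linarith
  qed
qed

lemma bounded_measurable_mult [intro]:
  fixes f g :: "'a \<Rightarrow> 'b::{real_normed_algebra, second_countable_topology}"
  assumes "bounded_measurable M f" "bounded_measurable M g"
  shows "bounded_measurable M (\<lambda>x. f x * g x)"
proof -
  obtain B where B: "B > 0" "\<And>x. x \<in> space M \<Longrightarrow> norm (f x) \<le> B"
    using bounded_measurable_bound[OF assms(1)] by blast
  obtain C where C: "C > 0" "\<And>x. x \<in> space M \<Longrightarrow> norm (g x) \<le> C"
    using bounded_measurable_bound[OF assms(2)] by blast
  show ?thesis
  proof (rule bounded_measurableI)
    show "(\<lambda>x. f x * g x) \<in> borel_measurable M" using assms[THEN bounded_measurableD] by measurable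
    fix x assume x: "x \<in> space M"
    show "norm (f x * g x) \<le> B * C"
      using B(2)[OF x] C(2)[OF x] B(1) C(1) norm_mult_ineq[of "f x" "g x"] mult_mono[of "norm (f x)" B "norm (g x)" C] norm_ge_zero[of "g x"] by linarith
  qed
qed

lemma bounded_measurable_diff [intro]:
  assumes "bounded_measurable M f" "bounded_measurable M g"
  shows "bounded_measurable M (\<lambda>x. f x - g x)"
proof -
  obtain B where B: "B > 0" "\<And>x. x \<in> space M \<Longrightarrow> norm (f x) \<le> B"
    using bounded_measurable_bound[OF assms(1)] by blast
  obtain C where C: "C > 0" "\<And>x. x \<in> space M \<Longrightarrow> norm (g x) \<le> C"
    using bounded_measurable_bound[OF assms(2)] by blast
  show ?thesis
  proof (rule bounded_measurableI)
    show "(\<lambda>x. f x - g x) \<in> borel_measurable M" using assms[THEN bounded_measurableD] by measurable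
    fix x assume x: "x \<in> space M"
    show "norm (f x - g x) \<le> B + C"
      using B(2)[OF x] C(2)[OF x] norm_triangle_ineq4[of "f x" "g x"] by linarith
  qed
qed

lemma bounded_measurable_sum [intro]:
  "(\<And>i. i \<in> I \<Longrightarrow> bounded_measurable M (f i)) \<Longrightarrow> bounded_measurable M (\<lambda>x. \<Sum>i\<in>I. f i x)"
  by (induction I rule: infinite_finite_induct) auto

lemma bounded_measurable_prod [intro]:
  fixes f :: "'i \<Rightarrow> 'a \<Rightarrow> 'b::{real_normed_algebra, comm_ring_1, second_countable_topology}"
  shows "(\<And>i. i \<in> I \<Longrightarrow> bounded_measurable M (f i)) \<Longrightarrow> bounded_measurable M (\<lambda>x. \<Prod>i\<in>I. f i x)"
  by (induction I rule: infinite_finite_induct) auto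

lemma bounded_measurable_power [intro]:
  fixes f :: "'a \<Rightarrow> 'b::{real_normed_algebra_1, second_countable_topology}"
  shows "bounded_measurable M f \<Longrightarrow> bounded_measurable M (\<lambda>x. f x ^ n)"
  by (induction n) auto

lemma bounded_measurable_norm [intro]:
  "bounded_measurable M f \<Longrightarrow> bounded_measurable M (\<lambda>x. norm (f x))"
  by (auto simp: bounded_measurable_def)

lemma bounded_measurable_abs [intro]:
  fixes f :: "'a \<Rightarrow> real"
  shows "bounded_measurable M f \<Longrightarrow> bounded_measurable M (\<lambda>x. \<bar>f x\<bar>)"
  by (auto simp: bounded_measurable_def)

lemma bounded_measurable_compose:
  assumes "bounded_measurable N f" "T \<in> M \<rightarrow>\<^sub>M N"
  shows "bounded_measurable M (\<lambda>x. f (T x))"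
proof -
  obtain B where "\<And>x. x \<in> space N \<Longrightarrow> norm (f x) \<le> B"
    using bounded_measurable_bound[OF assms(1)] by blast
  then show ?thesis
    using measurable_compose[OF assms(2) bounded_measurableD[OF assms(1)]] measurable_space[OF assms(2)]
    by (intro bounded_measurableI) auto
qed

lemma bounded_measurable_fst [intro]: "bounded_measurable M f \<Longrightarrow> bounded_measurable (M \<Otimes>\<^sub>M N) (\<lambda>z. f (fst z))"
  by (erule bounded_measurable_compose) measurable

lemma bounded_measurable_snd [intro]: "bounded_measurable N f \<Longrightarrow> bounded_measurable (M \<Otimes>\<^sub>M N) (\<lambda>z. f (snd z))"
  by (erule bounded_measurable_compose) measurable

lemma (in finite_measure) bounded_measurable_integrable:
  fixes h :: "'a \<Rightarrow> 'b::{banach, second_countable_topology}"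
  assumes "bounded_measurable M h"
  shows "integrable M h"
  using assms by (auto simp: bounded_measurable_def intro!: integrable_const_bound)

lemma (in finite_measure) norm_integral_le_bound:
  fixes h :: "'a \<Rightarrow> 'b::{banach, second_countable_topology}"
  assumes "\<And>x. x \<in> space M \<Longrightarrow> norm (h x) \<le> B" "B \<ge> 0"
  shows "norm (\<integral>x. h x \<partial>M) \<le> B * measure M (space M)"
proof (cases "integrable M h")
  case True
  then have "norm (\<integral>x. h x \<partial>M) \<le> (\<integral>x. norm (h x) \<partial>M)" by (intro integral_norm_bound)
  also have "\<dots> \<le> (\<integral>x. B \<partial>M)" using True assms by (intro integral_mono) auto
  finally show ?thesis by (simp add: mult.commute)
qed (use assms in \<open>simp add: not_integrable_integral_eq\<close>)

lemma (in finite_measure) bounded_measurable_integral: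
  fixes h :: "'c \<times> 'a \<Rightarrow> 'b::{banach, second_countable_topology}"
  assumes h: "bounded_measurable (N \<Otimes>\<^sub>M M) h"
  shows "bounded_measurable N (\<lambda>x. \<integral>y. h (x, y) \<partial>M)"
proof -
  obtain B where B: "B > 0" "\<And>x. x \<in> space (N \<Otimes>\<^sub>M M) \<Longrightarrow> norm (h x) \<le> B"
    using bounded_measurable_bound[OF h] by blast
  show ?thesis
  proof (rule bounded_measurableI)
    show "(\<lambda>x. \<integral>y. h (x, y) \<partial>M) \<in> borel_measurable N"
      using bounded_measurableD[OF h] by (intro borel_measurable_lebesgue_integral) simp
    show "norm (\<integral>y. h (x, y) \<partial>M) \<le> B * measure M (space M)" if "x \<in> space N" for x
      using B that by (intro norm_integral_le_bound) (auto simp: space_pair_measure)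
  qed
qed

lemma bounded_measurable_Fubini:
  fixes h :: "'a \<Rightarrow> 'c \<Rightarrow> 'b::{banach, second_countable_topology}"
  assumes "finite_measure M" "finite_measure N" and h: "bounded_measurable (M \<Otimes>\<^sub>M N) (\<lambda>z. h (fst z) (snd z))"
  shows "(\<integral>x. (\<integral>y. h x y \<partial>N) \<partial>M) = (\<integral>y. (\<integral>x. h x y \<partial>M) \<partial>N)"
    "(\<integral>z. h (fst z) (snd z) \<partial>(M \<Otimes>\<^sub>M N)) = (\<integral>x. (\<integral>y. h x y \<partial>N) \<partial>M)"
proof -
  interpret M: finite_measure M by fact
  interpret N: finite_measure N by fact
  interpret pair_sigma_finite M N ..
  interpret MN: finite_measure "M \<Otimes>\<^sub>M N" by (intro finite_measure_pair_measure assms)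
  have i: "integrable (M \<Otimes>\<^sub>M N) (\<lambda>(x, y). h x y)"
    using MN.bounded_measurable_integrable[OF h] by (simp add: split_beta')
  show "(\<integral>x. (\<integral>y. h x y \<partial>N) \<partial>M) = (\<integral>y. (\<integral>x. h x y \<partial>M) \<partial>N)"
    using Fubini_integral[OF i] by simp
  show "(\<integral>z. h (fst z) (snd z) \<partial>(M \<Otimes>\<^sub>M N)) = (\<integral>x. (\<integral>y. h x y \<partial>N) \<partial>M)"
    using integral_fst'[OF i] by (simp add: split_beta')
qed

text \<open>A symmetric reproducing kernel is the kernel of an orthogonal projection, so its quadratic form
  lies between \<open>0\<close> and the squared norm.\<close>

lemma reproducing_quadratic_form:
  fixes S :: "'a \<Rightarrow> 'a \<Rightarrow> real"
  assumes M: "finite_measure M" and S: "bounded_measurable (M \<Otimes>\<^sub>M M) (\<lambda>z. S (fst z) (snd z))"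
    and sym: "\<And>x y. x \<in> space M \<Longrightarrow> y \<in> space M \<Longrightarrow> S x y = S y x"
    and rep: "\<And>x z. x \<in> space M \<Longrightarrow> z \<in> space M \<Longrightarrow> (\<integral>y. S x y * S y z \<partial>M) = S x z"
    and f: "bounded_measurable M f"
  shows "0 \<le> (\<integral>x. (\<integral>y. f x * f y * S x y \<partial>M) \<partial>M)"
    "(\<integral>x. (\<integral>y. f x * f y * S x y \<partial>M) \<partial>M) \<le> (\<integral>x. (f x)^2 \<partial>M)"
proof -
  interpret finite_measure M by fact
  \<comment> \<open>The image of \<open>f\<close> under the projection. The projection fixes
    \<open>g\<close>, so <g, g> = <f, g>; this gives the lower bound, and the squared norm of f - g
    gives the upper one.\<close>
  define g where "g = (\<lambda>x. \<integral>y. f y * S x y \<partial>M)"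
  have sw: "bounded_measurable (M \<Otimes>\<^sub>M M) (\<lambda>z. S (snd z) (fst z))"
    using bounded_measurable_compose[OF S, of "\<lambda>z. (snd z, fst z)"] by simp
  have S1: "bounded_measurable M (\<lambda>y. S x y)" if "x \<in> space M" for x
    using bounded_measurable_compose[OF S, of "\<lambda>y. (x, y)" M] that by simp
  have S2: "bounded_measurable M (\<lambda>x. S x y)" if "y \<in> space M" for y
    using bounded_measurable_compose[OF S, of "\<lambda>x. (x, y)" M] that by simp
  have "bounded_measurable (M \<Otimes>\<^sub>M M) (\<lambda>z. f (snd z) * S (fst z) (snd z))"
    by (intro bounded_measurable_mult bounded_measurable_snd[OF f] S)
  from bounded_measurable_integral[OF this] have bg: "bounded_measurable M g" by (simp add: g_def)
  have Sg: "(\<integral>x. S x y * g x \<partial>M) = g y" if y: "y \<in> space M" for y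
  proof -
    have "(\<integral>x. S x y * g x \<partial>M) = (\<integral>x. (\<integral>z. S x y * (f z * S x z) \<partial>M) \<partial>M)"
      by (simp add: g_def)
    also have "\<dots> = (\<integral>z. (\<integral>x. S x y * (f z * S x z) \<partial>M) \<partial>M)"
      by (rule bounded_measurable_Fubini(1)[OF M M]) (intro bounded_measurable_mult bounded_measurable_fst[OF S2[OF y]] bounded_measurable_snd[OF f] S)
    also have "\<dots> = (\<integral>z. f z * (\<integral>x. S y x * S x z \<partial>M) \<partial>M)"
    proof (rule Bochner_Integration.integral_cong[OF refl])
      fix z assume "z \<in> space M"
      have "(\<integral>x. S x y * (f z * S x z) \<partial>M) = (\<integral>x. f z * (S y x * S x z) \<partial>M)"
        by (rule Bochner_Integration.integral_cong) (use sym y in auto)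
      then show "(\<integral>x. S x y * (f z * S x z) \<partial>M) = f z * (\<integral>x. S y x * S x z \<partial>M)" by simp
    qed
    also have "\<dots> = g y" unfolding g_def
      by (rule Bochner_Integration.integral_cong) (use rep y in auto)
    finally show ?thesis .
  qed
  have q: "(\<integral>x. (\<integral>y. f x * f y * S x y \<partial>M) \<partial>M) = (\<integral>x. f x * g x \<partial>M)"
    by (simp add: g_def mult.assoc)
  have "(\<integral>x. g x * g x \<partial>M) = (\<integral>x. (\<integral>y. g x * (f y * S x y) \<partial>M) \<partial>M)"
    by (subst (2) g_def) simp
  also have "\<dots> = (\<integral>y. (\<integral>x. g x * (f y * S x y) \<partial>M) \<partial>M)"
    by (rule bounded_measurable_Fubini(1)[OF M M]) (intro bounded_measurable_mult bounded_measurable_fst[OF bg] bounded_measurable_snd[OF f] S)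
  also have "\<dots> = (\<integral>y. f y * (\<integral>x. S x y * g x \<partial>M) \<partial>M)"
    by (simp add: mult_ac)
  also have "\<dots> = (\<integral>y. f y * g y \<partial>M)"
    by (rule Bochner_Integration.integral_cong) (use Sg in auto)
  finally have gg: "(\<integral>x. g x * g x \<partial>M) = (\<integral>x. f x * g x \<partial>M)" .
  show "0 \<le> (\<integral>x. (\<integral>y. f x * f y * S x y \<partial>M) \<partial>M)"
    unfolding q gg[symmetric] by simp
  have int: "integrable M (\<lambda>x. f x * f x)" "integrable M (\<lambda>x. f x * g x)" "integrable M (\<lambda>x. g x * g x)"
    using f bg by (auto intro!: bounded_measurable_integrable)
  have "0 \<le> (\<integral>x. (f x - g x)^2 \<partial>M)" by simp
  also have "(\<integral>x. (f x - g x)^2 \<partial>M) = (\<integral>x. f x * f x - 2 * (f x * g x) + g x * g x \<partial>M)"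
    by (simp add: power2_eq_square algebra_simps)
  also have "\<dots> = (\<integral>x. f x * f x \<partial>M) - (\<integral>x. f x * g x \<partial>M)"
    using int gg by simp
  finally show "(\<integral>x. (\<integral>y. f x * f y * S x y \<partial>M) \<partial>M) \<le> (\<integral>x. (f x)^2 \<partial>M)"
    unfolding q by (simp add: power2_eq_square)
qed

section \<open>Harmonic components of a function and quadratic forms of zonal polynomials\<close>

context round_sphere
begin

lemma continuous_bounded_measurable:
  fixes h :: "real^'n \<Rightarrow> real"
  assumes "continuous_on UNIV h" shows "bounded_measurable \<sigma> h"
proof -
  have "compact (h ` sphere 0 1)"
    by (intro compact_continuous_image continuous_on_subset[OF assms]) auto
  then obtain B where "\<And>x. x \<in> sphere 0 1 \<Longrightarrow> norm (h x) \<le> B"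
    using compact_imp_bounded bounded_iff by (metis imageI)
  then show ?thesis using continuous_measurable[OF assms] by (intro bounded_measurableI[of _ _ B]) auto
qed

lemma continuous_bounded_measurable_pair:
  fixes h :: "(real^'n) \<times> (real^'n) \<Rightarrow> real"
  assumes h: "continuous_on UNIV h"
  shows "bounded_measurable (\<sigma> \<Otimes>\<^sub>M \<sigma>) h"
proof -
  have "compact (h ` (sphere 0 1 \<times> sphere 0 1))"
    by (intro compact_continuous_image continuous_on_subset[OF h] compact_Times) auto
  then obtain B where B: "\<And>x. x \<in> sphere 0 1 \<times> sphere 0 1 \<Longrightarrow> norm (h x) \<le> B"
    using compact_imp_bounded bounded_iff by (metis imageI)
  show ?thesis
    using continuous_integrable_pair[OF h] B
    by (intro bounded_measurableI[of _ _ B]) (auto simp: space_pair_measure)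
qed

lemma bounded_measurable_poly_inner: "bounded_measurable (\<sigma> \<Otimes>\<^sub>M \<sigma>) (\<lambda>z. poly p (fst z \<bullet> snd z))"
  by (intro continuous_bounded_measurable_pair continuous_intros)

lemma bounded_measurable_K: "bounded_measurable (\<sigma> \<Otimes>\<^sub>M \<sigma>) (\<lambda>z. K n (fst z) (snd z))"
  unfolding K_eq by (intro continuous_bounded_measurable_pair continuous_intros)

lemma K_integrable: "integrable \<sigma> (\<lambda>u. K n x u * K m y u)"
  unfolding K_eq by (intro continuous_integrable continuous_intros)

text \<open>Cauchy-Schwarz for a reproducing kernel: the squared norm of K(x, .) + c K(y, .) is
  nonnegative, and c = 1 and c = -1 give the two bounds.\<close>

lemma abs_P_le_1:
  fixes x y :: "real^'n"
  assumes x: "norm x = 1" and y: "norm y = 1"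
  shows "\<bar>poly (P n) (x \<bullet> y)\<bar> \<le> 1"
proof -
  let ?k = "harm_dim d n / area"
  have k: "?k > 0" using area_pos harm_dim_pos by simp
  have r: "(\<integral>u. K n a u * K n b u \<partial>\<sigma>) = K n a b" if "norm a = 1" "norm b = 1" for a b
    using K_reproducing[OF that, of n n] by (simp add: K_sym[of n _ b])
  have "0 \<le> (\<integral>u. (K n x u + c * K n y u)^2 \<partial>\<sigma>)" for c by simp
  moreover have "(\<integral>u. (K n x u + c * K n y u)^2 \<partial>\<sigma>) = ?k + 2 * c * K n x y + c^2 * ?k" for c
  proof -
    have "(\<integral>u. (K n x u + c * K n y u)^2 \<partial>\<sigma>)
      = (\<integral>u. K n x u * K n x u + (2 * c) * (K n x u * K n y u) + c^2 * (K n y u * K n y u) \<partial>\<sigma>)"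
      by (rule Bochner_Integration.integral_cong) (auto simp: power2_eq_square algebra_simps)
    also have "\<dots> = ?k + 2 * c * K n x y + c^2 * ?k"
      using K_integrable by (simp add: r x y K_diag)
    finally show ?thesis .
  qed
  ultimately have *: "0 \<le> ?k + 2 * c * K n x y + c^2 * ?k" for c by simp
  have "0 \<le> 2 * ?k * (1 + poly (P n) (x \<bullet> y))" "0 \<le> 2 * ?k * (1 - poly (P n) (x \<bullet> y))"
    using *[of 1] *[of "-1"] by (simp_all add: K_eq algebra_simps add_divide_distrib diff_divide_distrib)
  moreover have "0 \<le> u" if "0 \<le> 2 * ?k * u" for u
    using that k by (metis mult_pos_neg not_le mult_2 add_pos_pos)
  ultimately have "0 \<le> 1 + poly (P n) (x \<bullet> y)" "0 \<le> 1 - poly (P n) (x \<bullet> y)" by blast+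
  then show ?thesis by linarith
qed

definition qform :: "(real^'n \<Rightarrow> real) \<Rightarrow> real poly \<Rightarrow> real" where
  "qform f p = (\<integral>x. (\<integral>y. f x * f y * poly p (x \<bullet> y) \<partial>\<sigma>) \<partial>\<sigma>)"

lemma qform_linear:
  assumes f: "bounded_measurable \<sigma> f"
  shows "qform f (\<Sum>j\<in>A. Polynomial.smult (a j) (p j)) = (\<Sum>j\<in>A. a j * qform f (p j))"
proof -
  have b: "bounded_measurable (\<sigma> \<Otimes>\<^sub>M \<sigma>) (\<lambda>z. f (fst z) * f (snd z) * poly (p j) (fst z \<bullet> snd z))" for j
    using f by (intro bounded_measurable_mult bounded_measurable_fst bounded_measurable_snd bounded_measurable_poly_inner)
  have i1: "integrable \<sigma> (\<lambda>x. \<integral>y. f x * f y * poly (p j) (x \<bullet> y) \<partial>\<sigma>)" for j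
    using bounded_measurable_integrable[OF bounded_measurable_integral[OF b]] by simp
  have i2: "integrable \<sigma> (\<lambda>y. f x * f y * poly (p j) (x \<bullet> y))" for j x
    by (intro bounded_measurable_integrable bounded_measurable_mult f bounded_measurable_const continuous_bounded_measurable continuous_intros)
  have "qform f (\<Sum>j\<in>A. Polynomial.smult (a j) (p j)) = (\<integral>x. (\<integral>y. (\<Sum>j\<in>A. a j * (f x * f y * poly (p j) (x \<bullet> y))) \<partial>\<sigma>) \<partial>\<sigma>)"
    by (simp add: qform_def poly_sum sum_distrib_left mult_ac)
  also have "\<dots> = (\<integral>x. (\<Sum>j\<in>A. a j * (\<integral>y. f x * f y * poly (p j) (x \<bullet> y) \<partial>\<sigma>)) \<partial>\<sigma>)"
    using i2 by (subst Bochner_Integration.integral_sum) auto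
  also have "\<dots> = (\<Sum>j\<in>A. a j * qform f (p j))"
    using i1 by (subst Bochner_Integration.integral_sum) (auto simp: qform_def)
  finally show ?thesis .
qed

text \<open>The squared norm of the component of \<open>f\<close> in the harmonics of degree
  j.\<close>

definition hpart :: "(real^'n \<Rightarrow> real) \<Rightarrow> nat \<Rightarrow> real" where
  "hpart f j = harm_dim d j / area * qform f (P j)"

lemma qform_expansion:
  assumes f: "bounded_measurable \<sigma> f" and n: "degree p \<le> n"
  shows "qform f p = (\<Sum>j\<le>n. J (p * P j) * hpart f j)"
proof -
  obtain a where a: "p = (\<Sum>j\<le>n. Polynomial.smult (a j) (P j))"
    using poly_basis_expansion[of P p n] degree_P P_nonzero n by blast
  have "J (p * P j) = a j * (area / harm_dim d j)" if "j \<le> n" for j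
  proof -
    have "J (p * P j) = (\<Sum>i\<le>n. a i * J (P i * P j))"
      unfolding a by (simp add: sum_distrib_right J_sum J_smult)
    also have "\<dots> = a j * J (P j * P j)"
      using that by (subst sum.remove[of _ j]) (auto intro!: sum.neutral simp: orthogonal_P)
    finally show ?thesis by (simp add: norm_P)
  qed
  then have "(\<Sum>j\<le>n. J (p * P j) * hpart f j) = (\<Sum>j\<le>n. a j * qform f (P j))"
    using area_pos harm_dim_pos by (intro sum.cong refl) (simp add: hpart_def less_imp_neq[symmetric])
  then show ?thesis using qform_linear[OF f, of a P "{..n}"] a by metis
qed

text \<open>Kernels of different degrees are orthogonal, so a finite sum of them is again
  reproducing and \<open>reproducing_quadratic_form\<close> applies. The upper bound is Bessel's
  inequality.\<close>

lemma sum_hpart_bounds: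
  assumes f: "bounded_measurable \<sigma> f" and A: "finite A"
  shows "0 \<le> (\<Sum>j\<in>A. hpart f j)" "(\<Sum>j\<in>A. hpart f j) \<le> (\<integral>x. (f x)^2 \<partial>\<sigma>)"
proof -
  define S where "S = (\<lambda>x y. \<Sum>j\<in>A. K j x y)"
  have q: "(\<integral>x. (\<integral>y. f x * f y * S x y \<partial>\<sigma>) \<partial>\<sigma>) = (\<Sum>j\<in>A. hpart f j)"
    using qform_linear[OF f, of "\<lambda>j. harm_dim d j / area" P A]
    by (simp add: qform_def hpart_def S_def K_eq poly_sum)
  have bS: "bounded_measurable (\<sigma> \<Otimes>\<^sub>M \<sigma>) (\<lambda>z. S (fst z) (snd z))"
    unfolding S_def by (intro bounded_measurable_sum bounded_measurable_K)
  have sym: "S x y = S y x" for x y by (simp add: S_def K_sym)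
  have rep: "(\<integral>y. S x y * S y z \<partial>\<sigma>) = S x z" if "x \<in> space \<sigma>" "z \<in> space \<sigma>" for x z
  proof -
    have "(\<integral>y. S x y * S y z \<partial>\<sigma>) = (\<integral>y. (\<Sum>i\<in>A. \<Sum>j\<in>A. K i x y * K j y z) \<partial>\<sigma>)"
      by (simp add: S_def sum_product)
    also have "\<dots> = (\<Sum>i\<in>A. \<Sum>j\<in>A. \<integral>y. K i x y * K j y z \<partial>\<sigma>)"
    proof -
      have "integrable \<sigma> (\<lambda>y. K i x y * K j y z)" for i j
        using K_integrable[of i x j z] by (simp add: K_sym[of j z])
      then show ?thesis by (simp add: Bochner_Integration.integral_sum)
    qed
    also have "\<dots> = (\<Sum>i\<in>A. \<Sum>j\<in>A. if i = j then K i x z else 0)"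
      using that by (simp add: K_reproducing)
    also have "\<dots> = S x z" using A by (simp add: S_def)
    finally show ?thesis .
  qed
  show "0 \<le> (\<Sum>j\<in>A. hpart f j)" "(\<Sum>j\<in>A. hpart f j) \<le> (\<integral>x. (f x)^2 \<partial>\<sigma>)"
    using reproducing_quadratic_form[OF finite_measure_axioms bS sym rep f] unfolding q by auto
qed

lemma hpart_nonneg: "bounded_measurable \<sigma> f \<Longrightarrow> hpart f j \<ge> 0"
  using sum_hpart_bounds(1)[of f "{j}"] by simp

lemma summable_hpart: "bounded_measurable \<sigma> f \<Longrightarrow> summable (hpart f)"
  using sum_hpart_bounds(2)[of f "{..<n}" for n] hpart_nonneg
  by (intro summableI_nonneg_bounded) auto

text \<open>The weights \<open>hpart f j\<close> are summable and do not depend on n, so Tannery's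
  theorem needs no more than convergence of each Legendre coefficient under a uniform bound.
  Convergence of the kernels themselves is never asked for.\<close>

lemma qform_tendsto:
  assumes f: "bounded_measurable \<sigma> f"
    and bound: "\<And>j n. \<bar>J (p n * P j)\<bar> \<le> B"
    and lim: "\<And>j. (\<lambda>n. J (p n * P j)) \<longlonglongrightarrow> c j"
  shows "(\<lambda>n. qform f (p n)) \<longlonglongrightarrow> (\<Sum>j. c j * hpart f j)"
proof -
  have "(\<lambda>n. suminf (\<lambda>j. J (p n * P j) * hpart f j)) \<longlonglongrightarrow> (\<Sum>j. c j * hpart f j)"
  proof (rule tannerys_theorem[THEN conjunct2, THEN conjunct2])
    show "(\<lambda>n. J (p n * P j) * hpart f j) \<longlonglongrightarrow> c j * hpart f j" for j
      by (intro tendsto_mult lim tendsto_const)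
    have "norm (J (p n * P j) * hpart f j) \<le> B * hpart f j" for n j
      using bound[of n j] hpart_nonneg[OF f, of j] by (simp add: abs_mult mult_right_mono)
    then show "\<forall>\<^sub>F (j, n) in at_top \<times>\<^sub>F sequentially. norm (J (p n * P j) * hpart f j) \<le> B * hpart f j"
      by (intro always_eventually) auto
    show "summable (\<lambda>j. B * hpart f j)" by (intro summable_mult summable_hpart f)
  qed simp
  moreover have "suminf (\<lambda>j. J (p n * P j) * hpart f j) = qform f (p n)" for n
  proof -
    \<comment> \<open>The series is a finite sum, because \<open>P j\<close> is orthogonal to
      polynomials of smaller degree.\<close>
    have "suminf (\<lambda>j. J (p n * P j) * hpart f j) = (\<Sum>j\<le>degree (p n). J (p n * P j) * hpart f j)"
      by (intro suminf_finite) (auto simp: mult.commute[of "p n"] orthogonal_lower_degree not_le)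
    then show ?thesis using qform_expansion[OF f order_refl] by simp
  qed
  ultimately show ?thesis by simp
qed

end

section \<open>The arcsine limit\<close>

text \<open>For m = d - 1 this is the total mass of the zonal density in the polar angle.\<close>

definition wallis :: "nat \<Rightarrow> real" where
  "wallis m = integral {0..pi} (\<lambda>\<theta>. sin \<theta> ^ m)"

lemma wallis_Suc_Suc: "(real m + 2) * wallis (Suc (Suc m)) = (real m + 1) * wallis m"
proof -
  \<comment> \<open>This antiderivative vanishes at both ends, and its derivative combines the
    powers m and m + 2 of the sine.\<close>
  let ?F = "\<lambda>\<theta>. - cos \<theta> * sin \<theta> ^ Suc m"
  have i: "(\<lambda>\<theta>. sin \<theta> ^ k) integrable_on {0..pi}" for k
    by (intro integrable_continuous_interval continuous_intros)
  have "((\<lambda>\<theta>. (real m + 2) * sin \<theta> ^ Suc (Suc m) - (real m + 1) * sin \<theta> ^ m) has_integral (?F pi - ?F 0)) {0..pi}"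
  proof (rule fundamental_theorem_of_calculus)
    fix x :: real
    have "(?F has_real_derivative (sin x * sin x ^ Suc m - (real m + 1) * ((cos x)^2 * sin x ^ m))) (at x within {0..pi})"
    proof -
      have 1: "((\<lambda>\<theta>. - cos \<theta>) has_real_derivative sin x) (at x within {0..pi})"
        by (auto intro!: derivative_eq_intros)
      have 2: "((\<lambda>\<theta>. sin \<theta> ^ Suc m) has_real_derivative (real (Suc m) * (cos x * sin x ^ (Suc m - Suc 0)))) (at x within {0..pi})"
        using has_field_derivative_at_within[OF DERIV_power[OF DERIV_sin[of x], of "Suc m"]] by simp
      show ?thesis by (rule DERIV_cong[OF DERIV_mult[OF 1 2]]) (simp add: power2_eq_square algebra_simps)
    qed
    also have "(cos x)^2 * sin x ^ m = sin x ^ m - sin x ^ Suc (Suc m)"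
      by (simp only: cos_squared_eq) (simp add: algebra_simps power2_eq_square)
    finally show "(?F has_vector_derivative ((real m + 2) * sin x ^ Suc (Suc m) - (real m + 1) * sin x ^ m)) (at x within {0..pi})"
      by (simp add: has_real_derivative_iff_has_vector_derivative algebra_simps)
  qed simp
  then have "integral {0..pi} (\<lambda>\<theta>. (real m + 2) * sin \<theta> ^ Suc (Suc m) - (real m + 1) * sin \<theta> ^ m) = 0"
    by (simp add: integral_unique del: power_Suc)
  then show ?thesis
    using Henstock_Kurzweil_Integration.integral_diff[OF integrable_on_mult_right[OF i[of "Suc (Suc m)"], of "real m + 2"]
        integrable_on_mult_right[OF i[of m], of "real m + 1"]]
    by (simp add: wallis_def del: power_Suc)
qed

text \<open>The recurrence advances by two, so the induction starts at 0 and 1; each step multiplies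
  the Gamma factor in the numerator by (m + 1)/2.\<close>

lemma wallis_Gamma: "wallis m = 2 ^ m * Gamma ((real m + 1) / 2) ^ 2 / Gamma (real m + 1)"
proof (induction m rule: induct_nat_012)
  case 0
  show ?case by (simp add: wallis_def Gamma_one_half_real)
next
  case 1
  have "(sin has_integral (- cos pi - - cos 0)) {0..pi}"
    by (rule fundamental_theorem_of_calculus)
      (auto intro!: derivative_eq_intros simp: has_real_derivative_iff_has_vector_derivative[symmetric])
  then have "integral {0..pi} sin = 2" by (simp add: integral_unique)
  then show ?case by (simp add: wallis_def Gamma_numeral)
next
  case (ge2 m)
  have g1: "Gamma ((real m + 1)/2 + 1) = (real m + 1)/2 * Gamma ((real m + 1)/2)"
    by (rule Gamma_plus1) (auto elim!: nonpos_Ints_cases)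
  have g2: "Gamma (real m + 1 + 1) = (real m + 1) * Gamma (real m + 1)"
    by (rule Gamma_plus1) (auto elim!: nonpos_Ints_cases)
  have g3: "Gamma (real m + 1 + 1 + 1) = (real m + 1 + 1) * Gamma (real m + 1 + 1)"
    by (rule Gamma_plus1) (auto elim!: nonpos_Ints_cases)
  have G: "Gamma (real m + 1) > 0" by (rule Gamma_real_pos) simp
  have e: "(real (Suc (Suc m)) + 1) / 2 = (real m + 1)/2 + 1" "real (Suc (Suc m)) + 1 = real m + 1 + 1 + 1" by simp_all
  have "wallis (Suc (Suc m)) = (real m + 1) / (real m + 2) * wallis m"
    using wallis_Suc_Suc[of m] by (simp add: field_simps)
  also have "\<dots> = 2 ^ Suc (Suc m) * ((real m + 1)/2 * Gamma ((real m + 1)/2)) ^ 2 / ((real m + 2) * ((real m + 1) * Gamma (real m + 1)))"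
  proof -
    have "(r + 1) / (r + 2) * (p * g^2 / G) = 4 * p * ((r + 1)/2 * g)^2 / ((r + 2) * ((r + 1) * G))"
      if "r + 2 \<noteq> 0" "r + 1 \<noteq> 0" "G \<noteq> 0" for r p g G :: real
      using that by (simp add: divide_simps power2_eq_square)
    note gen = this
    have p: "2 ^ Suc (Suc m) = 4 * (2::real) ^ m" by simp
    show ?thesis unfolding ge2(1) p by (rule gen) (use less_imp_neq[OF G] in auto)
  qed
  also have "\<dots> = 2 ^ Suc (Suc m) * Gamma ((real (Suc (Suc m)) + 1) / 2) ^ 2 / Gamma (real (Suc (Suc m)) + 1)"
    unfolding e(1) g1 unfolding e(2) g3 g2 by (simp add: add.commute)
  finally show ?case .
qed

lemma wallis_pos: "wallis m > 0"
  unfolding wallis_Gamma by (intro divide_pos_pos mult_pos_pos zero_less_power Gamma_real_pos) auto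

section \<open>The zonal functional in the polar angle and its Chebyshev basis\<close>

context round_sphere
begin

definition trig :: "real poly \<Rightarrow> real" where
  "trig p = integral {0..pi} (\<lambda>\<theta>. poly p (cos \<theta>) * sin \<theta> ^ (d - 1))"

lemma integrable_trig: "(\<lambda>\<theta>. poly p (cos \<theta>) * sin \<theta> ^ k) integrable_on {0..pi}"
  by (intro integrable_continuous_interval continuous_intros)

lemma trig_add: "trig (p + q) = trig p + trig q"
  unfolding trig_def using integrable_trig by (simp add: algebra_simps Henstock_Kurzweil_Integration.integral_add)

lemma trig_smult: "trig (Polynomial.smult c p) = c * trig p"
  unfolding trig_def by (simp add: mult.assoc)

lemma trig_moment: "(real b + 1 + real d) * trig ([:0, 1:] ^ (b + 2)) = (real b + 1) * trig ([:0, 1:] ^ b)"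
  and trig_1: "trig [:0, 1:] = 0"
proof -
  obtain e where e: "d = Suc e" using d2 by (cases d) auto
  \<comment> \<open>The integrand is the derivative of cos^b sin^d with the sign reversed only in
    its second summand's sine factor from cos; the boundary values vanish as d > 0. The exponent b =
    0 gives the first moment, \<open>Suc b\<close> the recurrence.\<close>
  have *: "((\<lambda>\<theta>. real d * (cos \<theta> ^ Suc b * sin \<theta> ^ e) - (if b = 0 then 0 else real b * (cos \<theta> ^ (b - 1) * sin \<theta> ^ Suc d)) :: real) has_integral 0) {0..pi}"
    if "b = b" for b
  proof -
    let ?F = "\<lambda>\<theta>::real. cos \<theta> ^ b * sin \<theta> ^ d"
    have "((\<lambda>\<theta>. real d * (cos \<theta> ^ Suc b * sin \<theta> ^ e) - (if b = 0 then 0 else real b * (cos \<theta> ^ (b - 1) * sin \<theta> ^ Suc d))) has_integral (?F pi - ?F 0)) {0..pi}"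
    proof (rule fundamental_theorem_of_calculus)
      fix x :: real
      have "(?F has_real_derivative (real d * (cos x ^ Suc b * sin x ^ e) - (if b = 0 then 0 else real b * (cos x ^ (b - 1) * sin x ^ Suc d)))) (at x within {0..pi})"
      proof -
        have 1: "((\<lambda>\<theta>. cos \<theta> ^ b) has_real_derivative (real b * (- sin x * cos x ^ (b - Suc 0)))) (at x within {0..pi})"
          using has_field_derivative_at_within[OF DERIV_power[OF DERIV_cos[of x], of b]] by simp
        have 2: "((\<lambda>\<theta>. sin \<theta> ^ d) has_real_derivative (real d * (cos x * sin x ^ (d - Suc 0)))) (at x within {0..pi})"
          using has_field_derivative_at_within[OF DERIV_power[OF DERIV_sin[of x], of d]] by simp
        show ?thesis by (rule DERIV_cong[OF DERIV_mult[OF 1 2]]) (simp add: e)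
      qed
      then show "(?F has_vector_derivative (real d * (cos x ^ Suc b * sin x ^ e) - (if b = 0 then 0 else real b * (cos x ^ (b - 1) * sin x ^ Suc d)))) (at x within {0..pi})"
        by (simp add: has_real_derivative_iff_has_vector_derivative)
    qed simp
    then show ?thesis by (simp add: e)
  qed
  show "trig [:0, 1:] = 0"
    using integral_unique[OF *[of 0]] d2 by (simp add: trig_def e[THEN arg_cong[of _ _ "\<lambda>n. n - 1"], simplified])
  have "((\<lambda>\<theta>. (real b + 1 + real d) * (cos \<theta> ^ (b + 2) * sin \<theta> ^ (d - 1)) - (real b + 1) * (cos \<theta> ^ b * sin \<theta> ^ (d - 1))) has_integral 0) {0..pi}"
  proof (rule has_integral_eq[OF _ *[of "Suc b", OF refl]])
    fix x :: real
    have "sin x ^ Suc d = sin x ^ e - (cos x)^2 * sin x ^ e"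
      by (simp only: cos_squared_eq e) (simp add: algebra_simps power2_eq_square)
    then have "cos x ^ b * sin x ^ Suc d = cos x ^ b * (sin x ^ e - (cos x)^2 * sin x ^ e)"
      by (simp only:)
    also have "\<dots> = cos x ^ b * sin x ^ e - cos x ^ (b + 2) * sin x ^ e"
      by (simp add: power2_eq_square algebra_simps)
    finally have E: "cos x ^ b * sin x ^ Suc d = cos x ^ b * sin x ^ e - cos x ^ (b + 2) * sin x ^ e" .
    show "real d * (cos x ^ Suc (Suc b) * sin x ^ e) - (if Suc b = 0 then 0 else real (Suc b) * (cos x ^ (Suc b - 1) * sin x ^ Suc d))
      = (real b + 1 + real d) * (cos x ^ (b + 2) * sin x ^ (d - 1)) - (real b + 1) * (cos x ^ b * sin x ^ (d - 1))"
      by (simp only: if_not_P[OF Suc_not_Zero] diff_Suc_1 E) (simp add: e algebra_simps)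
  qed
  then have z: "integral {0..pi} (\<lambda>\<theta>. (real b + 1 + real d) * (cos \<theta> ^ (b + 2) * sin \<theta> ^ (d - 1)) - (real b + 1) * (cos \<theta> ^ b * sin \<theta> ^ (d - 1))) = 0"
    by (rule integral_unique)
  have "(\<lambda>\<theta>::real. cos \<theta> ^ i * sin \<theta> ^ (d - 1)) integrable_on {0..pi}" for i
    by (intro integrable_continuous_interval continuous_intros)
  note ib = this
  have t: "trig ([:0, 1:] ^ i) = integral {0..pi} (\<lambda>\<theta>. cos \<theta> ^ i * sin \<theta> ^ (d - 1))" for i
    by (simp add: trig_def poly_power)
  have "integral {0..pi} (\<lambda>\<theta>. (real b + 1 + real d) * (cos \<theta> ^ (b + 2) * sin \<theta> ^ (d - 1)) - (real b + 1) * (cos \<theta> ^ b * sin \<theta> ^ (d - 1)))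
      = (real b + 1 + real d) * trig ([:0, 1:] ^ (b + 2)) - (real b + 1) * trig ([:0, 1:] ^ b)"
    unfolding t Henstock_Kurzweil_Integration.integral_diff[OF integrable_on_mult_right[OF ib] integrable_on_mult_right[OF ib]]
      Henstock_Kurzweil_Integration.integral_mult_right ..
  with z show "(real b + 1 + real d) * trig ([:0, 1:] ^ (b + 2)) = (real b + 1) * trig ([:0, 1:] ^ b)"
    by linarith
qed

abbreviation W :: real where "W \<equiv> wallis (d - 1)"

text \<open>Both functionals satisfy the same two-step moment recurrence and agree on 1 and t up to
  the factor. This comparison takes the place of polar coordinates on the sphere.\<close>

lemma J_trig: "J p = area / W * trig p"
proof -
  define G where "G = (\<lambda>p. J p * W - area * trig p)"
  have "G p = 0"
  proof (rule linear_functional_monomials)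
    show "G ([:0, 1:] ^ i) = 0" for i
    proof (induction i rule: induct_nat_012)
      case 0
      show ?case by (simp add: G_def J_1 trig_def wallis_def)
    next
      case 1
      show ?case using J_odd[of 1] trig_1 by (simp add: G_def)
    next
      case (ge2 n)
      have "(real n + 1 + real d) * G ([:0, 1:] ^ (n + 2)) = (real n + 1) * G ([:0, 1:] ^ n)"
        unfolding G_def right_diff_distrib
        using arg_cong[OF J_moment[of n], of "\<lambda>u. u * W"] arg_cong[OF trig_moment[of n], of "\<lambda>u. area * u"]
        by (simp only: mult.assoc mult.left_commute)
      then show ?case using ge2(1) by (simp del: power_Suc)
    qed
  qed (simp_all add: G_def J_add J_smult trig_add trig_smult algebra_simps)
  then show ?thesis using wallis_pos[of "d - 1"] by (simp add: G_def field_simps)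
qed

text \<open>Chebyshev polynomials of the first kind. All but the constant one integrate to 0 against
  the arcsine law, so they are the basis in which that law is recognised.\<close>

fun cheb :: "nat \<Rightarrow> real poly" where
  "cheb 0 = 1"
| "cheb (Suc 0) = [:0, 1:]"
| "cheb (Suc (Suc n)) = Polynomial.smult 2 ([:0, 1:] * cheb (Suc n)) - cheb n"

lemma degree_cheb_aux: "degree (cheb n) \<le> n \<and> coeff (cheb n) n > 0"
proof (induction n rule: cheb.induct)
  case (3 n)
  have d1: "degree ([:0, 1:] * cheb (Suc n)) \<le> Suc (Suc n)"
    using 3 by (intro order_trans[OF degree_mult_le]) auto
  have "coeff (cheb n) (Suc (Suc n)) = 0" using 3 by (intro coeff_eq_0) linarith
  then have "coeff (cheb (Suc (Suc n))) (Suc (Suc n)) > 0" using 3 by simp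
  moreover have "degree (cheb (Suc (Suc n))) \<le> Suc (Suc n)"
    unfolding cheb.simps using d1 3
    by (intro degree_diff_le order_trans[OF degree_smult_le]) auto
  ultimately show ?case by blast
qed auto

lemma degree_cheb: "degree (cheb n) = n" and cheb_nonzero: "cheb n \<noteq> 0"
  using degree_cheb_aux[of n] le_degree[of "cheb n" n] by auto

lemma poly_cheb_cos: "poly (cheb n) (cos \<theta>) = cos (real n * \<theta>)"
proof (induction n rule: cheb.induct)
  case (3 n)
  have "cos (real (Suc (Suc n)) * \<theta>) = cos (real (Suc n) * \<theta> + \<theta>)" "cos (real n * \<theta>) = cos (real (Suc n) * \<theta> - \<theta>)"
    by (simp_all add: algebra_simps)
  then have "cos (real (Suc (Suc n)) * \<theta>) + cos (real n * \<theta>) = 2 * cos \<theta> * cos (real (Suc n) * \<theta>)"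
    by (simp only: cos_add cos_diff) simp
  then show ?case using 3 by simp
qed auto

text \<open>A matrix entry of multiplication by \<open>cheb m\<close> between degrees n and i,
  divided by the squared norm of \<open>P n\<close>.\<close>

definition umat :: "nat \<Rightarrow> nat \<Rightarrow> nat \<Rightarrow> real" where
  "umat m n i = harm_dim d n / area * J (P i * (cheb m * P n))"

lemma umat_X:
  "harm_dim d n / area * J ([:0, 1:] * P i * Q)
   = (real i + real d - 1) / (2 * real i + real d - 1) * (harm_dim d n / area * J (P (Suc i) * Q))
   + real i / (2 * real i + real d - 1) * (harm_dim d n / area * J (P (i - 1) * Q))"
proof -
  have nz: "2 * real i + real d - 1 \<noteq> 0" using d2 by simp
  have "J ([:0, 1:] * P i * Q) = ((real i + real d - 1) * J (P (Suc i) * Q) + real i * J (P (i - 1) * Q)) / (2 * real i + real d - 1)"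
    using J_X_P[of i Q] nz by (metis nonzero_mult_div_cancel_left)
  then show ?thesis by (simp add: add_divide_distrib distrib_left mult_ac)
qed

lemma nat_shift_tendsto: "filterlim (\<lambda>n. nat (int n + j)) at_top sequentially"
proof (rule filterlim_at_top_mono)
  show "filterlim (\<lambda>n. n - nat \<bar>j\<bar>) at_top sequentially" by (rule filterlim_minus_const_nat_at_top)
  show "\<forall>\<^sub>F n in sequentially. n - nat \<bar>j\<bar> \<le> nat (int n + j)" by (intro always_eventually allI) linarith
qed

text \<open>Both coefficients of the recurrence tend to 1/2, so multiplication by t acts in the
  limit as half the sum of the two neighbouring shifts.\<close>

lemma umat_step_tendsto:
  assumes up: "(\<lambda>n. umat m n (nat (int n + (j + 1)))) \<longlonglongrightarrow> u"
    and down: "(\<lambda>n. umat m n (nat (int n + (j - 1)))) \<longlonglongrightarrow> v"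
  shows "(\<lambda>n. harm_dim d n / area * J ([:0, 1:] * P (nat (int n + j)) * (cheb m * P n))) \<longlonglongrightarrow> (u + v) / 2"
proof -
  let ?i = "\<lambda>n. nat (int n + j)"
  have a: "(\<lambda>i. (real i + real d - 1) / (2 * real i + real d - 1)) \<longlonglongrightarrow> 1/2"
    and c: "(\<lambda>i. real i / (2 * real i + real d - 1)) \<longlonglongrightarrow> 1/2" by real_asymp+
  have "(\<lambda>n. (real (?i n) + real d - 1) / (2 * real (?i n) + real d - 1) * umat m n (nat (int n + (j + 1)))
      + real (?i n) / (2 * real (?i n) + real d - 1) * umat m n (nat (int n + (j - 1)))) \<longlonglongrightarrow> 1/2 * u + 1/2 * v"
    by (intro tendsto_add tendsto_mult up down filterlim_compose[OF a nat_shift_tendsto] filterlim_compose[OF c nat_shift_tendsto])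
  moreover have "\<forall>\<^sub>F n in sequentially. (real (?i n) + real d - 1) / (2 * real (?i n) + real d - 1) * umat m n (nat (int n + (j + 1)))
      + real (?i n) / (2 * real (?i n) + real d - 1) * umat m n (nat (int n + (j - 1)))
      = harm_dim d n / area * J ([:0, 1:] * P (?i n) * (cheb m * P n))"
    using eventually_ge_at_top[of "nat \<bar>j\<bar> + 1"]
  proof eventually_elim
    case (elim n)
    then have "nat (int n + (j + 1)) = Suc (?i n)" "nat (int n + (j - 1)) = ?i n - 1" by linarith+
    then show ?case unfolding umat_X umat_def by simp
  qed
  ultimately have "(\<lambda>n. harm_dim d n / area * J ([:0, 1:] * P (?i n) * (cheb m * P n))) \<longlonglongrightarrow> 1/2 * u + 1/2 * v"
    by (rule Lim_transform_eventually)
  moreover have "1/2 * u + 1/2 * v = (u + v) / 2" by simp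
  ultimately show ?thesis by (simp only:)
qed

text \<open>If S is the shift and t acts as (S + 1/S)/2, the Chebyshev recurrence makes
  \<open>cheb m\<close> act as half the sum of the m-th powers of S and 1/S. The offset j is an
  integer; \<open>nat\<close> truncates only for finitely many n.\<close>

lemma umat_tendsto:
  "(\<lambda>n. umat m n (nat (int n + j))) \<longlonglongrightarrow> (of_bool (j = int m) + of_bool (j = - int m)) / 2"
proof (induction m arbitrary: j rule: cheb.induct)
  case 1
  have "\<forall>\<^sub>F n in sequentially. umat 0 n (nat (int n + j)) = of_bool (j = 0)"
    using eventually_ge_at_top[of "nat \<bar>j\<bar> + 1"]
  proof eventually_elim
    case (elim n)
    then have "nat (int n + j) \<noteq> n" if "j \<noteq> 0" using that by linarith
    then show ?case using area_pos harm_dim_pos[of n]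
      by (cases "j = 0") (auto simp: umat_def norm_P orthogonal_P)
  qed
  then have "(\<lambda>n. umat 0 n (nat (int n + j))) \<longlonglongrightarrow> of_bool (j = 0)" by (rule tendsto_eventually)
  then show ?case by (cases "j = 0") simp_all
next
  case 2
  \<comment> \<open>The induction rule provides no hypothesis for degree 1, so the case of degree 0
    is proved again, at every offset.\<close>
  have base: "(\<lambda>n. umat 0 n (nat (int n + j))) \<longlonglongrightarrow> of_bool (j = 0)" for j
  proof -
    have "\<forall>\<^sub>F n in sequentially. umat 0 n (nat (int n + j)) = of_bool (j = 0)"
      using eventually_ge_at_top[of "nat \<bar>j\<bar> + 1"]
    proof eventually_elim
      case (elim n)
      then have "nat (int n + j) \<noteq> n" if "j \<noteq> 0" using that by linarith
      then show ?case using area_pos harm_dim_pos[of n]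
        by (cases "j = 0") (auto simp: umat_def norm_P orthogonal_P)
    qed
    then show ?thesis by (rule tendsto_eventually)
  qed
  have 1: "(\<lambda>n. umat (Suc 0) n (nat (int n + j))) = (\<lambda>n. harm_dim d n / area * J ([:0, 1:] * P (nat (int n + j)) * (cheb 0 * P n)))"
    by (rule ext) (simp add: umat_def mult.left_commute)
  have 2: "(of_bool (j + 1 = 0) + of_bool (j - 1 = 0)) / 2 = (of_bool (j = int (Suc 0)) + of_bool (j = - int (Suc 0))) / (2::real)"
    by auto
  show ?case using umat_step_tendsto[OF base[of "j + 1"] base[of "j - 1"]] unfolding 1 2 .
next
  case (3 m)
  let ?s = "\<lambda>n. harm_dim d n / area * J ([:0, 1:] * P (nat (int n + j)) * (cheb (Suc m) * P n))"
  have rec: "umat (Suc (Suc m)) n i = 2 * (harm_dim d n / area * J ([:0, 1:] * P i * (cheb (Suc m) * P n))) - umat m n i" for n i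
  proof -
    have "P i * (cheb (Suc (Suc m)) * P n) = Polynomial.smult 2 ([:0, 1:] * P i * (cheb (Suc m) * P n)) - P i * (cheb m * P n)"
      by (simp add: algebra_simps)
    then show ?thesis unfolding umat_def by (simp only: J_diff J_smult right_diff_distrib mult_ac)
  qed
  have lim: "(\<lambda>n. 2 * ?s n - umat m n (nat (int n + j))) \<longlonglongrightarrow>
     2 * (((of_bool (j + 1 = int (Suc m)) + of_bool (j + 1 = - int (Suc m))) / 2 + (of_bool (j - 1 = int (Suc m)) + of_bool (j - 1 = - int (Suc m))) / 2) / 2)
     - (of_bool (j = int m) + of_bool (j = - int m)) / 2"
    by (intro tendsto_diff tendsto_mult tendsto_const umat_step_tendsto 3)
  have val: "2 * (((of_bool (j + 1 = int (Suc m)) + of_bool (j + 1 = - int (Suc m))) / 2 + (of_bool (j - 1 = int (Suc m)) + of_bool (j - 1 = - int (Suc m))) / 2) / 2)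
     - (of_bool (j = int m) + of_bool (j = - int m)) / 2
     = (of_bool (j = int (Suc (Suc m))) + of_bool (j = - int (Suc (Suc m)))) / (2::real)"
    by (auto simp: of_bool_def)
  show ?case unfolding rec using lim unfolding val .
qed

lemma trig_open: "integral {0<..<pi} (\<lambda>\<theta>. poly p (cos \<theta>)) = integral {0..pi} (\<lambda>\<theta>. poly p (cos \<theta>))"
  by (rule integral_open_interval_real[symmetric])

lemma integral_cheb: "integral {0..pi} (\<lambda>\<theta>. poly (cheb m) (cos \<theta>)) = (if m = 0 then pi else 0)"
proof (cases "m = 0")
  case False
  have "((\<lambda>\<theta>. cos (real m * \<theta>)) has_integral (sin (real m * pi) / real m - sin (real m * 0) / real m)) {0..pi}"
    using False by (intro fundamental_theorem_of_calculus)
      (auto intro!: derivative_eq_intros simp: has_real_derivative_iff_has_vector_derivative[symmetric])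
  then show ?thesis using False sin_npi[of m] by (simp add: poly_cheb_cos integral_unique)
qed simp

text \<open>Offset 0 in \<open>umat_tendsto\<close>: after expansion of \<open>p\<close> in
  Chebyshev polynomials only the constant one contributes to the limit, and likewise to the integral
  over the angle.\<close>

lemma arcsine_limit:
  "(\<lambda>n. harm_dim d n / area * J (p * (P n * P n))) \<longlonglongrightarrow> integral {0..pi} (\<lambda>\<theta>. poly p (cos \<theta>)) / pi"
proof -
  obtain k a where a: "p = (\<Sum>m\<le>k. Polynomial.smult (a m) (cheb m))"
    using poly_basis_expansion[of cheb p "degree p"] degree_cheb cheb_nonzero by blast
  have 1: "(\<lambda>n. harm_dim d n / area * J (cheb m * (P n * P n))) \<longlonglongrightarrow> of_bool (m = 0)" for m
    using umat_tendsto[of m 0] by (cases "m = 0") (simp_all add: umat_def mult_ac)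
  have "(\<lambda>n. \<Sum>m\<le>k. a m * (harm_dim d n / area * J (cheb m * (P n * P n)))) \<longlonglongrightarrow> (\<Sum>m\<le>k. a m * of_bool (m = 0))"
    by (intro tendsto_sum tendsto_mult tendsto_const 1)
  moreover have "(\<Sum>m\<le>k. a m * (harm_dim d n / area * J (cheb m * (P n * P n)))) = harm_dim d n / area * J (p * (P n * P n))" for n
    by (subst a) (simp add: sum_distrib_right J_sum J_smult sum_distrib_left mult_ac)
  moreover have "(\<Sum>m\<le>k. a m * of_bool (m = 0)) = integral {0..pi} (\<lambda>\<theta>. poly p (cos \<theta>)) / pi"
  proof -
    have i: "(\<lambda>\<theta>. poly (cheb m) (cos \<theta>)) integrable_on {0..pi}" for m
      by (intro integrable_continuous_interval continuous_intros)
    have "integral {0..pi} (\<lambda>\<theta>. poly p (cos \<theta>)) = integral {0..pi} (\<lambda>\<theta>. \<Sum>m\<le>k. a m * poly (cheb m) (cos \<theta>))"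
      by (subst a) (simp add: poly_sum)
    also have "\<dots> = (\<Sum>m\<le>k. integral {0..pi} (\<lambda>\<theta>. a m * poly (cheb m) (cos \<theta>)))"
      by (intro Henstock_Kurzweil_Integration.integral_sum integrable_on_mult_right i) simp
    also have "\<dots> = (\<Sum>m\<le>k. a m * of_bool (m = 0)) * pi"
      by (simp add: integral_cheb sum_distrib_right if_distrib[of "(*) _"] of_bool_def cong: if_cong)
    finally show ?thesis by simp
  qed
  ultimately show ?thesis by simp
qed

end

section \<open>The limit of the variance form\<close>

text \<open>Only divergence is used later, so a linear lower bound suffices in every
  dimension.\<close>

lemma harm_dim_ge:
  assumes d: "d \<ge> 2" shows "real n \<le> harm_dim d n"
proof -
  have c: "n + 1 \<le> (n + Suc e) choose Suc e" for n e
  proof (induction n)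
    case (Suc n)
    have "(Suc n + Suc e) choose Suc e = (n + Suc e choose e) + (n + Suc e choose Suc e)" by simp
    moreover have "(n + Suc e choose e) > 0" by (intro zero_less_binomial) simp
    ultimately show ?case using Suc by linarith
  qed simp
  obtain e where e: "d = Suc (Suc e)" using d by (metis add_2_eq_Suc le_Suc_ex)
  have "n \<le> (n + d - 1) choose (d - 1)" using c[of n e] unfolding e by simp
  moreover have "(2 * real n + real d - 1) / (real n + real d - 1) \<ge> 1" using d by (simp add: divide_simps)
  ultimately have "1 * real n \<le> (2 * real n + real d - 1) / (real n + real d - 1) * real ((n + d - 1) choose (d - 1))"
    by (intro mult_mono) auto
  then show ?thesis by (simp add: harm_dim_def)
qed

lemma harm_dim_at_top: "d \<ge> 2 \<Longrightarrow> filterlim (harm_dim d) at_top sequentially"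
  by (rule filterlim_at_top_mono[OF filterlim_real_sequentially]) (simp add: harm_dim_ge)

context round_sphere
begin

text \<open>The coefficients of the powers of t^2 in the binomial series of (1 - t^2)^(-(d-1)/2).
  With the sign included they are nonnegative.\<close>

definition gcoef :: "nat \<Rightarrow> real" where
  "gcoef i = ((- ((real d - 1) / 2)) gchoose i) * (-1) ^ i"

text \<open>The reciprocal of the zonal density in the angle, so that its product with that density
  is the uniform measure on (0, pi). At t = 1 and t = -1 division by zero makes it 0.\<close>

definition rkernel :: "real \<Rightarrow> real" where
  "rkernel t = 1 / sin (arccos t) ^ (d - 1)"

text \<open>Polynomials increasing to \<open>rkernel\<close> on the open interval. They carry to the
  unbounded kernel what is known for polynomials.\<close>

definition rpoly :: "nat \<Rightarrow> real poly" where
  "rpoly l = (\<Sum>i<l. Polynomial.smult (gcoef i) ([:0, 1:] ^ (2 * i)))"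

lemma gcoef_nonneg: "gcoef i \<ge> 0"
proof -
  have "gcoef i = pochhammer ((real d - 1) / 2) i / fact i"
    by (simp add: gcoef_def gbinomial_pochhammer power_mult_distrib[symmetric])
  then show ?thesis using d2 by (simp add: pochhammer_nonneg)
qed

lemma poly_rpoly: "poly (rpoly l) t = (\<Sum>i<l. gcoef i * (t^2)^i)"
  by (simp add: rpoly_def poly_sum poly_power power_mult)

lemma rpoly_nonneg: "poly (rpoly l) t \<ge> 0"
  unfolding poly_rpoly by (intro sum_nonneg mult_nonneg_nonneg gcoef_nonneg) auto

lemma rpoly_mono: "l \<le> m \<Longrightarrow> poly (rpoly l) t \<le> poly (rpoly m) t"
  unfolding poly_rpoly by (intro sum_mono2) (auto intro!: mult_nonneg_nonneg gcoef_nonneg)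

lemma rpoly_tendsto:
  assumes t: "\<bar>t\<bar> < 1" shows "(\<lambda>l. poly (rpoly l) t) \<longlonglongrightarrow> rkernel t"
proof -
  have t2: "t^2 < 1" using t by (simp add: abs_square_less_1)
  then have "\<bar>- (t^2)\<bar> < 1" by simp
  from gen_binomial_real[OF this, of "- ((real d - 1) / 2)"]
  have "(\<lambda>n. gcoef n * (t^2)^n) sums (1 - t^2) powr (- ((real d - 1) / 2))"
    by (simp add: gcoef_def power_minus[of "t^2"] mult.assoc)
  moreover have "(1 - t^2) powr (- ((real d - 1) / 2)) = rkernel t"
  proof -
    have "real (d - 1) = real d - 1" using d2 by simp
    then have "sqrt (1 - t^2) ^ (d - 1) = (1 - t^2) powr ((real d - 1) / 2)"
      using t2 by (simp add: powr_half_sqrt[symmetric] powr_powr powr_realpow[symmetric])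
    then show ?thesis using t
      by (simp add: rkernel_def sin_arccos powr_minus_divide)
  qed
  ultimately show ?thesis unfolding poly_rpoly sums_def by simp
qed

lemma rkernel_nonneg: "\<bar>t\<bar> \<le> 1 \<Longrightarrow> rkernel t \<ge> 0"
  by (simp add: rkernel_def sin_arccos abs_square_le_1)

lemma rkernel_pos: "\<bar>t\<bar> < 1 \<Longrightarrow> rkernel t > 0"
  by (simp add: rkernel_def sin_arccos abs_square_less_1)

lemma rpoly_le: "\<bar>t\<bar> < 1 \<Longrightarrow> poly (rpoly l) t \<le> rkernel t"
  using rpoly_mono by (intro incseq_le rpoly_tendsto) (auto simp: incseq_def)

lemma rkernel_cos: "0 < \<theta> \<Longrightarrow> \<theta> < pi \<Longrightarrow> rkernel (cos \<theta>) * sin \<theta> ^ (d - 1) = 1"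
  using sin_gt_zero[of \<theta>] by (simp add: rkernel_def arccos_cos)

lemma abs_inner_le: "norm x = 1 \<Longrightarrow> norm y = 1 \<Longrightarrow> \<bar>x \<bullet> (y::real^'n)\<bar> \<le> 1"
  using Cauchy_Schwarz_ineq2[of x y] by simp

lemma abs_cos_less: "0 < \<theta> \<Longrightarrow> \<theta> < pi \<Longrightarrow> \<bar>cos \<theta>\<bar> < 1"
  using cos_monotone_0_pi[of 0 \<theta>] cos_monotone_0_pi[of \<theta> pi] by auto

text \<open>On the open interval \<open>rpoly\<close> times the power of the sine lies between 0 and
  1 and tends to 1, so dominated convergence removes the weight. The end points, where the kernel is
  singular, are left out first.\<close>

lemma J_rpoly_tendsto:
  "(\<lambda>l. J (rpoly l * q)) \<longlonglongrightarrow> area / W * integral {0..pi} (\<lambda>\<theta>. poly q (cos \<theta>))"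
proof -
  have "compact ((\<lambda>\<theta>. poly q (cos \<theta>)) ` {0..pi})"
    by (intro compact_continuous_image continuous_intros) auto
  then obtain B where B: "\<And>\<theta>. \<theta> \<in> {0..pi} \<Longrightarrow> \<bar>poly q (cos \<theta>)\<bar> \<le> B"
    using compact_imp_bounded bounded_iff by (metis imageI real_norm_def)
  have "(\<lambda>l. integral {0<..<pi} (\<lambda>\<theta>. poly (rpoly l * q) (cos \<theta>) * sin \<theta> ^ (d - 1)))
      \<longlonglongrightarrow> integral {0<..<pi} (\<lambda>\<theta>. poly q (cos \<theta>))"
  proof (rule dominated_convergence(2)[where h = "\<lambda>_. B"])
    show "(\<lambda>\<theta>. poly (rpoly l * q) (cos \<theta>) * sin \<theta> ^ (d - 1)) integrable_on {0<..<pi}" for l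
      using integrable_trig integrable_on_open_interval_real by blast
    show "(\<lambda>_. B) integrable_on {0<..<pi}"
      using integrable_const_ivl[of B 0 pi] integrable_on_open_interval_real by blast
    fix l and \<theta> :: real assume th: "\<theta> \<in> {0<..<pi}"
    have s: "sin \<theta> > 0" using th sin_gt_zero by auto
    have "poly (rpoly l) (cos \<theta>) * sin \<theta> ^ (d - 1) \<le> rkernel (cos \<theta>) * sin \<theta> ^ (d - 1)"
      using th s rpoly_le[OF abs_cos_less, of \<theta> l] by (intro mult_right_mono) auto
    then have le: "poly (rpoly l) (cos \<theta>) * sin \<theta> ^ (d - 1) \<le> 1" using rkernel_cos th by simp
    have ge: "0 \<le> poly (rpoly l) (cos \<theta>) * sin \<theta> ^ (d - 1)" using s rpoly_nonneg[of l "cos \<theta>"] by simp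
    have "\<bar>poly (rpoly l * q) (cos \<theta>) * sin \<theta> ^ (d - 1)\<bar>
        = (poly (rpoly l) (cos \<theta>) * sin \<theta> ^ (d - 1)) * \<bar>poly q (cos \<theta>)\<bar>"
      using ge s by (simp add: abs_mult rpoly_nonneg)
    also have "\<dots> \<le> 1 * B" using le ge B[of \<theta>] th by (intro mult_mono) auto
    finally show "norm (poly (rpoly l * q) (cos \<theta>) * sin \<theta> ^ (d - 1)) \<le> B" by simp
  next
    fix \<theta> :: real assume th: "\<theta> \<in> {0<..<pi}"
    have "(\<lambda>l. poly (rpoly l) (cos \<theta>) * (poly q (cos \<theta>) * sin \<theta> ^ (d - 1)))
       \<longlonglongrightarrow> rkernel (cos \<theta>) * (poly q (cos \<theta>) * sin \<theta> ^ (d - 1))"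
      using th by (intro tendsto_mult rpoly_tendsto abs_cos_less tendsto_const) auto
    moreover have "rkernel (cos \<theta>) * (poly q (cos \<theta>) * sin \<theta> ^ (d - 1)) = poly q (cos \<theta>)"
      using rkernel_cos[of \<theta>] th by (simp add: mult.left_commute)
    ultimately show "(\<lambda>l. poly (rpoly l * q) (cos \<theta>) * sin \<theta> ^ (d - 1)) \<longlonglongrightarrow> poly q (cos \<theta>)"
      by (simp only: poly_mult mult.assoc)
  qed
  then have "(\<lambda>l. area / W * trig (rpoly l * q)) \<longlonglongrightarrow> area / W * integral {0..pi} (\<lambda>\<theta>. poly q (cos \<theta>))"
    unfolding trig_def trig_open
    by (intro tendsto_mult tendsto_const) (simp add: integral_open_interval_real)
  then show ?thesis by (simp add: J_trig)
qed

lemma P_square_on_axis: "\<bar>t\<bar> = 1 \<Longrightarrow> (poly (P n) t)^2 = 1"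
  using P_one[of n] P_parity[of n 1] by (cases "t = 1") (auto simp: abs_if power_mult_distrib power_mult[symmetric] split: if_splits)

text \<open>The squares of \<open>P n\<close> equal 1 at the two poles, while their integrals
  \<open>area / harm_dim d n\<close> tend to 0; hence the poles have measure 0.\<close>

lemma AE_inner_less_1:
  assumes x: "norm (x::real^'n) = 1"
  shows "AE y in \<sigma>. \<bar>x \<bullet> y\<bar> < 1"
proof -
  let ?N = "{y \<in> space \<sigma>. \<bar>x \<bullet> y\<bar> = 1}"
  have "(\<lambda>y. \<bar>x \<bullet> y\<bar>) \<in> borel_measurable \<sigma>"
    by (intro continuous_measurable continuous_intros)
  then have N: "?N \<in> sets \<sigma>" by measurable
  have le: "measure \<sigma> ?N \<le> area / real n" if n: "n > 0" for n
  proof -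
    have "?N \<inter> space \<sigma> = ?N" by auto
    then have "measure \<sigma> ?N = (\<integral>y. indicator ?N y \<partial>\<sigma>)" unfolding Bochner_Integration.integral_indicator by simp
    also have "\<dots> \<le> (\<integral>y. poly (P n * P n) (y \<bullet> x) \<partial>\<sigma>)"
    proof (rule integral_mono)
      show "integrable \<sigma> (indicator ?N :: _ \<Rightarrow> real)" using N by (simp add: emeasure_eq_measure)
      fix y assume "y \<in> space \<sigma>"
      show "indicator ?N y \<le> poly (P n * P n) (y \<bullet> x)"
        using P_square_on_axis[of "y \<bullet> x" n]
        by (auto simp: indicator_def inner_commute power2_eq_square)
    qed (rule integrable_poly_inner)
    also have "\<dots> = area / harm_dim d n" by (simp only: J_eq[OF x] norm_P)
    also have "\<dots> \<le> area / real n" using n harm_dim_ge[OF d2, of n] area_pos by (intro divide_left_mono) auto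
    finally show ?thesis .
  qed
  have "(\<lambda>n. area / real n) \<longlonglongrightarrow> 0" by (rule lim_const_over_n)
  moreover have "\<forall>\<^sub>F n in sequentially. measure \<sigma> ?N \<le> area / real n"
    using eventually_gt_at_top[of 0] by eventually_elim (rule le)
  ultimately have "measure \<sigma> ?N \<le> 0" by (rule tendsto_lowerbound) simp
  then have "emeasure \<sigma> ?N = 0" by (simp add: emeasure_eq_measure measure_le_0_iff)
  with N have "AE y in \<sigma>. y \<notin> ?N" by (intro AE_not_in) (auto simp: null_sets_def)
  then show ?thesis
  proof (rule AE_mp, intro AE_I2 impI)
    fix y assume y: "y \<in> space \<sigma>" "y \<notin> ?N"
    then show "\<bar>x \<bullet> y\<bar> < 1" using abs_inner_le[OF x, of y] by auto
  qed
qed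

section \<open>Integrals against the singular limit kernel\<close>

lemma rkernel_inner_measurable:
  assumes x: "norm (x::real^'n) = 1" shows "(\<lambda>y. rkernel (x \<bullet> y)) \<in> borel_measurable \<sigma>"
proof -
  have "(\<lambda>y. 1 / sqrt (1 - (x \<bullet> y)^2) ^ (d - 1)) \<in> borel_measurable borel" by measurable
  from borel_measurable_sigma[OF this] show ?thesis
    by (rule measurable_cong[THEN iffD1, rotated])
      (use abs_inner_le[OF x] in \<open>auto simp: rkernel_def sin_arccos abs_le_iff\<close>)
qed

lemma rkernel_integral:
  assumes x: "norm (x::real^'n) = 1"
  shows "integrable \<sigma> (\<lambda>y. rkernel (x \<bullet> y))" "(\<integral>y. rkernel (x \<bullet> y) \<partial>\<sigma>) = area * pi / W"
proof -
  have i: "integrable \<sigma> (\<lambda>y. poly (rpoly l) (x \<bullet> y))" for l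
    using integrable_poly_inner[of "rpoly l" x] by (simp add: inner_commute)
  have m: "AE y in \<sigma>. mono (\<lambda>l. poly (rpoly l) (x \<bullet> y))" by (intro AE_I2 monoI rpoly_mono)
  have l: "AE y in \<sigma>. (\<lambda>l. poly (rpoly l) (x \<bullet> y)) \<longlonglongrightarrow> rkernel (x \<bullet> y)"
    using AE_inner_less_1[OF x] by eventually_elim (rule rpoly_tendsto)
  have "(\<integral>y. poly (rpoly l) (x \<bullet> y) \<partial>\<sigma>) = J (rpoly l * 1)" for l
    using J_eq[OF x, of "rpoly l"] by (simp add: inner_commute)
  then have c: "(\<lambda>l. \<integral>y. poly (rpoly l) (x \<bullet> y) \<partial>\<sigma>) \<longlonglongrightarrow> area * pi / W"
    using J_rpoly_tendsto[of 1] by simp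
  show "integrable \<sigma> (\<lambda>y. rkernel (x \<bullet> y))" "(\<integral>y. rkernel (x \<bullet> y) \<partial>\<sigma>) = area * pi / W"
    using integrable_monotone_convergence[OF i m l c rkernel_inner_measurable[OF x]]
      integral_monotone_convergence[OF i m l c rkernel_inner_measurable[OF x]] by auto
qed

text \<open>The integral of the kernel in one variable is the same constant for every x. So the
  integrable majorant inside is a multiple of the kernel, and outside it is a constant.\<close>

lemma rkernel_convergence:
  assumes a: "bounded_measurable \<sigma> a" and b: "bounded_measurable \<sigma> b"
  shows "(\<lambda>l. \<integral>x. a x * (\<integral>y. b y * poly (rpoly l) (x \<bullet> y) \<partial>\<sigma>) \<partial>\<sigma>)
      \<longlonglongrightarrow> (\<integral>x. a x * (\<integral>y. b y * rkernel (x \<bullet> y) \<partial>\<sigma>) \<partial>\<sigma>)"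
    and "bounded_measurable \<sigma> (\<lambda>x. \<integral>y. b y * rkernel (x \<bullet> y) \<partial>\<sigma>)"
    and "\<And>x. norm x = 1 \<Longrightarrow> integrable \<sigma> (\<lambda>y. b y * rkernel (x \<bullet> y))"
proof -
  let ?c = "area * pi / W"
  have c: "?c \<ge> 0" using area_pos wallis_pos[of "d-1"] by simp
  obtain A where A: "A > 0" "\<And>x. x \<in> space \<sigma> \<Longrightarrow> norm (a x) \<le> A" using bounded_measurable_bound[OF a] by blast
  obtain B where B: "B > 0" "\<And>x. x \<in> space \<sigma> \<Longrightarrow> norm (b x) \<le> B" using bounded_measurable_bound[OF b] by blast
  have bp: "bounded_measurable (\<sigma> \<Otimes>\<^sub>M \<sigma>) (\<lambda>z. b (snd z) * poly (rpoly l) (fst z \<bullet> snd z))" for l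
    using b by (intro bounded_measurable_mult bounded_measurable_snd bounded_measurable_poly_inner)
  have bl: "bounded_measurable \<sigma> (\<lambda>x. \<integral>y. b y * poly (rpoly l) (x \<bullet> y) \<partial>\<sigma>)" for l
    using bounded_measurable_integral[OF bp[of l]] by simp
  have int: "integrable \<sigma> (\<lambda>y. b y * rkernel (x \<bullet> y))" if "norm x = 1" for x
  proof (rule Bochner_Integration.integrable_bound)
    show "integrable \<sigma> (\<lambda>y. B * rkernel (x \<bullet> y))" using rkernel_integral(1)[OF that] by simp
    show "(\<lambda>y. b y * rkernel (x \<bullet> y)) \<in> borel_measurable \<sigma>"
      using rkernel_inner_measurable[OF that] bounded_measurableD[OF b] by simp
    show "AE y in \<sigma>. norm (b y * rkernel (x \<bullet> y)) \<le> norm (B * rkernel (x \<bullet> y))"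
      using B by (intro AE_I2) (auto simp: abs_mult intro!: mult_right_mono)
  qed
  then show "\<And>x. norm x = 1 \<Longrightarrow> integrable \<sigma> (\<lambda>y. b y * rkernel (x \<bullet> y))" .
  have lim: "(\<lambda>l. \<integral>y. b y * poly (rpoly l) (x \<bullet> y) \<partial>\<sigma>) \<longlonglongrightarrow> (\<integral>y. b y * rkernel (x \<bullet> y) \<partial>\<sigma>)" if x: "norm x = 1" for x
  proof (rule integral_dominated_convergence)
    show "(\<lambda>y. b y * rkernel (x \<bullet> y)) \<in> borel_measurable \<sigma>" using int[OF x] by simp
    show "(\<lambda>y. b y * poly (rpoly l) (x \<bullet> y)) \<in> borel_measurable \<sigma>" for l
      by (intro borel_measurable_times bounded_measurableD[OF b] continuous_measurable continuous_intros)
    show "integrable \<sigma> (\<lambda>y. B * rkernel (x \<bullet> y))" using rkernel_integral(1)[OF x] by simp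
    show "AE y in \<sigma>. (\<lambda>l. b y * poly (rpoly l) (x \<bullet> y)) \<longlonglongrightarrow> b y * rkernel (x \<bullet> y)"
      using AE_inner_less_1[OF x] by eventually_elim (intro tendsto_mult tendsto_const rpoly_tendsto)
    show "AE y in \<sigma>. norm (b y * poly (rpoly l) (x \<bullet> y)) \<le> B * rkernel (x \<bullet> y)" for l
      using AE_inner_less_1[OF x] AE_space
    proof eventually_elim
      case (elim y)
      then show ?case using B(2)[OF elim(2)] rpoly_le[OF elim(1)] rpoly_nonneg B(1)
        by (auto simp: abs_mult intro!: mult_mono)
    qed
  qed
  have bnd: "norm (\<integral>y. b y * rkernel (x \<bullet> y) \<partial>\<sigma>) \<le> B * ?c" if x: "norm x = 1" for x
  proof -
    have "norm (\<integral>y. b y * rkernel (x \<bullet> y) \<partial>\<sigma>) \<le> (\<integral>y. norm (b y * rkernel (x \<bullet> y)) \<partial>\<sigma>)"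
      by (rule integral_norm_bound)
    also have "\<dots> \<le> (\<integral>y. B * rkernel (x \<bullet> y) \<partial>\<sigma>)"
    proof (rule integral_mono)
      show "norm (b y * rkernel (x \<bullet> y)) \<le> B * rkernel (x \<bullet> y)" if "y \<in> space \<sigma>" for y
        using B(2)[OF that] rkernel_nonneg[OF abs_inner_le[OF x]] that by (auto simp: abs_mult intro!: mult_right_mono)
    qed (use int[OF x] rkernel_integral(1)[OF x] in auto)
    finally show ?thesis using rkernel_integral(2)[OF x] by simp
  qed
  show bk: "bounded_measurable \<sigma> (\<lambda>x. \<integral>y. b y * rkernel (x \<bullet> y) \<partial>\<sigma>)"
  proof (rule bounded_measurableI)
    show "(\<lambda>x. \<integral>y. b y * rkernel (x \<bullet> y) \<partial>\<sigma>) \<in> borel_measurable \<sigma>"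
      by (rule borel_measurable_LIMSEQ_real[OF lim]) (use bl in \<open>auto dest: bounded_measurableD\<close>)
  qed (use bnd in auto)
  show "(\<lambda>l. \<integral>x. a x * (\<integral>y. b y * poly (rpoly l) (x \<bullet> y) \<partial>\<sigma>) \<partial>\<sigma>)
      \<longlonglongrightarrow> (\<integral>x. a x * (\<integral>y. b y * rkernel (x \<bullet> y) \<partial>\<sigma>) \<partial>\<sigma>)"
  proof (rule integral_dominated_convergence[where w = "\<lambda>_. A * (B * ?c)"])
    show "(\<lambda>x. a x * (\<integral>y. b y * rkernel (x \<bullet> y) \<partial>\<sigma>)) \<in> borel_measurable \<sigma>"
      using a bk by (intro borel_measurable_times bounded_measurableD)
    show "(\<lambda>x. a x * (\<integral>y. b y * poly (rpoly l) (x \<bullet> y) \<partial>\<sigma>)) \<in> borel_measurable \<sigma>" for l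
      using a bl by (intro borel_measurable_times bounded_measurableD)
    show "AE x in \<sigma>. (\<lambda>l. a x * (\<integral>y. b y * poly (rpoly l) (x \<bullet> y) \<partial>\<sigma>)) \<longlonglongrightarrow> a x * (\<integral>y. b y * rkernel (x \<bullet> y) \<partial>\<sigma>)"
      by (intro AE_I2 tendsto_mult tendsto_const lim) simp
    show "AE x in \<sigma>. norm (a x * (\<integral>y. b y * poly (rpoly l) (x \<bullet> y) \<partial>\<sigma>)) \<le> A * (B * ?c)" for l
    proof (rule AE_I2)
      fix x assume xs: "x \<in> space \<sigma>"
      then have x: "norm x = 1" by simp
      have "norm (\<integral>y. b y * poly (rpoly l) (x \<bullet> y) \<partial>\<sigma>) \<le> (\<integral>y. norm (b y * poly (rpoly l) (x \<bullet> y)) \<partial>\<sigma>)"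
        by (rule integral_norm_bound)
      also have "\<dots> \<le> (\<integral>y. B * rkernel (x \<bullet> y) \<partial>\<sigma>)"
      proof (rule integral_mono_AE)
        show "AE y in \<sigma>. norm (b y * poly (rpoly l) (x \<bullet> y)) \<le> B * rkernel (x \<bullet> y)"
          using AE_inner_less_1[OF x] AE_space
        proof eventually_elim
          case (elim y)
          then show ?case using B(2)[OF elim(2)] rpoly_le[OF elim(1)] rpoly_nonneg B(1)
            by (auto simp: abs_mult intro!: mult_mono)
        qed
        show "integrable \<sigma> (\<lambda>y. norm (b y * poly (rpoly l) (x \<bullet> y)))"
          by (intro bounded_measurable_integrable bounded_measurable_norm bounded_measurable_mult b continuous_bounded_measurable continuous_intros)
      qed (use rkernel_integral(1)[OF x] in auto)
      also have "\<dots> = B * ?c" using rkernel_integral(2)[OF x] by simp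
      finally show "norm (a x * (\<integral>y. b y * poly (rpoly l) (x \<bullet> y) \<partial>\<sigma>)) \<le> A * (B * ?c)"
        unfolding norm_mult by (rule mult_mono[OF A(2)[OF xs]]) (use A(1) in auto)
    qed
  qed simp
qed

text \<open>Fubini is applied to the bounded polynomial kernels only; the symmetry then passes to
  the limit.\<close>

lemma rkernel_form_sym:
  assumes a: "bounded_measurable \<sigma> a" and b: "bounded_measurable \<sigma> b"
  shows "(\<integral>x. a x * (\<integral>y. b y * rkernel (x \<bullet> y) \<partial>\<sigma>) \<partial>\<sigma>) = (\<integral>x. b x * (\<integral>y. a y * rkernel (x \<bullet> y) \<partial>\<sigma>) \<partial>\<sigma>)"
proof -
  have "(\<integral>x. a x * (\<integral>y. b y * poly (rpoly l) (x \<bullet> y) \<partial>\<sigma>) \<partial>\<sigma>) = (\<integral>x. b x * (\<integral>y. a y * poly (rpoly l) (x \<bullet> y) \<partial>\<sigma>) \<partial>\<sigma>)" for l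
  proof -
    have "(\<integral>x. (\<integral>y. a x * (b y * poly (rpoly l) (x \<bullet> y)) \<partial>\<sigma>) \<partial>\<sigma>) = (\<integral>y. (\<integral>x. a x * (b y * poly (rpoly l) (x \<bullet> y)) \<partial>\<sigma>) \<partial>\<sigma>)"
      using a b by (intro bounded_measurable_Fubini(1) finite_measure_axioms bounded_measurable_mult
          bounded_measurable_fst bounded_measurable_snd bounded_measurable_poly_inner)
    moreover have "(\<integral>x. a x * (b y * poly (rpoly l) (x \<bullet> y)) \<partial>\<sigma>) = b y * (\<integral>x. a x * poly (rpoly l) (y \<bullet> x) \<partial>\<sigma>)" for y
      by (subst integral_mult_right_zero[symmetric]) (simp add: mult.left_commute inner_commute[of y])
    ultimately show ?thesis by simp
  qed
  note eq = this
  show ?thesis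
    by (rule LIMSEQ_unique[OF rkernel_convergence(1)[OF a b, unfolded eq] rkernel_convergence(1)[OF b a]])
qed

text \<open>The Legendre coefficients of the normalised squares of \<open>P n\<close> and those of
  the scaled \<open>rpoly l\<close> have the same limits. By \<open>qform_tendsto\<close> both
  quadratic forms converge to the same series, and the second limit is known in closed form.\<close>

lemma rkernel_form_limit:
  assumes f: "bounded_measurable \<sigma> f"
  shows "(\<lambda>n. harm_dim d n / area * qform f (P n * P n)) \<longlonglongrightarrow>
     W / (area * pi) * (\<integral>x. f x * (\<integral>y. f y * rkernel (x \<bullet> y) \<partial>\<sigma>) \<partial>\<sigma>)"
proof -
  \<comment> \<open>The integrals of the Legendre polynomials against the arcsine law.\<close>
  define c where "c = (\<lambda>j. integral {0..pi} (\<lambda>\<theta>. poly (P j) (cos \<theta>)) / pi)"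
  have sm: "qform f (Polynomial.smult a p) = a * qform f p" for a p
    using qform_linear[OF f, of "\<lambda>_. a" "\<lambda>_. p" "{()}"] by simp
  let ?y = "axis undefined 1 :: real^'n"
  have ny: "norm ?y = 1" by (simp add: norm_axis_1)
  \<comment> \<open>For nonnegative p the estimate |P_j| <= 1 bounds every coefficient by the total
    mass, uniformly in j.\<close>
  have bound: "\<bar>J (p * P j)\<bar> \<le> J p" if p: "\<And>t. poly p t \<ge> 0" for p j
  proof -
    have "\<bar>J (p * P j)\<bar> \<le> (\<integral>x. \<bar>poly (p * P j) (x \<bullet> ?y)\<bar> \<partial>\<sigma>)"
      unfolding J_def using integral_norm_bound[of \<sigma> "\<lambda>x. poly (p * P j) (x \<bullet> ?y)"] by simp
    also have "\<dots> \<le> (\<integral>x. poly p (x \<bullet> ?y) \<partial>\<sigma>)"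
    proof (rule integral_mono)
      fix x assume "x \<in> space \<sigma>"
      then have "\<bar>poly (P j) (x \<bullet> ?y)\<bar> \<le> 1" using ny by (intro abs_P_le_1) auto
      then show "\<bar>poly (p * P j) (x \<bullet> ?y)\<bar> \<le> poly p (x \<bullet> ?y)"
        using p[of "x \<bullet> ?y"] by (simp add: abs_mult mult_left_le)
    qed (auto intro!: integrable_abs integrable_poly_inner simp del: poly_mult)
    finally show ?thesis by (simp add: J_def)
  qed
  have 1: "(\<lambda>n. qform f (Polynomial.smult (harm_dim d n / area) (P n * P n))) \<longlonglongrightarrow> (\<Sum>j. c j * hpart f j)"
  proof (rule qform_tendsto[OF f, where B = 1])
    fix j n
    have k: "harm_dim d n / area > 0" using harm_dim_pos[of n] area_pos by simp
    have "\<bar>J (Polynomial.smult (harm_dim d n / area) (P n * P n) * P j)\<bar> \<le> J (Polynomial.smult (harm_dim d n / area) (P n * P n))"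
      by (rule bound) (simp only: poly_smult poly_mult, rule mult_nonneg_nonneg[OF less_imp_le[OF k] zero_le_square])
    then show "\<bar>J (Polynomial.smult (harm_dim d n / area) (P n * P n) * P j)\<bar> \<le> 1"
    proof -
      have "harm_dim d n / area * (area / harm_dim d n) = 1" using harm_dim_pos[of n] area_pos by simp
      with \<open>_ \<le> J (Polynomial.smult (harm_dim d n / area) (P n * P n))\<close> show ?thesis unfolding J_smult norm_P by (simp only:)
    qed
    show "(\<lambda>n. J (Polynomial.smult (harm_dim d n / area) (P n * P n) * P j)) \<longlonglongrightarrow> c j"
      using arcsine_limit[of "P j"] by (simp add: c_def J_smult mult.commute[of "P j"])
  qed
  have pos: "W / (area * pi) > 0" using wallis_pos[of "d-1"] area_pos by simp
  obtain D where D: "\<And>l. J (rpoly l) \<le> D"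
  proof -
    have "(\<lambda>l. J (rpoly l)) \<longlonglongrightarrow> area / W * integral {0..pi} (\<lambda>\<theta>. poly 1 (cos \<theta>))"
      using J_rpoly_tendsto[of 1] by simp
    then have "Bseq (\<lambda>l. J (rpoly l))" by (rule convergentI[THEN convergent_imp_Bseq])
    then show ?thesis using that by (auto simp: Bseq_def abs_le_iff)
  qed
  have 2: "(\<lambda>l. qform f (Polynomial.smult (W / (area * pi)) (rpoly l))) \<longlonglongrightarrow> (\<Sum>j. c j * hpart f j)"
  proof (rule qform_tendsto[OF f, where B = "W / (area * pi) * D"])
    fix j l
    have "\<bar>J (rpoly l * P j)\<bar> \<le> D" using bound[of "rpoly l" j] rpoly_nonneg D order_trans by blast
    then show "\<bar>J (Polynomial.smult (W / (area * pi)) (rpoly l) * P j)\<bar> \<le> W / (area * pi) * D"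
      unfolding mult_smult_left J_smult abs_mult abs_of_pos[OF pos] by (rule mult_left_mono[OF _ less_imp_le[OF pos]])
    have "(\<lambda>l. W / (area * pi) * J (rpoly l * P j)) \<longlonglongrightarrow> W / (area * pi) * (area / W * integral {0..pi} (\<lambda>\<theta>. poly (P j) (cos \<theta>)))"
      by (intro tendsto_mult tendsto_const J_rpoly_tendsto)
    then show "(\<lambda>l. J (Polynomial.smult (W / (area * pi)) (rpoly l) * P j)) \<longlonglongrightarrow> c j"
      using wallis_pos[of "d-1"] area_pos by (simp add: J_smult c_def)
  qed
  have "qform f (rpoly l) = (\<integral>x. f x * (\<integral>y. f y * poly (rpoly l) (x \<bullet> y) \<partial>\<sigma>) \<partial>\<sigma>)" for l
    by (simp add: qform_def mult.assoc)
  then have "(\<lambda>l. qform f (Polynomial.smult (W / (area * pi)) (rpoly l))) \<longlonglongrightarrow>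
      W / (area * pi) * (\<integral>x. f x * (\<integral>y. f y * rkernel (x \<bullet> y) \<partial>\<sigma>) \<partial>\<sigma>)"
    unfolding sm using rkernel_convergence(1)[OF f f] by (intro tendsto_mult tendsto_const) simp
  with 2 have "(\<Sum>j. c j * hpart f j) = W / (area * pi) * (\<integral>x. f x * (\<integral>y. f y * rkernel (x \<bullet> y) \<partial>\<sigma>) \<partial>\<sigma>)"
    by (rule LIMSEQ_unique)
  with 1 show ?thesis by (simp add: sm)
qed

text \<open>The square is expanded. By symmetry of the kernel the two square terms have the same
  integral, and the constant mass of the kernel in one variable evaluates it.\<close>

lemma dirichlet_form:
  assumes f: "bounded_measurable \<sigma> f"
  shows "(\<integral>x. (\<integral>y. (f x - f y)^2 / sin (arccos (x \<bullet> y)) ^ (d - 1) \<partial>\<sigma>) \<partial>\<sigma>)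
     = 2 * (area * pi / W * (\<integral>x. (f x)^2 \<partial>\<sigma>) - (\<integral>x. f x * (\<integral>y. f y * rkernel (x \<bullet> y) \<partial>\<sigma>) \<partial>\<sigma>))"
    and "\<And>x. norm x = 1 \<Longrightarrow> integrable \<sigma> (\<lambda>y. (f x - f y)^2 / sin (arccos (x \<bullet> y)) ^ (d - 1))"
    and "integrable \<sigma> (\<lambda>x. \<integral>y. (f x - f y)^2 / sin (arccos (x \<bullet> y)) ^ (d - 1) \<partial>\<sigma>)"
proof -
  let ?c = "area * pi / W"
  define G H where "G = (\<lambda>x. \<integral>y. f y * rkernel (x \<bullet> y) \<partial>\<sigma>)" and "H = (\<lambda>x. \<integral>y. (f y)^2 * rkernel (x \<bullet> y) \<partial>\<sigma>)"
  have f2: "bounded_measurable \<sigma> (\<lambda>x. (f x)^2)" using f by (rule bounded_measurable_power)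
  have G: "bounded_measurable \<sigma> G" and H: "bounded_measurable \<sigma> H"
    unfolding G_def H_def using rkernel_convergence(2)[OF f f] rkernel_convergence(2)[OF f2 f2] by auto
  \<comment> \<open>This includes equal and antipodal points, where both sides are 0 by the
    convention for division.\<close>
  have eq: "(f x - f y)^2 / sin (arccos (x \<bullet> y)) ^ (d - 1)
      = (f x)^2 * rkernel (x \<bullet> y) - 2 * f x * (f y * rkernel (x \<bullet> y)) + (f y)^2 * rkernel (x \<bullet> y)" for x y
    by (simp add: rkernel_def power2_eq_square diff_divide_distrib add_divide_distrib algebra_simps)
  have int: "integrable \<sigma> (\<lambda>y. rkernel (x \<bullet> y))" "integrable \<sigma> (\<lambda>y. f y * rkernel (x \<bullet> y))" "integrable \<sigma> (\<lambda>y. (f y)^2 * rkernel (x \<bullet> y))"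
    if "norm x = 1" for x
    using rkernel_integral(1)[OF that] rkernel_convergence(3)[OF f f that] rkernel_convergence(3)[OF f2 f2 that] by auto
  show "integrable \<sigma> (\<lambda>y. (f x - f y)^2 / sin (arccos (x \<bullet> y)) ^ (d - 1))" if "norm x = 1" for x
    unfolding eq using int[OF that] by simp
  have inner: "(\<integral>y. (f x - f y)^2 / sin (arccos (x \<bullet> y)) ^ (d - 1) \<partial>\<sigma>) = ?c * (f x)^2 - 2 * (f x * G x) + H x" if "x \<in> space \<sigma>" for x
    using that unfolding eq using int[of x] rkernel_integral(2)[of x] by (simp add: G_def H_def)
  have b: "integrable \<sigma> (\<lambda>x. (f x)^2)" "integrable \<sigma> (\<lambda>x. f x * G x)" "integrable \<sigma> H"
    using bounded_measurable_integrable[OF f2] bounded_measurable_integrable[OF bounded_measurable_mult[OF f G]]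
      bounded_measurable_integrable[OF H] by simp_all
  have "integrable \<sigma> (\<lambda>x. ?c * (f x)^2 - 2 * (f x * G x) + H x)" using b by simp
  then show "integrable \<sigma> (\<lambda>x. \<integral>y. (f x - f y)^2 / sin (arccos (x \<bullet> y)) ^ (d - 1) \<partial>\<sigma>)"
    by (subst Bochner_Integration.integrable_cong[OF refl inner]) auto
  \<comment> \<open>Symmetry with the constant function 1 moves the square of f out of the inner
    integral.\<close>
  have "(\<integral>x. H x \<partial>\<sigma>) = (\<integral>x. 1 * (\<integral>y. (f y)^2 * rkernel (x \<bullet> y) \<partial>\<sigma>) \<partial>\<sigma>)" by (simp add: H_def)
  also have "\<dots> = (\<integral>x. (f x)^2 * (\<integral>y. 1 * rkernel (x \<bullet> y) \<partial>\<sigma>) \<partial>\<sigma>)"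
    by (rule rkernel_form_sym[OF bounded_measurable_const f2])
  also have "\<dots> = (\<integral>x. ?c * (f x)^2 \<partial>\<sigma>)"
    by (rule Bochner_Integration.integral_cong) (simp_all add: rkernel_integral(2))
  finally have Hc: "(\<integral>x. H x \<partial>\<sigma>) = ?c * (\<integral>x. (f x)^2 \<partial>\<sigma>)" by simp
  have "(\<integral>x. (\<integral>y. (f x - f y)^2 / sin (arccos (x \<bullet> y)) ^ (d - 1) \<partial>\<sigma>) \<partial>\<sigma>) = (\<integral>x. ?c * (f x)^2 - 2 * (f x * G x) + H x \<partial>\<sigma>)"
    by (rule Bochner_Integration.integral_cong[OF refl inner])
  also have "\<dots> = ?c * (\<integral>x. (f x)^2 \<partial>\<sigma>) - 2 * (\<integral>x. f x * G x \<partial>\<sigma>) + (\<integral>x. H x \<partial>\<sigma>)"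
    using b by simp
  finally show "(\<integral>x. (\<integral>y. (f x - f y)^2 / sin (arccos (x \<bullet> y)) ^ (d - 1) \<partial>\<sigma>) \<partial>\<sigma>)
     = 2 * (?c * (\<integral>x. (f x)^2 \<partial>\<sigma>) - (\<integral>x. f x * (\<integral>y. f y * rkernel (x \<bullet> y) \<partial>\<sigma>) \<partial>\<sigma>))"
    unfolding Hc G_def by simp
qed

text \<open>The left side is the variance of the linear statistic of \<open>f\<close> divided by the
  number of points. The squared kernel contributes the normalised quadratic form of P_n^2 times
  \<open>harm_dim d n / area\<close>, so one power of the dimension cancels; the factor 2 below
  \<open>W\<close> comes from the expansion of the square in \<open>dirichlet_form\<close>.\<close>

lemma variance_form_limit:
  assumes f: "bounded_measurable \<sigma> f"
  shows "(\<lambda>n. (harm_dim d n / area * (\<integral>x. (f x)^2 \<partial>\<sigma>) - (\<integral>x. (\<integral>y. f x * f y * (K n x y)^2 \<partial>\<sigma>) \<partial>\<sigma>)) / harm_dim d n)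
    \<longlonglongrightarrow> W / (2 * area^2 * pi) * (\<integral>x. (\<integral>y. (f x - f y)^2 / sin (arccos (x \<bullet> y)) ^ (d - 1) \<partial>\<sigma>) \<partial>\<sigma>)"
proof -
  let ?I = "\<integral>x. (f x)^2 \<partial>\<sigma>" and ?Q = "\<integral>x. f x * (\<integral>y. f y * rkernel (x \<bullet> y) \<partial>\<sigma>) \<partial>\<sigma>"
  have pos: "W > 0" "area > 0" using wallis_pos area_pos by auto
  have "(\<integral>x. (\<integral>y. f x * f y * (K n x y)^2 \<partial>\<sigma>) \<partial>\<sigma>) = (harm_dim d n / area)^2 * qform f (P n * P n)" for n
  proof -
    have eq: "f x * f y * (K n x y)^2 = (harm_dim d n / area)^2 * (f x * f y * poly (P n * P n) (x \<bullet> y))" for x y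
      by (simp add: K_eq power2_eq_square)
    show ?thesis unfolding eq qform_def by (simp only: integral_mult_right_zero)
  qed
  then have "(harm_dim d n / area * ?I - (\<integral>x. (\<integral>y. f x * f y * (K n x y)^2 \<partial>\<sigma>) \<partial>\<sigma>)) / harm_dim d n
      = (?I - harm_dim d n / area * qform f (P n * P n)) / area" for n
    using harm_dim_pos[of n] pos by (simp add: field_simps power2_eq_square)
  moreover have "(\<lambda>n. (?I - harm_dim d n / area * qform f (P n * P n)) / area) \<longlonglongrightarrow> (?I - W / (area * pi) * ?Q) / area"
    using pos by (intro tendsto_divide tendsto_diff tendsto_const rkernel_form_limit f) auto
  moreover have "(?I - W / (area * pi) * ?Q) / area = W / (2 * area^2 * pi) * (2 * (area * pi / W * ?I - ?Q))"
    using pos by (simp add: field_simps power2_eq_square)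
  ultimately show ?thesis unfolding dirichlet_form(1)[OF f] by simp
qed

text \<open>If the double integral is 0, the inner one vanishes for some x. Off the poles the kernel
  is positive, so this single x already gives f(y) = f(x) for almost all y.\<close>

lemma dirichlet_form_pos:
  assumes f: "bounded_measurable \<sigma> f" and nc: "\<not> (\<exists>c. AE x in \<sigma>. f x = c)"
  shows "(\<integral>x. (\<integral>y. (f x - f y)^2 / sin (arccos (x \<bullet> y)) ^ (d - 1) \<partial>\<sigma>) \<partial>\<sigma>) > 0"
proof (rule ccontr)
  let ?g = "\<lambda>x y. (f x - f y)^2 / sin (arccos (x \<bullet> y)) ^ (d - 1)"
  have eq: "?g x y = (f x - f y)^2 * rkernel (x \<bullet> y)" for x y by (simp add: rkernel_def)
  have nn: "0 \<le> ?g x y" if "norm x = 1" "norm y = 1" for x y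
    unfolding eq using rkernel_nonneg[OF abs_inner_le[OF that]] by simp
  assume "\<not> ?thesis"
  moreover have nni: "0 \<le> (\<integral>y. ?g x y \<partial>\<sigma>)" if "x \<in> space \<sigma>" for x
    using that nn by (intro integral_nonneg_AE AE_I2) auto
  moreover have "0 \<le> (\<integral>x. (\<integral>y. ?g x y \<partial>\<sigma>) \<partial>\<sigma>)" by (rule integral_nonneg_AE[OF AE_I2[OF nni]])
  ultimately have "(\<integral>x. (\<integral>y. ?g x y \<partial>\<sigma>) \<partial>\<sigma>) = 0" by linarith
  then have ae0: "AE x in \<sigma>. (\<integral>y. ?g x y \<partial>\<sigma>) = 0"
    using integral_nonneg_eq_0_iff_AE[OF dirichlet_form(3)[OF f] AE_I2[OF nni]] by blast
  have "\<exists>x\<in>space \<sigma>. (\<integral>y. ?g x y \<partial>\<sigma>) = 0"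
  proof (rule ccontr)
    assume none: "\<not> (\<exists>x\<in>space \<sigma>. (\<integral>y. ?g x y \<partial>\<sigma>) = 0)"
    have "AE x in \<sigma>. False"
      using ae0 AE_space by eventually_elim (use none in blast)
    then have "emeasure \<sigma> (space \<sigma>) = 0"
      using AE_iff_measurable[OF sets.top[of \<sigma>], of "\<lambda>_. False"] by (simp del: space_sigma)
    then show False
      using area_pos measure_sigma by (simp add: emeasure_eq_measure)
  qed
  then obtain x where x: "x \<in> space \<sigma>" "(\<integral>y. ?g x y \<partial>\<sigma>) = 0" by blast
  then have nx: "norm x = 1" by simp
  have "AE y in \<sigma>. ?g x y = 0"
  proof -
    have "AE y in \<sigma>. 0 \<le> ?g x y" using nn[OF nx] by (intro AE_I2) simp
    from integral_nonneg_eq_0_iff_AE[OF dirichlet_form(2)[OF f nx] this] x(2) show ?thesis by blast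
  qed
  then have "AE y in \<sigma>. f y = f x"
    using AE_inner_less_1[OF nx]
  proof eventually_elim
    case (elim y)
    then show ?case unfolding eq using rkernel_pos[OF elim(2)] by simp
  qed
  with nc show False by blast
qed

end

section \<open>Determinants\<close>

lemma ldet_eq_det: "ldet m A = Determinant.det (Matrix.mat m m (\<lambda>(i,j). A i j))"
  unfolding ldet_def
  by (subst det_def'[of _ m]) (auto simp: lessThan_atLeast0 permutes_in_image intro!: sum.cong prod.cong)

text \<open>The characteristic polynomial of \<open>- A\<close> has no positive root, hence is nonnegative at \<open>0\<close>.\<close>

lemma ldet_nonneg:
  assumes psd: "\<And>v. 0 \<le> (\<Sum>i<m. \<Sum>j<m. v i * v j * A i j)"
  shows "0 \<le> ldet m (A :: nat \<Rightarrow> nat \<Rightarrow> real)"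
proof -
  define B where "B = Matrix.mat m m (\<lambda>(i,j). A i j)"
  have B: "B \<in> carrier_mat m m" by (simp add: B_def)
  define p where "p = char_poly (- B)"
  have mB: "- B \<in> carrier_mat m m" using B by simp
  \<comment> \<open>For an eigenvector w of -A with eigenvalue s, the quadratic form of A at w is -s
    |w|^2, which is negative for positive s.\<close>
  have ev: "poly p s \<noteq> 0" if s: "s > 0" for s
  proof
    assume "poly p s = 0"
    then have "eigenvalue (- B) s" using eigenvalue_root_char_poly[OF mB] by (simp add: p_def)
    then obtain v where v: "v \<in> carrier_vec m" "v \<noteq> 0\<^sub>v m" "- B *\<^sub>v v = s \<cdot>\<^sub>v v"
      using mB by (auto simp: eigenvalue_def eigenvector_def)
    define w where "w = (\<lambda>i. vec_index v i)"
    have e: "(\<Sum>j<m. A i j * w j) = - s * w i" if "i < m" for i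
    proof -
      have "vec_index (- B *\<^sub>v v) i = (\<Sum>j<m. (- A i j) * w j)"
        using that v(1) by (simp add: B_def w_def scalar_prod_def lessThan_atLeast0 sum_negf)
      also have "vec_index (- B *\<^sub>v v) i = s * w i" unfolding v(3) using that v(1) by (simp add: w_def)
      finally show ?thesis by (simp add: sum_negf)
    qed
    have "(\<Sum>i<m. \<Sum>j<m. w i * w j * A i j) = (\<Sum>i<m. w i * (\<Sum>j<m. A i j * w j))"
      by (simp add: sum_distrib_left mult_ac)
    also have "\<dots> = (\<Sum>i<m. w i * (- s * w i))" by (intro sum.cong refl arg_cong2[of _ _ _ _ "(*)"]) (simp add: e)
    also have "\<dots> = - s * (\<Sum>i<m. (w i)^2)"
      by (simp add: sum_distrib_left power2_eq_square mult_ac sum_negf)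
    finally have "s * (\<Sum>i<m. (w i)^2) \<le> 0" using psd[of w] by simp
    then have "(\<Sum>i<m. (w i)^2) \<le> 0" using s by (simp add: mult_le_0_iff)
    then have "(\<Sum>i<m. (w i)^2) = 0" by (meson antisym sum_nonneg zero_le_power2)
    then have "w i = 0" if "i < m" for i using that by (simp add: sum_nonneg_eq_0_iff)
    then have "v = 0\<^sub>v m" using v(1) by (intro eq_vecI) (auto simp: w_def)
    with v(2) show False by simp
  qed
  have lead: "coeff p m = 1" "degree p = m" using degree_monic_char_poly[OF mB] by (auto simp: p_def)
  have "0 \<le> poly p 0"
  proof (rule ccontr)
    assume "\<not> 0 \<le> poly p 0"
    then have neg: "poly p 0 < 0" by simp
    have "lead_coeff p > 0" using lead by simp
    from poly_pinfty_gt_lc[OF this] obtain n where n: "\<And>x. x \<ge> n \<Longrightarrow> lead_coeff p \<le> poly p x" by auto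
    have "poly p (max n 1) > 0" using n[of "max n 1"] lead by simp
    moreover have "(0::real) < max n 1" by (simp add: less_max_iff_disj)
    ultimately obtain x where "x > 0" "poly p x = 0" using poly_IVT_pos[of 0 "max n 1" p] neg by blast
    with ev show False by blast
  qed
  moreover have "poly p 0 = Determinant.det B"
    unfolding p_def char_poly_def
    by (rule poly_det_cong[OF B]) (use mB B in \<open>auto simp: char_poly_matrix_def\<close>)
  ultimately show ?thesis by (simp add: ldet_eq_det B_def)
qed

section \<open>Logarithm of a determinant near the identity\<close>

lemma Ln_one_plus_bound:
  fixes z :: complex
  assumes z: "norm z \<le> 1/2"
  shows "norm (Ln (1 + z) - (z - z^2 / 2)) \<le> 2 * norm z ^ 3"
proof -
  let ?S = "cball (0::complex) (norm z)"
  \<comment> \<open>Its derivative is u^2 / (1 + u), of norm at most 2 |z|^2 on the ball; the mean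
    value inequality then supplies the third power.\<close>
  let ?f = "\<lambda>u. Ln (1 + u) - (u - u^2 / 2)"
  have "norm (?f z - ?f 0) \<le> (2 * norm z ^ 2) * norm (z - 0)"
  proof (rule field_differentiable_bound)
    show "convex ?S" by simp
    fix u :: complex assume u: "u \<in> ?S"
    then have u2: "norm u \<le> 1/2" "norm u \<le> norm z" using z by auto
    have re: "Re (1 + u) > 0" using u2 abs_Re_le_cmod[of u] by simp
    then have nr: "1 + u \<notin> \<real>\<^sub>\<le>\<^sub>0" by (auto simp: complex_nonpos_Reals_iff)
    have nz: "1 + u \<noteq> 0"
    proof
      assume "1 + u = 0"
      then have "Re (1 + u) = 0" by (simp only: zero_complex.sel)
      with re show False by simp
    qed
    have g: "((\<lambda>u. 1 + u) has_field_derivative 1) (at u within ?S)"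
      using DERIV_add[OF DERIV_const DERIV_ident] by (simp add: has_field_derivative_at_within)
    have h1: "((\<lambda>u. Ln (1 + u)) has_field_derivative inverse (1 + u) * 1) (at u within ?S)"
      by (rule DERIV_chain2[OF has_field_derivative_Ln[OF nr] g])
    have h2: "((\<lambda>u. u - u^2 / 2) has_field_derivative (1 - u)) (at u within ?S)"
      by (auto intro!: derivative_eq_intros)
    have "(?f has_field_derivative (1 / (1 + u) - (1 - u))) (at u within ?S)"
      using DERIV_diff[OF h1 h2] by (simp add: inverse_eq_divide)
    then show "(?f has_field_derivative (u^2 / (1 + u))) (at u within ?S)"
    proof (rule DERIV_cong)
      show "1 / (1 + u) - (1 - u) = u^2 / (1 + u)" using nz by (simp add: field_simps power2_eq_square)
    qed
    have "1 - norm u \<le> norm (1 + u)" using norm_triangle_ineq2[of 1 "-u"] by simp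
    then have "norm (1 + u) \<ge> 1/2" using u2 by linarith
    then have "norm (u^2 / (1 + u)) \<le> norm u ^ 2 / (1/2)"
      unfolding norm_divide norm_power by (intro divide_left_mono) (auto intro!: mult_pos_pos)
    also have "\<dots> \<le> 2 * norm z ^ 2" using u2 by (simp add: power_mono)
    finally show "norm (u^2 / (1 + u)) \<le> 2 * norm z ^ 2" .
  qed auto
  then show ?thesis by (simp add: power3_eq_cube power2_eq_square)
qed

definition mtrace :: "'a::comm_ring_1 mat \<Rightarrow> 'a" where
  "mtrace A = (\<Sum>i<dim_row A. A $$ (i, i))"

lemma mtrace_mult_commute:
  assumes "A \<in> carrier_mat n n" "B \<in> carrier_mat n n"
  shows "mtrace (A * B) = mtrace (B * A)"
proof -
  have "mtrace (A * B) = (\<Sum>i<n. \<Sum>j<n. A $$ (i,j) * B $$ (j,i))"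
    using assms by (simp add: mtrace_def scalar_prod_def lessThan_atLeast0)
  also have "\<dots> = (\<Sum>j<n. \<Sum>i<n. B $$ (j,i) * A $$ (i,j))"
    by (subst sum.swap) (simp add: mult.commute)
  also have "\<dots> = mtrace (B * A)"
    using assms by (simp add: mtrace_def scalar_prod_def lessThan_atLeast0)
  finally show ?thesis .
qed

lemma mtrace_conj:
  assumes c: "P \<in> carrier_mat n n" "B \<in> carrier_mat n n" "Q \<in> carrier_mat n n" and QP: "Q * P = 1\<^sub>m n"
  shows "mtrace (P * B * Q) = mtrace B"
proof -
  have "mtrace (P * B * Q) = mtrace (Q * (P * B))" using c by (intro mtrace_mult_commute[of _ n]) auto
  also have "Q * (P * B) = (Q * P) * B" using c by (intro assoc_mult_mat[symmetric]) auto
  finally show ?thesis using c QP by simp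
qed

text \<open>A general complex matrix cannot be diagonalised, but it has a triangular form, whose
  diagonal carries the eigenvalues and determines det(1 + A) and the traces of A and A^2. The
  logarithm is then expanded eigenvalue by eigenvalue.\<close>

lemma det_log_expansion:
  fixes A :: "complex mat"
  assumes A: "A \<in> carrier_mat n n" and e: "\<epsilon> \<le> 1/2" and ev: "\<And>k. eigenvalue A k \<Longrightarrow> norm k \<le> \<epsilon>"
  obtains z where "Determinant.det (1\<^sub>m n + A) = exp z" "norm (z - (mtrace A - mtrace (A * A) / 2)) \<le> 2 * real n * \<epsilon> ^ 3"
proof -
  obtain es where es: "char_poly A = (\<Prod>a\<leftarrow>es. [:- a, 1:])" "length es = n"
    using char_poly_factorized[OF A] by blast
  obtain B P Q where sd: "schur_decomposition A es = (B, P, Q)" by (cases "schur_decomposition A es") auto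
  from schur_decomposition[OF A es(1) sd]
  have sim: "similar_mat_wit A B P Q" and ut: "upper_triangular B" and dg: "diag_mat B = es" by auto
  from similar_mat_witD2[OF A sim] have PQ: "P * Q = 1\<^sub>m n" "Q * P = 1\<^sub>m n" "A = P * B * Q"
    and c: "B \<in> carrier_mat n n" "P \<in> carrier_mat n n" "Q \<in> carrier_mat n n" by auto
  define b where "b = (\<lambda>i. B $$ (i,i))"
  have bes: "b i = es ! i" if "i < n" for i
    using that c dg[symmetric] by (simp add: b_def diag_mat_def)
  have nb: "norm (b i) \<le> \<epsilon>" if i: "i < n" for i
  proof -
    have "es ! i \<in> set es" using i es(2) by simp
    then have "poly (char_poly A) (b i) = 0" unfolding es(1) bes[OF i]
      by (auto simp: poly_prod_list prod_list_zero_iff)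
    then show ?thesis using ev eigenvalue_root_char_poly[OF A] by blast
  qed
  have "1\<^sub>m n + A = P * (1\<^sub>m n + B) * Q"
  proof -
    have "P * (1\<^sub>m n + B) * Q = (P * 1\<^sub>m n + P * B) * Q" using c by (subst mult_add_distrib_mat) auto
    also have "\<dots> = P * 1\<^sub>m n * Q + P * B * Q" using c by (intro add_mult_distrib_mat) auto
    also have "\<dots> = 1\<^sub>m n + A" using c PQ by simp
    finally show ?thesis by simp
  qed
  then have "similar_mat (1\<^sub>m n + A) (1\<^sub>m n + B)"
    using c PQ A unfolding similar_mat_def similar_mat_wit_def by (intro exI[of _ P] exI[of _ Q]) (auto simp: Let_def)
  then have "Determinant.det (1\<^sub>m n + A) = Determinant.det (1\<^sub>m n + B)" by (rule det_similar)
  also have "\<dots> = prod_list (diag_mat (1\<^sub>m n + B))"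
    using c ut by (intro det_upper_triangular[of _ n]) (auto simp: upper_triangular_def)
  also have "\<dots> = (\<Prod>i<n. 1 + b i)"
  proof -
    have "diag_mat (1\<^sub>m n + B) = map (\<lambda>i. 1 + b i) [0..<n]" using c by (auto simp: diag_mat_def b_def)
    then show ?thesis using prod.distinct_set_conv_list[of "[0..<n]" "\<lambda>i. 1 + b i"] by (simp add: lessThan_atLeast0)
  qed
  finally have det: "Determinant.det (1\<^sub>m n + A) = (\<Prod>i<n. 1 + b i)" .
  have tr: "mtrace A = (\<Sum>i<n. b i)"
    unfolding PQ(3) using c PQ(2) by (subst mtrace_conj[of _ n]) (auto simp: mtrace_def b_def)
  have AA: "A * A = P * (B * B) * Q"
  proof -
    have "A * A = P * B * Q * (P * B * Q)" using PQ(3) by simp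
    also have "\<dots> = P * B * (Q * P) * B * Q" using c
      by (simp add: assoc_mult_mat[of _ n n _ n _ n])
    also have "\<dots> = P * (B * B) * Q" unfolding PQ(2) using c
      by (simp add: assoc_mult_mat[of _ n n _ n _ n])
    finally show ?thesis .
  qed
  have "mtrace (A * A) = mtrace (B * B)"
    unfolding AA using c PQ(2) by (intro mtrace_conj[of _ n]) auto
  also have "\<dots> = (\<Sum>i<n. (b i)^2)"
  proof -
    have "(B * B) $$ (i,i) = (b i)^2" if i: "i < n" for i
    proof -
      have "(B * B) $$ (i,i) = (\<Sum>j<n. B $$ (i,j) * B $$ (j,i))"
        using i c by (simp add: scalar_prod_def lessThan_atLeast0)
      also have "\<dots> = (\<Sum>j<n. if j = i then (b i)^2 else 0)"
      proof (rule sum.cong[OF refl])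
        fix j assume j: "j \<in> {..<n}"
        consider "j = i" | "j < i" | "i < j" by linarith
        then show "B $$ (i,j) * B $$ (j,i) = (if j = i then (b i)^2 else 0)"
          using ut i j c by cases (auto simp: b_def power2_eq_square upper_triangular_def)
      qed
      finally show ?thesis using i by simp
    qed
    then show ?thesis using c by (simp add: mtrace_def)
  qed
  finally have tr2: "mtrace (A * A) = (\<Sum>i<n. (b i)^2)" .
  \<comment> \<open>A sum of principal logarithms is not in general the principal logarithm of the
    product; hence the conclusion speaks of some z with exp z equal to the determinant.\<close>
  define z where "z = (\<Sum>i<n. Ln (1 + b i))"
  have nz: "1 + b i \<noteq> 0" if "i < n" for i
  proof
    assume "1 + b i = 0"
    then have "b i = -1" by (simp add: add_eq_0_iff)
    then show False using nb[OF that] e by simp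
  qed
  have "exp z = (\<Prod>i<n. 1 + b i)" unfolding z_def exp_sum[OF finite_lessThan]
    using nz by (intro prod.cong) auto
  moreover have "norm (z - (mtrace A - mtrace (A * A) / 2)) \<le> 2 * real n * \<epsilon> ^ 3"
  proof -
    have "z - (mtrace A - mtrace (A * A) / 2) = (\<Sum>i<n. Ln (1 + b i) - (b i - (b i)^2 / 2))"
      unfolding z_def tr tr2 by (simp add: sum_subtractf sum_divide_distrib)
    also have "norm \<dots> \<le> (\<Sum>i<n. 2 * \<epsilon> ^ 3)"
    proof (rule sum_norm_le)
      fix i assume i: "i \<in> {..<n}"
      have "norm (Ln (1 + b i) - (b i - (b i)^2 / 2)) \<le> 2 * norm (b i) ^ 3"
        using nb[of i] i e by (intro Ln_one_plus_bound) auto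
      also have "\<dots> \<le> 2 * \<epsilon> ^ 3" using nb[of i] i by (intro mult_left_mono power_mono) auto
      finally show "norm (Ln (1 + b i) - (b i - (b i)^2 / 2)) \<le> 2 * \<epsilon> ^ 3" .
    qed
    finally show ?thesis by simp
  qed
  ultimately show ?thesis using that[of z] det by simp
qed

section \<open>Reproducing kernels\<close>

text \<open>The abstract setting of an orthogonal projection with constant diagonal
  \<open>c\<close>. Its rank is its trace \<open>c * mass\<close>, which in the application is
  \<open>harm_dim d n\<close>.\<close>

locale reproducing_kernel = finite_measure \<mu> for \<mu> :: "'b measure" +
  fixes K :: "'b \<Rightarrow> 'b \<Rightarrow> real" and c :: real
  assumes K_bm: "bounded_measurable (\<mu> \<Otimes>\<^sub>M \<mu>) (\<lambda>z. K (fst z) (snd z))"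
    and K_sym: "\<And>x y. x \<in> space \<mu> \<Longrightarrow> y \<in> space \<mu> \<Longrightarrow> K x y = K y x"
    and K_diag: "\<And>x. x \<in> space \<mu> \<Longrightarrow> K x x = c"
    and K_rep: "\<And>x z. x \<in> space \<mu> \<Longrightarrow> z \<in> space \<mu> \<Longrightarrow> (\<integral>y. K x y * K y z \<partial>\<mu>) = K x z"
    and c_pos: "0 < c" and mass_pos: "0 < measure \<mu> (space \<mu>)"
begin

abbreviation mass :: real where "mass \<equiv> measure \<mu> (space \<mu>)"

lemma K_section: "x \<in> space \<mu> \<Longrightarrow> bounded_measurable \<mu> (K x)"
  using bounded_measurable_compose[OF K_bm, of "\<lambda>y. (x, y)" \<mu>] by simp

lemma K_section': "y \<in> space \<mu> \<Longrightarrow> bounded_measurable \<mu> (\<lambda>x. K x y)"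
  using bounded_measurable_compose[OF K_bm, of "\<lambda>x. (x, y)" \<mu>] by simp

lemma K_rep': "x \<in> space \<mu> \<Longrightarrow> z \<in> space \<mu> \<Longrightarrow> (\<integral>y. K x y * K z y \<partial>\<mu>) = K x z"
  using K_rep[of x z] by (metis (mono_tags, lifting) Bochner_Integration.integral_cong K_sym)

lemma K_square: "x \<in> space \<mu> \<Longrightarrow> (\<integral>y. (K x y)^2 \<partial>\<mu>) = c"
  using K_rep'[of x x] K_diag by (simp add: power2_eq_square)

lemma abs_K_le:
  assumes x: "x \<in> space \<mu>" and y: "y \<in> space \<mu>" shows "\<bar>K x y\<bar> \<le> c"
proof -
  have i: "integrable \<mu> (\<lambda>u. K a u * K b u)" if "a \<in> space \<mu>" "b \<in> space \<mu>" for a b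
    by (intro bounded_measurable_integrable bounded_measurable_mult K_section that)
  have *: "0 \<le> c + 2 * e * K x y + e^2 * c" for e
  proof -
    have "0 \<le> (\<integral>u. (K x u + e * K y u)^2 \<partial>\<mu>)" by simp
    also have "\<dots> = (\<integral>u. K x u * K x u + (2 * e) * (K x u * K y u) + e^2 * (K y u * K y u) \<partial>\<mu>)"
      by (rule Bochner_Integration.integral_cong) (auto simp: power2_eq_square algebra_simps)
    also have "\<dots> = c + 2 * e * K x y + e^2 * c"
      using i[OF x x] i[OF x y] i[OF y y] by (simp add: K_rep' x y K_diag)
    finally show ?thesis .
  qed
  show ?thesis using *[of 1] *[of "-1"] by auto
qed

text \<open>Cauchy-Schwarz against the constant 1. Integrating the pointwise bound c instead would
  give \<open>c * mass\<close>; the square root gained here is what makes the degenerate part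
  negligible.\<close>

lemma integral_abs_K_le:
  assumes x: "x \<in> space \<mu>" shows "(\<integral>y. \<bar>K x y\<bar> \<partial>\<mu>) \<le> sqrt (mass * c)"
proof -
  \<comment> \<open>The value that minimises the integral of ((K x y)^2 / t + t) / 2.\<close>
  define t where "t = sqrt (c / mass)"
  have t: "t > 0" "t^2 = c / mass" using c_pos mass_pos by (auto simp: t_def)
  have bm: "bounded_measurable \<mu> (\<lambda>y. \<bar>K x y\<bar>)" "bounded_measurable \<mu> (\<lambda>y. (K x y)^2)"
    using K_section[OF x] by auto
  have "(\<integral>y. \<bar>K x y\<bar> \<partial>\<mu>) \<le> (\<integral>y. ((K x y)^2 / t + t) / 2 \<partial>\<mu>)"
  proof (rule integral_mono)
    show "integrable \<mu> (\<lambda>y. \<bar>K x y\<bar>)" using bm(1) by (rule bounded_measurable_integrable)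
    show "integrable \<mu> (\<lambda>y. ((K x y)^2 / t + t) / 2)" using bounded_measurable_integrable[OF bm(2)] by simp
    fix y
    have "0 \<le> (\<bar>K x y\<bar> - t)^2" by simp
    then show "\<bar>K x y\<bar> \<le> ((K x y)^2 / t + t) / 2" using t by (simp add: power2_diff field_simps power2_eq_square)
  qed
  also have "\<dots> = (c / t + mass * t) / 2"
    using bounded_measurable_integrable[OF bm(2)] K_square[OF x] by simp
  also have "\<dots> = mass * t"
  proof -
    have "c / t = mass * t" using t mass_pos by (simp add: field_simps power2_eq_square)
    then show ?thesis by simp
  qed
  also have "\<dots> = sqrt (mass * c)"
    using mass_pos c_pos by (simp add: t_def real_sqrt_divide real_sqrt_mult field_simps flip: power2_eq_square)
  finally show ?thesis .
qed

lemma integral_abs_KK_le: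
  assumes x: "x \<in> space \<mu>" and y: "y \<in> space \<mu>" shows "(\<integral>u. \<bar>K x u\<bar> * \<bar>K u y\<bar> \<partial>\<mu>) \<le> c"
proof -
  have bm: "bounded_measurable \<mu> (\<lambda>u. (K x u)^2)" "bounded_measurable \<mu> (\<lambda>u. (K u y)^2)"
    using K_section[OF x] K_section'[OF y] by auto
  have "(\<integral>u. \<bar>K x u\<bar> * \<bar>K u y\<bar> \<partial>\<mu>) \<le> (\<integral>u. ((K x u)^2 + (K u y)^2) / 2 \<partial>\<mu>)"
  proof (rule integral_mono)
    show "integrable \<mu> (\<lambda>u. \<bar>K x u\<bar> * \<bar>K u y\<bar>)"
      by (intro bounded_measurable_integrable bounded_measurable_mult bounded_measurable_abs K_section K_section' x y)
    show "integrable \<mu> (\<lambda>u. ((K x u)^2 + (K u y)^2) / 2)" using bm[THEN bounded_measurable_integrable] by simp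
    fix u
    have "0 \<le> (\<bar>K x u\<bar> - \<bar>K u y\<bar>)^2" by simp
    then show "\<bar>K x u\<bar> * \<bar>K u y\<bar> \<le> ((K x u)^2 + (K u y)^2) / 2" by (simp add: power2_diff)
  qed
  also have "\<dots> = ((\<integral>u. (K x u)^2 \<partial>\<mu>) + (\<integral>u. (K u y)^2 \<partial>\<mu>)) / 2"
    using bm[THEN bounded_measurable_integrable] by simp
  also have "(\<integral>u. (K u y)^2 \<partial>\<mu>) = (\<integral>u. (K y u)^2 \<partial>\<mu>)"
    by (rule Bochner_Integration.integral_cong) (use K_sym y in auto)
  finally show ?thesis by (simp add: K_square x y)
qed

text \<open>Belonging to the range of the projection is required at every point and not almost
  everywhere, since the functions are evaluated at the points of the process.\<close>

definition orthonormal_system :: "nat \<Rightarrow> (nat \<Rightarrow> 'b \<Rightarrow> real) \<Rightarrow> bool" where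
  "orthonormal_system m \<phi> \<longleftrightarrow> (\<forall>a<m. bounded_measurable \<mu> (\<phi> a) \<and> (\<forall>x\<in>space \<mu>. (\<integral>y. K x y * \<phi> a y \<partial>\<mu>) = \<phi> a x))
     \<and> (\<forall>a<m. \<forall>b<m. (\<integral>x. \<phi> a x * \<phi> b x \<partial>\<mu>) = of_bool (a = b))"

text \<open>The component of K(x, .) orthogonal to the system; a nonzero one extends the
  system.\<close>

definition residual :: "nat \<Rightarrow> (nat \<Rightarrow> 'b \<Rightarrow> real) \<Rightarrow> 'b \<Rightarrow> 'b \<Rightarrow> real" where
  "residual m \<phi> x y = K x y - (\<Sum>a<m. \<phi> a x * \<phi> a y)"

context
  fixes m \<phi> x
  assumes os: "orthonormal_system m \<phi>" and x: "x \<in> space \<mu>"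
begin

lemma phi_bm: "a < m \<Longrightarrow> bounded_measurable \<mu> (\<phi> a)"
  using os by (simp add: orthonormal_system_def)

lemma residual_bm: "bounded_measurable \<mu> (residual m \<phi> x)"
  unfolding residual_def by (intro bounded_measurable_diff bounded_measurable_sum bounded_measurable_mult bounded_measurable_const K_section x phi_bm) simp

lemma residual_orth:
  assumes b: "b < m" shows "(\<integral>y. residual m \<phi> x y * \<phi> b y \<partial>\<mu>) = 0"
proof -
  have i: "integrable \<mu> (\<lambda>y. K x y * \<phi> b y)" "\<And>a. a < m \<Longrightarrow> integrable \<mu> (\<lambda>y. \<phi> a y * \<phi> b y)"
    by (intro bounded_measurable_integrable bounded_measurable_mult K_section x phi_bm b; assumption)+
  have "(\<integral>y. residual m \<phi> x y * \<phi> b y \<partial>\<mu>) = (\<integral>y. K x y * \<phi> b y - (\<Sum>a<m. \<phi> a x * (\<phi> a y * \<phi> b y)) \<partial>\<mu>)"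
    by (simp add: residual_def left_diff_distrib sum_distrib_right mult.assoc)
  also have "\<dots> = (\<integral>y. K x y * \<phi> b y \<partial>\<mu>) - (\<Sum>a<m. \<phi> a x * (\<integral>y. \<phi> a y * \<phi> b y \<partial>\<mu>))"
    using i by (subst Bochner_Integration.integral_diff) (auto simp: Bochner_Integration.integral_sum)
  also have "\<dots> = \<phi> b x - (\<Sum>a<m. \<phi> a x * of_bool (a = b))"
    using os x b by (auto simp: orthonormal_system_def intro!: sum.cong)
  also have "\<dots> = 0" using b by (simp add: of_bool_def if_distrib cong: if_cong)
  finally show ?thesis .
qed

lemma residual_rep:
  assumes z: "z \<in> space \<mu>" shows "(\<integral>y. K z y * residual m \<phi> x y \<partial>\<mu>) = residual m \<phi> x z"
proof -
  have i: "integrable \<mu> (\<lambda>y. K z y * K x y)" "\<And>a. a < m \<Longrightarrow> integrable \<mu> (\<lambda>y. K z y * \<phi> a y)"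
    by (intro bounded_measurable_integrable bounded_measurable_mult K_section x z phi_bm; assumption)+
  have "(\<integral>y. K z y * residual m \<phi> x y \<partial>\<mu>) = (\<integral>y. K z y * K x y - (\<Sum>a<m. \<phi> a x * (K z y * \<phi> a y)) \<partial>\<mu>)"
    by (simp add: residual_def right_diff_distrib sum_distrib_left mult_ac)
  also have "\<dots> = (\<integral>y. K z y * K x y \<partial>\<mu>) - (\<Sum>a<m. \<phi> a x * (\<integral>y. K z y * \<phi> a y \<partial>\<mu>))"
    using i by (subst Bochner_Integration.integral_diff) (auto simp: Bochner_Integration.integral_sum)
  also have "\<dots> = residual m \<phi> x z"
    using os x z by (auto simp: orthonormal_system_def residual_def K_rep' K_sym)
  finally show ?thesis .
qed

lemma residual_norm: "(\<integral>y. residual m \<phi> x y * residual m \<phi> x y \<partial>\<mu>) = c - (\<Sum>a<m. (\<phi> a x)^2)"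
proof -
  have i: "integrable \<mu> (\<lambda>y. K x y * residual m \<phi> x y)" "\<And>a. a < m \<Longrightarrow> integrable \<mu> (\<lambda>y. residual m \<phi> x y * \<phi> a y)"
    by (intro bounded_measurable_integrable bounded_measurable_mult K_section x residual_bm phi_bm; assumption)+
  have "(\<integral>y. residual m \<phi> x y * residual m \<phi> x y \<partial>\<mu>) = (\<integral>y. K x y * residual m \<phi> x y - (\<Sum>a<m. \<phi> a x * (residual m \<phi> x y * \<phi> a y)) \<partial>\<mu>)"
    by (subst (2) residual_def) (simp add: right_diff_distrib sum_distrib_left mult_ac)
  also have "\<dots> = (\<integral>y. K x y * residual m \<phi> x y \<partial>\<mu>) - (\<Sum>a<m. \<phi> a x * (\<integral>y. residual m \<phi> x y * \<phi> a y \<partial>\<mu>))"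
    using i by (subst Bochner_Integration.integral_diff) (auto simp: Bochner_Integration.integral_sum)
  also have "\<dots> = residual m \<phi> x x"
    using residual_rep[OF x] residual_orth by simp
  finally show ?thesis using K_diag[OF x] by (simp add: residual_def power2_eq_square)
qed

end

text \<open>The squared norm of the residual is nonnegative, so the squares of the system sum to at
  most c at every point; integration counts the functions.\<close>

lemma orthonormal_system_bound:
  assumes os: "orthonormal_system m \<phi>" shows "real m \<le> c * mass"
proof -
  have i: "integrable \<mu> (\<lambda>x. \<phi> a x * \<phi> a x)" if "a < m" for a
    using os that by (intro bounded_measurable_integrable bounded_measurable_mult) (auto simp: orthonormal_system_def)
  have "real m = (\<Sum>a<m. (\<integral>x. \<phi> a x * \<phi> a x \<partial>\<mu>))" using os by (simp add: orthonormal_system_def)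
  also have "\<dots> = (\<integral>x. (\<Sum>a<m. \<phi> a x * \<phi> a x) \<partial>\<mu>)" using i by (simp add: Bochner_Integration.integral_sum)
  also have "\<dots> \<le> (\<integral>x. c \<partial>\<mu>)"
  proof (rule integral_mono)
    show "(\<Sum>a<m. \<phi> a x * \<phi> a x) \<le> c" if "x \<in> space \<mu>" for x
    proof -
      have "0 \<le> (\<integral>y. residual m \<phi> x y * residual m \<phi> x y \<partial>\<mu>)" by simp
      then show ?thesis unfolding residual_norm[OF os that] by (simp add: power2_eq_square)
    qed
  qed (use i in auto)
  finally show ?thesis by (simp add: mult.commute)
qed

text \<open>A maximal orthonormal system in the range of the projection reproduces the kernel;
  Bessel's inequality bounds its size by the trace.\<close>

lemma orthonormal_basis_exists:
  obtains n \<phi> where "real n = c * mass" "orthonormal_system n \<phi>"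
    "\<And>x y. x \<in> space \<mu> \<Longrightarrow> y \<in> space \<mu> \<Longrightarrow> K x y = (\<Sum>a<n. \<phi> a x * \<phi> a y)"
proof -
  define S where "S = {m. \<exists>\<phi>. orthonormal_system m \<phi>}"
  have "S \<subseteq> {..nat \<lfloor>c * mass\<rfloor>}"
    using orthonormal_system_bound by (auto simp: S_def le_nat_floor)
  then have fin: "finite S" using finite_subset by blast
  have "orthonormal_system 0 (\<lambda>_ _. 0)" by (simp add: orthonormal_system_def)
  then have "S \<noteq> {}" by (auto simp: S_def)
  then have "Max S \<in> S" using fin by (rule Max_in[rotated])
  define n where "n = Max S"
  obtain \<phi> where os: "orthonormal_system n \<phi>" using \<open>Max S \<in> S\<close> by (auto simp: S_def n_def)
  have notS: "Suc n \<notin> S" using Max_ge[OF fin, of "Suc n"] by (auto simp: n_def)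
  \<comment> \<open>If this fails at some x, the normalised residual at x is a further function of
    the system, against maximality.\<close>
  have norm0: "c - (\<Sum>a<n. (\<phi> a x)^2) = 0" if x: "x \<in> space \<mu>" for x
  proof (rule ccontr)
    define q where "q = c - (\<Sum>a<n. (\<phi> a x)^2)"
    note bm = residual_bm[OF os x]
    have "0 \<le> q" unfolding q_def residual_norm[OF os x, symmetric] by simp
    moreover assume "c - (\<Sum>a<n. (\<phi> a x)^2) \<noteq> 0"
    ultimately have q: "q > 0" by (simp add: q_def)
    define r where "r = (\<lambda>y. residual n \<phi> x y / sqrt q)"
    define \<psi> where "\<psi> = \<phi>(n := r)"
    have rbm: "bounded_measurable \<mu> r" unfolding r_def divide_inverse
      by (intro bounded_measurable_mult bm bounded_measurable_const)
    have rr: "(\<integral>y. r y * r y \<partial>\<mu>) = 1"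
    proof -
      have "(\<integral>y. r y * r y \<partial>\<mu>) = (\<integral>y. (residual n \<phi> x y * residual n \<phi> x y) / q \<partial>\<mu>)"
        using q by (simp add: r_def)
      also have "\<dots> = 1" using residual_norm[OF os x] q by (simp add: q_def[symmetric])
      finally show ?thesis .
    qed
    have rphi: "(\<integral>y. r y * \<phi> b y \<partial>\<mu>) = 0" "(\<integral>y. \<phi> b y * r y \<partial>\<mu>) = 0" if "b < n" for b
    proof -
      have "(\<integral>y. r y * \<phi> b y \<partial>\<mu>) = (\<integral>y. residual n \<phi> x y * \<phi> b y / sqrt q \<partial>\<mu>)" by (simp add: r_def)
      also have "\<dots> = 0" using residual_orth[OF os x that] by simp
      finally show "(\<integral>y. r y * \<phi> b y \<partial>\<mu>) = 0" .
      then show "(\<integral>y. \<phi> b y * r y \<partial>\<mu>) = 0" by (simp add: mult.commute)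
    qed
    have rrep: "(\<integral>y. K z y * r y \<partial>\<mu>) = r z" if "z \<in> space \<mu>" for z
      using residual_rep[OF os x that] by (simp add: r_def)
    have "orthonormal_system (Suc n) \<psi>"
      using os rbm rr rphi rrep by (auto simp: orthonormal_system_def \<psi>_def less_Suc_eq)
    then have "Suc n \<in> S" by (auto simp: S_def)
    with notS show False by blast
  qed
  \<comment> \<open>A residual of norm 0 vanishes almost everywhere in y. Being reproduced by the
    kernel, it then vanishes at every y.\<close>
  have K: "K x y = (\<Sum>a<n. \<phi> a x * \<phi> a y)" if x: "x \<in> space \<mu>" and y: "y \<in> space \<mu>" for x y
  proof -
    have bm: "bounded_measurable \<mu> (\<lambda>y. residual n \<phi> x y * residual n \<phi> x y)"
      by (intro bounded_measurable_mult residual_bm[OF os x])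
    have "(\<integral>y. residual n \<phi> x y * residual n \<phi> x y \<partial>\<mu>) = 0"
      unfolding residual_norm[OF os x] by (rule norm0[OF x])
    then have "AE y in \<mu>. residual n \<phi> x y * residual n \<phi> x y = 0"
      using integral_nonneg_eq_0_iff_AE[OF bounded_measurable_integrable[OF bm]] by simp
    then have "(\<integral>u. K y u * residual n \<phi> x u \<partial>\<mu>) = (\<integral>u. 0 \<partial>\<mu>)"
    proof (intro integral_cong_AE)
      show "(\<lambda>u. K y u * residual n \<phi> x u) \<in> borel_measurable \<mu>"
        by (intro bounded_measurableD bounded_measurable_mult residual_bm[OF os x] K_section y)
    qed (auto elim!: eventually_mono)
    then have "residual n \<phi> x y = 0" using residual_rep[OF os x y] by simp
    then show ?thesis by (simp add: residual_def)
  qed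
  have i: "integrable \<mu> (\<lambda>x. \<phi> a x * \<phi> a x)" if "a < n" for a
    using os that by (intro bounded_measurable_integrable bounded_measurable_mult) (auto simp: orthonormal_system_def)
  have "real n = (\<Sum>a<n. (\<integral>x. \<phi> a x * \<phi> a x \<partial>\<mu>))" using os by (simp add: orthonormal_system_def)
  also have "\<dots> = (\<integral>x. (\<Sum>a<n. \<phi> a x * \<phi> a x) \<partial>\<mu>)" using i by (simp add: Bochner_Integration.integral_sum)
  also have "\<dots> = (\<integral>x. c \<partial>\<mu>)"
    by (rule Bochner_Integration.integral_cong) (use K K_diag in auto)
  also have "\<dots> = c * mass" by (simp add: mult.commute)
  finally show ?thesis using that os K by blast
qed

lemma dim_exists: "\<exists>n. real n = c * mass"
  using orthonormal_basis_exists by metis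

end

section \<open>Determinantal point processes\<close>

context finite_measure
begin

lemma product_sigma_finite_const: "product_sigma_finite (\<lambda>_::nat. M)"
  by unfold_locales

lemma finite_measure_PiM_const:
  assumes I: "finite (I :: nat set)" shows "finite_measure (PiM I (\<lambda>_. M))"
    and "measure (PiM I (\<lambda>_. M)) (space (PiM I (\<lambda>_. M))) = measure M (space M) ^ card I"
proof -
  interpret product_sigma_finite "\<lambda>_::nat. M" by (rule product_sigma_finite_const)
  have e: "emeasure (PiM I (\<lambda>_. M)) (space (PiM I (\<lambda>_. M))) = ennreal (measure M (space M) ^ card I)"
    unfolding space_PiM using I by (subst emeasure_PiM) (auto simp: emeasure_eq_measure ennreal_power)
  then show "finite_measure (PiM I (\<lambda>_. M))" by (intro finite_measureI) simp
  show "measure (PiM I (\<lambda>_. M)) (space (PiM I (\<lambda>_. M))) = measure M (space M) ^ card I"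
    using e by (simp add: measure_def)
qed

end

section \<open>Integrals over finite powers of the base measure\<close>

lemma bounded_measurable_component:
  assumes "bounded_measurable M h" "i \<in> I"
  shows "bounded_measurable (PiM I (\<lambda>_. M)) (\<lambda>x. h (x i))"
  using bounded_measurable_compose[OF assms(1), of "\<lambda>x. x i" "PiM I (\<lambda>_. M)"] assms(2) by simp

lemma bounded_measurable_component2:
  assumes h: "bounded_measurable (M \<Otimes>\<^sub>M M) (\<lambda>z. h (fst z) (snd z))" and i: "i \<in> I" "j \<in> I"
  shows "bounded_measurable (PiM I (\<lambda>_. M)) (\<lambda>x. h (x i) (x j))"
  using bounded_measurable_compose[OF h, of "\<lambda>x. (x i, x j)" "PiM I (\<lambda>_. M)"] i by simp

lemma (in finite_measure) integral_PiM_insert: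
  fixes h :: "(nat \<Rightarrow> 'a) \<Rightarrow> 'b::{banach, second_countable_topology}"
  assumes "finite I" "i \<notin> I" "bounded_measurable (PiM (insert i I) (\<lambda>_. M)) h"
  shows "(\<integral>x. h x \<partial>PiM (insert i I) (\<lambda>_. M)) = (\<integral>x. (\<integral>y. h (x(i := y)) \<partial>M) \<partial>PiM I (\<lambda>_. M))"
proof -
  interpret product_sigma_finite "\<lambda>_::nat. M" by (rule product_sigma_finite_const)
  interpret F: finite_measure "PiM (insert i I) (\<lambda>_. M)" using assms by (intro finite_measure_PiM_const) auto
  show ?thesis using assms(1,2) F.bounded_measurable_integrable[OF assms(3)] by (rule product_integral_insert)
qed

lemma (in finite_measure) integral_PiM_1:
  fixes h :: "'a \<Rightarrow> 'b::{banach, second_countable_topology}"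
  assumes "bounded_measurable M h"
  shows "(\<integral>x. h (x 0) \<partial>PiM {..<1::nat} (\<lambda>_. M)) = (\<integral>x. h x \<partial>M)"
proof -
  interpret product_sigma_finite "\<lambda>_::nat. M" by (rule product_sigma_finite_const)
  have "{..<1::nat} = {0}" by auto
  then show ?thesis using product_integral_singleton[of h 0] bounded_measurableD[OF assms] by simp
qed

lemma (in finite_measure) integral_PiM_2:
  fixes h :: "'a \<Rightarrow> 'a \<Rightarrow> 'b::{banach, second_countable_topology}"
  assumes h: "bounded_measurable (M \<Otimes>\<^sub>M M) (\<lambda>z. h (fst z) (snd z))"
  shows "(\<integral>x. h (x 0) (x 1) \<partial>PiM {..<2::nat} (\<lambda>_. M)) = (\<integral>x. (\<integral>y. h x y \<partial>M) \<partial>M)"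
proof -
  have s: "{..<2::nat} = insert 1 {..<1}" by auto
  have bm: "bounded_measurable (PiM {..<2::nat} (\<lambda>_. M)) (\<lambda>x. h (x 0) (x 1))"
    by (rule bounded_measurable_component2[OF h]) auto
  have "(\<integral>x. h (x 0) (x 1) \<partial>PiM {..<2::nat} (\<lambda>_. M)) = (\<integral>x. (\<integral>y. h (x 0) y \<partial>M) \<partial>PiM {..<1::nat} (\<lambda>_. M))"
    using integral_PiM_insert[of "{..<1}" 1 "\<lambda>x. h (x 0) (x 1)"] bm unfolding s by simp
  also have "\<dots> = (\<integral>x. (\<integral>y. h x y \<partial>M) \<partial>M)"
    using integral_PiM_1[OF bounded_measurable_integral[OF h]] by simp
  finally show ?thesis .
qed

lemma ldet_1: "ldet 1 A = A 0 0"
  unfolding ldet_eq_det by (subst det_single) auto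

lemma ldet_2: "ldet 2 A = A 0 0 * A 1 1 - A 0 1 * A 1 0"
proof -
  have "{p. p permutes {..<2::nat}} = {id, Transposition.transpose 0 1}"
  proof -
    have "{..<2::nat} = {0, 1}" by auto
    then show ?thesis by (auto simp: permutes_doubleton_iff)
  qed
  moreover have "id \<noteq> Transposition.transpose (0::nat) 1" by (metis id_apply transpose_apply_first zero_neq_one)
  moreover have "sign (Transposition.transpose (0::nat) 1) = -1" by (simp add: sign_swap_id)
  ultimately show ?thesis by (simp add: ldet_def numeral_2_eq_2)
qed

lemma finite_distinct_tuples: "finite P \<Longrightarrow> finite (distinct_tuples m P)"
  unfolding distinct_tuples_def by (rule finite_subset[of _ "{..<m} \<rightarrow>\<^sub>E P"]) (auto intro: finite_PiE)

lemma card_distinct_tuples: "finite P \<Longrightarrow> card (distinct_tuples m P) = (\<Prod>i<m. card P - i)"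
  unfolding distinct_tuples_def using card_inj_on_subset_funcset[of "{..<m}" P "{..<m}"]
  by (simp add: lessThan_atLeast0)

lemma sum_distinct_tuples_1: "(\<Sum>x\<in>distinct_tuples 1 P. h (x 0)) = (\<Sum>v\<in>P. h v)"
proof (rule sum.reindex_bij_witness[of _ "\<lambda>v. (\<lambda>i\<in>{..<1}. v)" "\<lambda>x. x 0"])
  fix x assume "x \<in> distinct_tuples 1 P"
  then have x: "x \<in> {..<1} \<rightarrow>\<^sub>E P" by (simp add: distinct_tuples_def)
  show "(\<lambda>i\<in>{..<1::nat}. x 0) = x" using x by (intro ext) (auto simp: restrict_def PiE_def extensional_def)
qed (auto simp: distinct_tuples_def inj_on_def)

lemma sum_distinct_tuples_2:
  assumes "finite P"
  shows "(\<Sum>x\<in>distinct_tuples 2 P. h (x 0) (x 1)) = (\<Sum>v\<in>P. \<Sum>w\<in>P - {v}. h v w)"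
proof -
  have "(\<Sum>v\<in>P. \<Sum>w\<in>P - {v}. h v w) = (\<Sum>(v,w)\<in>(SIGMA v:P. P - {v}). h v w)"
    using assms by (subst sum.Sigma) auto
  also have "\<dots> = (\<Sum>x\<in>distinct_tuples 2 P. h (x 0) (x 1))"
  proof (rule sum.reindex_bij_witness[of _ "\<lambda>x. (x 0, x 1)" "\<lambda>(v,w). (\<lambda>i\<in>{..<2}. if i = 0 then v else w)"])
    fix x assume "x \<in> distinct_tuples 2 P"
    then have x: "x \<in> {..<2} \<rightarrow>\<^sub>E P" "inj_on x {..<2}" by (auto simp: distinct_tuples_def)
    have two: "{..<2::nat} = {0, 1}" by auto
    show "(case (x 0, x 1) of (v, w) \<Rightarrow> \<lambda>i\<in>{..<2}. if i = 0 then v else w) = x"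
      using x(1) by (intro ext) (auto simp: restrict_def PiE_def extensional_def two less_2_cases_iff)
    show "(x 0, x 1) \<in> (SIGMA v:P. P - {v})"
      using x unfolding two by (auto simp: PiE_def Pi_def)
  next
    fix a assume a: "a \<in> (SIGMA v:P. P - {v})"
    show "(case a of (v, w) \<Rightarrow> \<lambda>i\<in>{..<2::nat}. if i = 0 then v else w) \<in> distinct_tuples 2 P"
    proof -
      obtain v w where vw: "a = (v, w)" "v \<in> P" "w \<in> P" "v \<noteq> w" using a by auto
      have two: "{..<2::nat} = {0, 1}" by auto
      have "(\<lambda>i\<in>{..<2::nat}. if i = 0 then v else w) \<in> {..<2} \<rightarrow>\<^sub>E P"
        using vw by (intro restrict_PiE_iff[THEN iffD2]) auto
      moreover have "inj_on (\<lambda>i\<in>{..<2::nat}. if i = 0 then v else w) {..<2}"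
        unfolding two using vw by (auto simp: inj_on_def)
      ultimately show ?thesis by (simp add: distinct_tuples_def vw(1))
    qed
  qed auto
  finally show ?thesis ..
qed

text \<open>Both the base measure and the probability space provide facts on finite measures; the
  prefix \<open>KK\<close> selects those of the base measure.\<close>

locale determinantal_process = KK?: reproducing_kernel \<mu> K c + prob_space M
  for \<mu> :: "'b measure" and K c and M :: "'a measure" +
  fixes \<Phi> :: "'a \<Rightarrow> 'b set"
  assumes dpp: "is_dpp M \<mu> K \<Phi>"
begin

abbreviation mu_pow :: "nat \<Rightarrow> (nat \<Rightarrow> 'b) measure" where "mu_pow m \<equiv> PiM {..<m} (\<lambda>_. \<mu>)"

abbreviation rho :: "nat \<Rightarrow> (nat \<Rightarrow> 'b) \<Rightarrow> real" where "rho m x \<equiv> ldet m (\<lambda>a b. K (x a) (x b))"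

lemma Phi_finite: "\<omega> \<in> space M \<Longrightarrow> finite (\<Phi> \<omega>)" and Phi_space: "\<omega> \<in> space M \<Longrightarrow> \<Phi> \<omega> \<subseteq> space \<mu>"
  using dpp by (auto simp: is_dpp_def)

lemma distinct_tuples_space: "\<omega> \<in> space M \<Longrightarrow> x \<in> distinct_tuples m (\<Phi> \<omega>) \<Longrightarrow> x \<in> space (mu_pow m)"
  using Phi_space by (fastforce simp: distinct_tuples_def space_PiM PiE_def Pi_def)

lemma rho_bm: "bounded_measurable (mu_pow m) (rho m)"
  unfolding ldet_def
  by (intro bounded_measurable_sum bounded_measurable_mult bounded_measurable_const bounded_measurable_prod
      bounded_measurable_component2[OF K_bm]) (use permutes_in_image in force)+

text \<open>The values of the kernel at finitely many points form a Gram matrix. This matters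
  because \<open>is_dpp\<close> states the density through \<open>ennreal\<close>, which would cut
  negative values off at 0.\<close>

lemma rho_nonneg:
  assumes x: "x \<in> space (mu_pow m)" shows "0 \<le> rho m x"
proof (rule ldet_nonneg)
  fix v :: "nat \<Rightarrow> real"
  obtain n \<phi> where "orthonormal_system n \<phi>" and k: "\<And>x y. x \<in> space \<mu> \<Longrightarrow> y \<in> space \<mu> \<Longrightarrow> K x y = (\<Sum>a<n. \<phi> a x * \<phi> a y)"
    using orthonormal_basis_exists by metis
  have xs: "x i \<in> space \<mu>" if "i < m" for i using x that by (auto simp: space_PiM PiE_def Pi_def)
  have "(\<Sum>i<m. \<Sum>j<m. v i * v j * K (x i) (x j)) = (\<Sum>i<m. \<Sum>j<m. \<Sum>a<n. (v i * \<phi> a (x i)) * (v j * \<phi> a (x j)))"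
    using xs by (auto simp: k sum_distrib_left mult_ac intro!: sum.cong)
  also have "\<dots> = (\<Sum>a<n. \<Sum>i<m. \<Sum>j<m. (v i * \<phi> a (x i)) * (v j * \<phi> a (x j)))"
  proof -
    have "(\<Sum>i<m. \<Sum>j<m. \<Sum>a<n. f i j a) = (\<Sum>a<n. \<Sum>i<m. \<Sum>j<m. f i j a)" for f :: "nat \<Rightarrow> nat \<Rightarrow> nat \<Rightarrow> real"
    proof -
      have "(\<Sum>i<m. \<Sum>j<m. \<Sum>a<n. f i j a) = (\<Sum>i<m. \<Sum>a<n. \<Sum>j<m. f i j a)"
        by (rule sum.cong[OF refl], rule sum.swap)
      also have "\<dots> = (\<Sum>a<n. \<Sum>i<m. \<Sum>j<m. f i j a)" by (rule sum.swap)
      finally show ?thesis .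
    qed
    then show ?thesis by this
  qed
  also have "\<dots> = (\<Sum>a<n. (\<Sum>i<m. v i * \<phi> a (x i))^2)"
    by (simp add: power2_eq_square sum_product)
  also have "\<dots> \<ge> 0" by (intro sum_nonneg) simp
  finally show "0 \<le> (\<Sum>i<m. \<Sum>j<m. v i * v j * K (x i) (x j))" .
qed

lemma finite_measure_pow: "finite_measure (mu_pow m)"
  by (rule KK.finite_measure_PiM_const) simp

lemma expectation_tuples_nonneg:
  fixes g :: "(nat \<Rightarrow> 'b) \<Rightarrow> real"
  assumes m: "m \<ge> 1" and g: "bounded_measurable (mu_pow m) g" and nn: "\<And>x. x \<in> space (mu_pow m) \<Longrightarrow> 0 \<le> g x"
  shows "has_bochner_integral M (\<lambda>\<omega>. \<Sum>x\<in>distinct_tuples m (\<Phi> \<omega>). g x) (\<integral>x. g x * rho m x \<partial>mu_pow m)"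
proof -
  interpret F: finite_measure "mu_pow m" by (rule finite_measure_pow)
  have gm: "(\<lambda>x. ennreal (g x)) \<in> borel_measurable (mu_pow m)" using bounded_measurableD[OF g] by measurable
  have eq: "(\<Sum>x\<in>distinct_tuples m (\<Phi> \<omega>). ennreal (g x)) = ennreal (\<Sum>x\<in>distinct_tuples m (\<Phi> \<omega>). g x)"
    if "\<omega> \<in> space M" for \<omega>
    using distinct_tuples_space[OF that] nn by (intro sum_ennreal) auto
  have nonneg: "0 \<le> (\<Sum>x\<in>distinct_tuples m (\<Phi> \<omega>). g x)" if "\<omega> \<in> space M" for \<omega>
    using distinct_tuples_space[OF that] nn by (intro sum_nonneg) auto
  have d: "(\<lambda>\<omega>. \<Sum>x\<in>distinct_tuples m (\<Phi> \<omega>). ennreal (g x)) \<in> borel_measurable M"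
    "(\<integral>\<^sup>+\<omega>. (\<Sum>x\<in>distinct_tuples m (\<Phi> \<omega>). ennreal (g x)) \<partial>M) = (\<integral>\<^sup>+x. ennreal (g x) * ennreal (rho m x) \<partial>mu_pow m)"
    using dpp m gm by (auto simp: is_dpp_def)
  have meas: "(\<lambda>\<omega>. \<Sum>x\<in>distinct_tuples m (\<Phi> \<omega>). g x) \<in> borel_measurable M"
  proof -
    have "(\<lambda>\<omega>. enn2real (\<Sum>x\<in>distinct_tuples m (\<Phi> \<omega>). ennreal (g x))) \<in> borel_measurable M"
      using d(1) by measurable
    then show ?thesis
      by (rule measurable_cong[THEN iffD1, rotated]) (simp add: eq nonneg)
  qed
  have "(\<integral>\<^sup>+\<omega>. ennreal (\<Sum>x\<in>distinct_tuples m (\<Phi> \<omega>). g x) \<partial>M) = (\<integral>\<^sup>+\<omega>. (\<Sum>x\<in>distinct_tuples m (\<Phi> \<omega>). ennreal (g x)) \<partial>M)"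
    by (rule nn_integral_cong) (simp add: eq)
  also have "\<dots> = (\<integral>\<^sup>+x. ennreal (g x * rho m x) \<partial>mu_pow m)"
    unfolding d(2) by (rule nn_integral_cong) (simp add: nn rho_nonneg ennreal_mult')
  also have "\<dots> = ennreal (\<integral>x. g x * rho m x \<partial>mu_pow m)"
    using nn rho_nonneg by (intro nn_integral_eq_integral F.bounded_measurable_integrable bounded_measurable_mult g rho_bm AE_I2) auto
  finally show ?thesis
    using nn rho_nonneg nonneg by (intro has_bochner_integral_nn_integral meas AE_I2 integral_nonneg_AE) auto
qed

text \<open>Adding a bound makes the function nonnegative; the constant is subtracted by a second
  application to the constant function.\<close>

lemma expectation_tuples:
  fixes g :: "(nat \<Rightarrow> 'b) \<Rightarrow> real"
  assumes m: "m \<ge> 1" and g: "bounded_measurable (mu_pow m) g"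
  shows "has_bochner_integral M (\<lambda>\<omega>. \<Sum>x\<in>distinct_tuples m (\<Phi> \<omega>). g x) (\<integral>x. g x * rho m x \<partial>mu_pow m)"
proof -
  interpret F: finite_measure "mu_pow m" by (rule finite_measure_pow)
  obtain B where B: "B > 0" "\<And>x. x \<in> space (mu_pow m) \<Longrightarrow> norm (g x) \<le> B" using bounded_measurable_bound[OF g] by blast
  have gB: "bounded_measurable (mu_pow m) (\<lambda>x. g x + B)" using g by (intro bounded_measurable_add bounded_measurable_const)
  have 1: "has_bochner_integral M (\<lambda>\<omega>. \<Sum>x\<in>distinct_tuples m (\<Phi> \<omega>). g x + B) (\<integral>x. (g x + B) * rho m x \<partial>mu_pow m)"
    by (rule expectation_tuples_nonneg[OF m gB]) (use B(2) in \<open>force simp: abs_le_iff\<close>)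
  have 2: "has_bochner_integral M (\<lambda>\<omega>. \<Sum>x\<in>distinct_tuples m (\<Phi> \<omega>). B) (\<integral>x. B * rho m x \<partial>mu_pow m)"
    by (rule expectation_tuples_nonneg[OF m]) (use B(1) in auto)
  have "integrable (mu_pow m) (\<lambda>x. g x * rho m x)" "integrable (mu_pow m) (rho m)"
    using g rho_bm by (auto intro!: F.bounded_measurable_integrable bounded_measurable_mult)
  then have "(\<integral>x. (g x + B) * rho m x \<partial>mu_pow m) - (\<integral>x. B * rho m x \<partial>mu_pow m) = (\<integral>x. g x * rho m x \<partial>mu_pow m)"
    by (simp add: distrib_right)
  with has_bochner_integral_diff[OF 1 2] show ?thesis by (simp add: sum.distrib)
qed

lemma expectation_tuples_complex:
  fixes g :: "(nat \<Rightarrow> 'b) \<Rightarrow> complex"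
  assumes m: "m \<ge> 1" and g: "bounded_measurable (mu_pow m) g"
  shows "has_bochner_integral M (\<lambda>\<omega>. \<Sum>x\<in>distinct_tuples m (\<Phi> \<omega>). g x) (\<integral>x. g x * of_real (rho m x) \<partial>mu_pow m)"
proof -
  interpret F: finite_measure "mu_pow m" by (rule finite_measure_pow)
  obtain B where B: "B > 0" "\<And>x. x \<in> space (mu_pow m) \<Longrightarrow> norm (g x) \<le> B" using bounded_measurable_bound[OF g] by blast
  have "bounded_measurable (mu_pow m) (\<lambda>x. Re (g x))" "bounded_measurable (mu_pow m) (\<lambda>x. Im (g x))"
    using bounded_measurableD[OF g] B(2) by (auto intro!: bounded_measurableI[of _ _ B] order_trans[OF abs_Re_le_cmod] order_trans[OF abs_Im_le_cmod])
  note bm = this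
  note R = expectation_tuples[OF m bm(1)] and I = expectation_tuples[OF m bm(2)]
  have "has_bochner_integral M (\<lambda>\<omega>. of_real (\<Sum>x\<in>distinct_tuples m (\<Phi> \<omega>). Re (g x)) + \<i> * of_real (\<Sum>x\<in>distinct_tuples m (\<Phi> \<omega>). Im (g x)))
     (of_real (\<integral>x. Re (g x) * rho m x \<partial>mu_pow m) + \<i> * of_real (\<integral>x. Im (g x) * rho m x \<partial>mu_pow m))"
    by (intro has_bochner_integral_add has_bochner_integral_mult_right has_bochner_integral_of_real R I)
  moreover have "of_real (\<Sum>x\<in>A. Re (g x)) + \<i> * of_real (\<Sum>x\<in>A. Im (g x)) = (\<Sum>x\<in>A. g x)" for A
    by (simp add: complex_eq_iff)
  moreover have "of_real (\<integral>x. Re (g x) * rho m x \<partial>mu_pow m) + \<i> * of_real (\<integral>x. Im (g x) * rho m x \<partial>mu_pow m) = (\<integral>x. g x * of_real (rho m x) \<partial>mu_pow m)"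
  proof -
    have i: "integrable (mu_pow m) (\<lambda>x. Re (g x) * rho m x)" "integrable (mu_pow m) (\<lambda>x. Im (g x) * rho m x)"
      using bm rho_bm by (auto intro!: F.bounded_measurable_integrable bounded_measurable_mult)
    have "(\<integral>x. g x * of_real (rho m x) \<partial>mu_pow m) = (\<integral>x. of_real (Re (g x) * rho m x) + \<i> * of_real (Im (g x) * rho m x) \<partial>mu_pow m)"
      by (rule Bochner_Integration.integral_cong) (auto simp: complex_eq_iff)
    also have "\<dots> = of_real (\<integral>x. Re (g x) * rho m x \<partial>mu_pow m) + \<i> * of_real (\<integral>x. Im (g x) * rho m x \<partial>mu_pow m)"
      using i by (subst Bochner_Integration.integral_add) (auto simp del: of_real_mult simp: integral_complex_of_real)
    finally show ?thesis ..
  qed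
  ultimately show ?thesis by simp
qed

section \<open>Moments of linear statistics and the number of points\<close>

lemma K_bm2: "bounded_measurable (\<mu> \<Otimes>\<^sub>M \<mu>) (\<lambda>z. (K (fst z) (snd z))^2)"
  using K_bm by (rule bounded_measurable_power)

lemma has_integral_linear:
  assumes F: "bounded_measurable \<mu> F"
  shows "has_bochner_integral M (\<lambda>\<omega>. \<Sum>v\<in>\<Phi> \<omega>. F v) (c * (\<integral>x. F x \<partial>\<mu>))"
proof -
  have "has_bochner_integral M (\<lambda>\<omega>. \<Sum>x\<in>distinct_tuples 1 (\<Phi> \<omega>). F (x 0)) (\<integral>x. F (x 0) * rho 1 x \<partial>mu_pow 1)"
    by (rule expectation_tuples) (auto intro: bounded_measurable_component F)
  moreover have "(\<integral>x. F (x 0) * rho 1 x \<partial>mu_pow 1) = (\<integral>x. F (x 0) * c \<partial>mu_pow 1)"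
    unfolding ldet_1 by (rule Bochner_Integration.integral_cong) (auto simp: K_diag space_PiM PiE_def Pi_def)
  moreover have "\<dots> = c * (\<integral>x. F x \<partial>\<mu>)"
    using KK.integral_PiM_1[OF F] by (simp add: mult.commute)
  ultimately show ?thesis unfolding sum_distinct_tuples_1 by (simp only:)
qed

text \<open>The two-point density is c^2 - K(x, y)^2, since the diagonal is constant and the kernel
  symmetric.\<close>

lemma has_integral_pairs:
  assumes F: "bounded_measurable \<mu> F" and G: "bounded_measurable \<mu> G"
  shows "has_bochner_integral M (\<lambda>\<omega>. \<Sum>v\<in>\<Phi> \<omega>. \<Sum>w\<in>\<Phi> \<omega> - {v}. F v * G w)
     (c^2 * (\<integral>x. F x \<partial>\<mu>) * (\<integral>x. G x \<partial>\<mu>) - (\<integral>x. (\<integral>y. F x * G y * (K x y)^2 \<partial>\<mu>) \<partial>\<mu>))"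
proof -
  have FG: "bounded_measurable (\<mu> \<Otimes>\<^sub>M \<mu>) (\<lambda>z. F (fst z) * G (snd z))"
    by (intro bounded_measurable_mult bounded_measurable_fst bounded_measurable_snd F G)
  have FGK: "bounded_measurable (\<mu> \<Otimes>\<^sub>M \<mu>) (\<lambda>z. F (fst z) * G (snd z) * (K (fst z) (snd z))^2)"
    by (intro bounded_measurable_mult FG K_bm2)
  have h: "bounded_measurable (\<mu> \<Otimes>\<^sub>M \<mu>) (\<lambda>z. F (fst z) * G (snd z) * (c^2 - (K (fst z) (snd z))^2))"
    by (intro bounded_measurable_mult bounded_measurable_diff bounded_measurable_const FG K_bm2)
  have bmx: "bounded_measurable (mu_pow 2) (\<lambda>x. F (x 0) * G (x 1))"
    by (intro bounded_measurable_mult bounded_measurable_component F G) auto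
  have 1: "has_bochner_integral M (\<lambda>\<omega>. \<Sum>x\<in>distinct_tuples 2 (\<Phi> \<omega>). F (x 0) * G (x 1)) (\<integral>x. F (x 0) * G (x 1) * rho 2 x \<partial>mu_pow 2)"
    by (rule expectation_tuples[OF _ bmx]) simp
  have 2: "(\<Sum>x\<in>distinct_tuples 2 (\<Phi> \<omega>). F (x 0) * G (x 1)) = (\<Sum>v\<in>\<Phi> \<omega>. \<Sum>w\<in>\<Phi> \<omega> - {v}. F v * G w)" if "\<omega> \<in> space M" for \<omega>
    by (rule sum_distinct_tuples_2[OF Phi_finite[OF that]])
  have "(\<integral>x. F (x 0) * G (x 1) * rho 2 x \<partial>mu_pow 2) = (\<integral>x. F (x 0) * G (x 1) * (c^2 - (K (x 0) (x 1))^2) \<partial>mu_pow 2)"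
    unfolding ldet_2
  proof (rule Bochner_Integration.integral_cong[OF refl])
    fix x assume "x \<in> space (mu_pow 2)"
    then have "x 0 \<in> space \<mu>" "x 1 \<in> space \<mu>" by (auto simp: space_PiM PiE_def Pi_def)
    then show "F (x 0) * G (x 1) * (K (x 0) (x 0) * K (x 1) (x 1) - K (x 0) (x 1) * K (x 1) (x 0)) = F (x 0) * G (x 1) * (c^2 - (K (x 0) (x 1))^2)"
      using K_sym[of "x 0" "x 1"] by (simp add: K_diag power2_eq_square)
  qed
  also have "\<dots> = (\<integral>x. (\<integral>y. F x * G y * (c^2 - (K x y)^2) \<partial>\<mu>) \<partial>\<mu>)"
    by (rule KK.integral_PiM_2[OF h])
  also have "\<dots> = (\<integral>x. c^2 * F x * (\<integral>y. G y \<partial>\<mu>) - (\<integral>y. F x * G y * (K x y)^2 \<partial>\<mu>) \<partial>\<mu>)"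
  proof (rule Bochner_Integration.integral_cong[OF refl])
    fix x assume x: "x \<in> space \<mu>"
    have "integrable \<mu> (\<lambda>y. F x * G y * (K x y)^2)"
      by (intro finite_measure.bounded_measurable_integrable KK.finite_measure_axioms bounded_measurable_mult bounded_measurable_const G bounded_measurable_power K_section x)
    moreover have "integrable \<mu> G" using G by (intro finite_measure.bounded_measurable_integrable KK.finite_measure_axioms)
    ultimately have "(\<integral>y. c^2 * F x * G y - F x * G y * (K x y)^2 \<partial>\<mu>) = c^2 * F x * (\<integral>y. G y \<partial>\<mu>) - (\<integral>y. F x * G y * (K x y)^2 \<partial>\<mu>)"
      by simp
    then show "(\<integral>y. F x * G y * (c^2 - (K x y)^2) \<partial>\<mu>) = c^2 * F x * (\<integral>y. G y \<partial>\<mu>) - (\<integral>y. F x * G y * (K x y)^2 \<partial>\<mu>)"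
      by (simp add: right_diff_distrib mult_ac)
  qed
  also have "\<dots> = c^2 * (\<integral>x. F x \<partial>\<mu>) * (\<integral>x. G x \<partial>\<mu>) - (\<integral>x. (\<integral>y. F x * G y * (K x y)^2 \<partial>\<mu>) \<partial>\<mu>)"
  proof -
    have "integrable \<mu> F" using F by (intro finite_measure.bounded_measurable_integrable KK.finite_measure_axioms)
    moreover have "integrable \<mu> (\<lambda>x. \<integral>y. F x * G y * (K x y)^2 \<partial>\<mu>)"
      using finite_measure.bounded_measurable_integrable[OF KK.finite_measure_axioms finite_measure.bounded_measurable_integral[OF KK.finite_measure_axioms FGK]] by simp
    ultimately show ?thesis by simp
  qed
  finally have "(\<integral>x. F (x 0) * G (x 1) * rho 2 x \<partial>mu_pow 2) = c^2 * (\<integral>x. F x \<partial>\<mu>) * (\<integral>x. G x \<partial>\<mu>) - (\<integral>x. (\<integral>y. F x * G y * (K x y)^2 \<partial>\<mu>) \<partial>\<mu>)" .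
  with 1 show ?thesis
    by (subst (asm) has_bochner_integral_cong[OF refl 2 refl]) simp_all
qed

lemma square_sum_split:
  fixes F :: "'b \<Rightarrow> real"
  assumes "finite P" shows "(\<Sum>v\<in>P. F v)^2 = (\<Sum>v\<in>P. (F v)^2) + (\<Sum>v\<in>P. \<Sum>w\<in>P - {v}. F v * F w)"
proof -
  have "(\<Sum>v\<in>P. F v)^2 = (\<Sum>v\<in>P. \<Sum>w\<in>P. F v * F w)" by (simp add: power2_eq_square sum_product)
  also have "\<dots> = (\<Sum>v\<in>P. F v * F v + (\<Sum>w\<in>P - {v}. F v * F w))"
    using assms by (intro sum.cong refl) (simp add: sum.remove)
  finally show ?thesis by (simp add: sum.distrib power2_eq_square)
qed

lemma linear_statistic_variance:
  assumes F: "bounded_measurable \<mu> F"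
  defines "Y \<equiv> \<lambda>\<omega>. \<Sum>v\<in>\<Phi> \<omega>. F v"
  shows "integrable M Y" "expectation Y = c * (\<integral>x. F x \<partial>\<mu>)" "integrable M (\<lambda>\<omega>. (Y \<omega>)^2)"
    "variance Y = c * (\<integral>x. (F x)^2 \<partial>\<mu>) - (\<integral>x. (\<integral>y. F x * F y * (K x y)^2 \<partial>\<mu>) \<partial>\<mu>)"
proof -
  have hY: "has_bochner_integral M Y (c * (\<integral>x. F x \<partial>\<mu>))" unfolding Y_def by (rule has_integral_linear[OF F])
  then show iY: "integrable M Y" and eY: "expectation Y = c * (\<integral>x. F x \<partial>\<mu>)" by (auto simp: has_bochner_integral_iff)
  have F2: "bounded_measurable \<mu> (\<lambda>x. (F x)^2)" using F by (rule bounded_measurable_power)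
  have h2: "has_bochner_integral M (\<lambda>\<omega>. (\<Sum>v\<in>\<Phi> \<omega>. (F v)^2) + (\<Sum>v\<in>\<Phi> \<omega>. \<Sum>w\<in>\<Phi> \<omega> - {v}. F v * F w))
     (c * (\<integral>x. (F x)^2 \<partial>\<mu>) + (c^2 * (\<integral>x. F x \<partial>\<mu>) * (\<integral>x. F x \<partial>\<mu>) - (\<integral>x. (\<integral>y. F x * F y * (K x y)^2 \<partial>\<mu>) \<partial>\<mu>)))"
    by (intro has_bochner_integral_add has_integral_linear has_integral_pairs F F2)
  have sq: "(Y \<omega>)^2 = (\<Sum>v\<in>\<Phi> \<omega>. (F v)^2) + (\<Sum>v\<in>\<Phi> \<omega>. \<Sum>w\<in>\<Phi> \<omega> - {v}. F v * F w)" if "\<omega> \<in> space M" for \<omega>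
    unfolding Y_def by (rule square_sum_split[OF Phi_finite[OF that]])
  have h: "has_bochner_integral M (\<lambda>\<omega>. (Y \<omega>)^2)
     (c * (\<integral>x. (F x)^2 \<partial>\<mu>) + (c^2 * (\<integral>x. F x \<partial>\<mu>) * (\<integral>x. F x \<partial>\<mu>) - (\<integral>x. (\<integral>y. F x * F y * (K x y)^2 \<partial>\<mu>) \<partial>\<mu>)))"
    using h2 by (subst has_bochner_integral_cong[OF refl sq refl])
  then show i2: "integrable M (\<lambda>\<omega>. (Y \<omega>)^2)" by (auto simp: has_bochner_integral_iff)
  have "variance Y = expectation (\<lambda>\<omega>. (Y \<omega>)^2) - (expectation Y)^2"
    by (rule variance_eq[OF iY i2])
  then show "variance Y = c * (\<integral>x. (F x)^2 \<partial>\<mu>) - (\<integral>x. (\<integral>y. F x * F y * (K x y)^2 \<partial>\<mu>) \<partial>\<mu>)"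
    using h eY by (simp add: has_bochner_integral_iff power2_eq_square)
qed

text \<open>For the constant function 1 the two terms of the variance formula are equal by
  \<open>K_square\<close>, so the number of points is almost surely its mean, the rank.\<close>

lemma card_Phi:
  assumes n: "real n = c * mass" shows "AE \<omega> in M. card (\<Phi> \<omega>) = n"
proof -
  let ?Y = "\<lambda>\<omega>. \<Sum>v\<in>\<Phi> \<omega>. 1::real"
  note Y = linear_statistic_variance[OF bounded_measurable_const[of \<mu> 1]]
  have "(\<integral>x. (\<integral>y. (K x y)^2 \<partial>\<mu>) \<partial>\<mu>) = (\<integral>x. c \<partial>\<mu>)"
    by (rule Bochner_Integration.integral_cong) (auto simp: K_square)
  then have "variance ?Y = 0" using Y(4) by (simp add: mult.commute)
  moreover have "integrable M (\<lambda>\<omega>. (?Y \<omega> - expectation ?Y)^2)"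
    using Y(1,3) by (simp add: power2_diff)
  ultimately have "AE \<omega> in M. (?Y \<omega> - expectation ?Y)^2 = 0"
    using integral_nonneg_eq_0_iff_AE[of M "\<lambda>\<omega>. (?Y \<omega> - expectation ?Y)^2"] by simp
  then show ?thesis
  proof eventually_elim
    case (elim \<omega>)
    then have "real (card (\<Phi> \<omega>)) = c * mass" using Y(2) by (simp add: mult.commute)
    then show ?case using n by simp
  qed
qed

end

section \<open>Characteristic functions of linear statistics\<close>

context determinantal_process
begin

lemma integral_double_sum:
  fixes f :: "nat \<Rightarrow> nat \<Rightarrow> 'b \<Rightarrow> complex"
  assumes "\<And>a b. a < n \<Longrightarrow> b < n \<Longrightarrow> integrable \<mu> (f a b)"
  shows "(\<integral>x. (\<Sum>a<n. \<Sum>b<n. f a b x) \<partial>\<mu>) = (\<Sum>a<n. \<Sum>b<n. \<integral>x. f a b x \<partial>\<mu>)"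
proof -
  have "(\<integral>x. (\<Sum>a<n. \<Sum>b<n. f a b x) \<partial>\<mu>) = (\<Sum>a<n. \<integral>x. (\<Sum>b<n. f a b x) \<partial>\<mu>)"
    by (rule Bochner_Integration.integral_sum) (rule Bochner_Integration.integrable_sum, use assms in auto)
  also have "\<dots> = (\<Sum>a<n. \<Sum>b<n. \<integral>x. f a b x \<partial>\<mu>)"
    by (rule sum.cong[OF refl], rule Bochner_Integration.integral_sum) (use assms in auto)
  finally show ?thesis .
qed

lemma integral_mu_prod:
  fixes f :: "nat \<Rightarrow> 'b \<Rightarrow> complex"
  assumes "\<And>i. i < n \<Longrightarrow> bounded_measurable \<mu> (f i)"
  shows "(\<integral>x. (\<Prod>i<n. f i (x i)) \<partial>mu_pow n) = (\<Prod>i<n. \<integral>x. f i x \<partial>\<mu>)"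
proof -
  interpret product_sigma_finite "\<lambda>_::nat. \<mu>" by (rule KK.product_sigma_finite_const)
  show ?thesis using assms by (intro product_integral_prod finite_lessThan KK.bounded_measurable_integrable) auto
qed

text \<open>With exactly as many points as basis functions, the kernel matrix is a product of a
  square matrix and its transpose.\<close>

lemma rho_square:
  assumes k: "\<And>x y. x \<in> space \<mu> \<Longrightarrow> y \<in> space \<mu> \<Longrightarrow> K x y = (\<Sum>a<n. \<phi> a x * \<phi> a y)" and x: "x \<in> space (mu_pow n)"
  shows "rho n x = (ldet n (\<lambda>i a. \<phi> a (x i)))^2"
proof -
  let ?F = "Matrix.mat n n (\<lambda>(i,a). \<phi> a (x i))"
  have xs: "x i \<in> space \<mu>" if "i < n" for i using x that by (auto simp: space_PiM PiE_def Pi_def)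
  have "Matrix.mat n n (\<lambda>(a, b). K (x a) (x b)) = ?F * ?F\<^sup>T"
    by (rule eq_matI) (auto simp: scalar_prod_def k xs lessThan_atLeast0)
  then show ?thesis unfolding ldet_eq_det
    by (simp add: det_mult[of _ n] det_transpose[of _ n] power2_eq_square)
qed

text \<open>Andreief's identity: both determinants are expanded and integrated term by term.\<close>

lemma integral_prod_rho:
  fixes \<psi> :: "'b \<Rightarrow> complex"
  assumes os: "orthonormal_system n \<phi>" and k: "\<And>x y. x \<in> space \<mu> \<Longrightarrow> y \<in> space \<mu> \<Longrightarrow> K x y = (\<Sum>a<n. \<phi> a x * \<phi> a y)"
    and \<psi>: "bounded_measurable \<mu> \<psi>"
  shows "(\<integral>x. (\<Prod>i<n. \<psi> (x i)) * of_real (rho n x) \<partial>mu_pow n)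
    = fact n * Determinant.det (Matrix.mat n n (\<lambda>(a,b). \<integral>x. \<psi> x * of_real (\<phi> a x) * of_real (\<phi> b x) \<partial>\<mu>))"
proof -
  interpret F: finite_measure "mu_pow n" by (rule finite_measure_pow)
  define A where "A = (\<lambda>a b. \<integral>x. \<psi> x * of_real (\<phi> a x) * of_real (\<phi> b x) \<partial>\<mu>)"
  let ?S = "{p. p permutes {..<n}}"
  define h where "h = (\<lambda>p q x. (of_int (sign p) * of_int (sign q)) * (\<Prod>i<n. \<psi> (x i) * complex_of_real (\<phi> (p i) (x i)) * complex_of_real (\<phi> (q i) (x i))))"
  have pb: "bounded_measurable \<mu> (\<phi> a)" if "a < n" for a using os that by (simp add: orthonormal_system_def)
  have pc: "bounded_measurable \<mu> (\<lambda>x. complex_of_real (\<phi> a x))" if "a < n" for a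
    using pb[OF that] by (auto simp: bounded_measurable_def)
  have perm: "p i < n" if "p \<in> ?S" "i < n" for p i using that permutes_in_image[of p "{..<n}" i] by auto
  have bm: "bounded_measurable \<mu> (\<lambda>x. \<psi> x * complex_of_real (\<phi> (p i) x) * complex_of_real (\<phi> (q i) x))"
    if "p \<in> ?S" "q \<in> ?S" "i < n" for p q i
    using pc[OF perm[OF that(1,3)]] pc[OF perm[OF that(2,3)]] \<psi> by (intro bounded_measurable_mult)
  have hi: "integrable (mu_pow n) (h p q)" if pq: "p \<in> ?S" "q \<in> ?S" for p q
  proof -
    have "bounded_measurable (mu_pow n) (\<lambda>x. \<Prod>i<n. \<psi> (x i) * complex_of_real (\<phi> (p i) (x i)) * complex_of_real (\<phi> (q i) (x i)))"
    proof (rule bounded_measurable_prod)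
      fix i assume "i \<in> {..<n}"
      then show "bounded_measurable (mu_pow n) (\<lambda>x. \<psi> (x i) * complex_of_real (\<phi> (p i) (x i)) * complex_of_real (\<phi> (q i) (x i)))"
        by (intro bounded_measurable_component[OF bm[OF pq]]) auto
    qed
    then show ?thesis unfolding h_def
      by (intro F.bounded_measurable_integrable bounded_measurable_mult[OF bounded_measurable_const])
  qed
  have exp: "(\<Prod>i<n. \<psi> (x i)) * of_real (rho n x) = (\<Sum>p\<in>?S. \<Sum>q\<in>?S. h p q x)" if x: "x \<in> space (mu_pow n)" for x
  proof -
    have rs: "rho n x = (ldet n (\<lambda>i a. \<phi> a (x i)))^2" by (rule rho_square[OF k x])
    show ?thesis unfolding rs unfolding ldet_def power2_eq_square h_def
    by (simp add: sum_product sum_distrib_left prod.distrib mult_ac)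
  qed
  have "(\<integral>x. (\<Prod>i<n. \<psi> (x i)) * of_real (rho n x) \<partial>mu_pow n) = (\<integral>x. (\<Sum>p\<in>?S. \<Sum>q\<in>?S. h p q x) \<partial>mu_pow n)"
    by (rule Bochner_Integration.integral_cong[OF refl exp])
  also have "\<dots> = (\<Sum>p\<in>?S. \<Sum>q\<in>?S. (\<integral>x. h p q x \<partial>mu_pow n))"
  proof -
    have "(\<integral>x. (\<Sum>p\<in>?S. \<Sum>q\<in>?S. h p q x) \<partial>mu_pow n) = (\<Sum>p\<in>?S. (\<integral>x. (\<Sum>q\<in>?S. h p q x) \<partial>mu_pow n))"
      by (rule Bochner_Integration.integral_sum) (rule Bochner_Integration.integrable_sum, rule hi)
    also have "\<dots> = (\<Sum>p\<in>?S. \<Sum>q\<in>?S. (\<integral>x. h p q x \<partial>mu_pow n))"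
      by (rule sum.cong[OF refl], rule Bochner_Integration.integral_sum, rule hi)
    finally show ?thesis .
  qed
  also have "\<dots> = (\<Sum>p\<in>?S. \<Sum>q\<in>?S. of_int (sign p) * of_int (sign q) * (\<Prod>i<n. A (p i) (q i)))"
  proof (intro sum.cong refl)
    fix p q assume pq: "p \<in> ?S" "q \<in> ?S"
    show "(\<integral>x. h p q x \<partial>mu_pow n) = of_int (sign p) * of_int (sign q) * (\<Prod>i<n. A (p i) (q i))"
      unfolding h_def A_def using integral_mu_prod[of n "\<lambda>i x. \<psi> x * complex_of_real (\<phi> (p i) x) * complex_of_real (\<phi> (q i) x)"] bm[OF pq]
      by simp
  qed
  also have "\<dots> = (\<Sum>p\<in>?S. \<Sum>q\<in>?S. of_int (sign q) * (\<Prod>i<n. A i (q i)))"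
  proof (rule sum.cong[OF refl])
    fix p assume p: "p \<in> ?S"
    then have pp: "p permutes {..<n}" by simp
    \<comment> \<open>The substitution of q composed with the inverse of p shows that the inner sum
      does not depend on p; the outer sum then contributes the factor \<open>fact n\<close>.\<close>
    have "(\<Sum>q\<in>?S. of_int (sign q) * (\<Prod>i<n. A i (q i))) = (\<Sum>q\<in>?S. of_int (sign (q \<circ> inv_into UNIV p)) * (\<Prod>i<n. A i ((q \<circ> inv_into UNIV p) i)))"
      by (rule sum.reindex_bij_betw[symmetric, OF bij_betwI[where g = "\<lambda>q. q \<circ> p"]])
        (use pp in \<open>auto simp: permutes_compose permutes_inv comp_assoc permutes_inv_o\<close>)
    also have "\<dots> = (\<Sum>q\<in>?S. of_int (sign p) * of_int (sign q) * (\<Prod>i<n. A (p i) (q i)))"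
    proof (rule sum.cong[OF refl])
      fix q assume q: "q \<in> ?S"
      have "permutation p" "permutation q" "permutation (inv_into UNIV p)"
        using pp q permutes_inv[OF pp] by (auto simp: permutation_permutes)
      then have "sign (q \<circ> inv_into UNIV p) = sign p * sign q" by (simp add: sign_compose sign_inverse)
      moreover have "(\<Prod>i<n. A i ((q \<circ> inv_into UNIV p) i)) = (\<Prod>i<n. A (p i) (q i))"
      proof -
        have "(\<Prod>i<n. A i ((q \<circ> inv_into UNIV p) i)) = (\<Prod>i<n. A (p i) ((q \<circ> inv_into UNIV p) (p i)))"
          by (rule prod.permute[OF pp, unfolded comp_def])
        then show ?thesis using permutes_inverses(2)[OF pp] by simp
      qed
      ultimately show "of_int (sign (q \<circ> inv_into UNIV p)) * (\<Prod>i<n. A i ((q \<circ> inv_into UNIV p) i)) = of_int (sign p) * of_int (sign q) * (\<Prod>i<n. A (p i) (q i))"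
        by simp
    qed
    finally show "(\<Sum>q\<in>?S. of_int (sign p) * of_int (sign q) * (\<Prod>i<n. A (p i) (q i))) = (\<Sum>q\<in>?S. of_int (sign q) * (\<Prod>i<n. A i (q i)))" ..
  qed
  also have "\<dots> = fact n * (\<Sum>q\<in>?S. of_int (sign q) * (\<Prod>i<n. A i (q i)))"
    by (simp add: card_permutations[of "{..<n}" n])
  also have "(\<Sum>q\<in>?S. of_int (sign q) * (\<Prod>i<n. A i (q i))) = Determinant.det (Matrix.mat n n (\<lambda>(a,b). A a b))"
    by (subst det_def'[of _ n]) (auto simp: lessThan_atLeast0 permutes_in_image intro!: sum.cong prod.cong)
  finally show ?thesis by (simp add: A_def)
qed

text \<open>A tuple of n distinct points of an n-point set enumerates it, so all n! summands
  coincide.\<close>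

lemma prod_over_Phi:
  fixes \<psi> :: "'b \<Rightarrow> complex"
  assumes P: "finite P" "card P = n"
  shows "(\<Sum>x\<in>distinct_tuples n P. \<Prod>i<n. \<psi> (x i)) = fact n * (\<Prod>v\<in>P. \<psi> v)"
proof -
  have "(\<Prod>i<n. \<psi> (x i)) = (\<Prod>v\<in>P. \<psi> v)" if x: "x \<in> distinct_tuples n P" for x
  proof -
    have i: "inj_on x {..<n}" "x ` {..<n} \<subseteq> P" using x by (auto simp: distinct_tuples_def)
    then have "x ` {..<n} = P" using P by (intro card_subset_eq) (auto simp: card_image)
    then show ?thesis using prod.reindex[OF i(1), of \<psi>] by simp
  qed
  then have "(\<Sum>x\<in>distinct_tuples n P. \<Prod>i<n. \<psi> (x i)) = of_nat (card (distinct_tuples n P)) * (\<Prod>v\<in>P. \<psi> v)"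
    by simp
  also have "card (distinct_tuples n P) = fact n"
    using P by (simp add: card_distinct_tuples fact_prod_rev lessThan_atLeast0)
  finally show ?thesis by simp
qed

text \<open>Almost surely there are exactly n points, so the n-point density alone determines the
  expectation and no Fredholm series arises.\<close>

lemma expectation_prod:
  fixes \<psi> :: "'b \<Rightarrow> complex"
  assumes os: "orthonormal_system n \<phi>" and k: "\<And>x y. x \<in> space \<mu> \<Longrightarrow> y \<in> space \<mu> \<Longrightarrow> K x y = (\<Sum>a<n. \<phi> a x * \<phi> a y)"
    and n: "real n = c * mass" and \<psi>: "bounded_measurable \<mu> \<psi>"
    and meas: "(\<lambda>\<omega>. \<Prod>v\<in>\<Phi> \<omega>. \<psi> v) \<in> borel_measurable M"
  shows "expectation (\<lambda>\<omega>. \<Prod>v\<in>\<Phi> \<omega>. \<psi> v) = Determinant.det (Matrix.mat n n (\<lambda>(a,b). \<integral>x. \<psi> x * of_real (\<phi> a x) * of_real (\<phi> b x) \<partial>\<mu>))"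
proof -
  have n1: "n \<ge> 1" using n c_pos mass_pos by (cases n) auto
  have bp: "bounded_measurable (mu_pow n) (\<lambda>x. \<Prod>i<n. \<psi> (x i))"
    by (intro bounded_measurable_prod bounded_measurable_component[OF \<psi>]) simp
  note h = expectation_tuples_complex[OF n1 bp]
  let ?D = "Determinant.det (Matrix.mat n n (\<lambda>(a,b). \<integral>x. \<psi> x * of_real (\<phi> a x) * of_real (\<phi> b x) \<partial>\<mu>))"
  have h': "has_bochner_integral M (\<lambda>\<omega>. (\<Sum>x\<in>distinct_tuples n (\<Phi> \<omega>). \<Prod>i<n. \<psi> (x i)) / fact n) (fact n * ?D / fact n)"
  proof (rule has_bochner_integral_divide)
    have "(\<integral>x. (\<Prod>i<n. \<psi> (x i)) * of_real (rho n x) \<partial>mu_pow n) = fact n * ?D"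
      by (rule integral_prod_rho[OF os k \<psi>])
    then show "has_bochner_integral M (\<lambda>\<omega>. \<Sum>x\<in>distinct_tuples n (\<Phi> \<omega>). \<Prod>i<n. \<psi> (x i)) (fact n * ?D)"
      using h by (simp only:)
  qed
  have "AE \<omega> in M. (\<Sum>x\<in>distinct_tuples n (\<Phi> \<omega>). \<Prod>i<n. \<psi> (x i)) / fact n = (\<Prod>v\<in>\<Phi> \<omega>. \<psi> v)"
    using card_Phi[OF n] AE_space
    by eventually_elim (simp add: prod_over_Phi[OF Phi_finite])
  then have "expectation (\<lambda>\<omega>. \<Prod>v\<in>\<Phi> \<omega>. \<psi> v) = expectation (\<lambda>\<omega>. (\<Sum>x\<in>distinct_tuples n (\<Phi> \<omega>). \<Prod>i<n. \<psi> (x i)) / fact n)"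
    using h' meas by (intro integral_cong_AE) (auto simp: has_bochner_integral_iff)
  then show ?thesis using h' by (simp add: has_bochner_integral_iff)
qed

lemma bounded_measurable_of_real: "bounded_measurable N f \<Longrightarrow> bounded_measurable N (\<lambda>x. complex_of_real (f x))"
  by (auto simp: bounded_measurable_def)

text \<open>The eigenvalues of the compression of a multiplication operator lie in its numerical range.\<close>

lemma compression_eigenvalue_bound:
  assumes os: "orthonormal_system n \<phi>" and u: "bounded_measurable \<mu> u"
    and bound: "\<And>x. x \<in> space \<mu> \<Longrightarrow> norm (u x :: complex) \<le> \<epsilon>"
    and ev: "eigenvalue (Matrix.mat n n (\<lambda>(a,b). \<integral>x. u x * of_real (\<phi> a x) * of_real (\<phi> b x) \<partial>\<mu>)) k"
  shows "norm k \<le> \<epsilon>"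
proof -
  let ?A = "Matrix.mat n n (\<lambda>(a,b). \<integral>x. u x * of_real (\<phi> a x) * of_real (\<phi> b x) \<partial>\<mu>)"
  obtain v where v: "v \<in> carrier_vec n" "v \<noteq> 0\<^sub>v n" "?A *\<^sub>v v = k \<cdot>\<^sub>v v"
    using ev by (auto simp: eigenvalue_def eigenvector_def)
  define w where "w = (\<lambda>i. vec_index v i)"
  \<comment> \<open>The eigenvector as a function in the range of the projection. Pairing the
    eigenvalue equation with it gives k |w|^2 as the integral of u |h|^2.\<close>
  define h where "h = (\<lambda>x. \<Sum>b<n. w b * complex_of_real (\<phi> b x))"
  have pb: "bounded_measurable \<mu> (\<lambda>x. complex_of_real (\<phi> a x))" if "a < n" for a
    using os that by (intro bounded_measurable_of_real) (simp add: orthonormal_system_def)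
  have e: "(\<Sum>b<n. (\<integral>x. u x * of_real (\<phi> a x) * of_real (\<phi> b x) \<partial>\<mu>) * w b) = k * w a" if "a < n" for a
  proof -
    have "vec_index (?A *\<^sub>v v) a = (\<Sum>b<n. (\<integral>x. u x * of_real (\<phi> a x) * of_real (\<phi> b x) \<partial>\<mu>) * w b)"
      using that v(1) by (simp add: w_def scalar_prod_def lessThan_atLeast0)
    then show ?thesis unfolding v(3) using that v(1) by (simp add: w_def)
  qed
  have int: "integrable \<mu> (\<lambda>x. u x * of_real (\<phi> a x) * of_real (\<phi> b x))" if "a < n" "b < n" for a b
    by (intro KK.bounded_measurable_integrable bounded_measurable_mult u pb that)
  have ints: "integrable \<mu> (\<lambda>x. complex_of_real (\<phi> a x) * of_real (\<phi> b x))" if "a < n" "b < n" for a b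
    by (intro KK.bounded_measurable_integrable bounded_measurable_mult pb that)
  have nh: "of_real ((norm (h x))^2) = (\<Sum>a<n. \<Sum>b<n. cnj (w a) * w b * (of_real (\<phi> a x) * of_real (\<phi> b x)))" for x
  proof -
    have "complex_of_real ((norm (h x))^2) = cnj (h x) * h x" unfolding complex_norm_square by (rule mult.commute)
    also have "\<dots> = (\<Sum>a<n. \<Sum>b<n. cnj (w a) * w b * (of_real (\<phi> a x) * of_real (\<phi> b x)))"
      unfolding h_def cnj_sum sum_product by (intro sum.cong refl) (simp add: mult_ac)
    finally show ?thesis .
  qed
  have hb: "bounded_measurable \<mu> h" unfolding h_def
    by (intro bounded_measurable_sum bounded_measurable_mult bounded_measurable_const pb) simp
  have hb2: "bounded_measurable \<mu> (\<lambda>x. (norm (h x))^2)"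
    by (intro bounded_measurable_power bounded_measurable_norm hb)
  define W where "W = (\<Sum>a<n. (norm (w a))^2)"
  have hW: "(\<integral>x. (norm (h x))^2 \<partial>\<mu>) = W"
  proof -
    have "complex_of_real (\<integral>x. (norm (h x))^2 \<partial>\<mu>) = (\<integral>x. of_real ((norm (h x))^2) \<partial>\<mu>)"
      by (rule integral_complex_of_real[symmetric])
    also have "\<dots> = (\<integral>x. (\<Sum>a<n. \<Sum>b<n. cnj (w a) * w b * (of_real (\<phi> a x) * of_real (\<phi> b x))) \<partial>\<mu>)"
      unfolding nh ..
    also have "\<dots> = (\<Sum>a<n. \<Sum>b<n. cnj (w a) * w b * (\<integral>x. of_real (\<phi> a x) * of_real (\<phi> b x) \<partial>\<mu>))"
      by (subst integral_double_sum) (use ints in \<open>auto intro!: integrable_mult_right\<close>)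
    also have "\<dots> = (\<Sum>a<n. \<Sum>b<n. cnj (w a) * w b * of_bool (a = b))"
    proof (intro sum.cong refl)
      fix a b assume "a \<in> {..<n}" "b \<in> {..<n}"
      then have "(\<integral>x. \<phi> a x * \<phi> b x \<partial>\<mu>) = of_bool (a = b)" using os by (simp add: orthonormal_system_def)
      then have "(\<integral>x. complex_of_real (\<phi> a x * \<phi> b x) \<partial>\<mu>) = of_real (of_bool (a = b))"
        using integral_complex_of_real[of \<mu> "\<lambda>x. \<phi> a x * \<phi> b x"] by metis
      then show "cnj (w a) * w b * (\<integral>x. of_real (\<phi> a x) * of_real (\<phi> b x) \<partial>\<mu>) = cnj (w a) * w b * of_bool (a = b)"
        by (simp add: of_bool_def split: if_splits)
    qed
    also have "\<dots> = (\<Sum>a<n. cnj (w a) * w a)"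
      by (simp add: of_bool_def if_distrib cong: if_cong)
    also have "\<dots> = of_real W" unfolding W_def of_real_sum
      by (intro sum.cong refl) (simp only: complex_norm_square mult.commute)
    finally show ?thesis using of_real_eq_iff by blast
  qed
  have W0: "W > 0"
  proof -
    have "\<exists>a<n. w a \<noteq> 0"
    proof (rule ccontr)
      assume "\<not> (\<exists>a<n. w a \<noteq> 0)"
      then have "v = 0\<^sub>v n" using v(1) by (intro eq_vecI) (auto simp: w_def)
      with v(2) show False by simp
    qed
    then obtain a where "a < n" "w a \<noteq> 0" by blast
    then have "0 < (norm (w a))^2" "(norm (w a))^2 \<le> W" unfolding W_def by (auto intro!: member_le_sum)
    then show ?thesis by linarith
  qed
  have "k * of_real W = (\<Sum>a<n. cnj (w a) * (k * w a))"
    unfolding W_def of_real_sum sum_distrib_left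
    by (intro sum.cong refl) (simp only: complex_norm_square mult_ac)
  also have "\<dots> = (\<Sum>a<n. \<Sum>b<n. cnj (w a) * w b * (\<integral>x. u x * of_real (\<phi> a x) * of_real (\<phi> b x) \<partial>\<mu>))"
    by (intro sum.cong refl) (simp add: e[symmetric] sum_distrib_left mult_ac)
  also have "\<dots> = (\<integral>x. (\<Sum>a<n. \<Sum>b<n. cnj (w a) * w b * (u x * of_real (\<phi> a x) * of_real (\<phi> b x))) \<partial>\<mu>)"
    by (subst integral_double_sum) (use int in \<open>auto intro!: integrable_mult_right\<close>)
  also have "\<dots> = (\<integral>x. u x * of_real ((norm (h x))^2) \<partial>\<mu>)"
    unfolding nh by (simp add: sum_distrib_left mult_ac)
  finally have kW: "k * of_real W = (\<integral>x. u x * of_real ((norm (h x))^2) \<partial>\<mu>)" .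
  have "norm k * W = norm (k * of_real W)" using W0 by (simp add: norm_mult)
  also have "\<dots> \<le> (\<integral>x. norm (u x * of_real ((norm (h x))^2)) \<partial>\<mu>)" unfolding kW by (rule integral_norm_bound)
  also have "\<dots> \<le> (\<integral>x. \<epsilon> * (norm (h x))^2 \<partial>\<mu>)"
  proof (rule integral_mono)
    show "integrable \<mu> (\<lambda>x. norm (u x * of_real ((norm (h x))^2)))"
      by (intro KK.bounded_measurable_integrable bounded_measurable_norm bounded_measurable_mult u bounded_measurable_of_real hb2)
    show "integrable \<mu> (\<lambda>x. \<epsilon> * (norm (h x))^2)"
      by (intro KK.bounded_measurable_integrable bounded_measurable_mult bounded_measurable_const hb2)
    show "norm (u x * of_real ((norm (h x))^2)) \<le> \<epsilon> * (norm (h x))^2" if "x \<in> space \<mu>" for x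
      using bound[OF that] by (simp add: norm_mult norm_power mult_right_mono)
  qed
  also have "\<dots> = \<epsilon> * W" using hW by simp
  finally show ?thesis using W0 by simp
qed

text \<open>The matrix of the determinant is 1 + A, with A the compression of u = exp(i t F) - 1.
  Its trace is c times the integral of u, as the diagonal is constant, and the trace of A^2 is the
  integral of u(x) u(y) K(x, y)^2. Taylor expansion of u turns trace A - trace(A^2)/2 into i t E Y -
  t^2 Var Y / 2.\<close>

lemma characteristic_function_expansion:
  assumes F: "bounded_measurable \<mu> F" and B: "\<And>x. x \<in> space \<mu> \<Longrightarrow> \<bar>F x\<bar> \<le> B" and t: "\<bar>t\<bar> * B \<le> 1/2"
  defines "Y \<equiv> \<lambda>\<omega>. \<Sum>v\<in>\<Phi> \<omega>. F v"
  obtains z where "expectation (\<lambda>\<omega>. exp (\<i> * of_real (t * Y \<omega>))) = exp z"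
    "norm (z - (\<i> * of_real (t * expectation Y) - of_real (t^2 * variance Y / 2))) \<le> 3 * (c * mass) * (\<bar>t\<bar> * B) ^ 3"
proof -
  define \<epsilon> where "\<epsilon> = \<bar>t\<bar> * B"
  obtain n \<phi> where n: "real n = c * mass" and os: "orthonormal_system n \<phi>"
    and k: "\<And>x y. x \<in> space \<mu> \<Longrightarrow> y \<in> space \<mu> \<Longrightarrow> K x y = (\<Sum>a<n. \<phi> a x * \<phi> a y)"
    using orthonormal_basis_exists by metis
  define u where "u = (\<lambda>x. exp (\<i> * of_real (t * F x)) - 1)"
  \<comment> \<open>The first-order part of u. The trace of A needs u up to second order; the trace
    of A^2 is already quadratic in u and needs only g.\<close>
  define g where "g = (\<lambda>x. \<i> * complex_of_real (t * F x))"
  have Fm: "F \<in> borel_measurable \<mu>" using F by (rule bounded_measurableD)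
  have e0: "\<epsilon> \<ge> 0"
  proof -
    obtain x where "x \<in> space \<mu>" using mass_pos by (metis measure_empty equals0I less_irrefl)
    from B[OF this] have "B \<ge> 0" by linarith
    then show ?thesis by (simp add: \<epsilon>_def)
  qed
  have tF: "\<bar>t * F x\<bar> \<le> \<epsilon>" if "x \<in> space \<mu>" for x
    using B[OF that] by (simp add: \<epsilon>_def abs_mult mult_left_mono)
  have u0: "norm (u x) \<le> \<epsilon>" if "x \<in> space \<mu>" for x
    using iexp_approx1[of "t * F x" 0] tF[OF that] by (simp add: u_def)
  have u1: "norm (u x - g x) \<le> \<epsilon>^2 / 2" if "x \<in> space \<mu>" for x
  proof -
    have "norm (u x - g x) \<le> \<bar>t * F x\<bar>^2 / 2"
      using iexp_approx1[of "t * F x" 1] by (simp add: u_def g_def numeral_2_eq_2 diff_diff_eq)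
    also have "\<dots> \<le> \<epsilon>^2 / 2" using tF[OF that] by (intro divide_right_mono power_mono) auto
    finally show ?thesis .
  qed
  have u2: "norm (u x - (g x + (g x)^2 / 2)) \<le> \<epsilon>^3 / 6" if "x \<in> space \<mu>" for x
  proof -
    have "norm (u x - (g x + (g x)^2 / 2)) \<le> \<bar>t * F x\<bar>^3 / 6"
      using iexp_approx1[of "t * F x" 2] by (simp add: u_def g_def numeral_2_eq_2 numeral_3_eq_3 diff_diff_eq fact_numeral add.assoc)
    also have "\<dots> \<le> \<epsilon>^3 / 6" using tF[OF that] by (intro divide_right_mono power_mono) auto
    finally show ?thesis .
  qed
  have gb: "bounded_measurable \<mu> g" unfolding g_def
    by (intro bounded_measurable_mult bounded_measurable_const bounded_measurable_of_real F)
  have ub: "bounded_measurable \<mu> u"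
    by (rule bounded_measurableI[OF _ u0]) (auto simp: u_def intro!: borel_measurable_diff measurable_compose[OF Fm] borel_measurable_continuous_onI continuous_intros)
  have g0: "norm (g x) \<le> \<epsilon>" if "x \<in> space \<mu>" for x
    using tF[OF that] by (simp add: g_def norm_mult)
  define A where "A = Matrix.mat n n (\<lambda>(a,b). \<integral>x. u x * of_real (\<phi> a x) * of_real (\<phi> b x) \<partial>\<mu>)"
  have A: "A \<in> carrier_mat n n" by (simp add: A_def)
  have pb: "bounded_measurable \<mu> (\<lambda>x. complex_of_real (\<phi> a x))" if "a < n" for a
    using os that by (intro bounded_measurable_of_real) (simp add: orthonormal_system_def)
  have Ym: "Y \<in> borel_measurable M"
    using linear_statistic_variance(1)[OF F] by (auto simp: Y_def)
  have "expectation (\<lambda>\<omega>. exp (\<i> * of_real (t * Y \<omega>))) = expectation (\<lambda>\<omega>. \<Prod>v\<in>\<Phi> \<omega>. 1 + u v)"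
  proof (rule Bochner_Integration.integral_cong[OF refl])
    fix \<omega> assume "\<omega> \<in> space M"
    then have "finite (\<Phi> \<omega>)" by (rule Phi_finite)
    then show "exp (\<i> * of_real (t * Y \<omega>)) = (\<Prod>v\<in>\<Phi> \<omega>. 1 + u v)"
      by (simp add: u_def Y_def sum_distrib_left exp_sum[symmetric])
  qed
  also have "\<dots> = Determinant.det (Matrix.mat n n (\<lambda>(a,b). \<integral>x. (1 + u x) * of_real (\<phi> a x) * of_real (\<phi> b x) \<partial>\<mu>))"
  proof (rule expectation_prod[OF os k n])
    show "bounded_measurable \<mu> (\<lambda>v. 1 + u v)" by (intro bounded_measurable_add bounded_measurable_const ub)
    have "(\<lambda>\<omega>. exp (\<i> * of_real (t * Y \<omega>))) \<in> borel_measurable M"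
      by (intro measurable_compose[OF Ym] borel_measurable_continuous_onI continuous_intros)
    then show "(\<lambda>\<omega>. \<Prod>v\<in>\<Phi> \<omega>. 1 + u v) \<in> borel_measurable M"
      by (rule measurable_cong[THEN iffD1, rotated]) (simp add: u_def Y_def sum_distrib_left exp_sum[OF Phi_finite])
  qed
  also have "Matrix.mat n n (\<lambda>(a,b). \<integral>x. (1 + u x) * of_real (\<phi> a x) * of_real (\<phi> b x) \<partial>\<mu>) = 1\<^sub>m n + A"
  proof (rule eq_matI)
    fix a b assume "a < dim_row (1\<^sub>m n + A)" "b < dim_col (1\<^sub>m n + A)"
    then have ab: "a < n" "b < n" by (auto simp: A_def)
    have "(\<integral>x. \<phi> a x * \<phi> b x \<partial>\<mu>) = of_bool (a = b)" using os ab by (simp add: orthonormal_system_def)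
    then have d: "(\<integral>x. complex_of_real (\<phi> a x * \<phi> b x) \<partial>\<mu>) = of_real (of_bool (a = b))"
      using integral_complex_of_real[of \<mu> "\<lambda>x. \<phi> a x * \<phi> b x"] by metis
    have "integrable \<mu> (\<lambda>x. complex_of_real (\<phi> a x * \<phi> b x))" "integrable \<mu> (\<lambda>x. u x * of_real (\<phi> a x) * of_real (\<phi> b x))"
      unfolding of_real_mult by (intro KK.bounded_measurable_integrable bounded_measurable_mult pb ub ab)+
    then have "(\<integral>x. complex_of_real (\<phi> a x * \<phi> b x) + u x * of_real (\<phi> a x) * of_real (\<phi> b x) \<partial>\<mu>) = of_real (of_bool (a = b)) + (\<integral>x. u x * of_real (\<phi> a x) * of_real (\<phi> b x) \<partial>\<mu>)"
      unfolding d[symmetric] by (rule Bochner_Integration.integral_add)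
    then show "Matrix.mat n n (\<lambda>(a,b). \<integral>x. (1 + u x) * of_real (\<phi> a x) * of_real (\<phi> b x) \<partial>\<mu>) $$ (a, b) = (1\<^sub>m n + A) $$ (a, b)"
      using ab by (simp add: A_def distrib_right mult.assoc)
  qed (auto simp: A_def)
  finally have det: "expectation (\<lambda>\<omega>. exp (\<i> * of_real (t * Y \<omega>))) = Determinant.det (1\<^sub>m n + A)" .
  obtain z where z: "Determinant.det (1\<^sub>m n + A) = exp z" "norm (z - (mtrace A - mtrace (A * A) / 2)) \<le> 2 * real n * \<epsilon> ^ 3"
  proof (rule det_log_expansion[OF A])
    show "\<epsilon> \<le> 1/2" using t by (simp add: \<epsilon>_def)
    show "norm k \<le> \<epsilon>" if "eigenvalue A k" for k
      using compression_eigenvalue_bound[OF os ub u0 that[unfolded A_def]] .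
  qed
  have int: "integrable \<mu> (\<lambda>x. u x * of_real (\<phi> a x) * of_real (\<phi> b x))" if "a < n" "b < n" for a b
    by (intro KK.bounded_measurable_integrable bounded_measurable_mult ub pb that)
  have trA: "mtrace A = of_real c * (\<integral>x. u x \<partial>\<mu>)"
  proof -
    have "mtrace A = (\<integral>x. (\<Sum>a<n. u x * of_real (\<phi> a x) * of_real (\<phi> a x)) \<partial>\<mu>)"
      using int by (simp add: mtrace_def A_def Bochner_Integration.integral_sum)
    also have "\<dots> = (\<integral>x. of_real c * u x \<partial>\<mu>)"
    proof (rule Bochner_Integration.integral_cong[OF refl])
      fix x assume x: "x \<in> space \<mu>"
      have "complex_of_real c = of_real (\<Sum>a<n. \<phi> a x * \<phi> a x)" using k[OF x x] K_diag[OF x] by simp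
      then show "(\<Sum>a<n. u x * of_real (\<phi> a x) * of_real (\<phi> a x)) = of_real c * u x"
        by (simp add: sum_distrib_left sum_distrib_right mult_ac)
    qed
    finally show ?thesis by simp
  qed
  have uK: "bounded_measurable (\<mu> \<Otimes>\<^sub>M \<mu>) (\<lambda>z. a (fst z) * b (snd z) * of_real ((K (fst z) (snd z))^2))"
    if "bounded_measurable \<mu> a" "bounded_measurable \<mu> b" for a b :: "'b \<Rightarrow> complex"
    by (intro bounded_measurable_mult bounded_measurable_fst bounded_measurable_snd bounded_measurable_of_real that K_bm2)
  have trAA: "mtrace (A * A) = (\<integral>x. (\<integral>y. u x * u y * of_real ((K x y)^2) \<partial>\<mu>) \<partial>\<mu>)"
  proof -
    have "mtrace (A * A) = (\<Sum>a<n. \<Sum>b<n. (\<integral>x. u x * of_real (\<phi> a x) * of_real (\<phi> b x) \<partial>\<mu>) * (\<integral>y. u y * of_real (\<phi> b y) * of_real (\<phi> a y) \<partial>\<mu>))"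
      by (simp add: mtrace_def A_def scalar_prod_def lessThan_atLeast0)
    also have "\<dots> = (\<integral>x. (\<Sum>a<n. \<Sum>b<n. (u x * of_real (\<phi> a x) * of_real (\<phi> b x)) * (\<integral>y. u y * of_real (\<phi> b y) * of_real (\<phi> a y) \<partial>\<mu>)) \<partial>\<mu>)"
      by (subst integral_double_sum) (use int in \<open>auto intro!: integrable_mult_left\<close>)
    also have "\<dots> = (\<integral>x. (\<integral>y. u x * u y * of_real ((K x y)^2) \<partial>\<mu>) \<partial>\<mu>)"
    proof (rule Bochner_Integration.integral_cong[OF refl])
      fix x assume x: "x \<in> space \<mu>"
      have "(\<Sum>a<n. \<Sum>b<n. (u x * of_real (\<phi> a x) * of_real (\<phi> b x)) * (\<integral>y. u y * of_real (\<phi> b y) * of_real (\<phi> a y) \<partial>\<mu>))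
         = (\<integral>y. (\<Sum>a<n. \<Sum>b<n. (u x * of_real (\<phi> a x) * of_real (\<phi> b x)) * (u y * of_real (\<phi> b y) * of_real (\<phi> a y))) \<partial>\<mu>)"
        by (subst integral_double_sum) (use int in \<open>auto intro!: integrable_mult_right\<close>)
      also have "\<dots> = (\<integral>y. u x * u y * of_real ((K x y)^2) \<partial>\<mu>)"
      proof (rule Bochner_Integration.integral_cong[OF refl])
        fix y assume y: "y \<in> space \<mu>"
        show "(\<Sum>a<n. \<Sum>b<n. (u x * of_real (\<phi> a x) * of_real (\<phi> b x)) * (u y * of_real (\<phi> b y) * of_real (\<phi> a y))) = u x * u y * of_real ((K x y)^2)"
        proof -
          define r where "r = (\<lambda>a. complex_of_real (\<phi> a x * \<phi> a y))"
          have "(\<Sum>a<n. \<Sum>b<n. (u x * of_real (\<phi> a x) * of_real (\<phi> b x)) * (u y * of_real (\<phi> b y) * of_real (\<phi> a y)))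
              = (\<Sum>a<n. \<Sum>b<n. (u x * u y) * (r a * r b))"
            by (intro sum.cong refl) (simp add: r_def mult_ac)
          also have "\<dots> = (u x * u y) * ((\<Sum>a<n. r a) * (\<Sum>b<n. r b))"
            by (subst sum_product) (simp only: sum_distrib_left)
          also have "(\<Sum>a<n. r a) = of_real (K x y)" unfolding k[OF x y] r_def by (rule of_real_sum[symmetric])
          finally show ?thesis by (simp only: power2_eq_square of_real_mult)
        qed
      qed
      finally show "(\<Sum>a<n. \<Sum>b<n. (u x * of_real (\<phi> a x) * of_real (\<phi> b x)) * (\<integral>y. u y * of_real (\<phi> b y) * of_real (\<phi> a y) \<partial>\<mu>))
         = (\<integral>y. u x * u y * of_real ((K x y)^2) \<partial>\<mu>)" .
    qed
    finally show ?thesis .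
  qed
  let ?I1 = "\<integral>x. F x \<partial>\<mu>" and ?I2 = "\<integral>x. (F x)^2 \<partial>\<mu>" and ?Q = "\<integral>x. (\<integral>y. F x * F y * (K x y)^2 \<partial>\<mu>) \<partial>\<mu>"
  have c1: "norm (of_real c * (\<integral>x. u x \<partial>\<mu>) - (\<i> * of_real (t * (c * ?I1)) - of_real (t^2 * (c * ?I2) / 2))) \<le> c * mass * (\<epsilon>^3 / 6)"
  proof -
    have gg: "bounded_measurable \<mu> (\<lambda>x. g x + (g x)^2 / 2)"
      using gb bounded_measurable_mult[OF bounded_measurable_power[OF gb, of 2] bounded_measurable_const[of \<mu> "1/2"]]
      by (intro bounded_measurable_add) auto
    have "(\<integral>x. g x + (g x)^2 / 2 \<partial>\<mu>) = (\<integral>x. \<i> * of_real t * of_real (F x) + (- of_real (t^2 / 2)) * of_real ((F x)^2) \<partial>\<mu>)"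
      by (rule Bochner_Integration.integral_cong) (simp_all add: g_def power_mult_distrib)
    also have "\<dots> = \<i> * of_real t * of_real ?I1 + (- of_real (t^2 / 2)) * of_real ?I2"
    proof -
      have "integrable \<mu> (\<lambda>x. complex_of_real (F x))" "integrable \<mu> (\<lambda>x. complex_of_real ((F x)^2))"
        by (intro KK.bounded_measurable_integrable bounded_measurable_of_real F bounded_measurable_power)+
      then show ?thesis
        by (subst Bochner_Integration.integral_add) (auto simp del: of_real_power simp: integral_complex_of_real)
    qed
    finally have gi0: "(\<integral>x. g x + (g x)^2 / 2 \<partial>\<mu>) = \<i> * of_real t * of_real ?I1 + (- of_real (t^2 / 2)) * of_real ?I2" .
    have gi: "of_real c * (\<integral>x. g x + (g x)^2 / 2 \<partial>\<mu>) = \<i> * of_real (t * (c * ?I1)) - of_real (t^2 * (c * ?I2) / 2)"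
      unfolding gi0 by (simp add: algebra_simps)
    have "norm (of_real c * (\<integral>x. u x \<partial>\<mu>) - of_real c * (\<integral>x. g x + (g x)^2 / 2 \<partial>\<mu>)) = c * norm (\<integral>x. u x - (g x + (g x)^2 / 2) \<partial>\<mu>)"
      using KK.bounded_measurable_integrable[OF ub] KK.bounded_measurable_integrable[OF gg] c_pos
      by (simp add: right_diff_distrib[symmetric] norm_mult del: Bochner_Integration.integral_add)
    also have "\<dots> \<le> c * (\<epsilon>^3 / 6 * mass)"
      using c_pos e0 by (intro mult_left_mono KK.norm_integral_le_bound u2) auto
    finally show ?thesis unfolding gi by (simp add: mult_ac)
  qed
  have c2: "norm ((\<integral>x. (\<integral>y. u x * u y * of_real ((K x y)^2) \<partial>\<mu>) \<partial>\<mu>) - (- of_real (t^2 * ?Q))) \<le> c * mass * \<epsilon>^3"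
  proof -
    have FF: "(\<integral>x. (\<integral>y. g x * g y * of_real ((K x y)^2) \<partial>\<mu>) \<partial>\<mu>) = - of_real (t^2 * ?Q)"
    proof -
      have "g x * g y * of_real ((K x y)^2) = complex_of_real ((- (t^2)) * (F x * F y * (K x y)^2))" for x y
        by (simp add: g_def power2_eq_square algebra_simps)
      then show ?thesis by (simp only: integral_complex_of_real integral_mult_right_zero) simp
    qed
    have s1: "integrable \<mu> (\<lambda>y. a x * b y * of_real ((K x y)^2))" if "bounded_measurable \<mu> b" "x \<in> space \<mu>" for a b :: "'b \<Rightarrow> complex" and x
      by (intro KK.bounded_measurable_integrable bounded_measurable_mult bounded_measurable_const that(1) bounded_measurable_of_real bounded_measurable_power K_section that(2))
    have s2: "integrable \<mu> (\<lambda>x. \<integral>y. a x * b y * of_real ((K x y)^2) \<partial>\<mu>)" if "bounded_measurable \<mu> a" "bounded_measurable \<mu> b" for a b :: "'b \<Rightarrow> complex"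
      using KK.bounded_measurable_integrable[OF KK.bounded_measurable_integral[OF uK[OF that]]] by simp
    have "(\<integral>x. (\<integral>y. u x * u y * of_real ((K x y)^2) \<partial>\<mu>) \<partial>\<mu>) - (\<integral>x. (\<integral>y. g x * g y * of_real ((K x y)^2) \<partial>\<mu>) \<partial>\<mu>)
       = (\<integral>x. (\<integral>y. u x * u y * of_real ((K x y)^2) \<partial>\<mu>) - (\<integral>y. g x * g y * of_real ((K x y)^2) \<partial>\<mu>) \<partial>\<mu>)"
      by (rule Bochner_Integration.integral_diff[symmetric]) (intro s2 ub gb)+
    also have "norm \<dots> \<le> c * \<epsilon>^3 * mass"
    proof (rule KK.norm_integral_le_bound)
      fix x assume x: "x \<in> space \<mu>"
      have "(\<integral>y. u x * u y * of_real ((K x y)^2) \<partial>\<mu>) - (\<integral>y. g x * g y * of_real ((K x y)^2) \<partial>\<mu>)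
        = (\<integral>y. (u x * u y - g x * g y) * of_real ((K x y)^2) \<partial>\<mu>)"
        using s1[OF ub x] s1[OF gb x] by (simp add: left_diff_distrib)
      also have "norm \<dots> \<le> (\<integral>y. norm ((u x * u y - g x * g y) * of_real ((K x y)^2)) \<partial>\<mu>)" by (rule integral_norm_bound)
      also have "\<dots> \<le> (\<integral>y. \<epsilon>^3 * (K x y)^2 \<partial>\<mu>)"
      proof (rule integral_mono)
        show "integrable \<mu> (\<lambda>y. norm ((u x * u y - g x * g y) * of_real ((K x y)^2)))"
          by (intro KK.bounded_measurable_integrable bounded_measurable_norm bounded_measurable_mult bounded_measurable_diff bounded_measurable_const
              ub gb bounded_measurable_of_real bounded_measurable_power K_section x)
        show "integrable \<mu> (\<lambda>y. \<epsilon>^3 * (K x y)^2)"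
          by (intro KK.bounded_measurable_integrable bounded_measurable_mult bounded_measurable_const bounded_measurable_power K_section x)
        fix y assume y: "y \<in> space \<mu>"
        have "u x * u y - g x * g y = (u x - g x) * u y + g x * (u y - g y)" by (simp add: algebra_simps)
        also have "norm \<dots> \<le> norm (u x - g x) * norm (u y) + norm (g x) * norm (u y - g y)"
          unfolding norm_mult[symmetric] by (rule norm_triangle_ineq)
        also have "\<dots> \<le> \<epsilon>^2 / 2 * \<epsilon> + \<epsilon> * (\<epsilon>^2 / 2)"
          using u1[OF x] u0[OF y] g0[OF x] u1[OF y] e0 by (intro add_mono mult_mono) auto
        also have "\<dots> = \<epsilon>^3" by (simp add: power3_eq_cube power2_eq_square)
        finally show "norm ((u x * u y - g x * g y) * of_real ((K x y)^2)) \<le> \<epsilon>^3 * (K x y)^2"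
          by (simp add: norm_mult norm_power mult_right_mono)
      qed
      also have "\<dots> = c * \<epsilon>^3" using K_square[OF x] by simp
      finally show "norm ((\<integral>y. u x * u y * of_real ((K x y)^2) \<partial>\<mu>) - (\<integral>y. g x * g y * of_real ((K x y)^2) \<partial>\<mu>)) \<le> c * \<epsilon>^3" .
    qed (use c_pos e0 in simp)
    finally show ?thesis unfolding FF by (simp add: mult_ac)
  qed
  have EV: "expectation Y = c * ?I1" "variance Y = c * ?I2 - ?Q"
    using linear_statistic_variance(2,4)[OF F] by (simp_all add: Y_def)
  define T1 T2 where "T1 = of_real c * (\<integral>x. u x \<partial>\<mu>) - (\<i> * of_real (t * (c * ?I1)) - of_real (t^2 * (c * ?I2) / 2))"
    and "T2 = (\<integral>x. (\<integral>y. u x * u y * of_real ((K x y)^2) \<partial>\<mu>) \<partial>\<mu>) - (- of_real (t^2 * ?Q))"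
  have "z - (\<i> * of_real (t * expectation Y) - of_real (t^2 * variance Y / 2))
      = (z - (mtrace A - mtrace (A * A) / 2)) + (T1 - T2 / 2)"
    unfolding EV(2) unfolding EV(1) trA trAA T1_def T2_def by (simp add: field_simps)
  also have "norm \<dots> \<le> norm (z - (mtrace A - mtrace (A * A) / 2)) + (norm T1 + norm (T2 / 2))"
    by (intro order_trans[OF norm_triangle_ineq] add_left_mono norm_triangle_ineq4)
  \<comment> \<open>The logarithm costs 2, the trace of A costs 1/6, half the trace of A^2 costs
    1/2; the sum 8/3 is rounded up to 3.\<close>
  also have "\<dots> \<le> 2 * (c * mass) * \<epsilon>^3 + (c * mass * (\<epsilon>^3 / 6) + c * mass * \<epsilon>^3 / 2)"
    using z(2) c1 c2 n by (intro add_mono) (auto simp: T1_def T2_def norm_divide)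
  also have "\<dots> \<le> 3 * (c * mass) * \<epsilon>^3"
  proof -
    have "0 \<le> c * mass * \<epsilon>^3" using c_pos e0 by (intro mult_nonneg_nonneg) auto
    then show ?thesis by simp
  qed
  finally show ?thesis using that[of z] det z(1) by (simp add: \<epsilon>_def)
qed

end

section \<open>Degenerate statistics\<close>

text \<open>Later this lets selected coordinates of a long tuple act as the arguments of a function
  of k variables.\<close>

lemma (in finite_measure) distr_PiM_reindex_finite:
  fixes f :: "nat \<Rightarrow> nat"
  assumes A: "finite A" and f: "inj_on f A"
  shows "distr (PiM (f ` A) (\<lambda>_. M)) (PiM A (\<lambda>_. M)) (\<lambda>y. \<lambda>a\<in>A. y (f a)) = PiM A (\<lambda>_. M)"
proof -
  interpret product_sigma_finite "\<lambda>_::nat. M" by (rule product_sigma_finite_const)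
  have m: "(\<lambda>y. \<lambda>a\<in>A. y (f a)) \<in> PiM (f ` A) (\<lambda>_. M) \<rightarrow>\<^sub>M PiM A (\<lambda>_. M)"
    by (intro measurable_restrict measurable_component_singleton) auto
  show ?thesis
  proof (rule PiM_eqI)
    fix S assume S: "\<And>i. i \<in> A \<Longrightarrow> S i \<in> sets M"
    define T where "T = (\<lambda>j. S (the_inv_into A f j))"
    have T: "T (f i) = S i" if "i \<in> A" for i using that f by (simp add: T_def the_inv_into_f_f)
    have "(\<lambda>y. \<lambda>a\<in>A. y (f a)) -` PiE A S \<inter> space (PiM (f ` A) (\<lambda>_. M)) = PiE (f ` A) T"
    proof (intro equalityI subsetI)
      fix y assume y: "y \<in> (\<lambda>y. \<lambda>a\<in>A. y (f a)) -` PiE A S \<inter> space (PiM (f ` A) (\<lambda>_. M))"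
      then have 1: "(\<lambda>a\<in>A. y (f a)) \<in> PiE A S" and 2: "y \<in> extensional (f ` A)" by (auto simp: space_PiM PiE_def)
      have "y (f a) \<in> T (f a)" if "a \<in> A" for a using PiE_mem[OF 1 that] that T by simp
      then show "y \<in> PiE (f ` A) T" using 2 by (auto simp: PiE_def Pi_def)
    next
      fix y assume y: "y \<in> PiE (f ` A) T"
      have "y (f a) \<in> S a" "y (f a) \<in> space M" if "a \<in> A" for a
        using PiE_mem[OF y, of "f a"] that T sets.sets_into_space[OF S[OF that]] by auto
      then show "y \<in> (\<lambda>y. \<lambda>a\<in>A. y (f a)) -` PiE A S \<inter> space (PiM (f ` A) (\<lambda>_. M))"
        using y by (auto simp: space_PiM PiE_def Pi_def)
    qed
    moreover have "emeasure (PiM (f ` A) (\<lambda>_. M)) (PiE (f ` A) T) = (\<Prod>j\<in>f ` A. emeasure M (T j))"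
      by (rule emeasure_PiM) (use A S T in auto)
    ultimately show "emeasure (distr (PiM (f ` A) (\<lambda>_. M)) (PiM A (\<lambda>_. M)) (\<lambda>y. \<lambda>a\<in>A. y (f a))) (PiE A S) = (\<Prod>i\<in>A. emeasure M (S i))"
      using S A by (subst emeasure_distr[OF m]) (auto intro!: sets_PiM_I_finite simp: T prod.reindex[OF f])
  qed (use A in auto)
qed

text \<open>The square of a sum over tuples is a sum over pairs of tuples; the pairs are grouped by
  which entry of the first equals which entry of the second.\<close>

definition coincidences :: "nat \<Rightarrow> (nat \<Rightarrow> 'b) \<times> (nat \<Rightarrow> 'b) \<Rightarrow> (nat \<times> nat) set" where
  "coincidences k t = {(a,b). a < k \<and> b < k \<and> fst t a = snd t b}"

text \<open>\<open>q\<close> and \<open>q'\<close> place two k-tuples inside one m-tuple of distinct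
  points, overlapping exactly as the pattern prescribes. Pairs with this pattern thus become
  m-tuples, to which the correlation functions apply.\<close>

lemma sum_pairs_by_pattern:
  fixes q q' :: "nat \<Rightarrow> nat" and h :: "(nat \<Rightarrow> 'b) \<Rightarrow> (nat \<Rightarrow> 'b) \<Rightarrow> real"
  assumes q: "inj_on q {..<k}" "inj_on q' {..<k}" and cover: "q ` {..<k} \<union> q' ` {..<k} = {..<m}"
  shows "(\<Sum>z\<in>distinct_tuples m P. h (\<lambda>a\<in>{..<k}. z (q a)) (\<lambda>b\<in>{..<k}. z (q' b)))
    = (\<Sum>t\<in>{t \<in> distinct_tuples k P \<times> distinct_tuples k P. coincidences k t = {(a,b). a < k \<and> b < k \<and> q a = q' b}}. h (fst t) (snd t))"
proof -
  let ?R = "{(a,b). a < k \<and> b < k \<and> q a = q' b}"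
  let ?T = "{t \<in> distinct_tuples k P \<times> distinct_tuples k P. coincidences k t = ?R}"
  let ?i = "\<lambda>z. ((\<lambda>a\<in>{..<k}. z (q a)), (\<lambda>b\<in>{..<k}. z (q' b)))"
  define r r' where "r = the_inv_into {..<k} q" and "r' = the_inv_into {..<k} q'"
  have r: "r (q a) = a" "r' (q' a) = a" if "a < k" for a
    using that q by (auto simp: r_def r'_def the_inv_into_f_f)
  \<comment> \<open>Gluing of two tuples. A slot used by both is read from the first; the pattern
    ensures that the second agrees there.\<close>
  let ?j = "\<lambda>t. (\<lambda>c\<in>{..<m}. if c \<in> q ` {..<k} then fst t (r c) else snd t (r' c))"
  have qm: "q a < m" "q' a < m" if "a < k" for a using that cover by blast+
  have "(\<Sum>t\<in>?T. h (fst t) (snd t)) = (\<Sum>z\<in>distinct_tuples m P. h (\<lambda>a\<in>{..<k}. z (q a)) (\<lambda>b\<in>{..<k}. z (q' b)))"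
  proof (rule sum.reindex_bij_witness[of _ ?i ?j])
    fix t assume "t \<in> ?T"
    then obtain x y where t: "t = (x, y)" and x: "x \<in> {..<k} \<rightarrow>\<^sub>E P" "inj_on x {..<k}" and y: "y \<in> {..<k} \<rightarrow>\<^sub>E P" "inj_on y {..<k}"
      and R: "\<And>a b. a < k \<Longrightarrow> b < k \<Longrightarrow> x a = y b \<longleftrightarrow> q a = q' b"
      by (cases t) (auto simp: distinct_tuples_def coincidences_def set_eq_iff)
    define u where "u = ?j t"
    have j1: "u (q a) = x a" if "a < k" for a using that qm r by (auto simp: t u_def)
    have j2: "u (q' b) = y b" if b: "b < k" for b
    proof (cases "q' b \<in> q ` {..<k}")
      case True
      then obtain a where a: "a < k" "q a = q' b" by auto
      then have "x a = y b" using R b by simp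
      then show ?thesis using j1[OF a(1)] a by simp
    next
      case False
      then show ?thesis using b qm r by (auto simp: t u_def)
    qed
    have i: "?i u = t"
    proof -
      have "(\<lambda>a\<in>{..<k}. u (q a)) = x" using x(1) j1 by (intro ext) (auto simp: restrict_def PiE_def extensional_def)
      moreover have "(\<lambda>b\<in>{..<k}. u (q' b)) = y" using y(1) j2 by (intro ext) (auto simp: restrict_def PiE_def extensional_def)
      ultimately show ?thesis by (simp only: t)
    qed
    have inP: "u c \<in> P" if "c < m" for c
    proof -
      from that cover have "c \<in> q ` {..<k} \<or> c \<in> q' ` {..<k}" by blast
      then show ?thesis
      proof
        assume "c \<in> q ` {..<k}" then obtain a where "a < k" "c = q a" by auto
        then show ?thesis using j1[of a] PiE_mem[OF x(1), of a] by simp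
      next
        assume "c \<in> q' ` {..<k}" then obtain a where "a < k" "c = q' a" by auto
        then show ?thesis using j2[of a] PiE_mem[OF y(1), of a] by simp
      qed
    qed
    have "inj_on u {..<m}"
    proof (rule inj_onI)
      fix c c' assume c: "c \<in> {..<m}" "c' \<in> {..<m}" and eq: "u c = u c'"
      from c cover have "c \<in> q ` {..<k} \<or> c \<in> q' ` {..<k}" "c' \<in> q ` {..<k} \<or> c' \<in> q' ` {..<k}" by blast+
      then consider a b where "a < k" "b < k" "c = q a" "c' = q b" | a b where "a < k" "b < k" "c = q a" "c' = q' b"
        | a b where "a < k" "b < k" "c = q' a" "c' = q b" | a b where "a < k" "b < k" "c = q' a" "c' = q' b" by blast
      then show "c = c'"
      proof cases
        case 1 then have "x a = x b" using eq j1 by simp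
        then show ?thesis using 1 x(2) by (auto simp: inj_on_def)
      next
        case 2 then have "x a = y b" using eq j1 j2 by simp
        then show ?thesis using 2 R by simp
      next
        case 3 then have "x b = y a" using eq j1 j2 by simp
        then show ?thesis using 3 R by simp
      next
        case 4 then have "y a = y b" using eq j2 by simp
        then show ?thesis using 4 y(2) by (auto simp: inj_on_def)
      qed
    qed
    moreover have "u \<in> {..<m} \<rightarrow>\<^sub>E P" using inP by (auto simp: PiE_def Pi_def) (simp add: u_def)
    ultimately have ud: "u \<in> distinct_tuples m P" by (simp add: distinct_tuples_def)
    have hu: "h (\<lambda>a\<in>{..<k}. u (q a)) (\<lambda>b\<in>{..<k}. u (q' b)) = h (fst t) (snd t)"
      using arg_cong[OF i, of fst] arg_cong[OF i, of snd] by (simp only: fst_conv snd_conv)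
    show "?i (?j t) = t" using i unfolding u_def .
    show "?j t \<in> distinct_tuples m P" using ud unfolding u_def .
    show "h (\<lambda>a\<in>{..<k}. ?j t (q a)) (\<lambda>b\<in>{..<k}. ?j t (q' b)) = h (fst t) (snd t)" using hu unfolding u_def .
  next
    fix z assume "z \<in> distinct_tuples m P"
    then have z: "z \<in> {..<m} \<rightarrow>\<^sub>E P" "inj_on z {..<m}" by (auto simp: distinct_tuples_def)
    have zi: "z c = z c' \<longleftrightarrow> c = c'" if "c < m" "c' < m" for c c' using z(2) that by (auto simp: inj_on_def)
    have zP: "z c \<in> P" if "c < m" for c using z(1) that by auto
    show "?i z \<in> ?T"
    proof -
      have "(\<lambda>a\<in>{..<k}. z (q a)) \<in> distinct_tuples k P" "(\<lambda>a\<in>{..<k}. z (q' a)) \<in> distinct_tuples k P"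
        using zP qm zi q by (auto simp: distinct_tuples_def inj_on_def)
      moreover have "coincidences k (?i z) = ?R" using zi qm by (auto simp: coincidences_def)
      ultimately show ?thesis by simp
    qed
    show "?j (?i z) = z"
    proof
      fix c
      show "?j (?i z) c = z c"
      proof (cases "c < m")
        case False then show ?thesis using z(1) by (auto simp: PiE_def extensional_def)
      next
        case True
        then have "c \<in> q ` {..<k} \<or> (c \<notin> q ` {..<k} \<and> c \<in> q' ` {..<k})" using cover by blast
        then show ?thesis using True r by auto
      qed
    qed
  qed
  then show ?thesis ..
qed

text \<open>Two coincidences determine two entries of the second tuple from the first, which leaves
  k + (k - 2) free choices.\<close>

lemma card_many_coincidences:
  assumes P: "finite P" and C: "(i,j) \<in> C" "(i',j') \<in> C" "(i,j) \<noteq> (i',j')"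
  shows "card {t \<in> distinct_tuples k P \<times> distinct_tuples k P. coincidences k t = C} \<le> card P ^ (2 * k - 2)"
proof (cases "{t \<in> distinct_tuples k P \<times> distinct_tuples k P. coincidences k t = C} = {}")
  case False
  let ?T = "{t \<in> distinct_tuples k P \<times> distinct_tuples k P. coincidences k t = C}"
  have co: "i < k" "j < k" "i' < k" "j' < k" "\<And>t. t \<in> ?T \<Longrightarrow> fst t i = snd t j" "\<And>t. t \<in> ?T \<Longrightarrow> fst t i' = snd t j'"
    using False C(1,2) by (fastforce simp: coincidences_def)+
  \<comment> \<open>The entries of the first tuple are distinct, so one entry of the second cannot
    meet two of them.\<close>
  have jj: "j \<noteq> j'"
  proof
    assume j: "j = j'"
    obtain t where t: "t \<in> ?T" using False by blast
    then have eq: "fst t i = fst t i'" using co(5,6)[OF t] j by simp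
    have inj: "inj_on (fst t) {..<k}" using t by (simp add: distinct_tuples_def mem_Times_iff)
    have "i = i'" by (rule inj_onD[OF inj eq]) (simp_all add: co(1,3))
    with j C(3) show False by simp
  qed
  let ?S = "{..<k} - {j, j'}"
  let ?f = "\<lambda>t::(nat \<Rightarrow> 'a) \<times> (nat \<Rightarrow> 'a). (fst t, restrict (snd t) ?S)"
  have inj: "inj_on ?f ?T"
  proof (rule inj_onI)
    fix t t' assume t: "t \<in> ?T" "t' \<in> ?T" and eq: "?f t = ?f t'"
    then have f: "fst t = fst t'" and g: "restrict (snd t) ?S = restrict (snd t') ?S" by auto
    have e: "snd t \<in> {..<k} \<rightarrow>\<^sub>E P" "snd t' \<in> {..<k} \<rightarrow>\<^sub>E P" using t by (simp_all add: distinct_tuples_def mem_Times_iff)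
    have "snd t a = snd t' a" for a
    proof -
      consider "a \<in> ?S" | "a = j" | "a = j'" | "a \<notin> {..<k}" by blast
      then show ?thesis
      proof cases
        case 1 then show ?thesis using fun_cong[OF g, of a] by simp
      next
        case 2 then show ?thesis using co(5)[OF t(1)] co(5)[OF t(2)] f by simp
      next
        case 3 then show ?thesis using co(6)[OF t(1)] co(6)[OF t(2)] f by simp
      next
        case 4 then show ?thesis using e by (auto simp: PiE_def extensional_def)
      qed
    qed
    then show "t = t'" using f by (simp add: prod_eq_iff fun_eq_iff)
  qed
  have sub: "?f ` ?T \<subseteq> ({..<k} \<rightarrow>\<^sub>E P) \<times> (?S \<rightarrow>\<^sub>E P)"
    by (auto simp: distinct_tuples_def mem_Times_iff PiE_def Pi_def)
  have "card ?T = card (?f ` ?T)" using inj by (simp add: card_image)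
  also have "\<dots> \<le> card (({..<k} \<rightarrow>\<^sub>E P) \<times> (?S \<rightarrow>\<^sub>E P))"
    using P by (intro card_mono sub finite_cartesian_product finite_PiE) auto
  also have "\<dots> = card P ^ k * card P ^ (k - 2)"
  proof -
    have "card ?S = k - 2" using co(2,4) jj by (subst card_Diff_subset) auto
    then show ?thesis by (simp add: card_cartesian_product card_funcsetE)
  qed
  also have "\<dots> = card P ^ (2 * k - 2)"
  proof -
    have "k + (k - 2) = 2 * k - 2" using co(2,4) jj by linarith
    then show ?thesis by (simp add: power_add[symmetric])
  qed
  finally show ?thesis .
next
  case True
  show ?thesis unfolding True by simp
qed

section \<open>Size of the permutation terms of the correlation functions\<close>

context determinantal_process
begin

abbreviation NN :: real where "NN \<equiv> c * mass"

lemma space_pow_nth: "x \<in> space (PiM I (\<lambda>_. \<mu>)) \<Longrightarrow> i \<in> I \<Longrightarrow> x i \<in> space \<mu>"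
  by (auto simp: space_PiM PiE_def Pi_def)

lemma integral_edge_le:
  assumes I: "finite (I :: nat set)" "i \<in> I" "l \<in> I" "i \<noteq> l"
  shows "(\<integral>x. \<bar>K (x i) (x l)\<bar> \<partial>PiM I (\<lambda>_. \<mu>)) \<le> sqrt NN * mass ^ (card I - 1)"
proof -
  let ?I = "I - {i}"
  have ins: "insert i ?I = I" using I by auto
  interpret F: finite_measure "PiM ?I (\<lambda>_. \<mu>)" using I by (intro KK.finite_measure_PiM_const) auto
  have bm: "bounded_measurable (PiM I (\<lambda>_. \<mu>)) (\<lambda>x. \<bar>K (x i) (x l)\<bar>)"
    by (intro bounded_measurable_abs bounded_measurable_component2[OF K_bm] I)
  have "(\<integral>x. \<bar>K (x i) (x l)\<bar> \<partial>PiM I (\<lambda>_. \<mu>)) = (\<integral>x. (\<integral>y. \<bar>K y (x l)\<bar> \<partial>\<mu>) \<partial>PiM ?I (\<lambda>_. \<mu>))"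
    using KK.integral_PiM_insert[of ?I i "\<lambda>x. \<bar>K (x i) (x l)\<bar>"] I bm unfolding ins by simp
  also have "\<dots> \<le> \<bar>\<dots>\<bar>" by simp
  also have "\<dots> \<le> sqrt NN * measure (PiM ?I (\<lambda>_. \<mu>)) (space (PiM ?I (\<lambda>_. \<mu>)))"
  proof (subst real_norm_def[symmetric], rule F.norm_integral_le_bound)
    fix x assume x: "x \<in> space (PiM ?I (\<lambda>_. \<mu>))"
    then have xl: "x l \<in> space \<mu>" using I by (intro space_pow_nth[of x ?I]) auto
    have "(\<integral>y. \<bar>K y (x l)\<bar> \<partial>\<mu>) = (\<integral>y. \<bar>K (x l) y\<bar> \<partial>\<mu>)"
      by (rule Bochner_Integration.integral_cong) (use K_sym xl in auto)
    then show "norm (\<integral>y. \<bar>K y (x l)\<bar> \<partial>\<mu>) \<le> sqrt NN"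
      using integral_abs_K_le[OF xl] by (simp add: mult.commute)
  qed (use c_pos mass_pos in auto)
  also have "measure (PiM ?I (\<lambda>_. \<mu>)) (space (PiM ?I (\<lambda>_. \<mu>))) = mass ^ (card I - 1)"
    using KK.finite_measure_PiM_const(2)[of ?I] I by simp
  finally show ?thesis .
qed

text \<open>Any single moved point gives an off-diagonal factor of the kernel, whose integral saves
  a square root of \<open>NN\<close>; all other factors are bounded by c.\<close>

lemma permutation_product_bound_1:
  assumes p: "p permutes {..<m}" and i: "i < m" "p i \<noteq> i"
  shows "(\<integral>x. (\<Prod>j<m. \<bar>K (x j) (x (p j))\<bar>) \<partial>mu_pow m) \<le> sqrt NN * NN ^ (m - 1)"
proof -
  interpret F: finite_measure "mu_pow m" by (rule finite_measure_pow)
  have pm: "p j < m" if "j < m" for j using p that permutes_in_image[of p "{..<m}" j] by auto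
  have "(\<integral>x. (\<Prod>j<m. \<bar>K (x j) (x (p j))\<bar>) \<partial>mu_pow m) \<le> (\<integral>x. c ^ (m - 1) * \<bar>K (x i) (x (p i))\<bar> \<partial>mu_pow m)"
  proof (rule integral_mono)
    show "integrable (mu_pow m) (\<lambda>x. \<Prod>j<m. \<bar>K (x j) (x (p j))\<bar>)"
      by (intro F.bounded_measurable_integrable bounded_measurable_prod bounded_measurable_abs bounded_measurable_component2[OF K_bm]) (use pm in auto)
    show "integrable (mu_pow m) (\<lambda>x. c ^ (m - 1) * \<bar>K (x i) (x (p i))\<bar>)"
      by (intro F.bounded_measurable_integrable bounded_measurable_mult bounded_measurable_const bounded_measurable_abs bounded_measurable_component2[OF K_bm]) (use pm i in auto)
    fix x assume x: "x \<in> space (mu_pow m)"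
    have b: "\<bar>K (x j) (x (p j))\<bar> \<le> c" if "j < m" for j
      using that pm space_pow_nth[OF x] by (intro abs_K_le) auto
    have "(\<Prod>j<m. \<bar>K (x j) (x (p j))\<bar>) = \<bar>K (x i) (x (p i))\<bar> * (\<Prod>j\<in>{..<m} - {i}. \<bar>K (x j) (x (p j))\<bar>)"
      using i by (intro prod.remove) auto
    also have "\<dots> \<le> \<bar>K (x i) (x (p i))\<bar> * (\<Prod>j\<in>{..<m} - {i}. c)"
      using b by (intro mult_left_mono prod_mono) auto
    finally show "(\<Prod>j<m. \<bar>K (x j) (x (p j))\<bar>) \<le> c ^ (m - 1) * \<bar>K (x i) (x (p i))\<bar>"
      using i by (simp add: mult.commute)
  qed
  also have "\<dots> = c ^ (m - 1) * (\<integral>x. \<bar>K (x i) (x (p i))\<bar> \<partial>mu_pow m)" by (rule integral_mult_right_zero)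
  also have "\<dots> \<le> c ^ (m - 1) * (sqrt NN * mass ^ (card {..<m} - 1))"
    using c_pos i pm by (intro mult_left_mono integral_edge_le) auto
  also have "\<dots> = sqrt NN * NN ^ (m - 1)" by (simp add: power_mult_distrib)
  finally show ?thesis .
qed

text \<open>Three different factors are kept: the two that contain x_i and a third one that avoids
  it. Integrating x_i out of the first two leaves c in place of c^2 times the mass, which saves a
  full power of \<open>NN\<close>; the third saves a square root.\<close>

lemma permutation_product_bound_3:
  assumes p: "p permutes {..<m}" and i: "i < m" "p i \<noteq> i" and j: "j < m" "p j \<noteq> j" "j \<noteq> i" "p j \<noteq> i"
  shows "(\<integral>x. (\<Prod>j<m. \<bar>K (x j) (x (p j))\<bar>) \<partial>mu_pow m) \<le> sqrt NN * NN ^ (m - 2)"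
proof -
  interpret F: finite_measure "mu_pow m" by (rule finite_measure_pow)
  \<comment> \<open>The predecessor of i, which supplies the second factor containing x_i. It may
    equal p i; it differs from j because p j is not i.\<close>
  define a where "a = inv_into UNIV p i"
  have pa: "p a = i" using p by (simp add: a_def permutes_inverses)
  have a: "a < m" "a \<noteq> i" "a \<noteq> j"
    using permutes_in_image[OF p, of a] pa i j by auto
  have pm: "p j < m" if "j < m" for j using p that permutes_in_image[of p "{..<m}" j] by auto
  let ?h = "\<lambda>x. \<bar>K (x a) (x i)\<bar> * \<bar>K (x i) (x (p i))\<bar> * \<bar>K (x j) (x (p j))\<bar>"
  let ?I = "{..<m} - {i}"
  interpret G: finite_measure "PiM ?I (\<lambda>_. \<mu>)" by (intro KK.finite_measure_PiM_const) auto
  have m3: "m \<ge> 3"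
  proof -
    have "card {a, i, j} \<le> card {..<m}" using a i j by (intro card_mono) auto
    then show ?thesis using a j by simp
  qed
  have hb: "bounded_measurable (mu_pow m) ?h"
    by (intro bounded_measurable_mult bounded_measurable_abs bounded_measurable_component2[OF K_bm]) (use pm i j a in auto)
  have "(\<integral>x. (\<Prod>j<m. \<bar>K (x j) (x (p j))\<bar>) \<partial>mu_pow m) \<le> (\<integral>x. c ^ (m - 3) * ?h x \<partial>mu_pow m)"
  proof (rule integral_mono)
    show "integrable (mu_pow m) (\<lambda>x. \<Prod>j<m. \<bar>K (x j) (x (p j))\<bar>)"
      by (intro F.bounded_measurable_integrable bounded_measurable_prod bounded_measurable_abs bounded_measurable_component2[OF K_bm]) (use pm in auto)
    show "integrable (mu_pow m) (\<lambda>x. c ^ (m - 3) * ?h x)"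
      using F.bounded_measurable_integrable[OF hb] by (rule integrable_mult_right)
    fix x assume x: "x \<in> space (mu_pow m)"
    have b: "\<bar>K (x j) (x (p j))\<bar> \<le> c" if "j < m" for j
      using that pm space_pow_nth[OF x] by (intro abs_K_le) auto
    have "(\<Prod>j<m. \<bar>K (x j) (x (p j))\<bar>) = (\<Prod>j\<in>{a,i,j}. \<bar>K (x j) (x (p j))\<bar>) * (\<Prod>j\<in>{..<m} - {a,i,j}. \<bar>K (x j) (x (p j))\<bar>)"
      using a i j by (subst prod.subset_diff[of "{a,i,j}"]) (auto simp: mult.commute)
    also have "(\<Prod>j\<in>{a,i,j}. \<bar>K (x j) (x (p j))\<bar>) = ?h x" using a j pa by (simp add: mult_ac)
    also have "?h x * (\<Prod>j\<in>{..<m} - {a,i,j}. \<bar>K (x j) (x (p j))\<bar>) \<le> ?h x * (\<Prod>j\<in>{..<m} - {a,i,j}. c)"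
      using b by (intro mult_left_mono prod_mono) auto
    also have "(\<Prod>j\<in>{..<m} - {a,i,j}. c) = c ^ (m - 3)"
      using a i j by (simp add: card_Diff_subset numeral_3_eq_3)
    finally show "(\<Prod>j<m. \<bar>K (x j) (x (p j))\<bar>) \<le> c ^ (m - 3) * ?h x" by (simp add: mult.commute)
  qed
  also have "\<dots> = c ^ (m - 3) * (\<integral>x. ?h x \<partial>mu_pow m)" by (rule integral_mult_right_zero)
  also have "(\<integral>x. ?h x \<partial>mu_pow m) \<le> c * (sqrt NN * mass ^ (m - 2))"
  proof -
    have ins: "insert i ?I = {..<m}" using i by auto
    have "(\<integral>x. ?h x \<partial>mu_pow m) = (\<integral>x. (\<integral>y. ?h (x(i := y)) \<partial>\<mu>) \<partial>PiM ?I (\<lambda>_. \<mu>))"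
      using KK.integral_PiM_insert[of ?I i ?h] hb unfolding ins by simp
    also have "\<dots> = (\<integral>x. (\<integral>y. \<bar>K (x a) y\<bar> * \<bar>K y (x (p i))\<bar> \<partial>\<mu>) * \<bar>K (x j) (x (p j))\<bar> \<partial>PiM ?I (\<lambda>_. \<mu>))"
      using a i j by simp
    also have "\<dots> \<le> (\<integral>x. c * \<bar>K (x j) (x (p j))\<bar> \<partial>PiM ?I (\<lambda>_. \<mu>))"
    proof (rule integral_mono_AE')
      show "integrable (PiM ?I (\<lambda>_. \<mu>)) (\<lambda>x. c * \<bar>K (x j) (x (p j))\<bar>)"
        by (intro G.bounded_measurable_integrable bounded_measurable_mult bounded_measurable_const bounded_measurable_abs bounded_measurable_component2[OF K_bm]) (use pm j in auto)
      show "AE x in PiM ?I (\<lambda>_. \<mu>). (\<integral>y. \<bar>K (x a) y\<bar> * \<bar>K y (x (p i))\<bar> \<partial>\<mu>) * \<bar>K (x j) (x (p j))\<bar> \<le> c * \<bar>K (x j) (x (p j))\<bar>"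
      proof (intro AE_I2 mult_right_mono integral_abs_KK_le)
        fix x assume x: "x \<in> space (PiM ?I (\<lambda>_. \<mu>))"
        show "x a \<in> space \<mu>" "x (p i) \<in> space \<mu>" using a i pm by (auto intro!: space_pow_nth[OF x])
      qed simp
      show "AE x in PiM ?I (\<lambda>_. \<mu>). 0 \<le> c * \<bar>K (x j) (x (p j))\<bar>"
        using c_pos by (intro AE_I2) simp
    qed
    also have "\<dots> \<le> c * (sqrt NN * mass ^ (card ?I - 1))"
    proof -
      have "(\<integral>x. \<bar>K (x j) (x (p j))\<bar> \<partial>PiM ?I (\<lambda>_. \<mu>)) \<le> sqrt NN * mass ^ (card ?I - 1)"
        using j pm by (intro integral_edge_le) auto
      then show ?thesis using c_pos by (simp only: integral_mult_right_zero) (intro mult_left_mono; simp)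
    qed
    also have "card ?I - 1 = m - 2" using i by simp
    finally show ?thesis .
  qed
  also have "c ^ (m - 3) * (c * (sqrt NN * mass ^ (m - 2))) = sqrt NN * NN ^ (m - 2)"
  proof -
    have "m - 2 = Suc (m - 3)" using m3 by simp
    then show ?thesis by (simp add: power_mult_distrib)
  qed
  finally show ?thesis using c_pos by (simp add: mult_left_mono)
qed

end

section \<open>Vanishing margins\<close>

context determinantal_process
begin

lemma select_measurable:
  assumes "q ` {..<k} \<subseteq> {..<m}"
  shows "(\<lambda>z. \<lambda>a\<in>{..<k}. z (q a)) \<in> mu_pow m \<rightarrow>\<^sub>M mu_pow k"
  using assms by (intro measurable_restrict measurable_component_singleton) auto

text \<open>The coordinates of the first copy other than the i-th occur in g alone and are
  integrated first; with x_(q i) held fixed this is a margin of g, hence 0.\<close>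

lemma zero_margin_integral:
  fixes q :: "nat \<Rightarrow> nat" and h :: "(nat \<Rightarrow> 'b) \<Rightarrow> real"
  assumes q: "inj_on q {..<k}" "q ` {..<k} \<subseteq> {..<m}" and i: "i < k"
    and g: "bounded_measurable (mu_pow k) g"
    and zm: "\<And>x. x \<in> space \<mu> \<Longrightarrow> (\<integral>y. g (y(i := x)) \<partial>PiM ({..<k} - {i}) (\<lambda>_. \<mu>)) = 0"
    and h: "bounded_measurable (mu_pow m) h"
    and dep: "\<And>z z'. z \<in> space (mu_pow m) \<Longrightarrow> z' \<in> space (mu_pow m) \<Longrightarrow> (\<And>c. c < m \<Longrightarrow> c \<notin> q ` ({..<k} - {i}) \<Longrightarrow> z c = z' c) \<Longrightarrow> h z = h z'"
  shows "(\<integral>z. g (\<lambda>a\<in>{..<k}. z (q a)) * h z \<partial>mu_pow m) = 0"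
proof -
  interpret PS: product_sigma_finite "\<lambda>_::nat. \<mu>" by (rule KK.product_sigma_finite_const)
  interpret F: finite_measure "mu_pow m" by (rule finite_measure_pow)
  let ?A = "{..<k} - {i}"
  let ?J = "q ` ?A"
  let ?I = "{..<m} - ?J"
  have un: "?I \<union> ?J = {..<m}" using q(2) by auto
  let ?f = "\<lambda>z. g (\<lambda>a\<in>{..<k}. z (q a)) * h z"
  have "bounded_measurable (mu_pow m) ?f"
    by (intro bounded_measurable_mult bounded_measurable_compose[OF g] select_measurable q(2) h)
  then have fi: "integrable (PiM (?I \<union> ?J) (\<lambda>_. \<mu>)) ?f" unfolding un by (rule F.bounded_measurable_integrable)
  obtain u0 where u0: "u0 \<in> space \<mu>" using mass_pos by (metis measure_empty equals0I less_irrefl)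
  have merge_space: "merge ?I ?J (x, y) \<in> space (mu_pow m)" if "x \<in> space (PiM ?I (\<lambda>_. \<mu>))" "y \<in> space (PiM ?J (\<lambda>_. \<mu>))" for x y
    using that un by (auto simp: space_PiM merge_def PiE_def Pi_def extensional_def)
  have qi: "q i \<in> ?I" using q i by (auto simp: inj_on_def)
  have injA: "inj_on q ?A" using q(1) by (rule inj_on_subset) auto
  have "(\<integral>y. ?f (merge ?I ?J (x, y)) \<partial>PiM ?J (\<lambda>_. \<mu>)) = 0" if x: "x \<in> space (PiM ?I (\<lambda>_. \<mu>))" for x
  proof -
    \<comment> \<open>An arbitrary filling of the coordinates on which h does not depend; it
      displays h as a constant of the inner integral.\<close>
    let ?y0 = "\<lambda>_\<in>?J. u0"
    have y0: "?y0 \<in> space (PiM ?J (\<lambda>_. \<mu>))" using u0 by (auto simp: space_PiM)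
    have xqi: "x (q i) \<in> space \<mu>" using x qi by (rule space_pow_nth)
    have gm: "(\<lambda>w. g (w(i := x (q i)))) \<in> borel_measurable (PiM ?A (\<lambda>_. \<mu>))"
    proof (rule measurable_compose[OF _ bounded_measurableD[OF g]])
      show "(\<lambda>w. w(i := x (q i))) \<in> PiM ?A (\<lambda>_. \<mu>) \<rightarrow>\<^sub>M mu_pow k"
        using i xqi by (intro measurable_fun_upd[where J = ?A]) auto
    qed
    have m: "(\<lambda>y. \<lambda>a\<in>?A. y (q a)) \<in> PiM ?J (\<lambda>_. \<mu>) \<rightarrow>\<^sub>M PiM ?A (\<lambda>_. \<mu>)"
      by (intro measurable_restrict measurable_component_singleton) auto
    have "(\<integral>y. ?f (merge ?I ?J (x, y)) \<partial>PiM ?J (\<lambda>_. \<mu>))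
      = (\<integral>y. g ((\<lambda>a\<in>?A. y (q a))(i := x (q i))) * h (merge ?I ?J (x, ?y0)) \<partial>PiM ?J (\<lambda>_. \<mu>))"
    proof (rule Bochner_Integration.integral_cong[OF refl])
      fix y assume y: "y \<in> space (PiM ?J (\<lambda>_. \<mu>))"
      have "h (merge ?I ?J (x, y)) = h (merge ?I ?J (x, ?y0))"
        by (rule dep[OF merge_space[OF x y] merge_space[OF x y0]]) (auto simp: merge_def)
      moreover have "(\<lambda>a\<in>{..<k}. merge ?I ?J (x, y) (q a)) = (\<lambda>a\<in>?A. y (q a))(i := x (q i))"
      proof
        fix a
        consider "a = i" | "a \<in> ?A" | "a \<notin> {..<k}" by blast
        then show "(\<lambda>a\<in>{..<k}. merge ?I ?J (x, y) (q a)) a = ((\<lambda>a\<in>?A. y (q a))(i := x (q i))) a"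
        proof cases
          case 1 then show ?thesis using i qi by (simp add: merge_def)
        next
          case 2
          then have "q a \<in> ?J" by blast
          then have "merge ?I ?J (x, y) (q a) = y (q a)" by (simp add: merge_def)
          then show ?thesis using 2 by simp
        next
          case 3 then show ?thesis using i by auto
        qed
      qed
      ultimately show "?f (merge ?I ?J (x, y)) = g ((\<lambda>a\<in>?A. y (q a))(i := x (q i))) * h (merge ?I ?J (x, ?y0))" by (simp only:)
    qed
    also have "\<dots> = (\<integral>y. g ((\<lambda>a\<in>?A. y (q a))(i := x (q i))) \<partial>PiM ?J (\<lambda>_. \<mu>)) * h (merge ?I ?J (x, ?y0))"
      by (rule integral_mult_left_zero)
    also have "(\<integral>y. g ((\<lambda>a\<in>?A. y (q a))(i := x (q i))) \<partial>PiM ?J (\<lambda>_. \<mu>)) = (\<integral>w. g (w(i := x (q i))) \<partial>PiM ?A (\<lambda>_. \<mu>))"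
      using integral_distr[OF m gm] KK.distr_PiM_reindex_finite[of ?A q] injA by simp
    also have "\<dots> = 0" by (rule zm[OF xqi])
    finally show ?thesis by (simp only: mult_zero_left)
  qed
  then have "(\<integral>x. (\<integral>y. ?f (merge ?I ?J (x, y)) \<partial>PiM ?J (\<lambda>_. \<mu>)) \<partial>PiM ?I (\<lambda>_. \<mu>)) = (\<integral>x. 0 \<partial>PiM ?I (\<lambda>_. \<mu>))"
    by (rule Bochner_Integration.integral_cong[OF refl])
  moreover have "(\<integral>z. ?f z \<partial>PiM (?I \<union> ?J) (\<lambda>_. \<mu>)) = (\<integral>x. (\<integral>y. ?f (merge ?I ?J (x, y)) \<partial>PiM ?J (\<lambda>_. \<mu>)) \<partial>PiM ?I (\<lambda>_. \<mu>))"
    by (rule PS.product_integral_fold[OF _ _ _ fi]) auto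
  ultimately show ?thesis unfolding un by simp
qed

definition Kprod :: "nat \<Rightarrow> (nat \<Rightarrow> nat) \<Rightarrow> (nat \<Rightarrow> 'b) \<Rightarrow> real" where
  "Kprod m p z = (\<Prod>j<m. K (z j) (z (p j)))"

lemma Kprod_bm: "p permutes {..<m} \<Longrightarrow> bounded_measurable (mu_pow m) (Kprod m p)"
  unfolding Kprod_def using permutes_in_image[of p "{..<m}"]
  by (intro bounded_measurable_prod bounded_measurable_component2[OF K_bm]) auto

text \<open>A fixed point contributes the constant diagonal value, and the image of a moved point is
  moved as well, so only moved coordinates matter.\<close>

lemma Kprod_cong:
  assumes p: "p permutes {..<m}" and z: "z \<in> space (mu_pow m)" "z' \<in> space (mu_pow m)"
    and eq: "\<And>j. j < m \<Longrightarrow> p j \<noteq> j \<Longrightarrow> z j = z' j"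
  shows "Kprod m p z = Kprod m p z'"
  unfolding Kprod_def
proof (rule prod.cong[OF refl])
  fix j assume j: "j \<in> {..<m}"
  show "K (z j) (z (p j)) = K (z' j) (z' (p j))"
  proof (cases "p j = j")
    case True
    then show ?thesis using j space_pow_nth[OF z(1)] space_pow_nth[OF z(2)] by (simp add: K_diag)
  next
    case False
    have "p (p j) \<noteq> p j" using False permutes_inj[OF p] by (auto simp: inj_def)
    moreover have "p j < m" using permutes_in_image[OF p, of j] j by simp
    ultimately show ?thesis using eq[of j] eq[of "p j"] False j by simp
  qed
qed

text \<open>The two separation conditions say that, among the coordinates of the first copy, at most
  the i-th is shared with the second copy or moved by p. All others can be integrated out.\<close>

lemma zero_margin_Kprod:
  fixes q q' :: "nat \<Rightarrow> nat"
  assumes q: "inj_on q {..<k}" "q ` {..<k} \<subseteq> {..<m}" "q' ` {..<k} \<subseteq> {..<m}" and p: "p permutes {..<m}" and i: "i < k"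
    and g: "bounded_measurable (mu_pow k) g"
    and zm: "\<And>x. x \<in> space \<mu> \<Longrightarrow> (\<integral>y. g (y(i := x)) \<partial>PiM ({..<k} - {i}) (\<lambda>_. \<mu>)) = 0"
    and sep: "\<And>a b. a < k \<Longrightarrow> b < k \<Longrightarrow> q a = q' b \<Longrightarrow> a = i" "\<And>a. a < k \<Longrightarrow> p (q a) \<noteq> q a \<Longrightarrow> a = i"
  shows "(\<integral>z. g (\<lambda>a\<in>{..<k}. z (q a)) * (g (\<lambda>a\<in>{..<k}. z (q' a)) * Kprod m p z) \<partial>mu_pow m) = 0"
proof (rule zero_margin_integral[OF q(1,2) i g zm])
  show "bounded_measurable (mu_pow m) (\<lambda>z. g (\<lambda>a\<in>{..<k}. z (q' a)) * Kprod m p z)"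
    by (intro bounded_measurable_mult bounded_measurable_compose[OF g] select_measurable q(3) Kprod_bm p)
  fix z z' assume z: "z \<in> space (mu_pow m)" "z' \<in> space (mu_pow m)"
    and eq: "\<And>c. c < m \<Longrightarrow> c \<notin> q ` ({..<k} - {i}) \<Longrightarrow> z c = z' c"
  have "(\<lambda>a\<in>{..<k}. z (q' a)) = (\<lambda>a\<in>{..<k}. z' (q' a))"
  proof (rule restrict_ext)
    fix a assume "a \<in> {..<k}"
    then show "z (q' a) = z' (q' a)" using q(3) sep(1) by (intro eq) auto
  qed
  moreover have "Kprod m p z = Kprod m p z'"
    using sep(2) by (intro Kprod_cong[OF p z] eq) auto
  ultimately show "g (\<lambda>a\<in>{..<k}. z (q' a)) * Kprod m p z = g (\<lambda>a\<in>{..<k}. z' (q' a)) * Kprod m p z'" by simp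
qed auto

lemma Kprod_integral_bound:
  fixes G :: "(nat \<Rightarrow> 'b) \<Rightarrow> real"
  assumes p: "p permutes {..<m}" and G: "bounded_measurable (mu_pow m) G" and B: "\<And>z. z \<in> space (mu_pow m) \<Longrightarrow> \<bar>G z\<bar> \<le> B"
  shows "\<bar>\<integral>z. G z * Kprod m p z \<partial>mu_pow m\<bar> \<le> B * (\<integral>z. (\<Prod>j<m. \<bar>K (z j) (z (p j))\<bar>) \<partial>mu_pow m)"
proof -
  interpret F: finite_measure "mu_pow m" by (rule finite_measure_pow)
  have "\<bar>\<integral>z. G z * Kprod m p z \<partial>mu_pow m\<bar> \<le> (\<integral>z. \<bar>G z * Kprod m p z\<bar> \<partial>mu_pow m)" by (rule integral_abs_bound)
  also have "\<dots> \<le> (\<integral>z. B * \<bar>Kprod m p z\<bar> \<partial>mu_pow m)"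
  proof (rule integral_mono)
    show "integrable (mu_pow m) (\<lambda>z. \<bar>G z * Kprod m p z\<bar>)"
      by (intro F.bounded_measurable_integrable bounded_measurable_abs bounded_measurable_mult G Kprod_bm p)
    show "integrable (mu_pow m) (\<lambda>z. B * \<bar>Kprod m p z\<bar>)"
      by (intro F.bounded_measurable_integrable bounded_measurable_mult bounded_measurable_const bounded_measurable_abs Kprod_bm p)
    show "\<bar>G z * Kprod m p z\<bar> \<le> B * \<bar>Kprod m p z\<bar>" if "z \<in> space (mu_pow m)" for z
      using B[OF that] by (simp add: abs_mult mult_right_mono)
  qed
  also have "\<dots> = B * (\<integral>z. (\<Prod>j<m. \<bar>K (z j) (z (p j))\<bar>) \<partial>mu_pow m)"
    by (simp add: Kprod_def abs_prod)
  finally show ?thesis .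
qed

lemma rho_integral_bound:
  fixes G :: "(nat \<Rightarrow> 'b) \<Rightarrow> real"
  assumes G: "bounded_measurable (mu_pow m) G" and D: "\<And>p. p permutes {..<m} \<Longrightarrow> \<bar>\<integral>z. G z * Kprod m p z \<partial>mu_pow m\<bar> \<le> D"
  shows "\<bar>\<integral>z. G z * rho m z \<partial>mu_pow m\<bar> \<le> fact m * D"
proof -
  interpret F: finite_measure "mu_pow m" by (rule finite_measure_pow)
  let ?S = "{p. p permutes {..<m}}"
  have "(\<integral>z. G z * rho m z \<partial>mu_pow m) = (\<integral>z. (\<Sum>p\<in>?S. of_int (sign p) * (G z * Kprod m p z)) \<partial>mu_pow m)"
    by (simp add: ldet_def Kprod_def sum_distrib_left mult_ac)
  also have "\<dots> = (\<Sum>p\<in>?S. \<integral>z. of_int (sign p) * (G z * Kprod m p z) \<partial>mu_pow m)"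
    by (rule Bochner_Integration.integral_sum)
      (intro F.bounded_measurable_integrable bounded_measurable_mult bounded_measurable_const G Kprod_bm, simp)
  also have "\<dots> = (\<Sum>p\<in>?S. of_int (sign p) * (\<integral>z. G z * Kprod m p z \<partial>mu_pow m))" by simp
  also have "\<bar>\<dots>\<bar> \<le> (\<Sum>p\<in>?S. \<bar>of_int (sign p) * (\<integral>z. G z * Kprod m p z \<partial>mu_pow m)\<bar>)" by (rule sum_abs)
  also have "\<dots> \<le> (\<Sum>p\<in>?S. D)"
  proof (rule sum_mono)
    fix p assume "p \<in> ?S"
    then show "\<bar>of_int (sign p) * (\<integral>z. G z * Kprod m p z \<partial>mu_pow m)\<bar> \<le> D"
      using D[of p] by (cases rule: sign_cases[of p]) (auto simp: abs_mult)
  qed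
  also have "\<dots> = fact m * D" by (simp add: card_permutations[of "{..<m}" m])
  finally show ?thesis .
qed

section \<open>Second moment of a statistic with vanishing margins\<close>

context
  fixes k :: nat and g :: "(nat \<Rightarrow> 'b) \<Rightarrow> real" and B :: real
  assumes k1: "k \<ge> 1" and g: "bounded_measurable (mu_pow k) g"
    and B: "\<And>x. x \<in> space (mu_pow k) \<Longrightarrow> \<bar>g x\<bar> \<le> B"
    and zm: "\<And>i x. i < k \<Longrightarrow> x \<in> space \<mu> \<Longrightarrow> (\<integral>y. g (y(i := x)) \<partial>PiM ({..<k} - {i}) (\<lambda>_. \<mu>)) = 0"
begin

definition Gq :: "(nat \<Rightarrow> nat) \<Rightarrow> (nat \<Rightarrow> nat) \<Rightarrow> (nat \<Rightarrow> 'b) \<Rightarrow> real" where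
  "Gq q q' z = g (\<lambda>a\<in>{..<k}. z (q a)) * g (\<lambda>a\<in>{..<k}. z (q' a))"

lemma Gq_bm: "q ` {..<k} \<subseteq> {..<m} \<Longrightarrow> q' ` {..<k} \<subseteq> {..<m} \<Longrightarrow> bounded_measurable (mu_pow m) (Gq q q')"
  unfolding Gq_def by (intro bounded_measurable_mult bounded_measurable_compose[OF g] select_measurable)

lemma Gq_bound:
  assumes "q ` {..<k} \<subseteq> {..<m}" "q' ` {..<k} \<subseteq> {..<m}" "z \<in> space (mu_pow m)"
  shows "\<bar>Gq q q' z\<bar> \<le> B^2"
proof -
  have "(\<lambda>a\<in>{..<k}. z (q a)) \<in> space (mu_pow k)" "(\<lambda>a\<in>{..<k}. z (q' a)) \<in> space (mu_pow k)"
    using measurable_space[OF select_measurable[OF assms(1)] assms(3)] measurable_space[OF select_measurable[OF assms(2)] assms(3)] by auto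
  then show ?thesis unfolding Gq_def abs_mult power2_eq_square
    using B by (intro mult_mono order_trans[OF abs_ge_zero B]) auto
qed

text \<open>On 2k points a saving of NN^(3/2) is required. Permutations that do not provide it have
  so few moved points that one of the two copies has a vanishing integral.\<close>

lemma disjoint_pairs_bound:
  "\<bar>\<integral>z. Gq id ((+) k) z * rho (2 * k) z \<partial>mu_pow (2 * k)\<bar> \<le> fact (2 * k) * (B^2 * (sqrt NN * NN ^ (2 * k - 2)))"
proof (rule rho_integral_bound)
  let ?m = "2 * k"
  let ?D = "B^2 * (sqrt NN * NN ^ (2 * k - 2))"
  have D0: "0 \<le> ?D" using c_pos mass_pos by simp
  have im: "id ` {..<k} \<subseteq> {..<?m}" "(+) k ` {..<k} \<subseteq> {..<?m}" by auto
  show "bounded_measurable (mu_pow ?m) (Gq id ((+) k))" by (rule Gq_bm[OF im])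
  fix p assume p: "p permutes {..<?m}"
  have pinj: "p a = p b \<longleftrightarrow> a = b" for a b using permutes_inj[OF p] by (auto simp: inj_def)
  have plt: "p a < ?m \<longleftrightarrow> a < ?m" for a using permutes_in_image[OF p, of a] by simp
  show "\<bar>\<integral>z. Gq id ((+) k) z * Kprod ?m p z \<partial>mu_pow ?m\<bar> \<le> ?D"
  proof (cases "\<exists>i j. i < ?m \<and> p i \<noteq> i \<and> j < ?m \<and> p j \<noteq> j \<and> j \<noteq> i \<and> p j \<noteq> i")
    case True
    then obtain i j where ij: "i < ?m" "p i \<noteq> i" "j < ?m" "p j \<noteq> j" "j \<noteq> i" "p j \<noteq> i" by blast
    have "\<bar>\<integral>z. Gq id ((+) k) z * Kprod ?m p z \<partial>mu_pow ?m\<bar> \<le> B^2 * (\<integral>z. (\<Prod>j<?m. \<bar>K (z j) (z (p j))\<bar>) \<partial>mu_pow ?m)"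
      by (rule Kprod_integral_bound[OF p Gq_bm[OF im] Gq_bound[OF im]])
    also have "\<dots> \<le> ?D" using permutation_product_bound_3[OF p ij] by (intro mult_left_mono) auto
    finally show ?thesis .
  next
    case False
    then have two: "j = i \<or> p j = i" if "i < ?m" "p i \<noteq> i" "j < ?m" "p j \<noteq> j" for i j using that by blast
    \<comment> \<open>By \<open>two\<close>, p is the identity or a transposition. If at most one
      point of the first copy is moved, that copy integrates to 0; otherwise both moved points lie
      in the first copy and the second one is fixed.\<close>
    have "(\<exists>i<k. \<forall>a<k. p a \<noteq> a \<longrightarrow> a = i) \<or> (\<forall>a<k. p (k + a) = k + a)"
    proof (cases "\<exists>a b. a < k \<and> b < k \<and> a \<noteq> b \<and> p a \<noteq> a \<and> p b \<noteq> b")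
      case True
      then obtain a b where ab: "a < k" "b < k" "a \<noteq> b" "p a \<noteq> a" "p b \<noteq> b" by blast
      have "p b = a" using two[of a b] ab by auto
      have "p (k + e) = k + e" if e: "e < k" for e
      proof (rule ccontr)
        assume "p (k + e) \<noteq> k + e"
        then have "k + e = a \<or> p (k + e) = a" using two[of a "k + e"] ab e by auto
        then have "p (k + e) = p b" using ab \<open>p b = a\<close> by auto
        then show False using pinj[of "k + e" b] ab by simp
      qed
      then show ?thesis by blast
    next
      case False
      show ?thesis
      proof (cases "\<exists>a<k. p a \<noteq> a")
        case True then show ?thesis using False by blast
      next
        case False then show ?thesis using k1 by (intro disjI1 exI[of _ 0]) auto
      qed
    qed
    then have "(\<integral>z. Gq id ((+) k) z * Kprod ?m p z \<partial>mu_pow ?m) = 0"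
    proof
      assume "\<exists>i<k. \<forall>a<k. p a \<noteq> a \<longrightarrow> a = i"
      then obtain i where i: "i < k" "\<And>a. a < k \<Longrightarrow> p a \<noteq> a \<Longrightarrow> a = i" by blast
      have "(\<integral>z. g (\<lambda>a\<in>{..<k}. z (id a)) * (g (\<lambda>a\<in>{..<k}. z (k + a)) * Kprod ?m p z) \<partial>mu_pow ?m) = 0"
      proof (rule zero_margin_Kprod[OF _ im p i(1) g zm[OF i(1)]])
        show "a = i" if "a < k" "p (id a) \<noteq> id a" for a using i(2)[of a] that by simp
      qed auto
      then show ?thesis by (simp add: Gq_def mult.assoc)
    next
      assume fix2: "\<forall>a<k. p (k + a) = k + a"
      have k0: "0 < k" using k1 by simp
      have "(\<integral>z. g (\<lambda>a\<in>{..<k}. z (k + a)) * (g (\<lambda>a\<in>{..<k}. z (id a)) * Kprod ?m p z) \<partial>mu_pow ?m) = 0"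
      proof (rule zero_margin_Kprod[OF _ im(2,1) p k0 g zm[OF k0]])
        show "a = 0" if "a < k" "p (k + a) \<noteq> k + a" for a using fix2 that by blast
      qed auto
      then show ?thesis by (simp add: Gq_def mult_ac)
    qed
    then show ?thesis using D0 by simp
  qed
qed

text \<open>Entry j of the second tuple is identified with entry i of the first, the others take the
  slots from k to 2k - 2. The last entry fills slot k + j, which would otherwise stay vacant; for j
  = k - 1 there is no gap and the first branch takes precedence.\<close>

definition overlap :: "nat \<Rightarrow> nat \<Rightarrow> nat \<Rightarrow> nat" where
  "overlap i j b = (if b = j then i else if b = k - 1 then k + j else k + b)"

lemma overlap_props:
  assumes "i < k" "j < k"
  shows "inj_on (overlap i j) {..<k}" "id ` {..<k} \<union> overlap i j ` {..<k} = {..<2 * k - 1}"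
    "a < k \<Longrightarrow> b < k \<Longrightarrow> a = overlap i j b \<longleftrightarrow> a = i \<and> b = j"
proof -
  show "inj_on (overlap i j) {..<k}" using assms by (auto simp: inj_on_def overlap_def)
  show "a < k \<Longrightarrow> b < k \<Longrightarrow> a = overlap i j b \<longleftrightarrow> a = i \<and> b = j" using assms by (auto simp: overlap_def)
  show "id ` {..<k} \<union> overlap i j ` {..<k} = {..<2 * k - 1}"
  proof (intro equalityI subsetI)
    fix x assume "x \<in> id ` {..<k} \<union> overlap i j ` {..<k}"
    then consider "x < k" | b where "b < k" "x = overlap i j b" by auto
    then show "x \<in> {..<2 * k - 1}"
    proof cases
      case 1
      then show ?thesis by auto
    next
      case 2
      then show ?thesis using assms by (cases "b = j"; cases "b = k - 1") (auto simp: overlap_def)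
    qed
  next
    fix x assume x: "x \<in> {..<2 * k - 1}"
    consider "x < k" | "x = k + j" | "x > k - 1" "x \<noteq> k + j" using k1 by linarith
    then show "x \<in> id ` {..<k} \<union> overlap i j ` {..<k}"
    proof cases
      case 2
      then have "j \<noteq> k - 1" using x k1 by auto
      then have "x = overlap i j (k - 1)" using 2 by (auto simp: overlap_def)
      then show ?thesis using k1 by auto
    next
      case 3
      then have "x = overlap i j (x - k)" "x - k < k" using x by (auto simp: overlap_def)
      then show ?thesis by blast
    qed auto
  qed
qed

text \<open>With 2k - 1 points only a square root has to be saved, which any moved point achieves.
  For the identity permutation the shared coordinate is the only obstruction, and the margin at i
  vanishes.\<close>

lemma overlap_pairs_bound:
  assumes ij: "i < k" "j < k"
  shows "\<bar>\<integral>z. Gq id (overlap i j) z * rho (2 * k - 1) z \<partial>mu_pow (2 * k - 1)\<bar> \<le> fact (2 * k - 1) * (B^2 * (sqrt NN * NN ^ (2 * k - 2)))"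
proof (rule rho_integral_bound)
  let ?m = "2 * k - 1"
  let ?D = "B^2 * (sqrt NN * NN ^ (2 * k - 2))"
  have D0: "0 \<le> ?D" using c_pos mass_pos by simp
  have im: "id ` {..<k} \<subseteq> {..<?m}" "overlap i j ` {..<k} \<subseteq> {..<?m}" using overlap_props(2)[OF ij] by blast+
  show "bounded_measurable (mu_pow ?m) (Gq id (overlap i j))" by (rule Gq_bm[OF im])
  fix p assume p: "p permutes {..<?m}"
  show "\<bar>\<integral>z. Gq id (overlap i j) z * Kprod ?m p z \<partial>mu_pow ?m\<bar> \<le> ?D"
  proof (cases "\<exists>i<?m. p i \<noteq> i")
    case True
    then obtain l where l: "l < ?m" "p l \<noteq> l" by blast
    have "\<bar>\<integral>z. Gq id (overlap i j) z * Kprod ?m p z \<partial>mu_pow ?m\<bar> \<le> B^2 * (\<integral>z. (\<Prod>j<?m. \<bar>K (z j) (z (p j))\<bar>) \<partial>mu_pow ?m)"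
      by (rule Kprod_integral_bound[OF p Gq_bm[OF im] Gq_bound[OF im]])
    also have "\<dots> \<le> B^2 * (sqrt NN * NN ^ (?m - 1))" using permutation_product_bound_1[OF p l] by (intro mult_left_mono) auto
    also have "?m - 1 = 2 * k - 2" by simp
    finally show ?thesis .
  next
    case False
    have "(\<integral>z. g (\<lambda>a\<in>{..<k}. z (id a)) * (g (\<lambda>a\<in>{..<k}. z (overlap i j a)) * Kprod ?m p z) \<partial>mu_pow ?m) = 0"
    proof (rule zero_margin_Kprod[OF _ im p ij(1) g zm[OF ij(1)]])
      show "a = i" if "a < k" "b < k" "id a = overlap i j b" for a b using overlap_props(3)[OF ij that(1,2)] that(3) by simp
      show "a = i" if "a < k" "p (id a) \<noteq> id a" for a using False that im by auto
    qed auto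
    then show ?thesis using D0 by (simp add: Gq_def mult.assoc)
  qed
qed

text \<open>The three constants belong to the three kinds of coincidence patterns: none, exactly one
  (k * k choices), and at least two, whose number is at most 2 to the power k * k. The resulting
  exponent of \<open>NN\<close> is 2k - 3/2.\<close>

lemma degenerate_second_moment:
  defines "X \<equiv> \<lambda>\<omega>. \<Sum>x\<in>distinct_tuples k (\<Phi> \<omega>). g x"
  shows "integrable M X" "integrable M (\<lambda>\<omega>. (X \<omega>)^2)"
    "expectation (\<lambda>\<omega>. (X \<omega>)^2) \<le> (fact (2 * k) + real (k * k) * fact (2 * k - 1) + 2 ^ (k * k)) * B^2 * (sqrt NN * NN ^ (2 * k - 2))"
proof -
  let ?Y = "sqrt NN * NN ^ (2 * k - 2)"
  obtain n where n: "real n = NN" using dim_exists by blast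
  \<comment> \<open>\<open>NN\<close> is a positive integer; this absorbs the power 2k - 2 into the
    larger bound.\<close>
  have n1: "NN \<ge> 1" using n c_pos mass_pos by (cases n) (auto simp: zero_less_mult_iff)
  have B0: "B \<ge> 0"
  proof -
    obtain u0 where "u0 \<in> space \<mu>" using mass_pos by (metis measure_empty equals0I less_irrefl)
    then have "(\<lambda>_\<in>{..<k}. u0) \<in> space (mu_pow k)" by (auto simp: space_PiM)
    from B[OF this] show ?thesis by linarith
  qed
  show iX: "integrable M X"
    using expectation_tuples[OF k1 g] by (auto simp: X_def has_bochner_integral_iff)
  have card_le: "AE \<omega> in M. card (distinct_tuples k (\<Phi> \<omega>)) \<le> n ^ k"
    using card_Phi[OF n] AE_space
  proof eventually_elim
    case (elim \<omega>)
    have "card (distinct_tuples k (\<Phi> \<omega>)) \<le> card ({..<k} \<rightarrow>\<^sub>E \<Phi> \<omega>)"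
      using Phi_finite[OF elim(2)] by (intro card_mono finite_PiE) (auto simp: distinct_tuples_def)
    then show ?case using elim(1) by (simp add: card_funcsetE)
  qed
  have gP: "\<bar>g x\<bar> \<le> B" if "\<omega> \<in> space M" "x \<in> distinct_tuples k (\<Phi> \<omega>)" for \<omega> x
    using B distinct_tuples_space[OF that] by blast
  have X_le: "AE \<omega> in M. \<bar>X \<omega>\<bar> \<le> real (n ^ k) * B"
    using card_le AE_space
  proof eventually_elim
    case (elim \<omega>)
    have "\<bar>X \<omega>\<bar> \<le> (\<Sum>x\<in>distinct_tuples k (\<Phi> \<omega>). B)"
      unfolding X_def using gP[OF elim(2)] by (intro order_trans[OF sum_abs] sum_mono)
    also have "\<dots> \<le> real (n ^ k) * B" using elim(1) B0 by (simp add: mult_right_mono del: of_nat_power)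
    finally show ?case .
  qed
  show iX2: "integrable M (\<lambda>\<omega>. (X \<omega>)^2)"
  proof (rule integrable_const_bound)
    show "AE \<omega> in M. norm ((X \<omega>)^2) \<le> (real (n ^ k) * B)^2"
      using X_le by eventually_elim (simp add: abs_le_square_iff[symmetric] del: of_nat_power)
    show "(\<lambda>\<omega>. (X \<omega>)^2) \<in> borel_measurable M" using iX by measurable
  qed
  let ?IJ = "{..<k} \<times> {..<k}"
  define Z0 where "Z0 = (\<lambda>\<omega>. \<Sum>z\<in>distinct_tuples (2 * k) (\<Phi> \<omega>). Gq id ((+) k) z)"
  define Z1 where "Z1 = (\<lambda>ij \<omega>. \<Sum>z\<in>distinct_tuples (2 * k - 1) (\<Phi> \<omega>). Gq id (overlap (fst ij) (snd ij)) z)"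
  have im0: "id ` {..<k} \<subseteq> {..<2 * k}" "(+) k ` {..<k} \<subseteq> {..<2 * k}" by auto
  have h0: "has_bochner_integral M Z0 (\<integral>z. Gq id ((+) k) z * rho (2 * k) z \<partial>mu_pow (2 * k))"
    unfolding Z0_def using k1 by (intro expectation_tuples Gq_bm im0) auto
  have im1: "id ` {..<k} \<subseteq> {..<2 * k - 1}" "overlap i j ` {..<k} \<subseteq> {..<2 * k - 1}" if "i < k" "j < k" for i j
    using overlap_props(2)[OF that] by blast+
  have h1: "has_bochner_integral M (Z1 ij) (\<integral>z. Gq id (overlap (fst ij) (snd ij)) z * rho (2 * k - 1) z \<partial>mu_pow (2 * k - 1))" if "ij \<in> ?IJ" for ij
    unfolding Z1_def
  proof (rule expectation_tuples)
    have "fst ij < k" "snd ij < k" using that by auto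
    from Gq_bm[OF im1[OF this]] show "bounded_measurable (mu_pow (2 * k - 1)) (Gq id (overlap (fst ij) (snd ij)))" .
  qed (use k1 in auto)
  \<comment> \<open>The contribution of pairs with at least two coincidences. It is estimated by
    counting, without correlation functions.\<close>
  define R where "R = (\<lambda>\<omega>. (X \<omega>)^2 - Z0 \<omega> - (\<Sum>ij\<in>?IJ. Z1 ij \<omega>))"
  have iR: "integrable M R" unfolding R_def
    using iX2 h0 h1 by (intro Bochner_Integration.integrable_diff Bochner_Integration.integrable_sum) (auto simp: has_bochner_integral_iff)
  have R_le: "AE \<omega> in M. R \<omega> \<le> 2 ^ (k * k) * B^2 * real n ^ (2 * k - 2)"
    using card_Phi[OF n] AE_space
  proof eventually_elim
    case (elim \<omega>)
    let ?P = "\<Phi> \<omega>"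
    let ?A = "distinct_tuples k ?P \<times> distinct_tuples k ?P"
    let ?h = "\<lambda>t. g (fst t) * g (snd t)"
    define H where "H = (\<lambda>C. \<Sum>t\<in>{t \<in> ?A. coincidences k t = C}. ?h t)"
    have fP: "finite ?P" by (rule Phi_finite[OF elim(2)])
    have fA: "finite ?A" using finite_distinct_tuples[OF fP] by auto
    have "(X \<omega>)^2 = (\<Sum>t\<in>?A. ?h t)"
      by (simp add: X_def power2_eq_square sum_product sum.cartesian_product split_beta)
    also have "\<dots> = (\<Sum>C\<in>Pow ?IJ. H C)"
      unfolding H_def using fA by (intro sum.group[symmetric]) (auto simp: coincidences_def)
    finally have X2: "(X \<omega>)^2 = (\<Sum>C\<in>Pow ?IJ. H C)" .
    have Z0: "Z0 \<omega> = H {}"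
    proof -
      have "Z0 \<omega> = (\<Sum>z\<in>distinct_tuples (2 * k) ?P. g (\<lambda>a\<in>{..<k}. z (id a)) * g (\<lambda>a\<in>{..<k}. z (k + a)))"
        by (simp add: Z0_def Gq_def)
      also have "\<dots> = (\<Sum>t\<in>{t \<in> ?A. coincidences k t = {(a,b). a < k \<and> b < k \<and> id a = k + b}}. g (fst t) * g (snd t))"
      proof (rule sum_pairs_by_pattern)
        show "id ` {..<k} \<union> (+) k ` {..<k} = {..<2 * k}"
        proof (intro equalityI subsetI)
          fix x assume x: "x \<in> {..<2 * k}"
          show "x \<in> id ` {..<k} \<union> (+) k ` {..<k}"
          proof (cases "x < k")
            case False
            then have "x = k + (x - k)" "x - k < k" using x by auto
            then show ?thesis by blast
          qed auto
        qed auto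
      qed auto
      also have "{(a,b). a < k \<and> b < k \<and> id a = k + b} = {}" by auto
      finally show ?thesis by (simp only: H_def)
    qed
    have Z1: "Z1 (i,j) \<omega> = H {(i,j)}" if ij: "i < k" "j < k" for i j
    proof -
      have "Z1 (i,j) \<omega> = (\<Sum>z\<in>distinct_tuples (2 * k - 1) ?P. g (\<lambda>a\<in>{..<k}. z (id a)) * g (\<lambda>a\<in>{..<k}. z (overlap i j a)))"
        by (simp add: Z1_def Gq_def)
      also have "\<dots> = (\<Sum>t\<in>{t \<in> ?A. coincidences k t = {(a,b). a < k \<and> b < k \<and> id a = overlap i j b}}. g (fst t) * g (snd t))"
        by (rule sum_pairs_by_pattern) (use overlap_props(1,2)[OF ij] in auto)
      also have "{(a,b). a < k \<and> b < k \<and> id a = overlap i j b} = {(i,j)}" using overlap_props(3)[OF ij] ij by auto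
      finally show ?thesis by (simp only: H_def)
    qed
    have H_le: "\<bar>H C\<bar> \<le> B^2 * real n ^ (2 * k - 2)" if C: "C \<in> Pow ?IJ" "C \<noteq> {}" "\<And>ij. C \<noteq> {ij}" for C
    proof -
      obtain u v where uv: "u \<in> C" "v \<in> C" "u \<noteq> v" using C(2,3) by blast
      have "\<bar>H C\<bar> \<le> (\<Sum>t\<in>{t \<in> ?A. coincidences k t = C}. B^2)"
        unfolding H_def
      proof (intro order_trans[OF sum_abs] sum_mono)
        fix t assume "t \<in> {t \<in> ?A. coincidences k t = C}"
        then have "\<bar>g (fst t)\<bar> \<le> B" "\<bar>g (snd t)\<bar> \<le> B" using gP[OF elim(2)] by auto
        then show "\<bar>?h t\<bar> \<le> B^2" using B0 by (simp add: abs_mult power2_eq_square mult_mono)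
      qed
      also have "\<dots> = real (card {t \<in> ?A. coincidences k t = C}) * B^2" by simp
      also have "\<dots> \<le> real (n ^ (2 * k - 2)) * B^2"
        using card_many_coincidences[OF fP, of "fst u" "snd u" C "fst v" "snd v" k] uv elim(1)
        by (intro mult_right_mono of_nat_mono) (auto simp: prod_eq_iff)
      finally show ?thesis by (simp add: mult.commute)
    qed
    let ?S1 = "(\<lambda>ij. {ij}) ` ?IJ"
    let ?Rest = "Pow ?IJ - insert {} ?S1"
    have "(\<Sum>C\<in>Pow ?IJ. H C) = (\<Sum>C\<in>?Rest. H C) + (\<Sum>C\<in>insert {} ?S1. H C)"
      by (rule sum.subset_diff) auto
    also have "(\<Sum>C\<in>insert {} ?S1. H C) = H {} + (\<Sum>C\<in>?S1. H C)" by (subst sum.insert) auto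
    also have "(\<Sum>C\<in>?S1. H C) = (\<Sum>ij\<in>?IJ. H {ij})" by (subst sum.reindex) (auto simp: inj_on_def)
    also have "\<dots> = (\<Sum>ij\<in>?IJ. Z1 ij \<omega>)" using Z1 by (intro sum.cong refl) auto
    finally have "R \<omega> = (\<Sum>C\<in>?Rest. H C)" unfolding R_def X2 Z0 by simp
    also have "\<dots> \<le> (\<Sum>C\<in>?Rest. B^2 * real n ^ (2 * k - 2))"
    proof (rule sum_mono)
      fix C assume C: "C \<in> ?Rest"
      have "\<bar>H C\<bar> \<le> B^2 * real n ^ (2 * k - 2)"
        by (rule H_le) (use C in auto)
      then show "H C \<le> B^2 * real n ^ (2 * k - 2)" by linarith
    qed
    also have "\<dots> \<le> (\<Sum>C\<in>Pow ?IJ. B^2 * real n ^ (2 * k - 2))" by (intro sum_mono2) auto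
    also have "\<dots> = 2 ^ (k * k) * B^2 * real n ^ (2 * k - 2)" by (simp add: card_Pow card_cartesian_product)
    finally show ?case .
  qed
  have "expectation R \<le> 2 ^ (k * k) * B^2 * NN ^ (2 * k - 2)"
    using integral_mono_AE[OF iR _ R_le] n by (simp add: prob_space)
  also have "\<dots> \<le> 2 ^ (k * k) * B^2 * ?Y"
  proof (rule mult_left_mono)
    have "1 \<le> sqrt NN" using n1 by simp
    then show "NN ^ (2 * k - 2) \<le> ?Y" using n1 by (simp add: mult_le_cancel_right1)
  qed simp
  finally have ER: "expectation R \<le> 2 ^ (k * k) * B^2 * ?Y" .
  have E0: "expectation Z0 \<le> fact (2 * k) * (B^2 * ?Y)"
    using h0 disjoint_pairs_bound by (simp add: has_bochner_integral_iff abs_le_iff)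
  have E1: "expectation (Z1 ij) \<le> fact (2 * k - 1) * (B^2 * ?Y)" if "ij \<in> ?IJ" for ij
    using h1[OF that] overlap_pairs_bound[of "fst ij" "snd ij"] that by (auto simp: has_bochner_integral_iff abs_le_iff)
  have "expectation (\<lambda>\<omega>. (X \<omega>)^2) = expectation (\<lambda>\<omega>. Z0 \<omega> + (\<Sum>ij\<in>?IJ. Z1 ij \<omega>) + R \<omega>)"
    by (rule Bochner_Integration.integral_cong) (auto simp: R_def)
  also have "\<dots> = expectation Z0 + (\<Sum>ij\<in>?IJ. expectation (Z1 ij)) + expectation R"
  proof -
    have "integrable M Z0" "\<And>ij. ij \<in> ?IJ \<Longrightarrow> integrable M (Z1 ij)" using h0 h1 by (auto simp: has_bochner_integral_iff)
    then show ?thesis using iR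
      by (subst Bochner_Integration.integral_add) (auto simp: Bochner_Integration.integral_sum)
  qed
  also have "\<dots> \<le> fact (2 * k) * (B^2 * ?Y) + (\<Sum>ij\<in>?IJ. fact (2 * k - 1) * (B^2 * ?Y)) + 2 ^ (k * k) * B^2 * ?Y"
    using E0 E1 ER by (intro add_mono sum_mono) auto
  also have "\<dots> = (fact (2 * k) + real (k * k) * fact (2 * k - 1) + 2 ^ (k * k)) * B^2 * ?Y"
    by (simp add: card_cartesian_product algebra_simps)
  finally show "expectation (\<lambda>\<omega>. (X \<omega>)^2) \<le> (fact (2 * k) + real (k * k) * fact (2 * k - 1) + 2 ^ (k * k)) * B^2 * ?Y" .
qed

end

end

section \<open>Normal limits\<close>

lemma Cauchy_Schwarz_integral:
  fixes f g :: "'a \<Rightarrow> real"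
  assumes f: "f \<in> borel_measurable M" "integrable M (\<lambda>x. (f x)^2)" and g: "g \<in> borel_measurable M" "integrable M (\<lambda>x. (g x)^2)"
  shows "integrable M (\<lambda>x. f x * g x)" "(\<integral>x. f x * g x \<partial>M)^2 \<le> (\<integral>x. (f x)^2 \<partial>M) * (\<integral>x. (g x)^2 \<partial>M)"
proof -
  show fg: "integrable M (\<lambda>x. f x * g x)"
  proof (rule Bochner_Integration.integrable_bound[OF Bochner_Integration.integrable_add[OF f(2) g(2)]])
    show "(\<lambda>x. f x * g x) \<in> borel_measurable M" using f(1) g(1) by measurable
    have "\<bar>a * b\<bar> \<le> a^2 + b^2" for a b :: real
    proof -
      have "2 * (\<bar>a\<bar> * \<bar>b\<bar>) \<le> a^2 + b^2" using sum_squares_bound[of "\<bar>a\<bar>" "\<bar>b\<bar>"] by (simp add: mult.assoc)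
      moreover have "0 \<le> \<bar>a\<bar> * \<bar>b\<bar>" by simp
      ultimately show ?thesis unfolding abs_mult by linarith
    qed
    then show "AE x in M. norm (f x * g x) \<le> norm ((f x)^2 + (g x)^2)" by (auto intro: order_trans)
  qed
  define a b c where "a = (\<integral>x. (f x)^2 \<partial>M)" and "b = (\<integral>x. f x * g x \<partial>M)" and "c = (\<integral>x. (g x)^2 \<partial>M)"
  have quad: "0 \<le> s^2 * a + 2 * s * t * b + t^2 * c" for s t
  proof -
    have "0 \<le> (\<integral>x. (s * f x + t * g x)^2 \<partial>M)" by simp
    also have "\<dots> = (\<integral>x. s^2 * (f x)^2 + 2 * s * t * (f x * g x) + t^2 * (g x)^2 \<partial>M)"
      by (rule Bochner_Integration.integral_cong) (auto simp: power2_sum power_mult_distrib mult_ac)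
    also have "\<dots> = s^2 * a + 2 * s * t * b + t^2 * c"
      using f(2) g(2) fg by (simp add: a_def b_def c_def)
    finally show ?thesis .
  qed
  have "0 \<le> a" "0 \<le> c" by (simp_all add: a_def c_def)
  show "b^2 \<le> a * c"
  proof (cases "a = 0")
    case True
    have "b = 0"
    proof (rule ccontr)
      assume b: "b \<noteq> 0"
      \<comment> \<open>With a = 0 the quadratic form at s = -(c + 1)/(2b), t = 1 would equal
        -1.\<close>
      have "2 * (- (c + 1) / (2 * b)) * 1 * b = - (c + 1)" using b by (simp add: field_simps)
      then show False using quad[of "- (c + 1) / (2 * b)" 1] True by simp
    qed
    then show ?thesis using True by simp
  next
    case False
    have "0 \<le> a * (a * c - b^2)" using quad[of "-b" a] by (simp add: power2_eq_square algebra_simps)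
    then show ?thesis using False \<open>0 \<le> a\<close> by (simp add: zero_le_mult_iff)
  qed
qed

lemma (in prob_space) variance_le_second_moment:
  fixes G :: "'a \<Rightarrow> real"
  assumes "integrable M G" "integrable M (\<lambda>\<omega>. (G \<omega>)^2)"
  shows "variance G \<le> expectation (\<lambda>\<omega>. (G \<omega>)^2)"
  using variance_eq[OF assms] by simp

lemma (in prob_space) variance_sum_bound:
  fixes U V :: "'a \<Rightarrow> real"
  assumes U: "U \<in> borel_measurable M" "integrable M (\<lambda>x. (U x)^2)" and V: "V \<in> borel_measurable M" "integrable M (\<lambda>x. (V x)^2)"
  shows "\<bar>expectation (\<lambda>x. (U x + V x)^2) - expectation (\<lambda>x. (U x)^2)\<bar>
    \<le> 2 * sqrt (expectation (\<lambda>x. (U x)^2) * expectation (\<lambda>x. (V x)^2)) + expectation (\<lambda>x. (V x)^2)"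
proof -
  note CS = Cauchy_Schwarz_integral[OF U V]
  have "expectation (\<lambda>x. (U x + V x)^2) = expectation (\<lambda>x. (U x)^2 + 2 * (U x * V x) + (V x)^2)"
    by (simp add: power2_sum algebra_simps)
  also have "\<dots> = expectation (\<lambda>x. (U x)^2) + 2 * expectation (\<lambda>x. U x * V x) + expectation (\<lambda>x. (V x)^2)"
    using U V CS(1) by simp
  finally have e: "expectation (\<lambda>x. (U x + V x)^2) - expectation (\<lambda>x. (U x)^2) = 2 * expectation (\<lambda>x. U x * V x) + expectation (\<lambda>x. (V x)^2)" by simp
  have "\<bar>expectation (\<lambda>x. U x * V x)\<bar> \<le> sqrt (expectation (\<lambda>x. (U x)^2) * expectation (\<lambda>x. (V x)^2))"
    using CS(2) by (intro real_le_rsqrt) simp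
  moreover have "0 \<le> expectation (\<lambda>x. (V x)^2)" by simp
  ultimately show ?thesis unfolding e by linarith
qed

text \<open>The factor exp(i U) has modulus 1 and |exp(i V) - 1| <= |V|; Cauchy-Schwarz against 1
  passes to the second moment.\<close>

lemma (in prob_space) char_perturbation:
  fixes U V :: "'a \<Rightarrow> real"
  assumes U: "U \<in> borel_measurable M" and V: "V \<in> borel_measurable M" "integrable M (\<lambda>x. (V x)^2)"
  shows "norm (expectation (\<lambda>x. exp (\<i> * of_real (U x + V x))) - expectation (\<lambda>x. exp (\<i> * of_real (U x)))) \<le> sqrt (expectation (\<lambda>x. (V x)^2))"
proof -
  have iexp: "integrable M (\<lambda>x. exp (\<i> * complex_of_real (W x)))" if "W \<in> borel_measurable M" for W
    using that by (intro integrable_const_bound[of _ 1]) auto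
  have V1: "integrable M (\<lambda>x. 1 * \<bar>V x\<bar>)" "(expectation (\<lambda>x. 1 * \<bar>V x\<bar>))^2 \<le> expectation (\<lambda>x. 1^2) * expectation (\<lambda>x. \<bar>V x\<bar>^2)"
    by (rule Cauchy_Schwarz_integral; use V in simp)+
  have "norm (expectation (\<lambda>x. exp (\<i> * of_real (U x + V x))) - expectation (\<lambda>x. exp (\<i> * of_real (U x))))
      = norm (expectation (\<lambda>x. exp (\<i> * of_real (U x + V x)) - exp (\<i> * of_real (U x))))"
    using iexp[of U] iexp[of "\<lambda>x. U x + V x"] U V(1) by (subst Bochner_Integration.integral_diff) auto
  also have "\<dots> \<le> expectation (\<lambda>x. norm (exp (\<i> * complex_of_real (U x + V x)) - exp (\<i> * of_real (U x))))"
    by (rule integral_norm_bound)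
  also have "\<dots> \<le> expectation (\<lambda>x. \<bar>V x\<bar>)"
  proof (rule integral_mono)
    show "integrable M (\<lambda>x. norm (exp (\<i> * complex_of_real (U x + V x)) - exp (\<i> * of_real (U x))))"
      using iexp[of U] iexp[of "\<lambda>x. U x + V x"] U V(1) by auto
    show "integrable M (\<lambda>x. \<bar>V x\<bar>)" using V1(1) by simp
    fix x
    have "exp (\<i> * complex_of_real (U x + V x)) - exp (\<i> * of_real (U x)) = exp (\<i> * of_real (U x)) * (exp (\<i> * of_real (V x)) - 1)"
      by (simp add: exp_add algebra_simps)
    then have "norm (exp (\<i> * complex_of_real (U x + V x)) - exp (\<i> * of_real (U x))) = norm (exp (\<i> * of_real (V x)) - 1)"
      by (simp add: norm_mult)
    also have "\<dots> \<le> \<bar>V x\<bar>" using iexp_approx1[of "V x" 0] by simp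
    finally show "norm (exp (\<i> * complex_of_real (U x + V x)) - exp (\<i> * of_real (U x))) \<le> \<bar>V x\<bar>" .
  qed
  also have "\<dots> \<le> sqrt (expectation (\<lambda>x. (V x)^2))"
    using V1(2) by (intro real_le_rsqrt) (simp add: prob_space)
  finally show ?thesis .
qed

text \<open>The probabilistic part, separated from the geometry: \<open>A\<close> is the scale of
  the variance, \<open>N\<close> the number of points. After normalisation the argument \<tau> of
  the characteristic function of Y satisfies \<tau>^2 N -> t^2 / v, so the cubic error N |\<tau>|^3
  vanishes as N grows.\<close>

lemma variance_and_clt_of_main_term:
  fixes X Y G :: "nat \<Rightarrow> 'a \<Rightarrow> real" and M :: "nat \<Rightarrow> 'a measure" and a e N A :: "nat \<Rightarrow> real" and B q v :: real
  defines "E \<equiv> \<lambda>n (h :: 'a \<Rightarrow> real). \<integral>\<omega>. h \<omega> \<partial>M n"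
  defines "EC \<equiv> \<lambda>n (h :: 'a \<Rightarrow> complex). \<integral>\<omega>. h \<omega> \<partial>M n"
  defines "Var \<equiv> \<lambda>n h. \<integral>\<omega>. (h \<omega> - (\<integral>\<omega>'. h \<omega>' \<partial>M n))^2 \<partial>M n"
  assumes prob: "\<And>n. prob_space (M n)"
    and X: "\<And>n. X n \<in> borel_measurable (M n)"
    and Y: "\<And>n. integrable (M n) (Y n)" "\<And>n. integrable (M n) (\<lambda>\<omega>. (Y n \<omega>)^2)"
    and G: "\<And>n. integrable (M n) (G n)" "\<And>n. integrable (M n) (\<lambda>\<omega>. (G n \<omega>)^2)"
    and eq: "\<And>n. AE \<omega> in M n. X n \<omega> = a n * Y n \<omega> + e n + G n \<omega>"
    and pos: "\<And>n. A n > 0" "\<And>n. N n > 0" "q > 0" "v > 0"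
    and main: "(\<lambda>n. (a n)^2 * Var n (Y n) / A n) \<longlonglongrightarrow> q"
    and rem: "(\<lambda>n. E n (\<lambda>\<omega>. (G n \<omega>)^2) / A n) \<longlonglongrightarrow> 0"
    and YN: "(\<lambda>n. Var n (Y n) / N n) \<longlonglongrightarrow> v"
    and N: "filterlim N at_top sequentially"
    and cf: "\<And>n t. \<bar>t\<bar> * B \<le> 1/2 \<Longrightarrow> \<exists>z. EC n (\<lambda>\<omega>. exp (\<i> * of_real (t * Y n \<omega>))) = exp z \<and>
        norm (z - (\<i> * of_real (t * E n (Y n)) - of_real (t^2 * Var n (Y n) / 2))) \<le> 3 * N n * (\<bar>t\<bar> * B) ^ 3"
  shows "(\<lambda>n. Var n (X n) / A n) \<longlonglongrightarrow> q"
    and "weak_conv_m (\<lambda>n. distr (M n) borel (\<lambda>\<omega>. (X n \<omega> - E n (X n)) / sqrt (Var n (X n)))) std_normal_distribution"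
proof -
  interpret P: prob_space "M n" for n by (rule prob)
  define U where "U = (\<lambda>n \<omega>. a n * (Y n \<omega> - E n (Y n)))"
  define V where "V = (\<lambda>n \<omega>. G n \<omega> - E n (G n))"
  have EX: "E n (X n) = a n * E n (Y n) + e n + E n (G n)" for n
  proof -
    have "E n (X n) = E n (\<lambda>\<omega>. a n * Y n \<omega> + e n + G n \<omega>)"
      unfolding E_def by (rule integral_cong_AE) (use X Y G eq in auto)
    also have "\<dots> = a n * E n (Y n) + e n + E n (G n)"
      using Y(1)[of n] G(1)[of n] by (simp add: E_def P.prob_space)
    finally show ?thesis .
  qed
  have UV: "AE \<omega> in M n. X n \<omega> - E n (X n) = U n \<omega> + V n \<omega>" for n
    using eq[of n] by eventually_elim (simp add: EX U_def V_def algebra_simps)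
  have Um: "U n \<in> borel_measurable (M n)" and Vm: "V n \<in> borel_measurable (M n)" for n
    using Y(1)[of n] G(1)[of n] by (auto simp: U_def V_def)
  have U2: "integrable (M n) (\<lambda>\<omega>. (U n \<omega>)^2)" and V2: "integrable (M n) (\<lambda>\<omega>. (V n \<omega>)^2)" for n
    using Y[of n] G[of n] by (auto simp: U_def V_def power_mult_distrib power2_diff)
  have EU: "E n (\<lambda>\<omega>. (U n \<omega>)^2) = (a n)^2 * Var n (Y n)" for n
    by (simp add: U_def E_def Var_def power_mult_distrib)
  have EV: "E n (\<lambda>\<omega>. (V n \<omega>)^2) \<le> E n (\<lambda>\<omega>. (G n \<omega>)^2)" for n
    using P.variance_le_second_moment[OF G[of n]] by (simp add: V_def E_def)
  have EV0: "0 \<le> E n (\<lambda>\<omega>. (V n \<omega>)^2)" for n by (simp add: E_def)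
  have VX: "Var n (X n) = E n (\<lambda>\<omega>. (U n \<omega> + V n \<omega>)^2)" for n
    unfolding Var_def E_def
  proof (rule integral_cong_AE)
    show "AE \<omega> in M n. (X n \<omega> - (\<integral>\<omega>'. X n \<omega>' \<partial>M n))^2 = (U n \<omega> + V n \<omega>)^2"
      using UV[of n] by eventually_elim (simp add: E_def)
  qed (use X Um Vm in auto)
  define r where "r = (\<lambda>n. E n (\<lambda>\<omega>. (V n \<omega>)^2) / A n)"
  define s where "s = (\<lambda>n. (a n)^2 * Var n (Y n) / A n)"
  have r0: "r n \<ge> 0" for n using EV0 pos(1)[of n] by (simp add: r_def)
  have r: "r \<longlonglongrightarrow> 0"
  proof (rule tendsto_sandwich[OF _ _ tendsto_const rem])
    show "\<forall>\<^sub>F n in sequentially. r n \<le> E n (\<lambda>\<omega>. (G n \<omega>)^2) / A n"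
      using EV pos(1) by (intro always_eventually allI) (simp add: r_def divide_right_mono less_imp_le)
  qed (use r0 in auto)
  have s: "s \<longlonglongrightarrow> q" unfolding s_def by (rule main)
  define w where "w = (\<lambda>n. Var n (X n) / A n)"
  \<comment> \<open>Cauchy-Schwarz bounds the covariance of main term and remainder, so the two
    scaled variances differ by an amount tending to 0 with r.\<close>
  have ws: "\<bar>w n - s n\<bar> \<le> 2 * sqrt (s n * r n) + r n" for n
  proof -
    have "w n - s n = (E n (\<lambda>\<omega>. (U n \<omega> + V n \<omega>)^2) - E n (\<lambda>\<omega>. (U n \<omega>)^2)) / A n"
      by (simp add: w_def s_def VX EU diff_divide_distrib)
    then have "\<bar>w n - s n\<bar> = \<bar>E n (\<lambda>\<omega>. (U n \<omega> + V n \<omega>)^2) - E n (\<lambda>\<omega>. (U n \<omega>)^2)\<bar> / A n"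
      using pos(1)[of n] by (simp add: abs_divide)
    also have "\<dots> \<le> (2 * sqrt (E n (\<lambda>\<omega>. (U n \<omega>)^2) * E n (\<lambda>\<omega>. (V n \<omega>)^2)) + E n (\<lambda>\<omega>. (V n \<omega>)^2)) / A n"
      using P.variance_sum_bound[OF Um U2 Vm V2, of n] pos(1)[of n] by (intro divide_right_mono) (auto simp: E_def)
    also have "\<dots> = 2 * sqrt (s n * r n) + r n"
    proof -
      have "sqrt (s n * r n) = sqrt (E n (\<lambda>\<omega>. (U n \<omega>)^2) * E n (\<lambda>\<omega>. (V n \<omega>)^2)) / A n"
        using pos(1)[of n] by (simp add: s_def r_def EU real_sqrt_divide real_sqrt_mult_self)
      then show ?thesis by (simp add: r_def add_divide_distrib)
    qed
    finally show ?thesis .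
  qed
  have "(\<lambda>n. 2 * sqrt (s n * r n) + r n) \<longlonglongrightarrow> 2 * sqrt (q * 0) + 0" by (intro tendsto_intros s r)
  then have "(\<lambda>n. w n - s n) \<longlonglongrightarrow> 0"
    by (intro Lim_null_comparison[of "\<lambda>n. w n - s n"]) (use ws in auto)
  from tendsto_add[OF this s] have w: "w \<longlonglongrightarrow> q" by simp
  then show "(\<lambda>n. Var n (X n) / A n) \<longlonglongrightarrow> q" by (simp add: w_def)
  have wpos: "\<forall>\<^sub>F n in sequentially. w n > 0" using order_tendstoD(1)[OF w pos(3)] .
  let ?Z = "\<lambda>n \<omega>. (X n \<omega> - E n (X n)) / sqrt (Var n (X n))"
  show "weak_conv_m (\<lambda>n. distr (M n) borel (?Z n)) std_normal_distribution"
  proof (rule levy_continuity)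
    show "real_distribution (distr (M n) borel (?Z n))" for n using X by (intro P.real_distribution_distr) auto
    show "real_distribution std_normal_distribution" by (rule real_dist_normal_dist)
    fix t :: real
    \<comment> \<open>The factor carried by Y once the normalisation of X is taken into
      account.\<close>
    define \<tau> where "\<tau> = (\<lambda>n. t * a n / sqrt (Var n (X n)))"
    have chZ: "char (distr (M n) borel (?Z n)) t = EC n (\<lambda>\<omega>. exp (\<i> * of_real (\<tau> n * (Y n \<omega> - E n (Y n)) + t / sqrt (Var n (X n)) * V n \<omega>)))" for n
    proof -
      note [measurable] = X[of n] Vm[of n] borel_measurable_integrable[OF Y(1)[of n]]
      have "char (distr (M n) borel (?Z n)) t = EC n (\<lambda>\<omega>. exp (\<i> * of_real (t * ?Z n \<omega>)))"
        unfolding char_def E_def EC_def using X by (subst integral_distr) auto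
      also have "\<dots> = EC n (\<lambda>\<omega>. exp (\<i> * of_real (\<tau> n * (Y n \<omega> - E n (Y n)) + t / sqrt (Var n (X n)) * V n \<omega>)))"
        unfolding E_def EC_def
      proof (rule integral_cong_AE)
        show "AE \<omega> in M n. exp (\<i> * complex_of_real (t * ((X n \<omega> - (\<integral>\<omega>. X n \<omega> \<partial>M n)) / sqrt (Var n (X n)))))
          = exp (\<i> * of_real (\<tau> n * (Y n \<omega> - (\<integral>\<omega>. Y n \<omega> \<partial>M n)) + t / sqrt (Var n (X n)) * V n \<omega>))"
          using UV[of n]
        proof eventually_elim
          case (elim \<omega>)
          have "t * ((X n \<omega> - E n (X n)) / sqrt (Var n (X n))) = \<tau> n * (Y n \<omega> - E n (Y n)) + t / sqrt (Var n (X n)) * V n \<omega>"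
            unfolding elim by (simp add: \<tau>_def U_def add_divide_distrib diff_divide_distrib algebra_simps)
          then show ?case unfolding E_def EC_def by (simp only:)
        qed
      qed measurable
      finally show ?thesis .
    qed
    let ?c = "\<lambda>n. EC n (\<lambda>\<omega>. exp (\<i> * of_real (\<tau> n * (Y n \<omega> - E n (Y n)))))"
    have diff: "(\<lambda>n. char (distr (M n) borel (?Z n)) t - ?c n) \<longlonglongrightarrow> 0"
    proof (rule Lim_null_comparison)
      have "(\<lambda>n. \<bar>t\<bar> * sqrt (r n / w n)) \<longlonglongrightarrow> \<bar>t\<bar> * sqrt (0 / q)"
        using pos(3) by (intro tendsto_intros r w) auto
      then show "(\<lambda>n. \<bar>t\<bar> * sqrt (r n / w n)) \<longlonglongrightarrow> 0" by simp
      show "\<forall>\<^sub>F n in sequentially. norm (char (distr (M n) borel (?Z n)) t - ?c n) \<le> \<bar>t\<bar> * sqrt (r n / w n)"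
        using wpos
      proof eventually_elim
        case (elim n)
        have "norm (char (distr (M n) borel (?Z n)) t - ?c n) \<le> sqrt (E n (\<lambda>\<omega>. (t / sqrt (Var n (X n)) * V n \<omega>)^2))"
          unfolding chZ unfolding E_def EC_def
          by (rule P.char_perturbation) (use Y(1)[of n] Vm[of n] V2[of n] in \<open>auto simp: power_mult_distrib power_divide\<close>)
        also have "E n (\<lambda>\<omega>. (t / sqrt (Var n (X n)) * V n \<omega>)^2) = (t / sqrt (Var n (X n)))^2 * E n (\<lambda>\<omega>. (V n \<omega>)^2)"
          by (simp add: E_def power_mult_distrib power_divide)
        also have "\<dots> = t^2 * (r n / w n)"
          using elim pos(1)[of n] by (simp add: r_def w_def power_divide zero_less_divide_iff)
        also have "sqrt \<dots> = \<bar>t\<bar> * sqrt (r n / w n)" unfolding real_sqrt_mult by simp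
        finally show ?case .
      qed
    qed
    have \<tau>V: "\<forall>\<^sub>F n in sequentially. (\<tau> n)^2 * Var n (Y n) = t^2 * (s n / w n)"
      using wpos
    proof eventually_elim
      case (elim n)
      then show ?case using pos(1)[of n] by (simp add: \<tau>_def s_def w_def power_divide power_mult_distrib zero_less_divide_iff)
    qed
    have lim1: "(\<lambda>n. (\<tau> n)^2 * Var n (Y n)) \<longlonglongrightarrow> t^2"
    proof -
      have "(\<lambda>n. t^2 * (s n / w n)) \<longlonglongrightarrow> t^2 * (q / q)" using pos(3) by (intro tendsto_intros s w) auto
      then show ?thesis using pos(3) tendsto_cong[OF \<tau>V] by simp
    qed
    have lim2: "(\<lambda>n. (\<tau> n)^2 * N n) \<longlonglongrightarrow> t^2 / v"
    proof -
      have "(\<lambda>n. ((\<tau> n)^2 * Var n (Y n)) / (Var n (Y n) / N n)) \<longlonglongrightarrow> t^2 / v" using pos(4) by (intro tendsto_intros lim1 YN) auto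
      moreover have "\<forall>\<^sub>F n in sequentially. ((\<tau> n)^2 * Var n (Y n)) / (Var n (Y n) / N n) = (\<tau> n)^2 * N n"
        using order_tendstoD(1)[OF YN pos(4)] by eventually_elim (auto simp: zero_less_divide_iff)
      ultimately show ?thesis using tendsto_cong by fast
    qed
    have iN: "(\<lambda>n. inverse (N n)) \<longlonglongrightarrow> 0" by (rule tendsto_inverse_0_at_top[OF N])
    have lim3: "(\<lambda>n. (\<tau> n)^2) \<longlonglongrightarrow> 0"
    proof -
      have "(\<lambda>n. (\<tau> n)^2 * N n * inverse (N n)) \<longlonglongrightarrow> t^2 / v * 0" by (intro tendsto_intros lim2 iN)
      moreover have "(\<tau> n)^2 * N n * inverse (N n) = (\<tau> n)^2" for n using pos(2)[of n] by simp
      ultimately show ?thesis by simp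
    qed
    have lim4: "(\<lambda>n. \<bar>\<tau> n\<bar>) \<longlonglongrightarrow> 0" using tendsto_real_sqrt[OF lim3] by simp
    have lim5: "(\<lambda>n. 3 * N n * (\<bar>\<tau> n\<bar> * B) ^ 3) \<longlonglongrightarrow> 0"
    proof -
      have "(\<lambda>n. 3 * B^3 * ((\<tau> n)^2 * N n) * \<bar>\<tau> n\<bar>) \<longlonglongrightarrow> 3 * B^3 * (t^2 / v) * 0" by (intro tendsto_intros lim2 lim4)
      moreover have "3 * N n * (\<bar>\<tau> n\<bar> * B) ^ 3 = 3 * B^3 * ((\<tau> n)^2 * N n) * \<bar>\<tau> n\<bar>" for n
        by (simp add: power_mult_distrib power3_eq_cube power2_eq_square flip: abs_mult)
      ultimately show ?thesis by (simp only: mult_zero_right)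
    qed
    have small: "\<forall>\<^sub>F n in sequentially. \<bar>\<tau> n\<bar> * B \<le> 1/2"
    proof -
      have "(\<lambda>n. \<bar>\<tau> n\<bar> * B) \<longlonglongrightarrow> 0 * B" by (intro tendsto_intros lim4)
      then have "\<forall>\<^sub>F n in sequentially. \<bar>\<tau> n\<bar> * B < 1/2" by (intro order_tendstoD) auto
      then show ?thesis by eventually_elim simp
    qed
    \<comment> \<open>The expansion provides an exponent only for small \<tau>, hence the choice
      here and the validity merely for large n.\<close>
    define z where "z = (\<lambda>n. SOME z. EC n (\<lambda>\<omega>. exp (\<i> * of_real (\<tau> n * Y n \<omega>))) = exp z \<and>
        norm (z - (\<i> * of_real (\<tau> n * E n (Y n)) - of_real ((\<tau> n)^2 * Var n (Y n) / 2))) \<le> 3 * N n * (\<bar>\<tau> n\<bar> * B) ^ 3)"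
    have z: "\<forall>\<^sub>F n in sequentially. EC n (\<lambda>\<omega>. exp (\<i> * of_real (\<tau> n * Y n \<omega>))) = exp (z n) \<and>
        norm (z n - (\<i> * of_real (\<tau> n * E n (Y n)) - of_real ((\<tau> n)^2 * Var n (Y n) / 2))) \<le> 3 * N n * (\<bar>\<tau> n\<bar> * B) ^ 3"
      using small by eventually_elim (unfold z_def, rule someI_ex, rule cf)
    \<comment> \<open>The exponent of the centred statistic; without the divergent mean it
      converges.\<close>
    define y where "y = (\<lambda>n. z n - \<i> * of_real (\<tau> n * E n (Y n)))"
    have "(\<lambda>n. y n + of_real ((\<tau> n)^2 * Var n (Y n) / 2)) \<longlonglongrightarrow> 0"
      by (rule Lim_null_comparison[OF _ lim5]) (use z in \<open>auto elim!: eventually_mono simp: y_def algebra_simps\<close>)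
    moreover have "(\<lambda>n. complex_of_real ((\<tau> n)^2 * Var n (Y n) / 2)) \<longlonglongrightarrow> of_real (t^2 / 2)"
      by (intro tendsto_intros lim1) auto
    ultimately have "(\<lambda>n. (y n + of_real ((\<tau> n)^2 * Var n (Y n) / 2)) - of_real ((\<tau> n)^2 * Var n (Y n) / 2)) \<longlonglongrightarrow> 0 - of_real (t^2 / 2)"
      by (rule tendsto_diff)
    then have "y \<longlonglongrightarrow> of_real (- (t^2) / 2)" by simp
    then have ey: "(\<lambda>n. exp (y n)) \<longlonglongrightarrow> exp (of_real (- (t^2) / 2))" by (rule tendsto_exp)
    have "\<forall>\<^sub>F n in sequentially. exp (y n) = ?c n"
      using z
    proof eventually_elim
      case (elim n)
      have "?c n = EC n (\<lambda>\<omega>. exp (\<i> * of_real (\<tau> n * Y n \<omega>)) * exp (- (\<i> * of_real (\<tau> n * E n (Y n)))))"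
        by (simp add: exp_add[symmetric] algebra_simps)
      also have "\<dots> = EC n (\<lambda>\<omega>. exp (\<i> * of_real (\<tau> n * Y n \<omega>))) * exp (- (\<i> * of_real (\<tau> n * E n (Y n))))"
        unfolding E_def EC_def by (rule integral_mult_left_zero)
      also have "\<dots> = exp (y n)" unfolding elim[THEN conjunct1] y_def mult_exp_exp by simp
      finally show ?case by simp
    qed
    then have "?c \<longlonglongrightarrow> exp (of_real (- (t^2) / 2))" using ey tendsto_cong by fast
    from tendsto_add[OF diff this]
    show "(\<lambda>n. char (distr (M n) borel (?Z n)) t) \<longlonglongrightarrow> char std_normal_distribution t"
      by (simp add: char_std_normal_distribution exp_of_real[symmetric] del: exp_of_real)
  qed
qed

section \<open>The Hoeffding decomposition\<close>

text \<open>Once v occupies slot i, the remaining k - 1 slots are filled injectively from the other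
  points. If there are too few points, truncated subtraction puts a 0 into the product, in
  accordance with the absence of tuples.\<close>

lemma sum_distinct_tuples_component:
  fixes h :: "'b \<Rightarrow> real"
  assumes P: "finite P" and i: "i < k"
  shows "(\<Sum>x\<in>distinct_tuples k P. h (x i)) = real (\<Prod>l<k - 1. card P - 1 - l) * (\<Sum>v\<in>P. h v)"
proof -
  let ?A = "{..<k} - {i}"
  let ?T = "\<lambda>v. {x \<in> distinct_tuples k P. x i = v}"
  have cT: "card (?T v) = (\<Prod>l<k - 1. card P - 1 - l)" if v: "v \<in> P" for v
  proof -
    let ?R = "{y \<in> ?A \<rightarrow>\<^sub>E P - {v}. inj_on y ?A}"
    have ins: "insert i ?A = {..<k}" using i by auto
    have "bij_betw (\<lambda>x. x(i := undefined)) (?T v) ?R"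
    proof (rule bij_betwI[where g = "\<lambda>y. y(i := v)"])
      show "(\<lambda>x. x(i := undefined)) \<in> ?T v \<rightarrow> ?R"
      proof
        fix x assume x: "x \<in> ?T v"
        then have xP: "x j \<in> P" if "j < k" for j using that by (auto simp: distinct_tuples_def)
        have xi: "x j \<noteq> v" if "j < k" "j \<noteq> i" for j
          using x that i by (auto simp: distinct_tuples_def inj_on_def)
        have "inj_on (x(i := undefined)) ?A" using x by (auto simp: distinct_tuples_def inj_on_def)
        moreover have "x(i := undefined) \<in> ?A \<rightarrow>\<^sub>E P - {v}"
          using x xP xi by (auto simp: distinct_tuples_def PiE_def extensional_def)
        ultimately show "x(i := undefined) \<in> ?R" by blast
      qed
      show "(\<lambda>y. y(i := v)) \<in> ?R \<rightarrow> ?T v"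
      proof
        fix y assume y: "y \<in> ?R"
        then have yP: "y j \<in> P - {v}" if "j < k" "j \<noteq> i" for j using that by auto
        have "inj_on (y(i := v)) {..<k}"
          unfolding inj_on_def using y yP by (auto simp: inj_on_def)
        moreover have "y(i := v) \<in> {..<k} \<rightarrow>\<^sub>E P"
          using y v i by (auto simp: PiE_def extensional_def Pi_def)
        ultimately show "y(i := v) \<in> ?T v" by (simp add: distinct_tuples_def)
      qed
      show "(x(i := undefined))(i := v) = x" if "x \<in> ?T v" for x using that by auto
      show "(y(i := v))(i := undefined) = y" if "y \<in> ?R" for y
        using that by (auto simp: fun_eq_iff PiE_def extensional_def)
    qed
    then have "card (?T v) = card ?R" by (rule bij_betw_same_card)
    also have "\<dots> = (\<Prod>l<k - 1. card P - 1 - l)"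
      using card_inj_on_subset_funcset[of ?A "P - {v}" ?A] P v i by (simp add: lessThan_atLeast0)
    finally show ?thesis .
  qed
  have "(\<Sum>x\<in>distinct_tuples k P. h (x i)) = (\<Sum>v\<in>P. \<Sum>x\<in>?T v. h (x i))"
    using finite_distinct_tuples[OF P] P i by (intro sum.group[symmetric]) (auto simp: distinct_tuples_def)
  also have "\<dots> = (\<Sum>v\<in>P. \<Sum>x\<in>?T v. h v)" by (intro sum.cong refl) auto
  also have "\<dots> = (\<Sum>v\<in>P. real (\<Prod>l<k - 1. card P - 1 - l) * h v)" using cT by (intro sum.cong refl) (simp del: of_nat_prod)
  finally show ?thesis by (simp add: sum_distrib_left del: of_nat_prod)
qed

lemma falling_factorial_asymptotics:
  "(\<lambda>m. real (\<Prod>l<j. m - 1 - l) / real m ^ j) \<longlonglongrightarrow> 1"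
proof -
  have one: "(\<lambda>m. real (m - 1 - l) / real m) \<longlonglongrightarrow> 1" for l
  proof -
    have "(\<lambda>m. (real m - 1 - real l) / real m) \<longlonglongrightarrow> 1" by real_asymp
    moreover have "\<forall>\<^sub>F m in sequentially. (real m - 1 - real l) / real m = real (m - 1 - l) / real m"
      using eventually_ge_at_top[of "l + 1"] by eventually_elim (simp add: of_nat_diff)
    ultimately show ?thesis using tendsto_cong by fast
  qed
  have "(\<lambda>m. \<Prod>l<j. real (m - 1 - l) / real m) \<longlonglongrightarrow> (\<Prod>l<j. 1)" by (intro tendsto_prod one)
  then show ?thesis by (simp add: prod_dividef)
qed

section \<open>Margins and the degenerate part\<close>

context finite_measure
begin

lemma insert_coordinate_measurable:
  "i < k \<Longrightarrow> (\<lambda>z. (snd z)(i := fst z)) \<in> M \<Otimes>\<^sub>M PiM ({..<k} - {i}) (\<lambda>_. M) \<rightarrow>\<^sub>M PiM {..<k::nat} (\<lambda>_. M)"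
  by (intro measurable_fun_upd[where J = "{..<k} - {i}"]) auto

lemma bounded_measurable_margin:
  assumes f: "bounded_measurable (PiM {..<k} (\<lambda>_. M)) f" and i: "i < k"
  shows "bounded_measurable M (margin M k f i)"
proof -
  interpret A: finite_measure "PiM ({..<k} - {i}) (\<lambda>_. M)" by (rule finite_measure_PiM_const) simp
  show ?thesis
    using A.bounded_measurable_integral[OF bounded_measurable_compose[OF f insert_coordinate_measurable[OF i]]]
    by (simp add: margin_def[abs_def])
qed

lemma integral_margin:
  assumes f: "bounded_measurable (PiM {..<k} (\<lambda>_. M)) f" and i: "i < k"
  shows "(\<integral>x. margin M k f i x \<partial>M) = (\<integral>x. f x \<partial>PiM {..<k} (\<lambda>_. M))"
proof -
  let ?A = "{..<k} - {i}"
  have ins: "insert i ?A = {..<k}" using i by auto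
  have "(\<integral>x. f x \<partial>PiM {..<k} (\<lambda>_. M)) = (\<integral>y. (\<integral>x. f (y(i := x)) \<partial>M) \<partial>PiM ?A (\<lambda>_. M))"
    using integral_PiM_insert[of ?A i f] f unfolding ins by simp
  also have "\<dots> = (\<integral>x. (\<integral>y. f (y(i := x)) \<partial>PiM ?A (\<lambda>_. M)) \<partial>M)"
    using bounded_measurable_Fubini(1)[where M = M and N = "PiM ?A (\<lambda>_. M)" and h = "\<lambda>x y. f (y(i := x))"]
      bounded_measurable_compose[OF f insert_coordinate_measurable[OF i]] finite_measure_PiM_const(1)[of ?A] finite_measure_axioms
    by simp
  finally show ?thesis by (simp add: margin_def)
qed

lemma integral_PiM_component:
  fixes h :: "'a \<Rightarrow> real"
  assumes J: "finite (J :: nat set)" "j \<in> J" and h: "bounded_measurable M h"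
  shows "(\<integral>x. h (x j) \<partial>PiM J (\<lambda>_. M)) = measure M (space M) ^ (card J - 1) * (\<integral>x. h x \<partial>M)"
proof -
  have ins: "insert j (J - {j}) = J" using J by auto
  have "(\<integral>x. h (x j) \<partial>PiM J (\<lambda>_. M)) = (\<integral>x. (\<integral>y. h ((x(j := y)) j) \<partial>M) \<partial>PiM (J - {j}) (\<lambda>_. M))"
    using integral_PiM_insert[of "J - {j}" j "\<lambda>x. h (x j)"] bounded_measurable_component[OF h J(2)] J unfolding ins by simp
  also have "\<dots> = measure M (space M) ^ (card J - 1) * (\<integral>x. h x \<partial>M)"
    using finite_measure_PiM_const(2)[of "J - {j}"] J by simp
  finally show ?thesis .
qed

text \<open>Each normalised margin removes the mean once, so k of them remove it k times; the last
  term restores the k - 1 surplus copies.\<close>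

definition degenerate_part :: "nat \<Rightarrow> ((nat \<Rightarrow> 'a) \<Rightarrow> real) \<Rightarrow> (nat \<Rightarrow> 'a) \<Rightarrow> real" where
  "degenerate_part k f x = f x - (\<Sum>i<k. margin M k f i (x i)) / measure M (space M) ^ (k - 1)
     + real (k - 1) * (\<integral>z. f z \<partial>PiM {..<k} (\<lambda>_. M)) / measure M (space M) ^ k"

lemma bounded_measurable_degenerate_part:
  assumes f: "bounded_measurable (PiM {..<k} (\<lambda>_. M)) f"
  shows "bounded_measurable (PiM {..<k} (\<lambda>_. M)) (degenerate_part k f)"
  unfolding degenerate_part_def[abs_def] divide_inverse
  by (intro bounded_measurable_add bounded_measurable_diff bounded_measurable_mult bounded_measurable_const
      bounded_measurable_sum bounded_measurable_component[OF bounded_measurable_margin[OF f]] f) auto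

lemma margin_degenerate_part:
  assumes f: "bounded_measurable (PiM {..<k} (\<lambda>_. M)) f" and i: "i < k" and x: "x \<in> space M" and pos: "measure M (space M) > 0"
  shows "(\<integral>y. degenerate_part k f (y(i := x)) \<partial>PiM ({..<k} - {i}) (\<lambda>_. M)) = 0"
proof -
  let ?A = "{..<k} - {i}"
  interpret A: finite_measure "PiM ?A (\<lambda>_. M)" by (rule finite_measure_PiM_const) simp
  define s where "s = measure M (space M)"
  define I where "I = (\<integral>z. f z \<partial>PiM {..<k} (\<lambda>_. M))"
  have s0: "s > 0" using pos by (simp add: s_def)
  have cA: "card ?A = k - 1" using i by simp
  have mA: "measure (PiM ?A (\<lambda>_. M)) (space (PiM ?A (\<lambda>_. M))) = s ^ (k - 1)"
    using finite_measure_PiM_const(2)[of ?A] cA by (simp add: s_def)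
  have eq: "degenerate_part k f (y(i := x)) = f (y(i := x)) - margin M k f i x / s ^ (k - 1)
      - (\<Sum>j\<in>?A. margin M k f j (y j) / s ^ (k - 1)) + real (k - 1) * I / s ^ k" for y
  proof -
    have "(\<Sum>j<k. margin M k f j ((y(i := x)) j)) = margin M k f i x + (\<Sum>j\<in>?A. margin M k f j (y j))"
      using i by (subst sum.remove[of _ i]) auto
    then show ?thesis by (simp add: degenerate_part_def s_def I_def add_divide_distrib sum_divide_distrib)
  qed
  have fi: "integrable (PiM ?A (\<lambda>_. M)) (\<lambda>y. f (y(i := x)))"
  proof -
    have "(\<lambda>y. y(i := x)) \<in> PiM ?A (\<lambda>_. M) \<rightarrow>\<^sub>M PiM {..<k} (\<lambda>_. M)"
      using i x by (intro measurable_fun_upd[where J = ?A]) auto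
    then show ?thesis by (intro A.bounded_measurable_integrable bounded_measurable_compose[OF f])
  qed
  have gi: "integrable (PiM ?A (\<lambda>_. M)) (\<lambda>y. margin M k f j (y j) / s ^ (k - 1))" if "j \<in> ?A" for j
    using that by (intro integrable_divide A.bounded_measurable_integrable bounded_measurable_component[OF bounded_measurable_margin[OF f]]) auto
  have gv: "(\<integral>y. margin M k f j (y j) / s ^ (k - 1) \<partial>PiM ?A (\<lambda>_. M)) = s ^ (k - 2) * I / s ^ (k - 1)" if "j \<in> ?A" for j
    using that integral_PiM_component[of ?A j, OF _ _ bounded_measurable_margin[OF f]] integral_margin[OF f, of j] cA
    by (simp add: s_def I_def numeral_2_eq_2)
  have "(\<integral>y. degenerate_part k f (y(i := x)) \<partial>PiM ?A (\<lambda>_. M))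
    = margin M k f i x - s ^ (k - 1) * (margin M k f i x / s ^ (k - 1)) - (\<Sum>j\<in>?A. s ^ (k - 2) * I / s ^ (k - 1))
      + s ^ (k - 1) * (real (k - 1) * I / s ^ k)"
  proof -
    define u where "u = (\<lambda>y. f (y(i := x)))"
    define T where "T = (\<lambda>y. \<Sum>j\<in>?A. margin M k f j (y j) / s ^ (k - 1))"
    have u: "integrable (PiM ?A (\<lambda>_. M)) u" "(\<integral>y. u y \<partial>PiM ?A (\<lambda>_. M)) = margin M k f i x"
      using fi by (simp_all add: u_def margin_def)
    have T: "integrable (PiM ?A (\<lambda>_. M)) T"
      unfolding T_def by (rule Bochner_Integration.integrable_sum[OF gi])
    have "(\<integral>y. T y \<partial>PiM ?A (\<lambda>_. M)) = (\<Sum>j\<in>?A. \<integral>y. margin M k f j (y j) / s ^ (k - 1) \<partial>PiM ?A (\<lambda>_. M))"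
      unfolding T_def by (rule Bochner_Integration.integral_sum[OF gi])
    also have "\<dots> = (\<Sum>j\<in>?A. s ^ (k - 2) * I / s ^ (k - 1))" by (rule sum.cong[OF refl gv])
    finally have T2: "(\<integral>y. T y \<partial>PiM ?A (\<lambda>_. M)) = (\<Sum>j\<in>?A. s ^ (k - 2) * I / s ^ (k - 1))" .
    define c1 c2 where "c1 = margin M k f i x / s ^ (k - 1)" and "c2 = real (k - 1) * I / s ^ k"
    have "(\<integral>y. degenerate_part k f (y(i := x)) \<partial>PiM ?A (\<lambda>_. M)) = (\<integral>y. u y - c1 - T y + c2 \<partial>PiM ?A (\<lambda>_. M))"
      by (simp only: eq u_def T_def c1_def c2_def)
    also have "\<dots> = margin M k f i x - s ^ (k - 1) * c1 - (\<integral>y. T y \<partial>PiM ?A (\<lambda>_. M)) + s ^ (k - 1) * c2"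
      using u T by (simp add: mA)
    finally show ?thesis by (simp only: T2 c1_def c2_def)
  qed
  also have "\<dots> = - real (k - 1) * (s ^ (k - 2) * I / s ^ (k - 1)) + s ^ (k - 1) * (real (k - 1) * I / s ^ k)"
    using s0 cA by simp
  also have "\<dots> = 0"
  \<comment> \<open>For k = 1 the exponent \<open>k - 2\<close> is truncated, but the factor
    \<open>real (k - 1)\<close> is 0.\<close>
  proof (cases "k \<ge> 2")
    case True
    then obtain m where "k = Suc (Suc m)" using Suc_le_D by (metis numeral_2_eq_2 Suc_le_mono)
    then show ?thesis using s0 by (simp add: field_simps)
  next
    case False
    then have "k = 1" using i by simp
    then show ?thesis by simp
  qed
  finally show ?thesis .
qed

end

text \<open>The coefficients are falling factorials of the number of points. They are constants
  because that number is almost surely n, hence the identity holds almost everywhere.\<close>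

lemma (in determinantal_process) hoeffding_decomposition:
  assumes k: "k \<ge> 1" and n: "real n = c * mass"
  shows "AE \<omega> in M. (\<Sum>x\<in>distinct_tuples k (\<Phi> \<omega>). f x) =
    real (\<Prod>l<k - 1. n - 1 - l) / mass ^ (k - 1) * (\<Sum>v\<in>\<Phi> \<omega>. \<Sum>i<k. margin \<mu> k f i v)
    + - real (\<Prod>l<k. n - l) * (real (k - 1) * (\<integral>z. f z \<partial>mu_pow k) / mass ^ k)
    + (\<Sum>x\<in>distinct_tuples k (\<Phi> \<omega>). KK.degenerate_part k f x)"
  using card_Phi[OF n] AE_space
proof eventually_elim
  case (elim \<omega>)
  let ?T = "distinct_tuples k (\<Phi> \<omega>)"
  let ?e = "real (k - 1) * (\<integral>z. f z \<partial>mu_pow k) / mass ^ k"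
  have fin: "finite (\<Phi> \<omega>)" by (rule Phi_finite[OF elim(2)])
  have "(\<Sum>x\<in>?T. f x) = (\<Sum>x\<in>?T. (\<Sum>i<k. margin \<mu> k f i (x i)) / mass ^ (k - 1) - ?e + KK.degenerate_part k f x)"
    by (intro sum.cong refl) (simp add: KK.degenerate_part_def)
  also have "\<dots> = (\<Sum>x\<in>?T. \<Sum>i<k. margin \<mu> k f i (x i)) / mass ^ (k - 1) - real (card ?T) * ?e + (\<Sum>x\<in>?T. KK.degenerate_part k f x)"
    by (simp add: sum.distrib sum_subtractf sum_divide_distrib)
  also have "(\<Sum>x\<in>?T. \<Sum>i<k. margin \<mu> k f i (x i)) = (\<Sum>i<k. \<Sum>x\<in>?T. margin \<mu> k f i (x i))" by (rule sum.swap)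
  also have "\<dots> = (\<Sum>i<k. real (\<Prod>l<k - 1. n - 1 - l) * (\<Sum>v\<in>\<Phi> \<omega>. margin \<mu> k f i v))"
    using sum_distinct_tuples_component[OF fin] elim(1) by (intro sum.cong refl) auto
  also have "\<dots> = real (\<Prod>l<k - 1. n - 1 - l) * (\<Sum>v\<in>\<Phi> \<omega>. \<Sum>i<k. margin \<mu> k f i v)"
    by (simp add: sum_distrib_left[symmetric] sum.swap[of _ "\<Phi> \<omega>"] del: of_nat_prod)
  also have "card ?T = (\<Prod>l<k. n - l)" using card_distinct_tuples[OF fin, of k] elim(1) by simp
  finally show ?case by (simp del: of_nat_prod)
qed

text \<open>The squared coefficient of the linear statistic of F, divided by k_n^(2k-2), tends to
  s_d^(-(2k-2)); the variance of that statistic brings two further powers of s_d. Together they make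
  up the power 2k in \<open>C\<close>.\<close>

theorem theorem2:
  fixes d k :: nat
    and f :: "(nat \<Rightarrow> real^'n) \<Rightarrow> real"
    and M :: "nat \<Rightarrow> 'a measure"
    and \<Phi> :: "nat \<Rightarrow> 'a \<Rightarrow> (real^'n) set"
  defines "\<sigma> \<equiv> (sphere_measure :: (real^'n) measure)"
  defines "F \<equiv> (\<lambda>x. \<Sum>i<k. margin \<sigma> k f i x)"
  defines "L \<equiv> (\<lambda>n \<omega>. lin_stat k f (\<Phi> n \<omega>))"
  defines "C \<equiv> 2 ^ (d - 2) / (sphere_area d ^ (2 * k) * Gamma (real d) * pi)
               * Gamma (real d / 2) ^ 2
               * (\<integral>x. (\<integral>y. (F x - F y)^2 / sin (arccos (x \<bullet> y)) ^ (d - 1) \<partial>\<sigma>) \<partial>\<sigma>)"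
  assumes dim: "CARD('n) = d + 1" and d2: "d \<ge> 2"
    and k1: "k \<ge> 1"
    and f_meas: "f \<in> borel_measurable (PiM {..<k} (\<lambda>_. \<sigma>))"
    and f_bdd: "\<exists>B. \<forall>x\<in>space (PiM {..<k} (\<lambda>_. \<sigma>)). \<bar>f x\<bar> \<le> B"
    and F_nonconst: "\<not> (\<exists>c. AE x in \<sigma>. F x = c)"
    and prob: "\<And>n. prob_space (M n)"
    and dpp: "\<And>n. is_dpp (M n) \<sigma> (harm_kernel d n) (\<Phi> n)"
  shows "(\<lambda>n. prob_space.variance (M n) (L n) / harm_dim d n ^ (2 * k - 1))
           \<longlonglongrightarrow> C
         \<and> C > 0
         \<and> weak_conv_m
           (\<lambda>n. distr (M n) borel
              (\<lambda>\<omega>. (L n \<omega> - prob_space.expectation (M n) (L n)) / sqrt (prob_space.variance (M n) (L n))))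
           std_normal_distribution"
proof -
  interpret S: round_sphere \<sigma> d by unfold_locales (use dim d2 in \<open>simp_all add: \<sigma>_def\<close>)
  let ?s = "sphere_area d"
  have s0: "?s > 0" by (rule sphere_area_pos)
  have mass: "measure \<sigma> (space \<sigma>) = ?s" using S.measure_sigma by simp
  have DP: "determinantal_process \<sigma> (harm_kernel d n) (harm_dim d n / ?s) (M n) (\<Phi> n)" for n
  proof -
    interpret prob_space "M n" by (rule prob)
    show ?thesis
      by unfold_locales
        (use S.bounded_measurable_K S.K_sym S.K_diag S.K_reproducing[of _ _ n n] S.harm_dim_pos[of n] s0 mass dpp in auto)
  qed
  interpret D: determinantal_process \<sigma> "harm_kernel d n" "harm_dim d n / ?s" "M n" "\<Phi> n" for n by (rule DP)
  have NN: "harm_dim d n / ?s * measure \<sigma> (space \<sigma>) = harm_dim d n" for n using s0 mass by simp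
  \<comment> \<open>That \<open>harm_dim d n\<close> is an integer is not visible in its definition
    as a quotient; it is the rank of the projection.\<close>
  have "\<exists>m. real m = harm_dim d n" for n using D.dim_exists[of n] unfolding NN .
  then obtain N where N: "\<And>n. real (N n) = harm_dim d n" by metis
  have N0: "harm_dim d n > 0" for n by (rule S.harm_dim_pos)
  have Ntop: "filterlim (harm_dim d) at_top sequentially" by (rule harm_dim_at_top[OF d2])
  then have Ntop_nat: "filterlim N at_top sequentially"
    unfolding N[symmetric, abs_def] by (simp add: filterlim_sequentially_iff_filterlim_real N)
  have f: "bounded_measurable (PiM {..<k} (\<lambda>_. \<sigma>)) f"
    using f_meas f_bdd by (auto simp: bounded_measurable_def)
  have F: "bounded_measurable \<sigma> F"
    unfolding F_def by (intro bounded_measurable_sum S.bounded_measurable_margin f) auto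
  obtain B where B: "B > 0" "\<And>x. x \<in> space \<sigma> \<Longrightarrow> norm (F x) \<le> B" using bounded_measurable_bound[OF F] by blast
  let ?g = "S.degenerate_part k f"
  have g: "bounded_measurable (PiM {..<k} (\<lambda>_. \<sigma>)) ?g" by (rule S.bounded_measurable_degenerate_part[OF f])
  obtain B' where B': "B' > 0" "\<And>x. x \<in> space (PiM {..<k} (\<lambda>_. \<sigma>)) \<Longrightarrow> norm (?g x) \<le> B'" using bounded_measurable_bound[OF g] by blast
  have zm: "(\<integral>y. ?g (y(i := x)) \<partial>PiM ({..<k} - {i}) (\<lambda>_. \<sigma>)) = 0" if "i < k" "x \<in> space \<sigma>" for i x
    using S.margin_degenerate_part[OF f that] mass s0 by simp
  define Y where "Y = (\<lambda>n \<omega>. \<Sum>v\<in>\<Phi> n \<omega>. F v)"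
  define G where "G = (\<lambda>n \<omega>. \<Sum>x\<in>distinct_tuples k (\<Phi> n \<omega>). ?g x)"
  define a where "a = (\<lambda>n. real (\<Prod>l<k - 1. N n - 1 - l) / ?s ^ (k - 1))"
  define e where "e = (\<lambda>n. - real (\<Prod>l<k. N n - l) * (real (k - 1) * (\<integral>z. f z \<partial>PiM {..<k} (\<lambda>_. \<sigma>)) / ?s ^ k))"
  define DF where "DF = (\<integral>x. (\<integral>y. (F x - F y)^2 / sin (arccos (x \<bullet> y)) ^ (d - 1) \<partial>\<sigma>) \<partial>\<sigma>)"
  define v where "v = wallis (d - 1) / (2 * ?s^2 * pi) * DF"
  have DF0: "DF > 0" unfolding DF_def by (rule S.dirichlet_form_pos[OF F F_nonconst])
  have v0: "v > 0" unfolding v_def using DF0 wallis_pos[of "d - 1"] s0 by simp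
  define q where "q = (1 / ?s ^ (k - 1))^2 * v"
  have q0: "q > 0" unfolding q_def using v0 s0 by simp
  \<comment> \<open>The remaining constant of \<open>C\<close> is \<open>wallis (d - 1)\<close> in
    terms of Gamma values; the 2 in the denominator of \<open>v\<close> lowers the power of 2 to d -
    2.\<close>
  have Cq: "C = q"
  proof -
    obtain j where j: "k = Suc j" using k1 by (cases k) auto
    obtain m where m: "d = Suc (Suc m)" using d2 by (metis Suc_le_D Suc_le_mono numeral_2_eq_2)
    have W: "wallis (d - 1) = 2 ^ (d - 1) * Gamma (real d / 2) ^ 2 / Gamma (real d)"
      using wallis_Gamma[of "d - 1"] d2 by (simp add: of_nat_diff)
    have "q = (1 / ?s ^ (k - 1))^2 * (2 ^ (d - 1) * Gamma (real d / 2) ^ 2 / Gamma (real d) / (2 * ?s^2 * pi) * DF)"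
      unfolding q_def v_def W ..
    also have "\<dots> = 2 ^ (d - 2) / (?s ^ (2 * k) * Gamma (real d) * pi) * Gamma (real d / 2) ^ 2 * DF"
    proof -
      have rearrange: "(1 / p)^2 * (2 * x * g / G / (2 * t * r) * D) = x / (p^2 * t * G * r) * g * D" for p x g G t r D :: real
        by (simp add: power_one_over divide_simps)
      have two: "(2::real) ^ (d - 1) = 2 * 2 ^ (d - 2)" by (simp add: m)
      have area_pow: "?s ^ (2 * k) = (?s ^ (k - 1))^2 * ?s^2" by (simp add: j power_mult[symmetric] power_add[symmetric] mult.commute)
      show ?thesis unfolding two area_pow by (rule rearrange)
    qed
    finally show ?thesis by (simp add: C_def DF_def)
  qed
  have YV: "integrable (M n) (Y n)" "integrable (M n) (\<lambda>\<omega>. (Y n \<omega>)^2)"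
    "prob_space.variance (M n) (Y n) = harm_dim d n / ?s * (\<integral>x. (F x)^2 \<partial>\<sigma>) - (\<integral>x. (\<integral>y. F x * F y * (harm_kernel d n x y)^2 \<partial>\<sigma>) \<partial>\<sigma>)" for n
    using D.linear_statistic_variance[OF F, of n] unfolding Y_def by blast+
  have VY: "(\<lambda>n. prob_space.variance (M n) (Y n) / harm_dim d n) \<longlonglongrightarrow> v"
    unfolding YV(3) v_def DF_def by (rule S.variance_form_limit[OF F])
  \<comment> \<open>Independent of n, as the bound \<open>B'\<close> refers only to f and the
    sphere.\<close>
  let ?D = "(fact (2 * k) + real (k * k) * fact (2 * k - 1) + 2 ^ (k * k)) * B'^2"
  have GV: "integrable (M n) (G n)" "integrable (M n) (\<lambda>\<omega>. (G n \<omega>)^2)"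
    "(\<integral>\<omega>. (G n \<omega>)^2 \<partial>M n) \<le> ?D * (sqrt (harm_dim d n) * harm_dim d n ^ (2 * k - 2))" for n
    using D.degenerate_second_moment[OF k1 g, of B' n] B'(2) zm unfolding G_def NN by auto
  have LG: "L n \<in> borel_measurable (M n)" for n
    using D.expectation_tuples[OF k1 f, of n] by (auto simp: L_def lin_stat_def[abs_def] has_bochner_integral_iff)
  have dec: "AE \<omega> in M n. L n \<omega> = a n * Y n \<omega> + e n + G n \<omega>" for n
  proof -
    have n: "real (N n) = harm_dim d n / ?s * measure \<sigma> (space \<sigma>)" unfolding N NN ..
    show ?thesis
      using D.hoeffding_decomposition[OF k1 n, of f]
      unfolding L_def lin_stat_def a_def Y_def F_def e_def G_def mass .
  qed
  \<comment> \<open>The first form pairs with the squared coefficient and the variance of Y, the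
    second with the bound on the second moment of G.\<close>
  have split: "harm_dim d n ^ (2 * k - 1) = (harm_dim d n ^ (k - 1))^2 * harm_dim d n"
    "harm_dim d n ^ (2 * k - 1) = harm_dim d n ^ (2 * k - 2) * harm_dim d n" for n
    using k1 by (cases k; simp add: power_mult[symmetric] mult.commute)+
  have a_lim: "(\<lambda>n. a n / harm_dim d n ^ (k - 1)) \<longlonglongrightarrow> 1 / ?s ^ (k - 1)"
  proof -
    have "(\<lambda>n. real (\<Prod>l<k - 1. N n - 1 - l) / real (N n) ^ (k - 1) / ?s ^ (k - 1)) \<longlonglongrightarrow> 1 / ?s ^ (k - 1)"
      using filterlim_compose[OF falling_factorial_asymptotics Ntop_nat] s0 by (intro tendsto_divide tendsto_const) auto
    then show ?thesis by (simp add: a_def N mult.commute del: of_nat_prod)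
  qed
  note result = variance_and_clt_of_main_term[where X = L and Y = Y and G = G and M = M and a = a and e = e
      and N = "harm_dim d" and A = "\<lambda>n. harm_dim d n ^ (2 * k - 1)" and B = B and q = q and v = v]
  have main: "(\<lambda>n. (a n)^2 * prob_space.variance (M n) (Y n) / harm_dim d n ^ (2 * k - 1)) \<longlonglongrightarrow> q"
  proof -
    have "(\<lambda>n. (a n / harm_dim d n ^ (k - 1))^2 * (prob_space.variance (M n) (Y n) / harm_dim d n)) \<longlonglongrightarrow> q"
      unfolding q_def by (intro tendsto_intros a_lim VY)
    then show ?thesis unfolding split(1) by (simp add: power_divide)
  qed
  have rem: "(\<lambda>n. (\<integral>\<omega>. (G n \<omega>)^2 \<partial>M n) / harm_dim d n ^ (2 * k - 1)) \<longlonglongrightarrow> 0"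
  proof (rule Lim_null_comparison)
    show "(\<lambda>n. ?D * sqrt (inverse (harm_dim d n))) \<longlonglongrightarrow> 0"
      using tendsto_mult[OF tendsto_const tendsto_real_sqrt[OF tendsto_inverse_0_at_top[OF Ntop]], of ?D] by simp
    have "norm ((\<integral>\<omega>. (G n \<omega>)^2 \<partial>M n) / harm_dim d n ^ (2 * k - 1)) \<le> ?D * sqrt (inverse (harm_dim d n))" for n
    proof -
      have "norm ((\<integral>\<omega>. (G n \<omega>)^2 \<partial>M n) / harm_dim d n ^ (2 * k - 1)) = (\<integral>\<omega>. (G n \<omega>)^2 \<partial>M n) / harm_dim d n ^ (2 * k - 1)"
        using N0[of n] by simp
      also have "\<dots> \<le> ?D * (sqrt (harm_dim d n) * harm_dim d n ^ (2 * k - 2)) / harm_dim d n ^ (2 * k - 1)"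
        using GV(3) N0[of n] by (intro divide_right_mono) auto
      also have "\<dots> = ?D * (sqrt (harm_dim d n) / harm_dim d n)" unfolding split(2) using N0[of n] by simp
      also have "sqrt (harm_dim d n) / harm_dim d n = sqrt (inverse (harm_dim d n))"
        using N0[of n] sqrt_divide_self_eq[of "harm_dim d n"] by (simp add: real_sqrt_inverse)
      finally show ?thesis .
    qed
    then show "\<forall>\<^sub>F n in sequentially. norm ((\<integral>\<omega>. (G n \<omega>)^2 \<partial>M n) / harm_dim d n ^ (2 * k - 1)) \<le> ?D * sqrt (inverse (harm_dim d n))" by simp
  qed
  have cf: "\<exists>z. (\<integral>\<omega>. exp (\<i> * of_real (t * Y n \<omega>)) \<partial>M n) = exp z \<and>
      norm (z - (\<i> * of_real (t * (\<integral>\<omega>. Y n \<omega> \<partial>M n)) - of_real (t^2 * prob_space.variance (M n) (Y n) / 2))) \<le> 3 * harm_dim d n * (\<bar>t\<bar> * B) ^ 3"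
    if "\<bar>t\<bar> * B \<le> 1/2" for t n
  proof -
    have FB: "\<bar>F x\<bar> \<le> B" if "x \<in> space \<sigma>" for x using B(2)[OF that] by simp
    show ?thesis
      unfolding Y_def
      by (rule D.characteristic_function_expansion[OF F FB that, of n, unfolded NN]) (assumption | intro exI conjI)+
  qed
  have "(\<lambda>n. prob_space.variance (M n) (L n) / harm_dim d n ^ (2 * k - 1)) \<longlonglongrightarrow> q"
    by (rule result(1)) (use prob LG YV GV dec N0 q0 v0 main rem VY Ntop cf in auto)
  moreover have "weak_conv_m (\<lambda>n. distr (M n) borel
       (\<lambda>\<omega>. (L n \<omega> - prob_space.expectation (M n) (L n)) / sqrt (prob_space.variance (M n) (L n)))) std_normal_distribution"
    by (rule result(2)) (use prob LG YV GV dec N0 q0 v0 main rem VY Ntop cf in auto)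
  ultimately show ?thesis using q0 unfolding Cq by blast
qed

end
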